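(* Let $\xi=(\xi_t)_{t\ge 0}$ be a subordinator in the class $(\mathcal L)$, with Lévy density $g$ and constant $g_0$, and let $(\mathcal F_t)_{t\ge0}$ be its filtration (see context). Let $h:\mathbb R_+\times\Omega\times\mathbb R_+\to\mathbb R_+$ be a measurable function such that: (1) $h$ is $\mathcal P\otimes\mathcal B_{\mathbb R_+}$-measurable, where $\mathcal P$ denotes the predictable $\sigma$-algebra generated by $\xi$; (2) writing $h(s,x)=h(s,\omega,x)$, there exist finite constants $\kappa>1$ and $\alpha\in\,]0,1[$ such that almost surely $$|h(s,x)-h(s,y)|\le \kappa|x-y|^\alpha,\qquad \forall\,x,y\in\mathbb R_+,\ s\ge 0,$$ $$0<\kappa^{-1}\le h(s,x)\le\kappa<\infty,\qquad \forall\,x\in\mathbb R_+,\ s\ge 0.$$ Set $H(s,x)=\int_0^x h(s,y)\,dy$ for $s,x\ge 0$. Then: 1. The process $$M_t^H:=\exp\left(g_0\int_0^t\log h(s,0)\,ds\right)\prod_{s\le t}\left[h(s,\Delta\xi_s)\cdot\frac{g(H(s,\Delta\xi_s))}{g(\Delta\xi_s)}\right],\qquad t\ge0,$$ where by convention $h(s,0)\cdot\frac{g(H(s,0))}{g(0)}:=1$ for all $s\ge0$ (so the factor in square brackets is $1$ whenever $\Delta\xi_s=0$), is an $(\mathcal F_t,\mathbb P)$-martingale with $\mathbb E(M^H_t)=1$ and a.s. $M^H_t>0$. We can uniquely define a probability measure $\mathbb P^H$ such that $\mathbb P^H_{|\mathcal F_t}=M^H_t\cdot\mathbb P_{|\mathcal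 F_t}$ for all $t\ge 0$. 2. Setting $\xi^H_t:=\sum_{s\le t}H(s,\Delta\xi_s)$ for $t\ge0$, the process $\xi^H$ is distributed under $\mathbb P^H$ as $\xi$ under $\mathbb P$.
   Context: $\mathbb R_+=[0,\infty)$; $\Omega$ is the sample space on which $\xi$ is defined, $\mathbb P$ the underlying probability and $\mathbb E$ its expectation; $\mathcal B_{\mathbb R_+}$ is the Borel $\sigma$-algebra of $\mathbb R_+$. A subordinator is an increasing (i.e. non-decreasing) Lévy process $\xi$ with $\xi_0=0$. It is in the class $(\mathcal L)$ if it has zero drift and Lévy measure $\nu(dx)=g(x)\,dx$, $x>0$, where $g:\,]0,\infty[\,\to\mathbb R_+$ is measurable, $g>0$, $\int_1^\infty g(x)\,dx<\infty$, and there exist $g_0\ge 0$ and a measurable $\zeta:[0,1]\to\mathbb R$ with $\int_0^1|\zeta(x)|\,dx<\infty$ such that $g(x)=\frac{g_0}{x}+\zeta(x)$ for all $x\in\,]0,1]$. Thus $\mathbb E(e^{-\lambda\xi_t})=\exp(-t\Psi(\lambda))$ for $t\ge0$, $\lambda>0$, with $\Psi(\lambda)=\int_0^\infty(1-e^{-\lambda x})g(x)\,dx$. The filtration of $\xi$ is $\mathcal F_t=\sigma(\xi_s:s\le t)$, $t\ge0$, and $\Delta\xi_s=\xi_s-\xi_{s-}$. Sums and products over $s\le t$ effectively run over the countable set of jump times of $\xi$ in $[0,t]$.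
   Formalization: Existence of P^H (not its uniqueness nor the law of ξ^H) is claimed only when every càdlàg non-decreasing path from 0 is realised by some ω, since it can fail on a general Ω; P^H lives on σ(ξ_s: s≥0), and paths of ξ are càdlàg, non-decreasing, null at 0 for every ω. *)

theory Defs
  imports "HOL-Probability.Probability"
begin

text \<open>
  Processes are functions \<open>X :: real \<Rightarrow> 'a \<Rightarrow> real\<close> of which only the values \<open>X t \<omega>\<close> with
  \<open>t \<ge> 0\<close> and \<open>\<omega>\<close> in the sample space \<open>space P\<close> are relevant.
\<close>

definition cadlag :: "(real \<Rightarrow> real) \<Rightarrow> bool" where
  "cadlag x \<longleftrightarrow>
     (\<forall>t\<ge>0. (x \<longlongrightarrow> x t) (at_right t)) \<and> (\<forall>t>0. \<exists>l. (x \<longlongrightarrow> l) (at_left t))"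

text \<open>
  The path conditions and \<open>X 0 = 0\<close> are required for every sample point, not just almost
  surely: the filtration used below is the raw (uncompleted) one.
\<close>

definition levy_process :: "'a measure \<Rightarrow> (real \<Rightarrow> 'a \<Rightarrow> real) \<Rightarrow> bool" where
  "levy_process P X \<longleftrightarrow>
     prob_space P \<and>
     (\<forall>t\<ge>0. X t \<in> borel_measurable P) \<and>
     (\<forall>\<omega>\<in>space P. X 0 \<omega> = 0 \<and> cadlag (\<lambda>t. X t \<omega>)) \<and>
     (\<forall>(t :: nat \<Rightarrow> real) n. 0 \<le> t 0 \<and> (\<forall>i<n. t i \<le> t (Suc i)) \<longrightarrow>
        prob_space.indep_vars P (\<lambda>_. borel) (\<lambda>i \<omega>. X (t (Suc i)) \<omega> - X (t i) \<omega>) {..<n}) \<and>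
     (\<forall>s\<ge>0. \<forall>t\<ge>0. distr P borel (\<lambda>\<omega>. X (s + t) \<omega> - X s \<omega>) = distr P borel (X t))"

definition subordinator :: "'a measure \<Rightarrow> (real \<Rightarrow> 'a \<Rightarrow> real) \<Rightarrow> bool" where
  "subordinator P X \<longleftrightarrow>
     levy_process P X \<and> (\<forall>\<omega>\<in>space P. mono_on {0..} (\<lambda>t. X t \<omega>))"

text \<open>
  Drift \<open>d\<close> and Levy measure \<open>\<nu>\<close> (a Borel measure on the reals carried by the positive
  half-line) of a subordinator, given by the Levy-Khintchine formula for its Laplace transform.
\<close>

definition has_drift_and_levy_measure ::
    "'a measure \<Rightarrow> (real \<Rightarrow> 'a \<Rightarrow> real) \<Rightarrow> real \<Rightarrow> real measure \<Rightarrow> bool" where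
  "has_drift_and_levy_measure P X d \<nu> \<longleftrightarrow>
     0 \<le> d \<and> sets \<nu> = sets borel \<and> emeasure \<nu> {..0} = 0 \<and>
     (\<integral>\<^sup>+ x. ennreal (min 1 x) \<partial>\<nu>) < \<infinity> \<and>
     (\<forall>t\<ge>0. \<forall>q>0. (\<integral>\<omega>. exp (- q * X t \<omega>) \<partial>P) =
        exp (- t * (d * q + (\<integral>x. 1 - exp (- q * x) \<partial>\<nu>))))"

definition class_L :: "'a measure \<Rightarrow> (real \<Rightarrow> 'a \<Rightarrow> real) \<Rightarrow> (real \<Rightarrow> real) \<Rightarrow> real \<Rightarrow> bool" where
  "class_L P X g g0 \<longleftrightarrow>
     subordinator P X \<and>
     set_borel_measurable borel {0<..} g \<and> (\<forall>x>0. g x > 0) \<and>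
     has_drift_and_levy_measure P X 0
       (density lborel (\<lambda>x. ennreal (indicator {0<..} x * g x))) \<and>
     set_integrable lborel {1..} g \<and>
     g0 \<ge> 0 \<and>
     (\<exists>\<zeta> :: real \<Rightarrow> real. set_integrable lborel {0..1} \<zeta> \<and>
        (\<forall>x\<in>{0<..1}. g x = g0 / x + \<zeta> x))"

definition generated_sigma ::
    "'a set \<Rightarrow> (real \<Rightarrow> 'a \<Rightarrow> real) \<Rightarrow> real set \<Rightarrow> 'a measure" where
  "generated_sigma \<Omega> X T =
     sigma \<Omega> {X s -` A \<inter> \<Omega> |s A. s \<in> T \<and> A \<in> sets borel}"

definition natural_filtration :: "'a set \<Rightarrow> (real \<Rightarrow> 'a \<Rightarrow> real) \<Rightarrow> real \<Rightarrow> 'a measure" where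
  "natural_filtration \<Omega> X t = generated_sigma \<Omega> X {0..t}"

definition predictable_sigma :: "'a set \<Rightarrow> (real \<Rightarrow> 'a measure) \<Rightarrow> (real \<times> 'a) measure" where
  "predictable_sigma \<Omega> F =
     sigma ({0..} \<times> \<Omega>)
       ({{0} \<times> A |A. A \<in> sets (F 0)} \<union>
        {{s<..t} \<times> A |s t A. 0 \<le> s \<and> s < t \<and> A \<in> sets (F s)})"

definition martingale ::
    "'a measure \<Rightarrow> (real \<Rightarrow> 'a measure) \<Rightarrow> (real \<Rightarrow> 'a \<Rightarrow> real) \<Rightarrow> bool" where
  "martingale P F X \<longleftrightarrow>
     filtration (space P) F \<and> (\<forall>t\<ge>0. subalgebra P (F t)) \<and>
     (\<forall>t\<ge>0. X t \<in> borel_measurable (F t) \<and> integrable P (X t)) \<and>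
     (\<forall>s\<ge>0. \<forall>t\<ge>s. AE \<omega> in P. real_cond_exp P (F s) (X t) \<omega> = X s \<omega>)"

text \<open>The jump at time 0 is 0, i.e. the left limit at 0 is taken to be the initial value.\<close>

definition jump :: "(real \<Rightarrow> real) \<Rightarrow> real \<Rightarrow> real" where
  "jump x s = (if s > 0 then x s - Lim (at_left s) x else 0)"

text \<open>
  Unordered infinite product, the multiplicative counterpart of \<^const>\<open>infsum\<close>; as there, the
  value is 0 if the net of finite partial products does not converge.  Hence positivity of such
  a product entails its convergence.
\<close>

definition infprod :: "('i \<Rightarrow> real) \<Rightarrow> 'i set \<Rightarrow> real" where
  "infprod f A =
     (if \<exists>p. (prod f \<longlongrightarrow> p) (finite_subsets_at_top A)
      then Lim (finite_subsets_at_top A) (prod f) else 0)"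

definition H_of :: "(real \<Rightarrow> 'a \<Rightarrow> real \<Rightarrow> real) \<Rightarrow> real \<Rightarrow> 'a \<Rightarrow> real \<Rightarrow> real" where
  "H_of h s \<omega> x = (LBINT y:{0..x}. h s \<omega> y)"

definition jump_factor ::
    "(real \<Rightarrow> real) \<Rightarrow> (real \<Rightarrow> 'a \<Rightarrow> real \<Rightarrow> real) \<Rightarrow> real \<Rightarrow> 'a \<Rightarrow> real \<Rightarrow> real" where
  "jump_factor g h s \<omega> x = (if x = 0 then 1 else h s \<omega> x * (g (H_of h s \<omega> x) / g x))"

definition M_H ::
    "(real \<Rightarrow> 'a \<Rightarrow> real) \<Rightarrow> (real \<Rightarrow> real) \<Rightarrow> real \<Rightarrow> (real \<Rightarrow> 'a \<Rightarrow> real \<Rightarrow> real)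
       \<Rightarrow> real \<Rightarrow> 'a \<Rightarrow> real" where
  "M_H X g g0 h t \<omega> =
     exp (g0 * (LBINT s:{0..t}. ln (h s \<omega> 0))) *
     infprod (\<lambda>s. jump_factor g h s \<omega> (jump (\<lambda>r. X r \<omega>) s)) {0..t}"

definition xi_H ::
    "(real \<Rightarrow> 'a \<Rightarrow> real) \<Rightarrow> (real \<Rightarrow> 'a \<Rightarrow> real \<Rightarrow> real) \<Rightarrow> real \<Rightarrow> 'a \<Rightarrow> real" where
  "xi_H X h t \<omega> = (\<Sum>\<^sub>\<infinity>s\<in>{0..t}. H_of h s \<omega> (jump (\<lambda>r. X r \<omega>) s))"

text \<open>
  \<open>Q\<close> is a probability measure on the sigma-algebra generated by the whole process \<open>X\<close> whose
  restriction to each \<open>F\<^sub>t\<close> has density \<open>M t\<close> with respect to the restriction of \<open>P\<close>.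
\<close>

definition local_density_measure ::
    "'a measure \<Rightarrow> (real \<Rightarrow> 'a \<Rightarrow> real) \<Rightarrow> (real \<Rightarrow> 'a \<Rightarrow> real) \<Rightarrow> 'a measure \<Rightarrow> bool" where
  "local_density_measure P X M Q \<longleftrightarrow>
     prob_space Q \<and> space Q = space P \<and>
     sets Q = sets (generated_sigma (space P) X {0..}) \<and>
     (\<forall>t\<ge>0. restr_to_subalg Q (natural_filtration (space P) X t) =
        density (restr_to_subalg P (natural_filtration (space P) X t)) (\<lambda>\<omega>. ennreal (M t \<omega>)))"

text \<open>
  Every possible path of a subordinator is realised by some sample point, as on the canonical
  path space.  Without a condition of this kind, a consistent family of probability measures on
  the \<open>F\<^sub>t\<close> need not extend to a (countably additive) measure on the sigma-algebra they generate.
\<close>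

definition realises_all_paths :: "'a set \<Rightarrow> (real \<Rightarrow> 'a \<Rightarrow> real) \<Rightarrow> bool" where
  "realises_all_paths \<Omega> X \<longleftrightarrow>
     (\<forall>x. x 0 = 0 \<and> cadlag x \<and> mono_on {0..} x \<longrightarrow> (\<exists>\<omega>\<in>\<Omega>. \<forall>t\<ge>0. X t \<omega> = x t))"

definition same_law ::
    "'a measure \<Rightarrow> (real \<Rightarrow> 'a \<Rightarrow> real) \<Rightarrow> 'b measure \<Rightarrow> (real \<Rightarrow> 'b \<Rightarrow> real) \<Rightarrow> bool" where
  "same_law P X Q Y \<longleftrightarrow>
     (\<forall>t\<ge>0. X t \<in> borel_measurable P) \<and> (\<forall>t\<ge>0. Y t \<in> borel_measurable Q) \<and>
     distr P (\<Pi>\<^sub>M t\<in>{0..}. borel) (\<lambda>\<omega>. \<lambda>t\<in>{0..}. X t \<omega>) =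
     distr Q (\<Pi>\<^sub>M t\<in>{0..}. borel) (\<lambda>\<omega>. \<lambda>t\<in>{0..}. Y t \<omega>)"

end

theory Submission
  imports Defs
begin

text \<open>
  Let \<open>\<beta> > -1\<close> be predictable with \<open>\<integral> |\<beta>(s,x)| \<nu>(dx)\<close> bounded.  The process
  \<open>Z = \<Prod> (1 + \<beta>(s, \<Delta>\<xi>\<^sub>s)) exp (- \<integral>\<integral> \<beta> \<nu>(dx) ds)\<close> is a true martingale: for finitely many jumps
  \<open>Z\<close> satisfies a pathwise integral equation, which passes to the limit because the iterated sums of \<open>|\<beta>|\<close>
  over increasing jump times have summable expectations, and then the compensation formula applies.  That formula is
  itself derived from the Laplace transforms of the increments.
  For \<open>1 + \<beta> = h g(H)/g exp (- q H)\<close> the substitution \<open>y = H(s,x)\<close> and the behaviour \<open>g\<^sub>0/x\<close> of \<open>g\<close> at the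
  origin give \<open>\<integral> \<beta> \<nu>(dx) = - g\<^sub>0 log h(s,0) - \<Psi>(q)\<close>, with an absolute bound depending only on the Hoelder constants.
  Hence \<open>Z = M\<^sup>H exp (- q \<xi>\<^sup>H + t \<Psi>(q))\<close>: the case \<open>q = 0\<close> is the martingale property of \<open>M\<^sup>H\<close>, and the other
  integers \<open>q\<close> determine the conditional law of the increments of \<open>\<xi>\<^sup>H\<close> under the new measure.  Existence of that
  measure follows from Kolmogorov's theorem after regularising the coordinate process along the rationals.
\<close>

section \<open>Jumps of increasing paths\<close>

text \<open>No jump measure is given at the outset: the process is described by the laws of its
  increments, and \<nu> enters only through the Laplace exponent. The link is made by test functions
  of order x^2 at 0, for which sums over grid increments converge to sums over jumps, because a
  continuous part of an increasing path has no quadratic variation. Fatou gives one inequality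
  between the expectations; the reverse one comes from Laplace transforms of the sums, which are
  bounded and hence pass to the limit. The second obstacle is the uncompleted filtration:
  adaptedness is a claim about every sample point, while the bounds on \<open>h\<close> hold only
  almost surely. So products and sums are encoded by formulas that are measurable for all paths,
  with value 0 where they diverge, and the integrand is cut off by a predictable condition that
  almost surely removes nothing. Expectations stay in \<open>ennreal\<close>, with positive and
  negative parts on opposite sides of each equation; finiteness then enters the martingale property
  only in one final cancellation.\<close>

definition increasing_path :: "(real \<Rightarrow> real) \<Rightarrow> bool" where
  "increasing_path x \<longleftrightarrow> x 0 = 0 \<and> cadlag x \<and> mono_on {0..} x"

text \<open>Values in \<open>ennreal\<close> allow sums to be manipulated before any summability is
  known. The restriction to positive jumps leaves countably many terms on an increasing
  path.\<close>

definition jump_sum :: "(real \<Rightarrow> real) \<Rightarrow> real set \<Rightarrow> (real \<Rightarrow> ennreal) \<Rightarrow> ennreal" where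
  "jump_sum x T f = (\<integral>\<^sup>+ s. f s * indicator {s\<in>T. 0 < jump x s} s \<partial>count_space UNIV)"

text \<open>The Lebesgue-Stieltjes measure of the path stopped at T, scaled by c. Taking c = 1 + x T
  makes its mass at most 1, so that it becomes a subprobability kernel in the sample point.\<close>

definition stopped_measure :: "real \<Rightarrow> real \<Rightarrow> (real \<Rightarrow> real) \<Rightarrow> real measure" where
  "stopped_measure T c x = interval_measure (\<lambda>s. x (min T (max 0 s)) / c)"

text \<open>On a countable set a Borel measure is the counting measure weighted by its
  atoms.\<close>

lemma nn_integral_countable_atoms:
  fixes M :: "real measure"
  assumes sM: "sets M = sets borel" and D: "countable D"
  shows "(\<integral>\<^sup>+s. f s * indicator D s \<partial>M) = (\<integral>\<^sup>+s. f s * emeasure M {s} * indicator D s \<partial>count_space UNIV)"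
proof -
  have sub: "A \<in> sets M" if "A \<subseteq> D" for A
    unfolding sM using countable_subset[OF that D] by (rule sets.countable[rotated]) auto
  have D': "D \<in> sets M" using sub by auto
  have sp: "space M = UNIV" using sets_eq_imp_space_eq[OF sM] by simp
  have sr: "sets (restrict_space M D) = Pow D"
  proof (intro equalityI subsetI)
    fix A assume "A \<in> Pow D"
    then show "A \<in> sets (restrict_space M D)"
      unfolding sets_restrict_space using sub[of A] by (intro image_eqI[of _ _ A]) auto
  qed (auto simp: sets_restrict_space)
  have eq: "restrict_space M D = density (count_space D) (\<lambda>s. emeasure M {s})"
  proof (rule measure_eqI_countable[where A=D])
    fix a assume a: "a \<in> D"
    have "emeasure (density (count_space D) (\<lambda>s. emeasure M {s})) {a} = (\<integral>\<^sup>+s. emeasure M {s} * indicator {a} s \<partial>count_space D)"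
      using a by (subst emeasure_density) auto
    also have "\<dots> = emeasure M {a}"
      using a by (subst nn_integral_indicator_singleton) auto
    finally show "emeasure (restrict_space M D) {a} = emeasure (density (count_space D) (\<lambda>s. emeasure M {s})) {a}"
      using a D' sub by (simp add: emeasure_restrict_space sp)
  qed (auto simp: sr D)
  have "(\<integral>\<^sup>+s. f s * indicator D s \<partial>M) = (\<integral>\<^sup>+s. f s \<partial>restrict_space M D)"
    using D' by (subst nn_integral_restrict_space) (auto simp: sp)
  also have "\<dots> = (\<integral>\<^sup>+s. emeasure M {s} * f s \<partial>count_space D)"
    unfolding eq by (subst nn_integral_density) auto
  also have "\<dots> = (\<integral>\<^sup>+s. f s * emeasure M {s} * indicator D s \<partial>count_space UNIV)"
    by (subst nn_integral_count_space_indicator) (auto simp: mult.commute intro!: nn_integral_cong)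
  finally show ?thesis .
qed

context
  fixes x :: "real \<Rightarrow> real"
  assumes x: "increasing_path x"
begin

lemma path_zero: "x 0 = 0" using x by (simp add: increasing_path_def)

lemma path_mono: "0 \<le> s \<Longrightarrow> s \<le> t \<Longrightarrow> x s \<le> x t"
  using x by (auto simp: increasing_path_def mono_on_def)

lemma path_nonneg: "0 \<le> s \<Longrightarrow> 0 \<le> x s"
  using path_mono[of 0 s] path_zero by simp

lemma path_right: "0 \<le> s \<Longrightarrow> (x \<longlongrightarrow> x s) (at s within {s..})"
proof -
  assume "0 \<le> s"
  then have "(x \<longlongrightarrow> x s) (at_right s)" using x by (auto simp: increasing_path_def cadlag_def)
  moreover have "at s within {s..} = at_right s"
  proof -
    have "{s..} - {s} = {s<..} - {s}" by auto
    then show ?thesis unfolding at_within_def by simp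
  qed
  ultimately show ?thesis by simp
qed

lemma path_left: "0 < s \<Longrightarrow> (x \<longlongrightarrow> x s - jump x s) (at_left s)"
proof -
  assume s: "0 < s"
  then obtain l where l: "(x \<longlongrightarrow> l) (at_left s)"
    using x by (auto simp: increasing_path_def cadlag_def)
  then have "Lim (at_left s) x = l" by (intro tendsto_Lim) auto
  then show ?thesis using l s by (simp add: jump_def)
qed

lemma jump_nonneg: "0 \<le> jump x s"
proof (cases "0 < s")
  case True
  have "x s - jump x s \<le> x s"
  proof (rule tendsto_upperbound[OF path_left[OF True]])
    show "\<forall>\<^sub>F r in at_left s. x r \<le> x s"
      using eventually_at_left_real[OF True] by eventually_elim (auto intro: path_mono)
  qed auto
  then show ?thesis by simp
qed (simp add: jump_def)

lemma jump_nonpos: "s \<le> 0 \<Longrightarrow> jump x s = 0" by (simp add: jump_def)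

lemma jump_pos_iff: "0 < jump x s \<longleftrightarrow> jump x s \<noteq> 0" using jump_nonneg[of s] by auto

text \<open>The index 0 is left out because the sequences of interest are grid points, and a grid
  with 0 cells divides by zero.\<close>

lemma tendsto_right_seq:
  assumes "0 \<le> s" "r \<longlonglongrightarrow> s" "\<And>n. 0 < n \<Longrightarrow> s \<le> r n"
  shows "(\<lambda>n. x (r n)) \<longlonglongrightarrow> x s"
proof -
  have c: "continuous (at s within {s..}) x" using path_right[OF assms(1)] by (simp add: continuous_within)
  have "(\<lambda>n. x (r (Suc n))) \<longlonglongrightarrow> x s"
    using continuous_within_tendsto_compose'[OF c, of "\<lambda>n. r (Suc n)" sequentially] assms
    by (auto intro: LIMSEQ_Suc)
  then show ?thesis by (rule LIMSEQ_imp_Suc)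
qed

lemma tendsto_left_seq:
  assumes "0 < s" "r \<longlonglongrightarrow> s" "\<And>n. 0 < n \<Longrightarrow> r n < s"
  shows "(\<lambda>n. x (r n)) \<longlonglongrightarrow> x s - jump x s"
proof -
  have "filterlim r (at_left s) sequentially"
    using assms(2,3) by (intro tendsto_imp_filterlim_at_left) (auto intro!: eventually_sequentiallyI[of 1])
  then show ?thesis using path_left[OF assms(1)] by (rule filterlim_compose[rotated])
qed

lemma stopped_mono: "c > 0 \<Longrightarrow> 0 \<le> T \<Longrightarrow> s \<le> t \<Longrightarrow> x (min T (max 0 s)) / c \<le> x (min T (max 0 t)) / c"
  by (intro divide_right_mono path_mono) auto

lemma stopped_right_cont:
  assumes T: "0 \<le> T" and c: "0 < c"
  shows "continuous (at_right s) (\<lambda>s. x (min T (max 0 s)) / c)"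
proof -
  have "((\<lambda>s. x (min T (max 0 s))) \<longlongrightarrow> x (min T (max 0 s))) (at_right s)"
  proof -
    let ?g = "\<lambda>s. min T (max 0 s)"
    have c: "continuous (at (?g s) within {?g s..}) x"
      using path_right[of "?g s"] T by (simp add: continuous_within)
    show ?thesis
    proof (rule continuous_within_tendsto_compose[OF c])
      show "\<forall>\<^sub>F r in at_right s. ?g r \<in> {?g s..}"
        by (rule eventually_at_rightI[of s "s+1"]) auto
    qed (auto intro!: tendsto_intros)
  qed
  then show ?thesis using c by (auto simp: continuous_within intro!: tendsto_intros)
qed

lemma sets_stopped[measurable_cong, simp]: "sets (stopped_measure T c x) = sets borel"
  by (simp add: stopped_measure_def)

lemma emeasure_stopped_Ioc:
  assumes "0 \<le> T" "0 < c"
  shows "emeasure (stopped_measure T c x) {a<..b} = (if a \<le> b then ennreal (x (min T (max 0 b)) / c - x (min T (max 0 a)) / c) else 0)"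
  unfolding stopped_measure_def
  using stopped_mono[OF assms(2,1)] stopped_right_cont[OF assms]
  by (subst emeasure_interval_measure_Ioc_eq) auto

lemma emeasure_stopped_UNIV:
  assumes "0 \<le> T" "0 < c"
  shows "emeasure (stopped_measure T c x) UNIV = ennreal (x T / c)"
proof -
  let ?M = "stopped_measure T c x"
  have "(\<lambda>n. emeasure ?M {- real n<..real n}) \<longlonglongrightarrow> emeasure ?M (\<Union>n. {- real n<..real n})"
    by (rule Lim_emeasure_incseq) (auto simp: incseq_def)
  moreover have "(\<Union>n. {- real n<..real n}) = UNIV"
  proof (intro set_eqI iffI UNIV_I)
    fix y :: real
    obtain n where "\<bar>y\<bar> < real n" using reals_Archimedean2 by blast
    then have "y \<in> {- real n<..real n}" by auto
    then show "y \<in> (\<Union>n. {- real n<..real n})" by blast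
  qed
  moreover have "(\<lambda>n. emeasure ?M {- real n<..real n}) \<longlonglongrightarrow> ennreal (x T / c)"
  proof (rule tendsto_eventually)
    obtain N where N: "T < real N" using reals_Archimedean2 by blast
    have "emeasure ?M {- real n<..real n} = ennreal (x T / c)" if "n \<ge> N" for n
    proof -
      have "T \<le> real n" "0 < n" using N that assms(1) by linarith+
      then show ?thesis using assms path_zero by (simp add: emeasure_stopped_Ioc min_def max_def)
    qed
    then show "\<forall>\<^sub>F n in sequentially. emeasure ?M {- real n<..real n} = ennreal (x T / c)"
      by (auto intro: eventually_sequentiallyI)
  qed
  ultimately show ?thesis using LIMSEQ_unique by metis
qed

text \<open>The singleton is the intersection of the intervals from s - 1/(n+1) to s, whose masses
  converge to the jump because the path has a left limit at s.\<close>

lemma emeasure_stopped_singleton: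
  assumes "0 < c" "0 < s" "s \<le> T"
  shows "emeasure (stopped_measure T c x) {s} = ennreal (jump x s / c)"
proof -
  let ?M = "stopped_measure T c x"
  have T: "0 \<le> T" using assms by simp
  let ?A = "\<lambda>n. {s - 1 / real (Suc n)<..s}"
  have A: "(\<Inter>n. ?A n) = {s}"
  proof safe
    fix y assume y: "y \<in> (\<Inter>n. ?A n)"
    have "s \<le> y"
    proof (rule field_le_epsilon)
      fix e :: real assume "0 < e"
      then obtain n where "1 / real (Suc n) < e" by (metis nat_approx_posE)
      then show "s \<le> y + e" using y by (auto dest!: spec[of _ n])
    qed
    with y show "y = s" by auto
  qed auto
  have fin: "emeasure ?M (?A n) \<noteq> \<infinity>" for n using T assms by (simp add: emeasure_stopped_Ioc)
  have "(\<lambda>n. emeasure ?M (?A n)) \<longlonglongrightarrow> emeasure ?M (\<Inter>n. ?A n)"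
  proof (rule Lim_emeasure_decseq)
    show "decseq ?A"
    proof (rule decseq_SucI, safe)
      fix n y assume y: "y \<in> ?A (Suc n)"
      have "1 / real (Suc (Suc n)) \<le> 1 / real (Suc n)" by (intro divide_left_mono) auto
      then show "y \<in> ?A n" using y by auto
    qed
  qed (use fin in auto)
  moreover have "(\<lambda>n. emeasure ?M (?A n)) \<longlonglongrightarrow> ennreal (jump x s / c)"
  proof -
    obtain N where N: "1 / real (Suc N) < s" using assms(2) nat_approx_posE by blast
    have l: "(\<lambda>n. s - 1 / real (Suc n)) \<longlonglongrightarrow> s"
      using tendsto_diff[OF tendsto_const LIMSEQ_inverse_real_of_nat, of s] by (simp add: inverse_eq_divide)
    have lim: "(\<lambda>n. x (s - 1 / real (Suc n))) \<longlonglongrightarrow> x s - jump x s"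
      by (rule tendsto_left_seq[OF assms(2) l]) auto
    have "(\<lambda>n. ennreal (x s / c - x (s - 1 / real (Suc n)) / c)) \<longlonglongrightarrow> ennreal (x s / c - (x s - jump x s) / c)"
      by (intro tendsto_intros lim) (use assms in auto)
    then have lim': "(\<lambda>n. ennreal (x s / c - x (s - 1 / real (Suc n)) / c)) \<longlonglongrightarrow> ennreal (jump x s / c)"
      by (simp add: diff_divide_distrib)
    have "\<forall>\<^sub>F n in sequentially. ennreal (x s / c - x (s - 1 / real (Suc n)) / c) = emeasure ?M (?A n)"
    proof (rule eventually_sequentiallyI[of N])
      fix n assume "N \<le> n"
      then have "1 / real (Suc n) \<le> 1 / real (Suc N)" by (intro divide_left_mono) auto
      then have m: "min T (max 0 (s - 1 / real (Suc n))) = s - 1 / real (Suc n)" "min T (max 0 s) = s" "s - 1 / real (Suc n) \<le> s"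
        using N assms zero_less_divide_1_iff[of "real (Suc n)"] by linarith+
      then show "ennreal (x s / c - x (s - 1 / real (Suc n)) / c) = emeasure ?M (?A n)"
        unfolding emeasure_stopped_Ioc[OF T assms(1)] m(1,2) using m(3) by (simp del: of_nat_Suc)
    qed
    then show ?thesis by (rule Lim_transform_eventually[OF lim'])
  qed
  ultimately show ?thesis using LIMSEQ_unique A by metis
qed

text \<open>Jump times up to n are atoms of a finite measure, which has only countably many.\<close>

lemma countable_jumps: "countable {s. 0 < jump x s}"
proof -
  have "countable {s. 0 < jump x s \<and> s \<le> real n}" for n
  proof -
    interpret finite_measure "stopped_measure (real n) 1 x"
      by (rule finite_measureI) (simp add: emeasure_stopped_UNIV sets_eq_imp_space_eq[OF sets_stopped])
    have "countable {y. measure (stopped_measure (real n) 1 x) {y} \<noteq> 0}" by (rule countable_support)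
    moreover have "measure (stopped_measure (real n) 1 x) {s} \<noteq> 0" if "0 < jump x s" "s \<le> real n" for s
      using emeasure_stopped_singleton[of 1 s "real n"] that jump_nonpos[of s] by (cases "0 < s") (auto simp: measure_def)
    ultimately show ?thesis by (rule_tac countable_subset) auto
  qed
  then have "countable (\<Union>n. {s. 0 < jump x s \<and> s \<le> real n})" by auto
  moreover have "{s. 0 < jump x s} = (\<Union>n. {s. 0 < jump x s \<and> s \<le> real n})"
    using real_arch_simple by auto
  ultimately show ?thesis by simp
qed

text \<open>Each jump time is an atom of mass jump/c, so dividing the summand by that mass turns the
  sum into an integral against a finite measure. Dominated convergence and measurability in the
  sample point become available through this form.\<close>

lemma jump_sum_stopped:
  assumes c: "0 < c" and T: "T \<subseteq> {..t}" and t: "0 \<le> t"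
  shows "jump_sum x T f = (\<integral>\<^sup>+s. f s / ennreal (jump x s / c) * indicator {s\<in>T. 0 < jump x s} s \<partial>stopped_measure t c x)"
proof -
  let ?D = "{s\<in>T. 0 < jump x s}"
  have D: "countable ?D" by (rule countable_subset[OF _ countable_jumps]) auto
  show ?thesis
    unfolding jump_sum_def nn_integral_countable_atoms[OF sets_stopped D]
  proof (intro nn_integral_cong)
    fix s
    show "f s * indicator ?D s = f s / ennreal (jump x s / c) * emeasure (stopped_measure t c x) {s} * indicator ?D s"
    proof (cases "s \<in> ?D")
      case True
      then have s: "0 < s" "s \<le> t" "0 < jump x s" using jump_nonpos[of s] T by (cases "0 < s"; auto)+
      have "f s / ennreal (jump x s / c) * ennreal (jump x s / c) = f s"
        using s c by (intro ennreal_divide_times[THEN trans]) (auto simp: ennreal_mult_divide_eq )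
      then show ?thesis using s c by (simp add: emeasure_stopped_singleton)
    qed simp
  qed
qed

text \<open>For the summand equal to the jump the integrand is at most 1. Equality fails when the
  path has a continuous part.\<close>

lemma jump_sum_jump_le: "0 \<le> t \<Longrightarrow> jump_sum x {0<..t} (\<lambda>s. ennreal (jump x s)) \<le> ennreal (x t)"
proof -
  assume t: "0 \<le> t"
  have "jump_sum x {0<..t} (\<lambda>s. ennreal (jump x s)) =
      (\<integral>\<^sup>+s. ennreal (jump x s) / ennreal (jump x s / 1) * indicator {s\<in>{0<..t}. 0 < jump x s} s \<partial>stopped_measure t 1 x)"
    using t by (intro jump_sum_stopped) auto
  also have "\<dots> \<le> (\<integral>\<^sup>+s. indicator UNIV s \<partial>stopped_measure t 1 x)"
    by (intro nn_integral_mono) (auto simp: ennreal_divide_self split: split_indicator)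
  also have "\<dots> = ennreal (x t)" using t sets_eq_imp_space_eq[OF sets_stopped[of t 1]]
    by (subst nn_integral_indicator) (auto simp: emeasure_stopped_UNIV)
  finally show ?thesis .
qed

end

section \<open>Regular grids and sums over grid increments\<close>

definition gridpt :: "real \<Rightarrow> real \<Rightarrow> nat \<Rightarrow> int \<Rightarrow> real" where
  "gridpt a b n i = a + (b - a) * of_int i / real n"

text \<open>The ceiling selects the right end of the cell containing s, the cells being open on the
  left and closed on the right; the left end is then strictly below s and sees the left limit of the
  path.\<close>

definition gridix :: "real \<Rightarrow> real \<Rightarrow> nat \<Rightarrow> real \<Rightarrow> int" where
  "gridix a b n s = \<lceil>(s - a) * real n / (b - a)\<rceil>"

lemma gridpt_mono: "a \<le> b \<Longrightarrow> i \<le> j \<Longrightarrow> gridpt a b n i \<le> gridpt a b n j"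
  unfolding gridpt_def by (intro add_left_mono divide_right_mono mult_left_mono) auto

lemma gridix_unique:
  assumes "a < b" "0 < n" "gridpt a b n i < s" "s \<le> gridpt a b n (i+1)"
  shows "gridix a b n s = i + 1"
proof -
  have "of_int i < (s - a) * real n / (b - a)" "(s - a) * real n / (b - a) \<le> of_int i + 1"
    using assms unfolding gridpt_def by (auto simp: field_simps)
  then show ?thesis unfolding gridix_def by (intro ceiling_unique) auto
qed

lemma grid_bounds:
  assumes "a < b" "0 < n"
  shows "gridpt a b n (gridix a b n s - 1) < s" "s \<le> gridpt a b n (gridix a b n s)"
proof -
  let ?r = "(s - a) * real n / (b - a)"
  have c: "of_int (gridix a b n s) - 1 < ?r" "?r \<le> of_int (gridix a b n s)"
    unfolding gridix_def by linarith+
  show "gridpt a b n (gridix a b n s - 1) < s" "s \<le> gridpt a b n (gridix a b n s)"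
    using c assms unfolding gridpt_def by (auto simp: field_simps)
qed

lemma gridix_range: "a < b \<Longrightarrow> 0 < n \<Longrightarrow> a < s \<Longrightarrow> s \<le> b \<Longrightarrow> 1 \<le> gridix a b n s \<and> gridix a b n s \<le> int n"
proof -
  assume *: "a < b" "0 < n" "a < s" "s \<le> b"
  have "0 < (s - a) * real n / (b - a)" "(s - a) * real n / (b - a) \<le> real n"
    using * by (auto simp: field_simps)
  then show ?thesis unfolding gridix_def by (auto simp: ceiling_le_iff)
qed

lemma grid_tendsto:
  assumes "a < b"
  shows "(\<lambda>n. gridpt a b n (gridix a b n s)) \<longlonglongrightarrow> s" "(\<lambda>n. gridpt a b n (gridix a b n s - 1)) \<longlonglongrightarrow> s"
proof -
  have d: "gridpt a b n (gridix a b n s) - gridpt a b n (gridix a b n s - 1) = (b - a) / real n" for n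
    unfolding gridpt_def by (cases "n = 0") (auto simp: field_simps)
  have l0: "(\<lambda>n. (b - a) / real n) \<longlonglongrightarrow> 0" by (rule lim_const_over_n)
  have l1: "(\<lambda>n. s + (b - a) / real n) \<longlonglongrightarrow> s" using tendsto_add[OF tendsto_const l0, of s] by simp
  have l2: "(\<lambda>n. s - (b - a) / real n) \<longlonglongrightarrow> s" using tendsto_diff[OF tendsto_const l0, of s] by simp
  have e: "\<forall>\<^sub>F n in sequentially. s \<le> gridpt a b n (gridix a b n s)"
    "\<forall>\<^sub>F n in sequentially. gridpt a b n (gridix a b n s) \<le> s + (b - a) / real n"
    "\<forall>\<^sub>F n in sequentially. s - (b - a) / real n \<le> gridpt a b n (gridix a b n s - 1)"
    "\<forall>\<^sub>F n in sequentially. gridpt a b n (gridix a b n s - 1) \<le> s"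
  proof -
    have *: "s \<le> gridpt a b n (gridix a b n s) \<and> gridpt a b n (gridix a b n s) \<le> s + (b - a) / real n \<and>
      s - (b - a) / real n \<le> gridpt a b n (gridix a b n s - 1) \<and> gridpt a b n (gridix a b n s - 1) \<le> s" if "1 \<le> n" for n
    proof -
      have "0 < n" using that by simp
      then show ?thesis using d[of n] grid_bounds[OF assms, of n s] by linarith
    qed
    then show "\<forall>\<^sub>F n in sequentially. s \<le> gridpt a b n (gridix a b n s)"
    "\<forall>\<^sub>F n in sequentially. gridpt a b n (gridix a b n s) \<le> s + (b - a) / real n"
    "\<forall>\<^sub>F n in sequentially. s - (b - a) / real n \<le> gridpt a b n (gridix a b n s - 1)"
    "\<forall>\<^sub>F n in sequentially. gridpt a b n (gridix a b n s - 1) \<le> s"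
      by (intro eventually_sequentiallyI[of 1]; blast)+
  qed
  show "(\<lambda>n. gridpt a b n (gridix a b n s)) \<longlonglongrightarrow> s"
    by (rule tendsto_sandwich[OF e(1,2) tendsto_const l1])
  show "(\<lambda>n. gridpt a b n (gridix a b n s - 1)) \<longlonglongrightarrow> s"
    by (rule tendsto_sandwich[OF e(3,4) l2 tendsto_const])
qed

lemma grid_left_tendsto:
  assumes x: "increasing_path x" and "0 \<le> a" "a < b" "a < s" "s \<le> b"
  shows "(\<lambda>n. x (gridpt a b n (gridix a b n s - 1))) \<longlonglongrightarrow> x s - jump x s"
    "(\<lambda>n. x (gridpt a b n (gridix a b n s))) \<longlonglongrightarrow> x s"
  using assms by (auto intro!: tendsto_left_seq[OF x] tendsto_right_seq[OF x] grid_tendsto grid_bounds)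

text \<open>Write u y = v y * y. The sum over the grid is the Stieltjes integral of the step
  function that equals v of the increment over the cell containing s. It converges pointwise to v of
  the jump at s: the bound u y <= y^2 gives v y <= y and makes the limit 0 at continuity points, and
  u y <= y gives the dominating constant 1 on a finite measure.\<close>

lemma increments_tendsto_jump_sum:
  fixes u :: "real \<Rightarrow> real"
  assumes x: "increasing_path x" and ab: "0 \<le> a" "a < b"
    and u: "continuous_on {0..} u" "\<And>y. 0 \<le> y \<Longrightarrow> 0 \<le> u y" "\<And>y. 0 \<le> y \<Longrightarrow> u y \<le> y^2" "\<And>y. 0 \<le> y \<Longrightarrow> u y \<le> y"
  shows "(\<lambda>n. ennreal (\<Sum>i<n. u (x (gridpt a b n (int i + 1)) - x (gridpt a b n (int i)))))
     \<longlonglongrightarrow> jump_sum x {a<..b} (\<lambda>s. ennreal (u (jump x s)))"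
proof -
  let ?M = "stopped_measure b 1 x"
  have b: "0 \<le> b" using ab by simp
  have [measurable_cong]: "sets ?M = sets borel" by (rule sets_stopped[OF x])
  let ?t = "\<lambda>n i. gridpt a b n (int i)"
  let ?inc = "\<lambda>n i. x (gridpt a b n (int i + 1)) - x (?t n i)"
  define v where "v y = u y / y" for y
  have v0: "v 0 = 0" by (simp add: v_def)
  have v: "0 \<le> v y" "v y \<le> y" "v y \<le> 1" "v y * y = u y" if "0 \<le> y" for y
    using u(2-4)[OF that] u(3)[of 0] that by (cases "y = 0"; auto simp: v_def field_simps power2_eq_square)+
  define V where "V n s = (\<Sum>i<n. ennreal (v (?inc n i)) * indicator {?t n i<..gridpt a b n (int i + 1)} s)" for n s
  have tr: "a \<le> ?t n i" "gridpt a b n (int i + 1) \<le> b" "?t n i \<le> gridpt a b n (int i + 1)" "0 \<le> ?t n i" if "i < n" for n i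
  proof -
    have n: "real n > 0" using that by auto
    show "a \<le> ?t n i" unfolding gridpt_def using ab by auto
    then show "0 \<le> ?t n i" using ab by simp
    have "(b - a) * (real i + 1) / real n \<le> (b - a) * real n / real n"
      using ab that by (intro divide_right_mono mult_left_mono) auto
    then show "gridpt a b n (int i + 1) \<le> b" unfolding gridpt_def using n by simp
    show "?t n i \<le> gridpt a b n (int i + 1)" using ab by (intro gridpt_mono) auto
  qed
  have inc: "0 \<le> ?inc n i" if "i < n" for n i
    using path_mono[OF x tr(4)[OF that] tr(3)[OF that]] by simp
  have meas[measurable]: "V n \<in> borel_measurable borel" for n unfolding V_def by measurable
  have int: "(\<integral>\<^sup>+s. V n s \<partial>?M) = ennreal (\<Sum>i<n. u (?inc n i))" for n
  proof -
    have "(\<integral>\<^sup>+s. V n s \<partial>?M) = (\<Sum>i<n. (\<integral>\<^sup>+s. ennreal (v (?inc n i)) * indicator {?t n i<..gridpt a b n (int i + 1)} s \<partial>?M))"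
      unfolding V_def by (subst nn_integral_sum) (auto simp: sets_stopped[OF x])
    also have "\<dots> = (\<Sum>i<n. ennreal (u (?inc n i)))"
    proof (rule sum.cong[OF refl])
      fix i assume "i \<in> {..<n}"
      then have i: "i < n" by simp
      have "emeasure ?M {?t n i<..gridpt a b n (int i + 1)} = ennreal (?inc n i)"
        using tr[OF i] ab by (subst emeasure_stopped_Ioc[OF x]) (auto simp: min_def max_def)
      then have "(\<integral>\<^sup>+s. ennreal (v (?inc n i)) * indicator {?t n i<..gridpt a b n (int i + 1)} s \<partial>?M)
        = ennreal (v (?inc n i)) * ennreal (?inc n i)"
        by (subst nn_integral_cmult_indicator) (auto simp: sets_stopped[OF x])
      also have "\<dots> = ennreal (u (?inc n i))"
        using v(1)[OF inc[OF i]] v(4)[OF inc[OF i]] inc[OF i] by (simp add: ennreal_mult[symmetric])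
      finally show "(\<integral>\<^sup>+s. ennreal (v (?inc n i)) * indicator {?t n i<..gridpt a b n (int i + 1)} s \<partial>?M) = ennreal (u (?inc n i))" .
    qed
    also have "\<dots> = ennreal (\<Sum>i<n. u (?inc n i))" using u(2) inc by (intro sum_ennreal) auto
    finally show ?thesis .
  qed
  have Vs: "V n s = (if a < s \<and> s \<le> b then ennreal (v (x (gridpt a b n (gridix a b n s)) - x (gridpt a b n (gridix a b n s - 1)))) else 0)"
    if n: "0 < n" for n s
  proof (cases "a < s \<and> s \<le> b")
    case True
    define k where "k = nat (gridix a b n s - 1)"
    have k: "gridix a b n s = int k + 1" "k < n"
      using gridix_range[OF ab(2) n, of s] True unfolding k_def by linarith+
    have *: "indicator {?t n i<..gridpt a b n (int i + 1)} s = (if i = k then 1 else 0::ennreal)" if "i < n" for i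
    proof -
      have "s \<in> {?t n i<..gridpt a b n (int i + 1)} \<longleftrightarrow> i = k"
      proof
        assume "s \<in> {?t n i<..gridpt a b n (int i + 1)}"
        then have "gridix a b n s = int i + 1" by (intro gridix_unique[OF ab(2) n]) simp_all
        then show "i = k" using k by simp
      next
        assume "i = k"
        then show "s \<in> {?t n i<..gridpt a b n (int i + 1)}"
          using grid_bounds[OF ab(2) n, of s] k by simp
      qed
      then show ?thesis by (auto simp only: indicator_def of_bool_def)
    qed
    have "V n s = (\<Sum>i<n. if i = k then ennreal (v (?inc n i)) else 0)"
      unfolding V_def by (rule sum.cong) (auto simp: *)
    then show ?thesis using True k by simp
  next
    case False
    then have "indicator {?t n i<..gridpt a b n (int i + 1)} s = (0::ennreal)" if "i < n" for i
      using tr[OF that] by (auto simp: indicator_def)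
    then show ?thesis using False by (auto simp: V_def)
  qed
  let ?W = "\<lambda>s. ennreal (v (jump x s)) * indicator {s\<in>{a<..b}. 0 < jump x s} s"
  have [measurable]: "?W \<in> borel_measurable borel"
  proof (rule measurable_discrete_difference[where X="{s. 0 < jump x s}" and f="\<lambda>_. 0"])
    show "countable {s. 0 < jump x s}" using x by (rule countable_jumps)
  qed auto
  have lim: "(\<lambda>n. V n s) \<longlonglongrightarrow> ?W s" for s
  proof (cases "a < s \<and> s \<le> b")
    case True
    let ?d = "\<lambda>n. x (gridpt a b n (gridix a b n s)) - x (gridpt a b n (gridix a b n s - 1))"
    have d: "?d \<longlonglongrightarrow> jump x s"
      using tendsto_diff[OF grid_left_tendsto(2,1)[OF x ab, of s]] True by simp
    have d0: "0 \<le> ?d n" if "0 < n" for n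
    proof -
      have "0 \<le> gridpt a b n (gridix a b n s - 1)"
        using gridix_range[OF ab(2) that] True ab that unfolding gridpt_def by auto
      then show ?thesis
        using path_mono[OF x, of "gridpt a b n (gridix a b n s - 1)" "gridpt a b n (gridix a b n s)"]
          gridpt_mono[of a b "gridix a b n s - 1" "gridix a b n s" n] ab by simp
    qed
    have "(\<lambda>n. v (?d n)) \<longlonglongrightarrow> v (jump x s)"
    proof (cases "jump x s = 0")
      case j: True
      show ?thesis unfolding j v0
        by (rule tendsto_sandwich[OF _ _ tendsto_const d[unfolded j]]; rule eventually_sequentiallyI[of 1])
          (use v d0 in auto)
    next
      case j: False
      have "(\<lambda>n. u (?d n)) \<longlonglongrightarrow> u (jump x s)"
      proof (rule continuous_on_tendsto_compose[OF u(1) d])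
        show "\<forall>\<^sub>F n in sequentially. ?d n \<in> {0..}"
          using d0 by (intro eventually_sequentiallyI[of 1]) simp
      qed (use jump_nonneg[OF x] in simp)
      then show ?thesis unfolding v_def using j d by (intro tendsto_divide) auto
    qed
    then have "(\<lambda>n. ennreal (v (?d n))) \<longlonglongrightarrow> ennreal (v (jump x s))" by (rule tendsto_ennrealI)
    moreover have "?W s = ennreal (v (jump x s))"
      using True v0 jump_nonneg[OF x, of s] by (cases "jump x s = 0") (auto simp: indicator_def)
    moreover have "\<forall>\<^sub>F n in sequentially. ennreal (v (?d n)) = V n s"
      using True by (intro eventually_sequentiallyI[of 1]) (auto simp: Vs)
    ultimately show ?thesis by (auto intro: Lim_transform_eventually)
  next
    case False
    then have "\<forall>\<^sub>F n in sequentially. V n s = ?W s"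
      by (intro eventually_sequentiallyI[of 1]) (auto simp: Vs)
    then show ?thesis by (rule tendsto_eventually)
  qed
  \<comment> \<open>The shift to \<open>Suc n\<close> excludes the degenerate grid with no cells,
    for which the description \<open>Vs\<close> of the step function fails.\<close>
  have "(\<lambda>n. \<integral>\<^sup>+s. V (Suc n) s \<partial>?M) \<longlonglongrightarrow> (\<integral>\<^sup>+s. ?W s \<partial>?M)"
  proof (rule nn_integral_dominated_convergence[where w="\<lambda>s. indicator UNIV s"])
    show "(\<integral>\<^sup>+s. indicator UNIV s \<partial>?M) < \<infinity>"
      using b by (subst nn_integral_indicator) (auto simp: emeasure_stopped_UNIV[OF x] sets_stopped[OF x])
    show "AE s in ?M. V (Suc j) s \<le> indicator UNIV s" for j
    proof (rule AE_I2)
      fix s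
      show "V (Suc j) s \<le> indicator UNIV s"
      proof (cases "a < s \<and> s \<le> b")
        case True
        let ?n = "Suc j"
        have "0 \<le> gridpt a b ?n (gridix a b ?n s - 1)"
          using gridix_range[OF ab(2), of ?n s] True ab unfolding gridpt_def by auto
        then have "0 \<le> x (gridpt a b ?n (gridix a b ?n s)) - x (gridpt a b ?n (gridix a b ?n s - 1))"
          using path_mono[OF x, of "gridpt a b ?n (gridix a b ?n s - 1)" "gridpt a b ?n (gridix a b ?n s)"]
          gridpt_mono[of a b "gridix a b ?n s - 1" "gridix a b ?n s" ?n] ab by simp
        then show ?thesis using v(3) by (subst Vs) (auto simp: ennreal_le_1)
      next
        case False
        then have "V (Suc j) s = 0" by (subst Vs) auto
        then show ?thesis by simp
      qed
    qed
    show "AE s in ?M. (\<lambda>i. V (Suc i) s) \<longlonglongrightarrow> ?W s" by (intro AE_I2 LIMSEQ_Suc lim)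
    show "V (Suc i) \<in> borel_measurable ?M" for i by measurable
    show "?W \<in> borel_measurable ?M" by measurable
    show "indicator UNIV \<in> borel_measurable ?M" by measurable
  qed
  then have "(\<lambda>n. \<integral>\<^sup>+s. V n s \<partial>?M) \<longlonglongrightarrow> (\<integral>\<^sup>+s. ?W s \<partial>?M)" by (rule LIMSEQ_imp_Suc)
  moreover have "jump_sum x {a<..b} (\<lambda>s. ennreal (u (jump x s))) =
      (\<integral>\<^sup>+s. ennreal (u (jump x s)) / ennreal (jump x s / 1) * indicator {s\<in>{a<..b}. 0 < jump x s} s \<partial>?M)"
    using b by (intro jump_sum_stopped[OF x]) auto
  moreover have "\<dots> = (\<integral>\<^sup>+s. ?W s \<partial>?M)"
    by (intro nn_integral_cong) (auto simp: v_def u(2) divide_ennreal jump_nonneg[OF x] split: split_indicator)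
  ultimately show ?thesis unfolding int by simp
qed

text \<open>Projecting time onto the interval from 0 to t gives a total map, so that "predictable,
  hence progressively measurable" becomes measurability of a composition.\<close>

definition clamp_time :: "real \<Rightarrow> real \<times> 'a \<Rightarrow> real \<times> 'a" where
  "clamp_time t p = (min t (max 0 (fst p)), snd p)"

section \<open>Subordinators and predictability\<close>

locale increasing_levy = prob_space P for P :: "'a measure" +
  fixes X :: "real \<Rightarrow> 'a \<Rightarrow> real"
  assumes subordinator: "subordinator P X"
begin

abbreviation F where "F \<equiv> natural_filtration (space P) X"
abbreviation Pred where "Pred \<equiv> predictable_sigma (space P) F"
abbreviation path where "path \<omega> \<equiv> (\<lambda>r. X r \<omega>)"
abbreviation jmp where "jmp \<omega> \<equiv> jump (path \<omega>)"
abbreviation jsum where "jsum \<omega> \<equiv> jump_sum (path \<omega>)"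

lemma X_measurable_P[measurable]: "0 \<le> t \<Longrightarrow> X t \<in> borel_measurable P"
  using subordinator by (auto simp: subordinator_def levy_process_def)

lemma path: "\<omega> \<in> space P \<Longrightarrow> increasing_path (path \<omega>)"
  using subordinator by (auto simp: subordinator_def levy_process_def increasing_path_def)

lemma X_0: "\<omega> \<in> space P \<Longrightarrow> X 0 \<omega> = 0"
  using subordinator by (auto simp: subordinator_def levy_process_def)

lemma space_F[simp]: "space (F t) = space P"
  unfolding natural_filtration_def generated_sigma_def by (rule space_measure_of) auto

lemma sets_F: "sets (F t) = sigma_sets (space P) {X s -` A \<inter> space P |s A. s \<in> {0..t} \<and> A \<in> sets borel}"
  unfolding natural_filtration_def generated_sigma_def by (rule sets_measure_of) auto

lemma X_adapted: "0 \<le> s \<Longrightarrow> s \<le> t \<Longrightarrow> X s \<in> borel_measurable (F t)"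
  by (rule measurableI) (auto simp: sets_F intro!: sigma_sets.Basic)

lemma sets_F_subset: "sets (F t) \<subseteq> sets P"
  unfolding sets_F
  by (rule sets.sigma_sets_subset) (auto intro!: measurable_sets[OF X_measurable_P])

lemma sets_F_mono: "s \<le> t \<Longrightarrow> sets (F s) \<subseteq> sets (F t)"
  unfolding sets_F
proof (rule sigma_sets_mono', safe)
  fix r A assume "s \<le> t" "r \<in> {0..s}" "A \<in> sets (borel :: real measure)"
  then have "r \<in> {0..t}" by auto
  then show "\<exists>r' A'. X r -` A \<inter> space P = X r' -` A' \<inter> space P \<and> r' \<in> {0..t} \<and> A' \<in> sets borel"
    using \<open>A \<in> sets borel\<close> by blast
qed

lemma subalgebra_F: "subalgebra P (F t)"
  using sets_F_subset by (auto simp: subalgebra_def)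

lemma filtration_F: "filtration (space P) F"
  by unfold_locales (use sets_F_mono in auto)

lemma measurable_F_mono: "s \<le> t \<Longrightarrow> f \<in> measurable (F s) N \<Longrightarrow> f \<in> measurable (F t) N"
  using sets_F_mono[of s t] by (auto simp: measurable_def)

lemma measurable_F_P: "f \<in> measurable (F t) N \<Longrightarrow> f \<in> measurable P N"
  using sets_F_subset[of t] by (auto simp: measurable_def)

section \<open>Predictable sets and measurability of sums over jumps\<close>

lemma predictable_generators:
  "{{0} \<times> A |A. A \<in> sets (F 0)} \<union> {{s<..t} \<times> A |s t A. 0 \<le> s \<and> s < t \<and> A \<in> sets (F s)} \<subseteq> Pow ({0..} \<times> space P)"
  using sets.sets_into_space[of _ "F _"] by fastforce

lemma space_Pred: "space Pred = {0..} \<times> space P"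
  unfolding predictable_sigma_def by (rule space_measure_of[OF predictable_generators])

text \<open>A generating rectangle that starts at u < t has its base in F u, hence in F t; one that
  starts at t or later is never reached by the clamped time.\<close>

lemma clamp_time_measurable[measurable]:
  assumes t: "0 \<le> t"
  shows "clamp_time t \<in> measurable (borel \<Otimes>\<^sub>M F t) Pred"
  unfolding predictable_sigma_def
proof (rule measurable_measure_of[OF predictable_generators])
  show "clamp_time t \<in> space (borel \<Otimes>\<^sub>M F t) \<rightarrow> {0..} \<times> space P"
    using t by (auto simp: clamp_time_def space_pair_measure)
  fix y assume "y \<in> {{0} \<times> A |A. A \<in> sets (F 0)} \<union> {{s<..t} \<times> A |s t A. 0 \<le> s \<and> s < t \<and> A \<in> sets (F s)}"
  then consider A where "y = {0} \<times> A" "A \<in> sets (F 0)"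
    | u v A where "y = {u<..v} \<times> A" "0 \<le> u" "u < v" "A \<in> sets (F u)" by auto
  then show "clamp_time t -` y \<inter> space (borel \<Otimes>\<^sub>M F t) \<in> sets (borel \<Otimes>\<^sub>M F t)"
  proof cases
    case 1
    have A: "A \<in> sets (F t)" using 1(2) sets_F_mono[OF t] by auto
    have "clamp_time t -` y \<inter> space (borel \<Otimes>\<^sub>M F t) = {s. min t (max 0 s) = 0} \<times> A"
      using sets.sets_into_space[OF A] by (auto simp: 1 clamp_time_def space_pair_measure)
    then show ?thesis using A by auto
  next
    case 2
    show ?thesis
    proof (cases "u < t")
      case True
      have A: "A \<in> sets (F t)" using 2(4) sets_F_mono[of u t] True by auto
      have "clamp_time t -` y \<inter> space (borel \<Otimes>\<^sub>M F t) = {s. u < min t (max 0 s) \<and> min t (max 0 s) \<le> v} \<times> A"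
        using sets.sets_into_space[OF A] by (auto simp: 2(1) clamp_time_def space_pair_measure)
      then show ?thesis using A by auto
    next
      case False
      then have "clamp_time t -` y \<inter> space (borel \<Otimes>\<^sub>M F t) = {}"
        by (auto simp: 2(1) clamp_time_def)
      then show ?thesis by simp
    qed
  qed
qed

text \<open>The cell index takes countably many values, and clamping it to 0..n keeps the grid times
  inside the interval from 0 to t. The offset d will be 0 or -1, for the two ends of a cell.\<close>

lemma X_grid_measurable:
  assumes t: "0 < t"
  shows "(\<lambda>(s,\<omega>). X (gridpt 0 t n (max 0 (min (int n) (gridix 0 t n s + d)))) \<omega>) \<in> borel_measurable (borel \<Otimes>\<^sub>M F t)"
proof -
  have "(\<lambda>p. X (gridpt 0 t n (max 0 (min (int n) (gridix 0 t n (fst p) + d)))) (snd p)) \<in> borel_measurable (borel \<Otimes>\<^sub>M F t)"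
  proof (rule measurable_compose_countable[where f="\<lambda>i p. X (gridpt 0 t n (max 0 (min (int n) (i + d)))) (snd p)"])
    fix i :: int
    let ?j = "max 0 (min (int n) (i + d))"
    have "0 \<le> gridpt 0 t n ?j" "gridpt 0 t n ?j \<le> t"
    proof -
      show "0 \<le> gridpt 0 t n ?j" unfolding gridpt_def using t by auto
      have "t * real_of_int ?j / real n \<le> t * real n / real n"
        using t by (intro divide_right_mono mult_left_mono) auto
      also have "\<dots> \<le> t" using t by (cases "n = 0") auto
      finally show "gridpt 0 t n ?j \<le> t" unfolding gridpt_def by simp
    qed
    then show "(\<lambda>p. X (gridpt 0 t n ?j) (snd p)) \<in> borel_measurable (borel \<Otimes>\<^sub>M F t)"
      by (intro measurable_compose[OF measurable_snd] X_adapted)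
  next
    show "(\<lambda>p. gridix 0 t n (fst p)) \<in> measurable (borel \<Otimes>\<^sub>M F t) (count_space UNIV)"
      unfolding gridix_def by measurable
  qed
  then show ?thesis by (simp add: split_beta)
qed

definition jump_before :: "real \<Rightarrow> real \<times> 'a \<Rightarrow> real" where
  "jump_before t p = (if 0 < fst p \<and> fst p \<le> t then jump (path (snd p)) (fst p) else 0)"

text \<open>The jump at s is the limit of the increments over the grid cells that contain s. This
  gives joint measurability in time and sample point.\<close>

lemma jump_before_measurable[measurable]:
  "jump_before t \<in> borel_measurable (borel \<Otimes>\<^sub>M F t)"
proof (cases "0 < t")
  case False
  then have "jump_before t = (\<lambda>_. 0)" by (auto simp: jump_before_def fun_eq_iff)
  then show ?thesis by simp
next
  case True
  let ?Y = "\<lambda>n d (p :: real \<times> 'a). X (gridpt 0 t n (max 0 (min (int n) (gridix 0 t n (fst p) + d)))) (snd p)"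
  have [measurable]: "?Y n d \<in> borel_measurable (borel \<Otimes>\<^sub>M F t)" for n d
    using X_grid_measurable[OF True, of n d] by (simp add: split_beta)
  let ?G = "\<lambda>n (p :: real \<times> 'a). if 0 < fst p \<and> fst p \<le> t then ?Y n 0 p - ?Y n (-1) p else 0"
  show ?thesis
  proof (rule borel_measurable_LIMSEQ_real[where u="\<lambda>n. ?G n"])
    show "?G n \<in> borel_measurable (borel \<Otimes>\<^sub>M F t)" for n by measurable
    fix p :: "real \<times> 'a" assume p: "p \<in> space (borel \<Otimes>\<^sub>M F t)"
    show "(\<lambda>n. ?G n p) \<longlonglongrightarrow> jump_before t p"
    proof (cases "0 < fst p \<and> fst p \<le> t")
      case s: True
      obtain s \<omega> where p': "p = (s,\<omega>)" by force
      have \<omega>: "\<omega> \<in> space P" using p by (auto simp: p' space_pair_measure)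
      have "(\<lambda>n. X (gridpt 0 t n (gridix 0 t n s)) \<omega> - X (gridpt 0 t n (gridix 0 t n s - 1)) \<omega>)
        \<longlonglongrightarrow> X s \<omega> - (X s \<omega> - jmp \<omega> s)"
        using s by (intro tendsto_diff grid_left_tendsto[OF path[OF \<omega>]] True) (auto simp: p')
      moreover have "\<forall>\<^sub>F n in sequentially. X (gridpt 0 t n (gridix 0 t n s)) \<omega> - X (gridpt 0 t n (gridix 0 t n s - 1)) \<omega> = ?G n p"
      proof (rule eventually_sequentiallyI[of 1])
        fix n :: nat assume "1 \<le> n"
        then have "1 \<le> gridix 0 t n s \<and> gridix 0 t n s \<le> int n"
          using s True by (intro gridix_range) (auto simp: p')
        then have "max 0 (min (int n) (gridix 0 t n s + 0)) = gridix 0 t n s"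
          "max 0 (min (int n) (gridix 0 t n s + (-1))) = gridix 0 t n s - 1" by auto
        then show "X (gridpt 0 t n (gridix 0 t n s)) \<omega> - X (gridpt 0 t n (gridix 0 t n s - 1)) \<omega> = ?G n p"
          using s by (simp add: p')
      qed
      ultimately show ?thesis using s by (auto simp: jump_before_def p' intro: Lim_transform_eventually)
    qed (auto simp: jump_before_def)
  qed
qed

text \<open>Half-open intervals generate the Borel sets and are stable under intersection, and their
  mass is an explicit function of X at times up to t.\<close>

lemma stopped_kernel:
  assumes t: "0 \<le> t"
  shows "(\<lambda>\<omega>. stopped_measure t (1 + X t \<omega>) (path \<omega>)) \<in> measurable (F t) (subprob_algebra borel)"
proof (rule measurable_subprob_algebra_generated[where G="range (\<lambda>(a,b). {a<..b::real})" and \<Omega>=UNIV])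
  have c: "0 < 1 + X t \<omega>" if "\<omega> \<in> space P" for \<omega>
    using path_nonneg[OF path[OF that] t] by simp
  show "sets borel = sigma_sets UNIV (range (\<lambda>(a, b). {a<..b::real}))"
    by (simp add: borel_sigma_sets_Ioc)
  show "Int_stable (range (\<lambda>(a, b). {a<..b::real}))"
    by (auto simp: Int_stable_def greaterThanAtMost_def) (metis (no_types, lifting) Int_greaterThanAtMost greaterThanAtMost_def rangeI case_prod_conv)
  fix \<omega> assume "\<omega> \<in> space (F t)"
  then have \<omega>: "\<omega> \<in> space P" by simp
  show "subprob_space (stopped_measure t (1 + X t \<omega>) (path \<omega>))"
  proof
    show "emeasure (stopped_measure t (1 + X t \<omega>) (path \<omega>)) (space (stopped_measure t (1 + X t \<omega>) (path \<omega>))) \<le> 1"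
      using c[OF \<omega>] by (simp add: sets_eq_imp_space_eq[OF sets_stopped] path[OF \<omega>] emeasure_stopped_UNIV[OF path[OF \<omega>] t c[OF \<omega>]] divide_le_eq)
    show "space (stopped_measure t (1 + X t \<omega>) (path \<omega>)) \<noteq> {}"
      by (simp add: sets_eq_imp_space_eq[OF sets_stopped[OF path[OF \<omega>]]])
  qed
  show "sets (stopped_measure t (1 + X t \<omega>) (path \<omega>)) = sets borel" by (rule sets_stopped[OF path[OF \<omega>]])
next
  have c: "0 < 1 + X t \<omega>" if "\<omega> \<in> space P" for \<omega>
    using path_nonneg[OF path[OF that] t] by simp
  have [measurable]: "X (min t (max 0 r)) \<in> borel_measurable (F t)" for r
    using t by (intro X_adapted) auto
  have [measurable]: "X t \<in> borel_measurable (F t)" using t by (intro X_adapted) auto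
  show "(\<lambda>\<omega>. emeasure (stopped_measure t (1 + X t \<omega>) (path \<omega>)) UNIV) \<in> borel_measurable (F t)"
    by (subst measurable_cong[where g="\<lambda>\<omega>. ennreal (X t \<omega> / (1 + X t \<omega>))"])
      (auto simp: emeasure_stopped_UNIV[OF path t c])
  fix A assume "A \<in> range (\<lambda>(a, b). {a<..b::real})"
  then obtain a b where A: "A = {a<..b}" by auto
  show "(\<lambda>\<omega>. emeasure (stopped_measure t (1 + X t \<omega>) (path \<omega>)) A) \<in> borel_measurable (F t)"
    unfolding A
    by (subst measurable_cong[where g="\<lambda>\<omega>. if a \<le> b then ennreal (X (min t (max 0 b)) \<omega> / (1 + X t \<omega>) - X (min t (max 0 a)) \<omega> / (1 + X t \<omega>)) else 0"])
      (auto simp: emeasure_stopped_Ioc[OF path t c])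
qed auto

text \<open>No measurable enumeration of the random jump times is used: the sum is an integral
  against the Stieltjes kernel, the weights being recovered from \<open>jump_before\<close>.\<close>

lemma jump_sum_measurable:
  assumes t: "0 \<le> t" and S[measurable]: "S \<in> sets borel" and St: "S \<subseteq> {0<..t}"
    and K[measurable]: "K \<in> borel_measurable (borel \<Otimes>\<^sub>M F t)"
  shows "(\<lambda>\<omega>. jsum \<omega> S (\<lambda>s. K (s, \<omega>))) \<in> borel_measurable (F t)"
proof -
  have [measurable]: "X t \<in> borel_measurable (F t)" using t by (intro X_adapted) auto
  let ?J = "\<lambda>\<omega> s. jump_before t (s, \<omega>)"
  let ?f = "\<lambda>\<omega> s. K (s, \<omega>) / ennreal (?J \<omega> s / (1 + X t \<omega>)) * indicator S s * indicator {0<..} (?J \<omega> s)"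
  have "(\<lambda>\<omega>. \<integral>\<^sup>+s. ?f \<omega> s \<partial>stopped_measure t (1 + X t \<omega>) (path \<omega>)) \<in> borel_measurable (F t)"
    by (rule nn_integral_measurable_subprob_algebra2[where N=borel, OF _ stopped_kernel[OF t]]) measurable
  also have "?this \<longleftrightarrow> ?thesis"
  proof (rule measurable_cong)
    fix \<omega> assume "\<omega> \<in> space (F t)"
    then have \<omega>: "\<omega> \<in> space P" by simp
    have c: "0 < 1 + X t \<omega>" using path_nonneg[OF path[OF \<omega>] t] by simp
    show "(\<integral>\<^sup>+s. ?f \<omega> s \<partial>stopped_measure t (1 + X t \<omega>) (path \<omega>)) = jsum \<omega> S (\<lambda>s. K (s, \<omega>))"
      using St t by (subst jump_sum_stopped[OF path[OF \<omega>] c, where t=t], force, force, intro nn_integral_cong) (auto simp: jump_before_def split: split_indicator)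
  qed
  finally show ?thesis .
qed

lemma jump_sum_predictable_measurable:
  assumes t: "0 \<le> t" and S: "S \<in> sets borel" "S \<subseteq> {0<..t}"
    and K[measurable]: "K \<in> borel_measurable (Pred \<Otimes>\<^sub>M borel)"
  shows "(\<lambda>\<omega>. jsum \<omega> S (\<lambda>s. K ((s, \<omega>), jmp \<omega> s))) \<in> borel_measurable (F t)"
proof -
  note clamp_time_measurable[OF t, measurable]
  have "(\<lambda>\<omega>. jsum \<omega> S (\<lambda>s. (\<lambda>p. K (clamp_time t p, jump_before t p)) (s, \<omega>))) \<in> borel_measurable (F t)"
    by (rule jump_sum_measurable[OF t S]) measurable
  also have "?this \<longleftrightarrow> ?thesis"
    using S(2) by (intro measurable_cong) (auto simp: jump_sum_def clamp_time_def jump_before_def intro!: nn_integral_cong split: split_indicator)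
  finally show ?thesis .
qed

lemma left_limit_predictable:
  fixes Y :: "real \<Rightarrow> 'a \<Rightarrow> 'b::{complete_linorder, second_countable_topology, linorder_topology}"
  assumes Y: "\<And>t. 0 \<le> t \<Longrightarrow> Y t \<in> borel_measurable (F t)"
    and lim: "\<And>s \<omega>. 0 < s \<Longrightarrow> \<omega> \<in> space P \<Longrightarrow> ((\<lambda>r. Y r \<omega>) \<longlongrightarrow> V (s, \<omega>)) (at_left s)"
    and V0: "\<And>\<omega>. \<omega> \<in> space P \<Longrightarrow> V (0, \<omega>) = c"
  shows "V \<in> borel_measurable Pred"
proof (rule borel_measurable_LIMSEQ_order[rotated])
  let ?k = "\<lambda>n p. \<lceil>fst p * real (Suc n)\<rceil>"
  let ?G = "\<lambda>n p. if fst p = 0 then c else Y (real_of_int (max 0 (?k n p - 1)) / real (Suc n)) (snd p)"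
  have rect: "{u<..v} \<times> A \<in> sets Pred" if "0 \<le> u" "u < v" "A \<in> sets (F u)" for u v A
    unfolding predictable_sigma_def using that
    by (subst sets_measure_of[OF predictable_generators]) (auto intro!: sigma_sets.Basic)
  have zero: "{0} \<times> A \<in> sets Pred" if "A \<in> sets (F 0)" for A
    unfolding predictable_sigma_def using that
    by (subst sets_measure_of[OF predictable_generators]) (auto intro!: sigma_sets.Basic)
  show "?G n \<in> borel_measurable Pred" for n
  proof (rule measurableI)
    fix B :: "'b set" assume B: "B \<in> sets borel"
    let ?u = "\<lambda>i. real i / real (Suc n)"
    let ?A = "\<lambda>i. {\<omega>\<in>space P. Y (?u i) \<omega> \<in> B}"
    have A: "?A i \<in> sets (F (?u i))" for i
      using measurable_sets[OF Y[of "?u i"] B] by (simp add: vimage_def Int_def conj_commute)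
    have "?G n -` B \<inter> space Pred = ({0} \<times> {\<omega>\<in>space P. c \<in> B}) \<union> (\<Union>i. {?u i<..?u (Suc i)} \<times> ?A i)" (is "?l = ?r")
    proof (rule set_eqI)
      fix p :: "real \<times> 'a"
      obtain s \<omega> where p: "p = (s, \<omega>)" by force
      show "p \<in> ?l \<longleftrightarrow> p \<in> ?r"
      proof (cases "s > 0")
        case True
        have k: "s \<in> {?u i<..?u (Suc i)} \<longleftrightarrow> ?k n p = int i + 1" for i
          by (simp add: p ceiling_eq_iff field_simps)
        have "0 < s * real (Suc n)" using True by simp
        then have "0 < ?k n p" by (simp add: p)
        define i where "i = nat (?k n p - 1)"
        have i: "?k n p = int i + 1" using \<open>0 < ?k n p\<close> unfolding i_def by linarith
        have "p \<in> ?l \<longleftrightarrow> \<omega> \<in> ?A i" using True i by (auto simp: p space_Pred)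
        moreover have "p \<in> ?r \<longleftrightarrow> (\<exists>j. ?k n p = int j + 1 \<and> \<omega> \<in> ?A j)"
          using True k by (simp add: p del: of_nat_Suc)
        ultimately show ?thesis using i by auto
      next
        case False
        have "s \<notin> {?u i<..?u (Suc i)}" for i
        proof -
          have "0 \<le> ?u i" by simp
          then show ?thesis using False unfolding greaterThanAtMost_iff by linarith
        qed
        then have "p \<in> ?r \<longleftrightarrow> s = 0 \<and> \<omega> \<in> space P \<and> c \<in> B"
          unfolding p by blast
        moreover have "p \<in> ?l \<longleftrightarrow> s = 0 \<and> \<omega> \<in> space P \<and> c \<in> B"
          using False by (cases "s = 0") (auto simp: p space_Pred)
        ultimately show ?thesis by simp
      qed
    qed
    moreover have "{\<omega>\<in>space P. c \<in> B} \<in> sets (F 0)" using sets.top[of "F 0"] by (cases "c \<in> B") auto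
    ultimately show "?G n -` B \<inter> space Pred \<in> sets Pred"
      using A by (auto intro!: sets.Un sets.countable_UN zero rect simp: divide_strict_right_mono simp del: of_nat_Suc)
  qed auto
  fix p assume p: "p \<in> space Pred"
  then obtain s \<omega> where p': "p = (s, \<omega>)" "0 \<le> s" "\<omega> \<in> space P" by (auto simp: space_Pred)
  show "(\<lambda>n. ?G n p) \<longlonglongrightarrow> V p"
  proof (cases "s = 0")
    case False
    then have s: "0 < s" using p' by simp
    let ?r = "\<lambda>n. real_of_int (max 0 (?k n p - 1)) / real (Suc n)"
    have b: "s - 1 / real (Suc n) \<le> ?r n \<and> ?r n < s" for n
    proof -
      have "0 < ?k n p" using s by (simp add: p')
      then have e: "?r n = (real_of_int (?k n p) - 1) / real (Suc n)" by simp
      have "real_of_int (?k n p) - 1 < s * real (Suc n)" "s * real (Suc n) \<le> real_of_int (?k n p)"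
        unfolding p' fst_conv by linarith+
      moreover have "s - 1 / real (Suc n) = (s * real (Suc n) - 1) / real (Suc n)"
        by (simp add: diff_divide_distrib del: of_nat_Suc)
      ultimately show ?thesis
        unfolding e by (simp add: divide_right_mono pos_divide_less_eq del: of_nat_Suc)
    qed
    have "(\<lambda>n. s - 1 / real (Suc n)) \<longlonglongrightarrow> s"
      using tendsto_diff[OF tendsto_const LIMSEQ_inverse_real_of_nat, of s] by (simp add: inverse_eq_divide)
    then have "?r \<longlonglongrightarrow> s"
      by (rule tendsto_sandwich[rotated 2, OF _ tendsto_const]) (use b in \<open>auto intro!: always_eventually less_imp_le\<close>)
    then have "filterlim ?r (at_left s) sequentially"
      using b by (intro tendsto_imp_filterlim_at_left) auto
    from filterlim_compose[OF lim[OF s p'(3)] this] show ?thesis using s by (simp add: p')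
  qed (use V0 p' in simp)
qed

section \<open>Independence of increments from the past\<close>

definition law :: "real \<Rightarrow> real measure" where "law t = distr P borel (X t)"

lemma prob_space_law: "0 \<le> t \<Longrightarrow> prob_space (law t)"
  unfolding law_def by (intro prob_space_distr) simp

lemma sets_law[measurable_cong, simp]: "sets (law t) = sets borel"
  by (simp add: law_def)

lemma increments_indep:
  assumes "0 \<le> t 0" "\<And>i. i < n \<Longrightarrow> t i \<le> t (Suc i)"
  shows "indep_vars (\<lambda>_. borel) (\<lambda>i \<omega>. X (t (Suc i)) \<omega> - X (t i) \<omega>) {..<n::nat}"
  using subordinator assms unfolding subordinator_def levy_process_def by blast

lemma increment_law: "0 \<le> s \<Longrightarrow> s \<le> t \<Longrightarrow> distr P borel (\<lambda>\<omega>. X t \<omega> - X s \<omega>) = law (t - s)"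
proof -
  assume st: "0 \<le> s" "s \<le> t"
  have "\<forall>s\<ge>0. \<forall>t\<ge>0. distr P borel (\<lambda>\<omega>. X (s + t) \<omega> - X s \<omega>) = distr P borel (X t)"
    using subordinator unfolding subordinator_def levy_process_def by blast
  then have "distr P borel (\<lambda>\<omega>. X (s + (t - s)) \<omega> - X s \<omega>) = distr P borel (X (t - s))"
    using st by (meson diff_ge_0_iff_ge)
  then show ?thesis by (simp add: law_def)
qed

text \<open>Independence is given for increments along one ordered sequence only. Sorting 0, u and
  the times of R and appending w produces such a sequence: since X starts at 0, every X r is a sum
  of increments from the block up to u, while the increment from u to w forms the last
  block.\<close>

lemma increment_indep_finite:
  assumes u: "0 \<le> u" "u \<le> w" and R: "finite R" "R \<subseteq> {0..u}"
    and D: "D \<in> sets (Pi\<^sub>M R (\<lambda>_. borel))" and C: "C \<in> sets borel"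
  shows "prob (((\<lambda>\<omega>. \<lambda>r\<in>R. X r \<omega>) -` D \<inter> space P) \<inter> ((\<lambda>\<omega>. X w \<omega> - X u \<omega>) -` C \<inter> space P)) =
    prob ((\<lambda>\<omega>. \<lambda>r\<in>R. X r \<omega>) -` D \<inter> space P) * prob ((\<lambda>\<omega>. X w \<omega> - X u \<omega>) -` C \<inter> space P)"
proof -
  define S where "S = insert 0 (insert u R)"
  have S: "finite S" using R(1) by (simp add: S_def)
  define L where "L = sorted_list_of_set S"
  define m where "m = length L"
  have L: "sorted L" "distinct L" "set L = insert 0 (insert u R)"
    using S by (simp_all add: L_def S_def[symmetric])
  have L0: "L \<noteq> []" using L(3) by auto
  have m: "0 < m" using L0 by (simp add: m_def)
  \<comment> \<open>Only the value at m is used beyond the list, so extending by the constant w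
    appends w as the last time.\<close>
  define t where "t i = (if i < m then L ! i else w)" for i
  have nth: "L ! i \<in> {0..u}" if "i < m" for i
    using nth_mem[of i L] that R(2) u(1) L(3) by (auto simp: m_def)
  have t0: "t 0 = 0"
  proof -
    obtain i where i: "i < m" "L ! i = 0" using L(3) by (metis insertI1 in_set_conv_nth m_def)
    have "L ! 0 \<le> L ! i" using sorted_nth_mono[OF L(1), of 0 i] i by (simp add: m_def)
    then show ?thesis using nth[OF m] i m by (simp add: t_def)
  qed
  have tm: "t (m - 1) = u"
  proof -
    obtain i where i: "i < m" "L ! i = u" using L(3) by (metis insertI1 insertI2 in_set_conv_nth m_def)
    have "L ! i \<le> L ! (m - 1)" using sorted_nth_mono[OF L(1), of i "m - 1"] i by (simp add: m_def)
    then show ?thesis using nth[of "m - 1"] i m by (simp add: t_def)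
  qed
  have tmono: "t i \<le> t (Suc i)" if "i < m" for i
    using that L(1) nth[OF that] u by (auto simp: t_def m_def sorted_iff_nth_mono)
  let ?inc = "\<lambda>i \<omega>. X (t (Suc i)) \<omega> - X (t i) \<omega>"
  have iv: "indep_vars (\<lambda>_. borel) ?inc {..<m}" using increments_indep[of t m] t0 tmono by simp
  have ex: "\<exists>i<m. t i = r" if "r \<in> R" for r
    using L(3) that by (metis in_set_conv_nth insertCI m_def t_def)
  define ix where "ix r = (SOME i. i < m \<and> t i = r)" for r
  have ix: "ix r < m" "t (ix r) = r" if "r \<in> R" for r
    using someI_ex[OF ex[OF that], folded ix_def] by auto
  have tele: "X (t i) \<omega> = (\<Sum>j<i. ?inc j \<omega>)" if "\<omega> \<in> space P" for i \<omega>
    using X_0[OF that] by (subst sum_lessThan_telescope) (simp add: t0)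
  let ?A = "{..<m - 1}" and ?B = "{m - 1}"
  let ?Y = "\<lambda>\<omega>. \<lambda>i\<in>?A. ?inc i \<omega>" and ?Z = "\<lambda>\<omega>. \<lambda>i\<in>?B. ?inc i \<omega>"
  have iv': "indep_var (Pi\<^sub>M ?A (\<lambda>_. borel)) ?Y (Pi\<^sub>M ?B (\<lambda>_. borel)) ?Z"
    using m by (intro indep_var_restrict[OF iv]) auto
  let ?f = "\<lambda>f. \<lambda>r\<in>R. \<Sum>j<ix r. f j :: real" and ?g = "\<lambda>f. f (m - 1) :: real"
  have f: "?f \<in> Pi\<^sub>M ?A (\<lambda>_. borel) \<rightarrow>\<^sub>M Pi\<^sub>M R (\<lambda>_. borel)"
  proof (intro measurable_restrict borel_measurable_sum)
    fix r j assume "r \<in> R" "j \<in> {..<ix r}"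
    then have "j \<in> ?A" using ix(1)[of r] by auto
    then show "(\<lambda>f. f j) \<in> borel_measurable (Pi\<^sub>M ?A (\<lambda>_. borel))" by (rule measurable_component_singleton)
  qed
  have g: "?g \<in> Pi\<^sub>M ?B (\<lambda>_. borel) \<rightarrow>\<^sub>M borel"
    by (rule measurable_component_singleton) simp
  have e1: "?f (?Y \<omega>) = (\<lambda>r\<in>R. X r \<omega>)" if "\<omega> \<in> space P" for \<omega>
  proof (rule restrict_ext)
    fix r assume r: "r \<in> R"
    have "(\<Sum>j<ix r. ?Y \<omega> j) = (\<Sum>j<ix r. ?inc j \<omega>)"
      using ix(1)[OF r] by (intro sum.cong) auto
    also have "\<dots> = X r \<omega>" using tele[OF that, of "ix r"] ix(2)[OF r] by simp
    finally show "(\<Sum>j<ix r. ?Y \<omega> j) = X r \<omega>" .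
  qed
  have e2: "?g (?Z \<omega>) = X w \<omega> - X u \<omega>" for \<omega>
    using m tm by (simp add: t_def)
  let ?D = "?f -` D \<inter> space (Pi\<^sub>M ?A (\<lambda>_. borel))" and ?C = "?g -` C \<inter> space (Pi\<^sub>M ?B (\<lambda>_. borel))"
  have D': "?Y -` ?D \<inter> space P = (\<lambda>\<omega>. \<lambda>r\<in>R. X r \<omega>) -` D \<inter> space P"
    using e1 by (auto simp: space_PiM PiE_iff)
  have C': "?Z -` ?C \<inter> space P = (\<lambda>\<omega>. X w \<omega> - X u \<omega>) -` C \<inter> space P"
    using e2 by (auto simp: space_PiM PiE_iff)
  have "prob ((\<lambda>x. (?Y x, ?Z x)) -` (?D \<times> ?C) \<inter> space P) = prob (?Y -` ?D \<inter> space P) * prob (?Z -` ?C \<inter> space P)"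
    by (rule indep_varD[OF iv' measurable_sets[OF f D] measurable_sets[OF g C]])
  moreover have "(\<lambda>x. (?Y x, ?Z x)) -` (?D \<times> ?C) \<inter> space P = (?Y -` ?D \<inter> space P) \<inter> (?Z -` ?C \<inter> space P)"
    by auto
  ultimately show ?thesis unfolding D' C' by simp
qed

text \<open>Finite-dimensional cylinder sets are stable under intersection and generate F u, so
  independence extends to the generated sigma-algebras.\<close>

lemma increment_indep:
  assumes u: "0 \<le> u" "u \<le> w"
    and A: "A \<in> sets (F u)" and C: "C \<in> sets borel"
  shows "prob (A \<inter> ((\<lambda>\<omega>. X w \<omega> - X u \<omega>) -` C \<inter> space P)) = prob A * prob ((\<lambda>\<omega>. X w \<omega> - X u \<omega>) -` C \<inter> space P)"
proof -
  let ?inc = "\<lambda>\<omega>. X w \<omega> - X u \<omega>"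
  define E where "E = {{\<omega>\<in>space P. \<forall>r\<in>R. X r \<omega> \<in> B r} | R B. finite R \<and> R \<subseteq> {0..u} \<and> (\<forall>r\<in>R. B r \<in> sets borel)}"
  define G where "G = {?inc -` A \<inter> space P |A. A \<in> sets borel}"
  have w: "0 \<le> w" using u by simp
  have incm: "?inc \<in> borel_measurable P" using u w by simp
  have EF: "E \<subseteq> sets (F u)"
  proof
    fix A assume "A \<in> E"
    then obtain R B where A: "A = {\<omega>\<in>space P. \<forall>r\<in>R. X r \<omega> \<in> B r}" "finite R" "R \<subseteq> {0..u}" "\<forall>r\<in>R. B r \<in> sets borel"
      by (auto simp: E_def)
    have "{\<omega>\<in>space (F u). \<forall>r\<in>R. X r \<omega> \<in> B r} \<in> sets (F u)"
    proof (rule sets.sets_Collect_finite_All[OF _ A(2)])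
      fix r assume r: "r \<in> R"
      then have "X r \<in> borel_measurable (F u)" using A(3) by (intro X_adapted) auto
      from measurable_sets[OF this] A(4) r show "{\<omega>\<in>space (F u). X r \<omega> \<in> B r} \<in> sets (F u)"
        by (auto simp: vimage_def Int_def conj_commute)
    qed
    then show "A \<in> sets (F u)" by (simp add: A)
  qed
  have sig: "sigma_sets (space P) E = sets (F u)"
  proof (rule antisym)
    have "sigma_sets (space (F u)) E \<subseteq> sets (F u)" using EF by (rule sets.sigma_sets_subset)
    then show "sigma_sets (space P) E \<subseteq> sets (F u)" by simp
    show "sets (F u) \<subseteq> sigma_sets (space P) E"
      unfolding sets_F
    proof (rule sigma_sets_mono', safe)
      fix s A assume "s \<in> {0..u}" "A \<in> sets (borel :: real measure)"
      then show "X s -` A \<inter> space P \<in> E"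
        unfolding E_def by (intro CollectI exI[of _ "{s}"] exI[of _ "\<lambda>_. A"]) auto
    qed
  qed
  have IE: "Int_stable E"
  proof (rule Int_stableI)
    fix a b assume "a \<in> E" "b \<in> E"
    then obtain R B R' B' where *: "a = {\<omega>\<in>space P. \<forall>r\<in>R. X r \<omega> \<in> B r}" "finite R" "R \<subseteq> {0..u}" "\<forall>r\<in>R. B r \<in> sets borel"
      "b = {\<omega>\<in>space P. \<forall>r\<in>R'. X r \<omega> \<in> B' r}" "finite R'" "R' \<subseteq> {0..u}" "\<forall>r\<in>R'. B' r \<in> sets borel"
      by (auto simp: E_def)
    let ?C = "\<lambda>r. (if r \<in> R then B r else UNIV) \<inter> (if r \<in> R' then B' r else UNIV)"
    have "a \<inter> b = {\<omega>\<in>space P. \<forall>r\<in>R\<union>R'. X r \<omega> \<in> ?C r}" using * by auto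
    moreover have "\<forall>r\<in>R\<union>R'. ?C r \<in> sets borel" using * by auto
    ultimately show "a \<inter> b \<in> E" unfolding E_def
      using * by (intro CollectI exI[of _ "R \<union> R'"] exI[of _ ?C]) auto
  qed
  have IG: "Int_stable G"
  proof (rule Int_stableI)
    fix a b assume "a \<in> G" "b \<in> G"
    then obtain A B where "a = ?inc -` A \<inter> space P" "b = ?inc -` B \<inter> space P" "A \<in> sets borel" "B \<in> sets borel"
      by (auto simp: G_def)
    then show "a \<inter> b \<in> G" unfolding G_def by (intro CollectI exI[of _ "A \<inter> B"]) auto
  qed
  have "indep_set E G"
  proof (rule indep_setI)
    show "E \<subseteq> events" using EF sets_F_subset by blast
    show "G \<subseteq> events" using measurable_sets[OF incm] by (auto simp: G_def)
    fix a b assume "a \<in> E" "b \<in> G"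
    then obtain R B C where *: "a = {\<omega>\<in>space P. \<forall>r\<in>R. X r \<omega> \<in> B r}" "finite R" "R \<subseteq> {0..u}" "\<forall>r\<in>R. B r \<in> sets borel"
      "b = ?inc -` C \<inter> space P" "C \<in> sets borel"
      by (auto simp: E_def G_def)
    have "Pi\<^sub>E R B \<in> sets (Pi\<^sub>M R (\<lambda>_. borel))" using * by (intro sets_PiM_I_finite) auto
    note increment_indep_finite[OF u *(2,3) this *(6)]
    moreover have "(\<lambda>\<omega>. \<lambda>r\<in>R. X r \<omega>) -` Pi\<^sub>E R B \<inter> space P = a" using * by (auto simp: PiE_iff)
    ultimately show "prob (a \<inter> b) = prob a * prob b" using * by simp
  qed
  then have "indep_set (sigma_sets (space P) E) (sigma_sets (space P) G)"
    using IE IG by (rule indep_set_sigma_sets)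
  then show ?thesis
    by (rule indep_setD) (use A C in \<open>auto simp: sig G_def intro!: sigma_sets.Basic\<close>)
qed

lemma id_measurable_F: "(\<lambda>\<omega>. \<omega>) \<in> P \<rightarrow>\<^sub>M F u"
  using measurable_F_P[OF measurable_ident_sets[OF refl]] .

text \<open>The image of P under the identity into F u is the restriction of P to the past.
  Independence in this product form lets the past be frozen while integrating over the
  increment.\<close>

lemma increment_joint:
  assumes u: "0 \<le> u" "u \<le> w"
  shows "distr P (F u) (\<lambda>\<omega>. \<omega>) \<Otimes>\<^sub>M law (w - u) = distr P (F u \<Otimes>\<^sub>M borel) (\<lambda>\<omega>. (\<omega>, X w \<omega> - X u \<omega>))"
proof (rule pair_measure_eqI)
  have w: "0 \<le> w" using u by simp
  note id_measurable_F[measurable]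
  have inc[measurable]: "(\<lambda>\<omega>. X w \<omega> - X u \<omega>) \<in> borel_measurable P" using u w by simp
  show "sigma_finite_measure (distr P (F u) (\<lambda>\<omega>. \<omega>))"
    by (intro prob_space_imp_sigma_finite prob_space_distr) simp
  show "sigma_finite_measure (law (w - u))"
    using u by (intro prob_space_imp_sigma_finite prob_space_law) simp
  show "sets (distr P (F u) (\<lambda>\<omega>. \<omega>) \<Otimes>\<^sub>M law (w - u)) = sets (distr P (F u \<Otimes>\<^sub>M borel) (\<lambda>\<omega>. (\<omega>, X w \<omega> - X u \<omega>)))"
    by (simp cong: sets_pair_measure_cong)
  fix A B assume "A \<in> sets (distr P (F u) (\<lambda>\<omega>. \<omega>))" "B \<in> sets (law (w - u))"
  then have A: "A \<in> sets (F u)" and B: "B \<in> sets borel" by auto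
  have 1: "(\<lambda>\<omega>. \<omega>) -` A \<inter> space P = A" using sets.sets_into_space[OF A] by auto
  have 2: "(\<lambda>\<omega>. (\<omega>, X w \<omega> - X u \<omega>)) -` (A \<times> B) \<inter> space P = A \<inter> ((\<lambda>\<omega>. X w \<omega> - X u \<omega>) -` B \<inter> space P)"
    by auto
  have "emeasure (law (w - u)) B = prob ((\<lambda>\<omega>. X w \<omega> - X u \<omega>) -` B \<inter> space P)"
    using B by (simp add: increment_law[OF u, symmetric] emeasure_distr emeasure_eq_measure)
  then show "emeasure (distr P (F u) (\<lambda>\<omega>. \<omega>)) A * emeasure (law (w - u)) B =
      emeasure (distr P (F u \<Otimes>\<^sub>M borel) (\<lambda>\<omega>. (\<omega>, X w \<omega> - X u \<omega>))) (A \<times> B)"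
    using A B sets.sets_into_space[OF A] by (simp add: emeasure_distr Int_absorb2 2 emeasure_eq_measure increment_indep[OF u A B] ennreal_mult)
qed

lemma nn_integral_increment:
  assumes u: "0 \<le> u" "u \<le> w" and f[measurable]: "f \<in> borel_measurable (F u \<Otimes>\<^sub>M borel)"
  shows "(\<integral>\<^sup>+\<omega>. f (\<omega>, X w \<omega> - X u \<omega>) \<partial>P) = (\<integral>\<^sup>+\<omega>. \<integral>\<^sup>+y. f (\<omega>, y) \<partial>law (w - u) \<partial>P)"
proof -
  have w: "0 \<le> w" using u by simp
  note id_measurable_F[measurable]
  have inc[measurable]: "(\<lambda>\<omega>. X w \<omega> - X u \<omega>) \<in> borel_measurable P" using u w by simp
  interpret L: prob_space "law (w - u)" using u by (intro prob_space_law) simp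
  have "(\<integral>\<^sup>+\<omega>. f (\<omega>, X w \<omega> - X u \<omega>) \<partial>P) = (\<integral>\<^sup>+p. f p \<partial>distr P (F u \<Otimes>\<^sub>M borel) (\<lambda>\<omega>. (\<omega>, X w \<omega> - X u \<omega>)))"
    by (subst nn_integral_distr) measurable
  also have "\<dots> = (\<integral>\<^sup>+p. f p \<partial>(distr P (F u) (\<lambda>\<omega>. \<omega>) \<Otimes>\<^sub>M law (w - u)))"
    by (simp add: increment_joint[OF u])
  also have "\<dots> = (\<integral>\<^sup>+\<omega>. \<integral>\<^sup>+y. f (\<omega>, y) \<partial>law (w - u) \<partial>distr P (F u) (\<lambda>\<omega>. \<omega>))"
    by (subst L.nn_integral_fst[symmetric]) (auto simp: measurable_cong_sets[OF sets_pair_measure_cong[OF sets_distr sets_law] refl])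
  also have "\<dots> = (\<integral>\<^sup>+\<omega>. \<integral>\<^sup>+y. f (\<omega>, y) \<partial>law (w - u) \<partial>P)"
    by (subst nn_integral_distr) auto
  finally show ?thesis .
qed

lemma nn_integral_increment_mult:
  assumes u: "0 \<le> u" "u \<le> w" and W[measurable]: "W \<in> borel_measurable (F u)" and \<psi>[measurable]: "\<psi> \<in> borel_measurable borel"
  shows "(\<integral>\<^sup>+\<omega>. W \<omega> * \<psi> (X w \<omega> - X u \<omega>) \<partial>P) = (\<integral>\<^sup>+\<omega>. W \<omega> \<partial>P) * (\<integral>\<^sup>+y. \<psi> y \<partial>law (w - u))"
proof -
  have [measurable]: "W \<in> borel_measurable P" using measurable_F_P[OF W] .
  have "(\<integral>\<^sup>+\<omega>. W \<omega> * \<psi> (X w \<omega> - X u \<omega>) \<partial>P) = (\<integral>\<^sup>+\<omega>. \<integral>\<^sup>+y. W \<omega> * \<psi> y \<partial>law (w - u) \<partial>P)"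
    using nn_integral_increment[OF u, of "\<lambda>p. W (fst p) * \<psi> (snd p)"] by simp
  also have "\<dots> = (\<integral>\<^sup>+\<omega>. W \<omega> * (\<integral>\<^sup>+y. \<psi> y \<partial>law (w - u)) \<partial>P)"
    by (simp add: nn_integral_cmult)
  finally show ?thesis by (simp add: nn_integral_multc)
qed

lemma nn_integral_grid_product:
  assumes ab: "0 \<le> a" "a < b" and \<psi>[measurable]: "\<psi> \<in> borel_measurable borel" and k: "k \<le> n"
  shows "(\<integral>\<^sup>+\<omega>. (\<Prod>i<k. \<psi> (X (gridpt a b n (int i + 1)) \<omega> - X (gridpt a b n (int i)) \<omega>)) \<partial>P)
    = (\<integral>\<^sup>+y. \<psi> y \<partial>law ((b - a) / real n)) ^ k"
  using k
proof (induction k)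
  case 0
  then show ?case by (simp add: emeasure_space_1)
next
  case (Suc k)
  let ?t = "\<lambda>i. gridpt a b n (int i)"
  have t: "0 \<le> ?t i" "?t i \<le> ?t j" if "i \<le> j" for i j
  proof -
    show "0 \<le> ?t i" unfolding gridpt_def using ab by auto
    show "?t i \<le> ?t j" using that ab by (intro gridpt_mono) auto
  qed
  have d: "gridpt a b n (int k + 1) - ?t k = (b - a) / real n"
    using Suc.prems unfolding gridpt_def by (simp add: field_simps)
  let ?W = "\<lambda>\<omega>. \<Prod>i<k. \<psi> (X (gridpt a b n (int i + 1)) \<omega> - X (?t i) \<omega>)"
  have W: "?W \<in> borel_measurable (F (?t k))"
  proof (rule borel_measurable_prod_ennreal)
    fix i assume "i \<in> {..<k}"
    then have i: "i \<le> k" "Suc i \<le> k" by auto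
    have [measurable]: "X (?t i) \<in> borel_measurable (F (?t k))" "X (gridpt a b n (int i + 1)) \<in> borel_measurable (F (?t k))"
      using t[OF i(1)] t[OF i(2)] by (auto intro!: X_adapted simp: add.commute)
    show "(\<lambda>\<omega>. \<psi> (X (gridpt a b n (int i + 1)) \<omega> - X (?t i) \<omega>)) \<in> borel_measurable (F (?t k))" by measurable
  qed
  have "(\<integral>\<^sup>+\<omega>. (\<Prod>i<Suc k. \<psi> (X (gridpt a b n (int i + 1)) \<omega> - X (?t i) \<omega>)) \<partial>P)
    = (\<integral>\<^sup>+\<omega>. ?W \<omega> * \<psi> (X (gridpt a b n (int k + 1)) \<omega> - X (?t k) \<omega>) \<partial>P)" by simp
  also have "\<dots> = (\<integral>\<^sup>+\<omega>. ?W \<omega> \<partial>P) * (\<integral>\<^sup>+y. \<psi> y \<partial>law ((b - a) / real n))"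
    unfolding d[symmetric] using t[of k "Suc k"] by (intro nn_integral_increment_mult W) (auto simp: add.commute)
  also have "\<dots> = (\<integral>\<^sup>+y. \<psi> y \<partial>law ((b - a) / real n)) ^ Suc k"
    using Suc by (simp add: mult.commute)
  finally show ?case .
qed

end

section \<open>Laplace transforms and the Levy measure\<close>

text \<open>By Bernstein approximation in the variable \<open>exp (- x)\<close>, whose moments are given.\<close>

lemma finite_measure_eqI_exp_moments:
  fixes M N :: "real measure"
  assumes M: "finite_measure M" "sets M = sets borel" "AE x in M. 0 \<le> x"
    and N: "finite_measure N" "sets N = sets borel" "AE x in N. 0 \<le> x"
    and eq: "\<And>k::nat. (\<integral>x. exp (- real k * x) \<partial>M) = (\<integral>x. exp (- real k * x) \<partial>N)"
  shows "M = N"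
proof -
  interpret M: finite_measure M by fact
  interpret N: finite_measure N by fact
  note [measurable_cong] = M(2) N(2)
  have spM: "space M = UNIV" using sets_eq_imp_space_eq[OF M(2)] by simp
  have spN: "space N = UNIV" using sets_eq_imp_space_eq[OF N(2)] by simp
  have intg: "integrable K (\<lambda>x. f (exp (- x)))"
    if K: "finite_measure K" "sets K = sets borel" "AE x in K. 0 \<le> x" and f: "continuous_on UNIV f" for K and f :: "real \<Rightarrow> real"
  proof -
    interpret K: finite_measure K by fact
    have [measurable]: "f \<in> borel_measurable borel" using f by (rule borel_measurable_continuous_onI)
    have "bounded (f ` {0..1})"
      by (intro compact_imp_bounded compact_continuous_image continuous_on_subset[OF f]) auto
    then obtain b where "\<forall>z\<in>f ` {0..1}. norm z \<le> b" unfolding bounded_iff by blast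
    then have b: "norm (f y) \<le> b" if "y \<in> {0..1}" for y using that by blast
    show ?thesis
    proof (rule K.integrable_const_bound[where B=b])
      show "AE x in K. norm (f (exp (- x))) \<le> b" using K(3) by eventually_elim (rule b, simp)
      show "(\<lambda>x. f (exp (- x))) \<in> borel_measurable K" using K(2) by measurable
    qed
  qed
  \<comment> \<open>The induction uses (1 - y)^(j+1) = (1 - y)^j - y * (1 - y)^j, which trades a
    factor 1 - y for a higher power of y.\<close>
  have poly: "(\<integral>x. exp (- x) ^ k * (1 - exp (- x)) ^ j \<partial>M) = (\<integral>x. exp (- x) ^ k * (1 - exp (- x)) ^ j \<partial>N)" for k j
  proof (induction j arbitrary: k)
    case 0
    then show ?case using eq[of k] by (simp add: exp_of_nat_mult[symmetric])
  next
    case (Suc j)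
    have e: "exp (- x) ^ k * (1 - exp (- x)) ^ Suc j = exp (- x) ^ k * (1 - exp (- x)) ^ j - exp (- x) ^ Suc k * (1 - exp (- x)) ^ j" for x :: real
      by (simp add: algebra_simps)
    have i: "integrable K (\<lambda>x. exp (- x) ^ k * (1 - exp (- x)) ^ j)" if "finite_measure K" "sets K = sets borel" "AE x in K. 0 \<le> x" for k and K :: "real measure"
      by (rule intg[OF that, of "\<lambda>y. y ^ k * (1 - y) ^ j"]) (intro continuous_intros)
    show ?case unfolding e
      using Suc[of k] Suc[of "Suc k"] by (subst (1 2) Bochner_Integration.integral_diff) (auto intro!: i M N simp del: power_Suc)
  qed
  have cont: "(\<integral>x. f (exp (- x)) \<partial>M) = (\<integral>x. f (exp (- x)) \<partial>N)" if f: "continuous_on UNIV f" for f :: "real \<Rightarrow> real"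
  proof -
    let ?m = "measure M UNIV"
    have mN: "measure N UNIV = ?m" using eq[of 0] by (simp add: spM spN)
    have close: "\<bar>(\<integral>x. f (exp (- x)) \<partial>K) - (\<integral>x. (\<Sum>i\<le>n. f (i / n) * Bernstein n i (exp (- x))) \<partial>K)\<bar> \<le> e * ?m"
      if K: "finite_measure K" "sets K = sets borel" "AE x in K. 0 \<le> x" "measure K UNIV = ?m" and n: "\<And>x. x \<in> {0..1} \<Longrightarrow> \<bar>f x - (\<Sum>i\<le>n. f (i / n) * Bernstein n i x)\<bar> < e" for K n e
    proof -
      interpret K: finite_measure K by fact
      have sp: "space K = UNIV" using sets_eq_imp_space_eq[OF K(2)] by simp
      let ?b = "\<lambda>y. \<Sum>i\<le>n. f (i / n) * Bernstein n i y"
      have cb: "continuous_on UNIV ?b" unfolding Bernstein_def by (intro continuous_intros)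
      have "\<bar>(\<integral>x. f (exp (- x)) \<partial>K) - (\<integral>x. ?b (exp (- x)) \<partial>K)\<bar> = \<bar>\<integral>x. f (exp (- x)) - ?b (exp (- x)) \<partial>K\<bar>"
        by (subst Bochner_Integration.integral_diff[OF intg[OF K(1-3) f] intg[OF K(1-3) cb]]) simp
      also have "\<dots> \<le> (\<integral>x. \<bar>f (exp (- x)) - ?b (exp (- x))\<bar> \<partial>K)" by (rule integral_abs_bound)
      also have "\<dots> \<le> (\<integral>x. e \<partial>K)"
      proof (rule integral_mono_AE)
        show "integrable K (\<lambda>x. \<bar>f (exp (- x)) - ?b (exp (- x))\<bar>)"
          by (intro integrable_abs Bochner_Integration.integrable_diff intg[OF K(1-3) f] intg[OF K(1-3) cb])
        show "AE x in K. \<bar>f (exp (- x)) - ?b (exp (- x))\<bar> \<le> e"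
          using K(3) by eventually_elim (auto intro!: n less_imp_le)
      qed simp
      also have "\<dots> = e * ?m" using K(4) by (simp add: sp)
      finally show ?thesis .
    qed
    have "\<bar>(\<integral>x. f (exp (- x)) \<partial>M) - (\<integral>x. f (exp (- x)) \<partial>N)\<bar> \<le> e" if e: "0 < e" for e
    proof -
      \<comment> \<open>Each of the two approximations costs at most d times the common mass; adding
        1 to the mass avoids a division by zero.\<close>
      define d where "d = e / (2 * (?m + 1))"
      have d: "0 < d" using e by (simp add: d_def add_nonneg_pos)
      obtain n where n: "\<And>x. x \<in> {0..1} \<Longrightarrow> \<bar>f x - (\<Sum>i\<le>n. f (i / n) * Bernstein n i x)\<bar> < d"
        using Bernstein_Weierstrass[OF continuous_on_subset[OF f subset_UNIV] d] by blast
      have "(\<integral>x. (\<Sum>i\<le>n. f (i / n) * Bernstein n i (exp (- x))) \<partial>M) = (\<integral>x. (\<Sum>i\<le>n. f (i / n) * Bernstein n i (exp (- x))) \<partial>N)"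
      proof -
        have i: "integrable K (\<lambda>x. Bernstein n i (exp (- x)))" if "finite_measure K" "sets K = sets borel" "AE x in K. 0 \<le> x" for i K
          unfolding Bernstein_def by (rule intg[OF that, of "\<lambda>y. real (n choose i) * y ^ i * (1 - y) ^ (n - i)"]) (intro continuous_intros)
        have b: "(\<integral>x. Bernstein n i (exp (- x)) \<partial>M) = (\<integral>x. Bernstein n i (exp (- x)) \<partial>N)" for i
          unfolding Bernstein_def using poly[of i "n - i"] by (simp add: mult.assoc)
        show ?thesis
          by (subst (1 2) Bochner_Integration.integral_sum) (auto intro!: i M N sum.cong integrable_mult_right simp: b)
      qed
      then have "\<bar>(\<integral>x. f (exp (- x)) \<partial>M) - (\<integral>x. f (exp (- x)) \<partial>N)\<bar> \<le> 2 * (d * ?m)"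
        using close[OF M refl n] close[OF N mN n] by linarith
      also have "\<dots> \<le> 2 * (d * (?m + 1))" using d by simp
      also have "\<dots> = e"
      proof -
        have "0 < ?m + 1" by (simp add: add_nonneg_pos)
        moreover have "2 * (e / (2 * m) * m) = e" if "0 < m" for m :: real using that by simp
        ultimately show ?thesis unfolding d_def by blast
      qed
      finally show ?thesis .
    qed
    then have "\<bar>(\<integral>x. f (exp (- x)) \<partial>M) - (\<integral>x. f (exp (- x)) \<partial>N)\<bar> \<le> 0"
      by (rule field_le_epsilon) simp
    then show ?thesis by simp
  qed
  have "cdf M = cdf N"
  proof
    fix a :: real
    define c where "c = exp (- a)"
    \<comment> \<open>Continuous piecewise linear functions decreasing to the indicator of y >= c;
      for y = exp (- x) this is the event x <= a.\<close>
    let ?f = "\<lambda>n (y :: real). max 0 (min 1 (1 + real n * (y - c)))"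
    have lim: "(\<lambda>n. \<integral>x. ?f n (exp (- x)) \<partial>K) \<longlonglongrightarrow> cdf K a"
      if K: "finite_measure K" "sets K = sets borel" for K
    proof -
      interpret K: finite_measure K by fact
      note [measurable_cong] = K(2)
      have "(\<lambda>n. \<integral>x. ?f n (exp (- x)) \<partial>K) \<longlonglongrightarrow> (\<integral>x. indicator {..a} x \<partial>K)"
      proof (rule integral_dominated_convergence[where w="\<lambda>_. 1"])
        show "AE x in K. (\<lambda>n. ?f n (exp (- x))) \<longlonglongrightarrow> indicator {..a} x"
        proof (rule AE_I2)
          fix x
          show "(\<lambda>n. ?f n (exp (- x))) \<longlonglongrightarrow> indicator {..a} x"
          proof (cases "x \<le> a")
            case True
            then have "c \<le> exp (- x)" by (simp add: c_def)
            then have "?f n (exp (- x)) = 1" for n by (simp add: max_def min_def)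
            then show ?thesis using True by simp
          next
            case False
            then have d: "0 < c - exp (- x)" by (simp add: c_def)
            obtain m where m: "1 / (c - exp (- x)) < real m" using reals_Archimedean2 by blast
            have "?f n (exp (- x)) = 0" if "m \<le> n" for n
            proof -
              have "1 < real m * (c - exp (- x))" using m d by (simp add: divide_less_eq)
              also have "\<dots> \<le> real n * (c - exp (- x))" using that d by simp
              finally have "1 + real n * (exp (- x) - c) < 0" by (simp add: algebra_simps)
              then show ?thesis by simp
            qed
            then have "\<forall>\<^sub>F n in sequentially. ?f n (exp (- x)) = indicator {..a} x"
              using False by (intro eventually_sequentiallyI[of m]) auto
            then show ?thesis by (rule tendsto_eventually)
          qed
        qed
        show "AE x in K. norm (?f n (exp (- x))) \<le> 1" for n by (rule AE_I2) auto
      qed auto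
      then show ?thesis using sets_eq_imp_space_eq[OF K(2)] by (simp add: cdf_def)
    qed
    have "(\<integral>x. ?f n (exp (- x)) \<partial>M) = (\<integral>x. ?f n (exp (- x)) \<partial>N)" for n
      by (rule cont) (intro continuous_intros)
    then show "cdf M a = cdf N a"
      using LIMSEQ_unique[OF lim[OF M(1,2)]] lim[OF N(1,2)] by simp
  qed
  then show ?thesis
    using M N by (intro cdf_unique') (auto simp: finite_borel_measure_def finite_borel_measure_axioms_def)
qed

text \<open>Invert exp z >= 1 + z + z^2/2 and use (1 - z + z^2/2) * (1 + z + z^2/2) = 1 + z^4/4 >=
  1.\<close>

lemma exp_minus_le_quadratic:
  fixes z :: real assumes "0 \<le> z" shows "exp (- z) \<le> 1 - z + z^2 / 2"
proof -
  have "1 + z + z^2 / 2 \<le> exp z" using exp_lower_Taylor_quadratic[OF assms] by simp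
  moreover have "0 < 1 + z + z^2 / 2" using assms by (simp add: add_pos_nonneg)
  ultimately have "1 / exp z \<le> 1 / (1 + z + z^2 / 2)"
    by (intro divide_left_mono mult_pos_pos) auto
  then have "exp (- z) \<le> 1 / (1 + z + z^2 / 2)"
    by (simp only: exp_minus inverse_eq_divide)
  also have "\<dots> \<le> 1 - z + z^2 / 2"
  proof -
    have "(1 - z + z^2 / 2) * (1 + z + z^2 / 2) = 1 + z^4 / 4"
      by (simp add: field_simps power2_eq_square power4_eq_xxxx)
    moreover have "0 \<le> z^4 / 4" by simp
    ultimately have "1 \<le> (1 - z + z^2 / 2) * (1 + z + z^2 / 2)" by linarith
    then show ?thesis unfolding pos_divide_le_eq[OF \<open>0 < 1 + z + z^2 / 2\<close>] .
  qed
  finally show ?thesis .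
qed

lemma tendsto_n_exp_minus_1: "(\<lambda>n. real n * (exp (c / real n) - 1)) \<longlonglongrightarrow> c"
proof -
  have "((\<lambda>h. exp (h * c)) has_real_derivative c) (at 0)"
    by (auto intro!: derivative_eq_intros)
  then have "((\<lambda>h. (exp (h * c) - 1) / h) \<longlongrightarrow> c) (at 0)"
    by (simp add: DERIV_def)
  moreover have "filterlim (\<lambda>n. 1 / real (Suc n)) (at 0) sequentially"
    using LIMSEQ_inverse_real_of_nat by (intro filterlim_atI) (auto simp: inverse_eq_divide)
  ultimately have "(\<lambda>n. (exp (1 / real (Suc n) * c) - 1) / (1 / real (Suc n))) \<longlonglongrightarrow> c"
    by (rule filterlim_compose)
  then have "(\<lambda>n. real (Suc n) * (exp (c / real (Suc n)) - 1)) \<longlonglongrightarrow> c"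
    by (simp add: mult.commute)
  then show ?thesis by (rule LIMSEQ_imp_Suc)
qed

section \<open>The Laplace exponent and a family of test functions\<close>

locale class_L_process = prob_space P for P :: "'a measure" +
  fixes X :: "real \<Rightarrow> 'a \<Rightarrow> real" and g :: "real \<Rightarrow> real" and g0 :: real
  assumes class_L: "class_L P X g g0"

sublocale class_L_process \<subseteq> increasing_levy P X
  by unfold_locales (use class_L in \<open>auto simp: class_L_def\<close>)

text \<open>Three properties meet here: as a second difference of exponentials its integrals are
  known from Laplace transforms; it is of order x^2 at 0, so its sums over increments converge; and
  it equals \<open>bump 0 x\<close> times exp (- k x), so its integrals are the exponential moments
  of the measure with weight \<open>bump 0\<close>.\<close>

definition bump :: "nat \<Rightarrow> real \<Rightarrow> real" where
  "bump k x = (1 - exp (- x))^2 * exp (- real k * x)"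

lemma bump_expand: "bump k x = - (1 - exp (- real k * x)) + 2 * (1 - exp (- real (Suc k) * x)) - (1 - exp (- real (Suc (Suc k)) * x))"
proof -
  have "exp (- real (Suc k) * x) = exp (- real k * x) * exp (- x)" "exp (- real (Suc (Suc k)) * x) = exp (- real k * x) * exp (- x) * exp (- x)"
    by (simp_all add: exp_add[symmetric] algebra_simps)
  then show ?thesis by (simp add: bump_def power2_eq_square algebra_simps)
qed

lemma bump_measurable[measurable]: "bump k \<in> borel_measurable borel"
  unfolding bump_def by measurable

lemma bump_bounds:
  assumes "0 \<le> y" shows "0 \<le> bump k y" "bump k y \<le> y^2" "bump k y \<le> y" "bump k y \<le> 1" "bump k y ^ 2 \<le> bump k y"
proof -
  let ?a = "1 - exp (- y)"
  have a: "0 \<le> ?a" "?a \<le> y" "?a \<le> 1" using assms exp_ge_add_one_self[of "- y"] by auto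
  have e: "exp (- real k * y) \<le> 1" "0 \<le> exp (- real k * y)" using assms by (auto simp: mult_nonneg_nonneg)
  show "0 \<le> bump k y" by (simp add: bump_def)
  have le: "bump k y \<le> ?a^2" unfolding bump_def using mult_left_mono[OF e(1), of "?a^2"] by simp
  also have "?a^2 \<le> y^2" using a by (intro power_mono) auto
  finally show "bump k y \<le> y^2" .
  have "?a^2 \<le> y * 1" unfolding power2_eq_square using a assms by (intro mult_mono) auto
  with le show "bump k y \<le> y" by simp
  have "?a^2 \<le> 1 * 1" unfolding power2_eq_square using a by (intro mult_mono) auto
  with le show 1: "bump k y \<le> 1" by simp
  show "bump k y ^ 2 \<le> bump k y" using 1 \<open>0 \<le> bump k y\<close> by (simp add: power2_eq_square mult_left_le)
qed

context class_L_process
begin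

definition \<nu> :: "real measure" where
  "\<nu> = density lborel (\<lambda>x. ennreal (indicator {0<..} x * g x))"

definition \<Psi> :: "real \<Rightarrow> real" where
  "\<Psi> q = (\<integral>x. 1 - exp (- q * x) \<partial>\<nu>)"

lemma g_measurable[measurable]: "(\<lambda>x. indicator {0<..} x * g x) \<in> borel_measurable borel"
  using class_L unfolding class_L_def set_borel_measurable_def by simp

lemma g_pos: "0 < x \<Longrightarrow> 0 < g x"
  using class_L unfolding class_L_def by simp

lemma sets_levy_measure[measurable_cong, simp]: "sets \<nu> = sets borel"
  by (simp add: \<nu>_def)

lemma space_levy_measure[simp]: "space \<nu> = UNIV"
  by (simp add: \<nu>_def)

lemma levy_drift: "has_drift_and_levy_measure P X 0 \<nu>"
  using class_L unfolding class_L_def \<nu>_def by blast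

lemma AE_levy_pos: "AE x in \<nu>. 0 < x"
  unfolding \<nu>_def by (subst AE_density) (auto intro!: AE_I2 split: split_indicator_asm)

lemma sigma_finite_levy_measure: "sigma_finite_measure \<nu>"
  unfolding \<nu>_def
  by (subst sigma_finite_measure.sigma_finite_iff_density_finite[OF sigma_finite_lborel]) auto

lemma laplace: "0 \<le> t \<Longrightarrow> 0 \<le> q \<Longrightarrow> (\<integral>\<omega>. exp (- q * X t \<omega>) \<partial>P) = exp (- t * \<Psi> q)"
proof (cases "q = 0")
  case True
  then show ?thesis by (simp add: \<Psi>_def prob_space)
next
  case False
  assume "0 \<le> t" "0 \<le> q"
  with False show ?thesis
    using levy_drift unfolding has_drift_and_levy_measure_def \<Psi>_def by auto
qed

lemma integrable_levy:
  assumes q: "0 \<le> q" shows "integrable \<nu> (\<lambda>x. 1 - exp (- q * x))"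
proof (rule integrableI_bounded)
  have "(\<integral>\<^sup>+x. ennreal (norm (1 - exp (- q * x))) \<partial>\<nu>) \<le> (\<integral>\<^sup>+x. ennreal (max 1 q) * ennreal (min 1 x) \<partial>\<nu>)"
  proof (rule nn_integral_mono_AE, use AE_levy_pos in eventually_elim)
    fix x :: real assume x: "0 < x"
    have "1 - exp (- q * x) \<le> q * x" "1 - exp (- q * x) \<le> 1" "0 \<le> 1 - exp (- q * x)"
      using exp_ge_add_one_self[of "- q * x"] q x by (auto simp: mult_nonneg_nonneg)
    moreover have "q * x \<le> max 1 q * x" using x by (intro mult_right_mono) auto
    moreover have "1 - exp (- q * x) \<le> max 1 q"
      using \<open>1 - exp (- q * x) \<le> 1\<close> by (rule order_trans) simp
    ultimately have "norm (1 - exp (- q * x)) \<le> max 1 q * min 1 x"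
      by (cases "x \<le> 1") (auto simp: min_def)
    then show "ennreal (norm (1 - exp (- q * x))) \<le> ennreal (max 1 q) * ennreal (min 1 x)"
      using x by (subst ennreal_mult[symmetric]) (auto simp del: max_mult_distrib_right)
  qed
  also have "\<dots> < \<infinity>"
    using levy_drift unfolding has_drift_and_levy_measure_def
    by (subst nn_integral_cmult) (auto simp: ennreal_mult_less_top)
  finally show "(\<integral>\<^sup>+x. ennreal (norm (1 - exp (- q * x))) \<partial>\<nu>) < \<infinity>" .
qed simp

lemma integral_lincomb3:
  fixes f1 f2 f3 :: "'b \<Rightarrow> real"
  assumes "integrable M f1" "integrable M f2" "integrable M f3"
  shows "(\<integral>x. - f1 x + 2 * f2 x - f3 x \<partial>M) = - (\<integral>x. f1 x \<partial>M) + 2 * (\<integral>x. f2 x \<partial>M) - (\<integral>x. f3 x \<partial>M)"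
  using assms by simp

lemma integrable_bump: "integrable \<nu> (bump k)"
  and integral_bump: "(\<integral>x. bump k x \<partial>\<nu>) =
    - \<Psi> (real k) + 2 * \<Psi> (real (Suc k)) - \<Psi> (real (Suc (Suc k)))"
proof -
  have i: "integrable \<nu> (\<lambda>x. 1 - exp (- real k * x))" for k by (rule integrable_levy) simp
  have b: "bump k = (\<lambda>x. - (1 - exp (- real k * x)) + 2 * (1 - exp (- real (Suc k) * x)) - (1 - exp (- real (Suc (Suc k)) * x)))"
    by (rule ext) (rule bump_expand)
  show "integrable \<nu> (bump k)"
    unfolding b by (intro Bochner_Integration.integrable_diff Bochner_Integration.integrable_add integrable_minus integrable_mult_right i)
  show "(\<integral>x. bump k x \<partial>\<nu>) =
    - \<Psi> (real k) + 2 * \<Psi> (real (Suc k)) - \<Psi> (real (Suc (Suc k)))"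
    unfolding b \<Psi>_def by (rule integral_lincomb3[OF i i i])
qed

lemma law_bump:
  assumes t: "0 \<le> t"
  shows "integrable (law t) (bump k)"
    "(\<integral>y. bump k y \<partial>law t) = (exp (- t * \<Psi> (real k)) - 1) - 2 * (exp (- t * \<Psi> (real (Suc k))) - 1) + (exp (- t * \<Psi> (real (Suc (Suc k)))) - 1)"
proof -
  have i: "integrable P (\<lambda>\<omega>. exp (- real k * X t \<omega>))" for k
    using t path_nonneg[OF path t] by (intro integrable_const_bound[where B=1]) (auto intro!: AE_I2 mult_nonneg_nonneg)
  have b: "bump k (X t \<omega>) = exp (- real k * X t \<omega>) - 2 * exp (- real (Suc k) * X t \<omega>) + exp (- real (Suc (Suc k)) * X t \<omega>)" for \<omega>
    unfolding bump_expand by simp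
  have 1: "integrable P (\<lambda>\<omega>. bump k (X t \<omega>))"
    unfolding b by (intro Bochner_Integration.integrable_diff Bochner_Integration.integrable_add integrable_mult_right i)
  then show "integrable (law t) (bump k)"
    unfolding law_def using t by (subst integrable_distr_eq) auto
  have "(\<integral>y. bump k y \<partial>law t) = (\<integral>\<omega>. bump k (X t \<omega>) \<partial>P)"
    unfolding law_def using t by (subst integral_distr) auto
  also have "\<dots> = (\<integral>\<omega>. exp (- real k * X t \<omega>) \<partial>P) - 2 * (\<integral>\<omega>. exp (- real (Suc k) * X t \<omega>) \<partial>P) + (\<integral>\<omega>. exp (- real (Suc (Suc k)) * X t \<omega>) \<partial>P)"
    unfolding b
    by (subst Bochner_Integration.integral_add, (intro Bochner_Integration.integrable_diff integrable_mult_right i)+,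
        subst Bochner_Integration.integral_diff, (intro integrable_mult_right i)+) simp
  finally have *: "(\<integral>y. bump k y \<partial>law t) = (\<integral>\<omega>. exp (- real k * X t \<omega>) \<partial>P) - 2 * (\<integral>\<omega>. exp (- real (Suc k) * X t \<omega>) \<partial>P) + (\<integral>\<omega>. exp (- real (Suc (Suc k)) * X t \<omega>) \<partial>P)" .
  show "(\<integral>y. bump k y \<partial>law t) = (exp (- t * \<Psi> (real k)) - 1) - 2 * (exp (- t * \<Psi> (real (Suc k))) - 1) + (exp (- t * \<Psi> (real (Suc (Suc k)))) - 1)"
    unfolding * laplace[OF t of_nat_0_le_iff] by simp
qed

lemma law_nonneg: "0 \<le> t \<Longrightarrow> AE y in law t. 0 \<le> y"
  unfolding law_def by (subst AE_distr_iff) (auto intro!: AE_I2 path_nonneg[OF path])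

text \<open>On these functions n times the law at time T/n tends to T times \<nu>. The bump is a
  linear combination of exponentials with coefficient sum 0, and n * (exp (c/n) - 1) tends to
  c.\<close>

lemma law_bump_limit:
  assumes T: "0 \<le> T"
  shows "(\<lambda>n. real n * (\<integral>y. bump k y \<partial>law (T / real n))) \<longlonglongrightarrow> T * (\<integral>x. bump k x \<partial>\<nu>)"
proof -
  have "(\<lambda>n. real n * (exp (- T * \<Psi> (real k) / real n) - 1)
     - 2 * (real n * (exp (- T * \<Psi> (real (Suc k)) / real n) - 1))
     + real n * (exp (- T * \<Psi> (real (Suc (Suc k))) / real n) - 1))
    \<longlonglongrightarrow> - T * \<Psi> (real k) - 2 * (- T * \<Psi> (real (Suc k))) + - T * \<Psi> (real (Suc (Suc k)))"
    by (intro tendsto_intros tendsto_n_exp_minus_1)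
  moreover have "- T * \<Psi> (real k) - 2 * (- T * \<Psi> (real (Suc k))) + - T * \<Psi> (real (Suc (Suc k)))
     = T * (\<integral>x. bump k x \<partial>\<nu>)"
    by (simp add: integral_bump algebra_simps del: of_nat_Suc)
  moreover have "real n * (\<integral>y. bump k y \<partial>law (T / real n)) =
     real n * (exp (- T * \<Psi> (real k) / real n) - 1)
     - 2 * (real n * (exp (- T * \<Psi> (real (Suc k)) / real n) - 1))
     + real n * (exp (- T * \<Psi> (real (Suc (Suc k))) / real n) - 1)" for n
    using T by (simp add: law_bump algebra_simps del: of_nat_Suc)
  ultimately show ?thesis by (simp only:)
qed

end

lemma gridpt_props:
  assumes ab: "0 \<le> a" "a < b" and i: "i < n"
  shows "a \<le> gridpt a b n (int i)" "gridpt a b n (int i) \<le> gridpt a b n (int i + 1)" "0 \<le> gridpt a b n (int i)"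
    "0 \<le> gridpt a b n (int i + 1)" "gridpt a b n (int i + 1) - gridpt a b n (int i) = (b - a) / real n"
proof -
  show 1: "a \<le> gridpt a b n (int i)" unfolding gridpt_def using ab by auto
  show 2: "gridpt a b n (int i) \<le> gridpt a b n (int i + 1)" using ab by (intro gridpt_mono) auto
  show "0 \<le> gridpt a b n (int i)" "0 \<le> gridpt a b n (int i + 1)" using 1 2 ab by auto
  show "gridpt a b n (int i + 1) - gridpt a b n (int i) = (b - a) / real n"
    using i unfolding gridpt_def by (simp add: field_simps)
qed

lemma jump_sum_cong: "(\<And>s. s \<in> T \<Longrightarrow> 0 < jump x s \<Longrightarrow> f s = h s) \<Longrightarrow> jump_sum x T f = jump_sum x T h"
  unfolding jump_sum_def by (intro nn_integral_cong) (auto split: split_indicator)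

lemma jump_sum_mono: "(\<And>s. s \<in> T \<Longrightarrow> 0 < jump x s \<Longrightarrow> f s \<le> h s) \<Longrightarrow> jump_sum x T f \<le> jump_sum x T h"
  unfolding jump_sum_def by (intro nn_integral_mono) (auto split: split_indicator)

lemma jump_sum_cmult: "jump_sum x T (\<lambda>s. c * f s) = c * jump_sum x T f"
  unfolding jump_sum_def by (subst nn_integral_cmult[symmetric]) (auto simp: mult.assoc)

lemma jump_sum_add: "jump_sum x T (\<lambda>s. f s + h s) = jump_sum x T f + jump_sum x T h"
  unfolding jump_sum_def by (subst nn_integral_add[symmetric]) (auto simp: distrib_right)

lemma jump_sum_SUP:
  assumes "\<And>s. incseq (\<lambda>i. U i s)"
  shows "jump_sum x T (\<lambda>s. SUP i. U i s) = (SUP i. jump_sum x T (U i))"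
proof -
  have "jump_sum x T (\<lambda>s. SUP i. U i s) = (\<integral>\<^sup>+s. (SUP i. U i s * indicator {s\<in>T. 0 < jump x s} s) \<partial>count_space UNIV)"
    unfolding jump_sum_def by (intro nn_integral_cong) (simp add: SUP_mult_right_ennreal)
  also have "\<dots> = (SUP i. jump_sum x T (U i))"
    unfolding jump_sum_def using assms
    by (intro nn_integral_monotone_convergence_SUP) (auto simp: incseq_def le_fun_def intro!: mult_right_mono)
  finally show ?thesis .
qed

lemma jump_sum_suminf: "jump_sum x T (\<lambda>s. \<Sum>i. f i s) = (\<Sum>i. jump_sum x T (f i))"
proof -
  have "jump_sum x T (\<lambda>s. \<Sum>i. f i s) = (\<integral>\<^sup>+s. (\<Sum>i. f i s * indicator {s\<in>T. 0 < jump x s} s) \<partial>count_space UNIV)"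
    unfolding jump_sum_def by (intro nn_integral_cong) (simp add: ennreal_suminf_multc)
  also have "\<dots> = (\<Sum>i. jump_sum x T (f i))"
    unfolding jump_sum_def by (rule nn_integral_suminf) simp
  finally show ?thesis .
qed

lemma jump_sum_restrict: "jump_sum x T (\<lambda>s. f s * indicator S s) = jump_sum x (T \<inter> S) f"
  unfolding jump_sum_def by (intro nn_integral_cong) (auto split: split_indicator)

lemma jump_sum_mono_set: "S \<subseteq> T \<Longrightarrow> jump_sum x S f \<le> jump_sum x T f"
  unfolding jump_sum_def by (intro nn_integral_mono) (auto split: split_indicator)

section \<open>Expected sums of the test functions over jumps\<close>

context class_L_process
begin

lemma nn_integral_bump_law:
  assumes "0 \<le> t" shows "(\<integral>\<^sup>+y. ennreal (bump k y) \<partial>law t) = ennreal (\<integral>y. bump k y \<partial>law t)"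
proof (rule nn_integral_eq_integral[OF law_bump(1)[OF assms]])
  show "AE y in law t. 0 \<le> bump k y" using law_nonneg[OF assms] by eventually_elim (rule bump_bounds)
qed

lemma bump_law_nonneg: "0 \<le> t \<Longrightarrow> 0 \<le> (\<integral>y. bump k y \<partial>law t)"
proof (rule integral_nonneg_AE)
  assume "0 \<le> t"
  then show "AE y in law t. 0 \<le> bump k y" by (rule eventually_mono[OF law_nonneg bump_bounds(1)])
qed

lemma bump_levy_nonneg: "0 \<le> (\<integral>x. bump k x \<partial>\<nu>)"
  by (rule integral_nonneg_AE, rule eventually_mono[OF AE_levy_pos]) (auto intro!: bump_bounds)

lemma increment_nonneg: "0 \<le> s \<Longrightarrow> s \<le> t \<Longrightarrow> \<omega> \<in> space P \<Longrightarrow> 0 \<le> X t \<omega> - X s \<omega>"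
  using path_mono[OF path] by simp

text \<open>A belongs to the past of every grid cell, and all cells have the same increment law, so
  the expectation factors n times.\<close>

lemma nn_integral_increment_sum:
  assumes ab: "0 \<le> a" "a < b" and A: "A \<in> sets (F a)"
  shows "(\<integral>\<^sup>+\<omega>. indicator A \<omega> * ennreal (\<Sum>i<n. bump k (X (gridpt a b n (int i + 1)) \<omega> - X (gridpt a b n (int i)) \<omega>)) \<partial>P)
    = emeasure P A * ennreal (real n * (\<integral>y. bump k y \<partial>law ((b - a) / real n)))" (is "?l = _")
proof -
  let ?i = "\<lambda>i \<omega>. X (gridpt a b n (int i + 1)) \<omega> - X (gridpt a b n (int i)) \<omega>"
  have T: "0 \<le> (b - a) / real n" using ab by simp
  have AP[measurable]: "A \<in> sets P" using A sets_F_subset by auto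
  have m: "?i i \<in> borel_measurable P" if "i < n" for i
    using gridpt_props[OF ab that] by (intro borel_measurable_diff X_measurable_P)
  have "?l = (\<integral>\<^sup>+\<omega>. (\<Sum>i<n. indicator A \<omega> * ennreal (bump k (?i i \<omega>))) \<partial>P)"
  proof (rule nn_integral_cong)
    fix \<omega> assume \<omega>: "\<omega> \<in> space P"
    have "0 \<le> bump k (?i i \<omega>)" if "i < n" for i
      using gridpt_props[OF ab that] \<omega> by (intro bump_bounds increment_nonneg)
    then show "indicator A \<omega> * ennreal (\<Sum>i<n. bump k (?i i \<omega>)) = (\<Sum>i<n. indicator A \<omega> * ennreal (bump k (?i i \<omega>)))"
      by (subst sum_ennreal[symmetric]) (auto simp: sum_distrib_left)
  qed
  also have "\<dots> = (\<Sum>i<n. (\<integral>\<^sup>+\<omega>. indicator A \<omega> * ennreal (bump k (?i i \<omega>)) \<partial>P))"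
    by (rule nn_integral_sum) (use m in measurable)
  also have "\<dots> = (\<Sum>i<n. emeasure P A * ennreal (\<integral>y. bump k y \<partial>law ((b - a) / real n)))"
  proof (rule sum.cong[OF refl])
    fix i assume "i \<in> {..<n}"
    then have i: "i < n" by simp
    have "A \<in> sets (F (gridpt a b n (int i)))" using A sets_F_mono[OF gridpt_props(1)[OF ab i]] by auto
    then have "(\<integral>\<^sup>+\<omega>. indicator A \<omega> * ennreal (bump k (?i i \<omega>)) \<partial>P) = (\<integral>\<^sup>+\<omega>. indicator A \<omega> \<partial>P) * (\<integral>\<^sup>+y. ennreal (bump k y) \<partial>law (gridpt a b n (int i + 1) - gridpt a b n (int i)))"
      using gridpt_props[OF ab i] by (intro nn_integral_increment_mult) auto
    then show "(\<integral>\<^sup>+\<omega>. indicator A \<omega> * ennreal (bump k (?i i \<omega>)) \<partial>P) = emeasure P A * ennreal (\<integral>y. bump k y \<partial>law ((b - a) / real n))"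
      unfolding gridpt_props(5)[OF ab i] by (simp add: nn_integral_bump_law[OF T])
  qed
  also have "\<dots> = emeasure P A * ennreal (real n * (\<integral>y. bump k y \<partial>law ((b - a) / real n)))"
    using bump_law_nonneg[OF T, of k] by (simp add: ennreal_mult ennreal_of_nat_eq_real_of_nat mult_ac)
  finally show ?thesis .
qed

abbreviation bump_sum :: "nat \<Rightarrow> real \<Rightarrow> real \<Rightarrow> 'a \<Rightarrow> ennreal" where
  "bump_sum k a b \<omega> \<equiv> jsum \<omega> {a<..b} (\<lambda>s. ennreal (bump k (jmp \<omega> s)))"

lemma bump_continuous: "continuous_on S (bump k)" unfolding bump_def by (intro continuous_intros)

lemma increment_sum_tendsto:
  assumes ab: "0 \<le> a" "a < b" and \<omega>: "\<omega> \<in> space P"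
  shows "(\<lambda>n. ennreal (\<Sum>i<n. bump k (X (gridpt a b n (int i + 1)) \<omega> - X (gridpt a b n (int i)) \<omega>))) \<longlonglongrightarrow> bump_sum k a b \<omega>"
  by (rule increments_tendsto_jump_sum[OF path[OF \<omega>] ab bump_continuous bump_bounds(1-3)])

lemma bump_sum_measurable[measurable]: "0 \<le> a \<Longrightarrow> 0 \<le> b \<Longrightarrow> bump_sum k a b \<in> borel_measurable P"
proof -
  assume "0 \<le> a" "0 \<le> b"
  then have "bump_sum k a b \<in> borel_measurable (F b)"
    using jump_sum_predictable_measurable[of b "{a<..b}" "\<lambda>p. ennreal (bump k (snd p))"] by force
  then show ?thesis by (rule measurable_F_P)
qed

text \<open>The sums over grid increments converge to the sum over jumps, and Fatou's lemma bounds
  the expectation of the limit.\<close>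

lemma bump_sum_upper:
  assumes ab: "0 \<le> a" "a < b" and A: "A \<in> sets (F a)"
  shows "(\<integral>\<^sup>+\<omega>. indicator A \<omega> * bump_sum k a b \<omega> \<partial>P) \<le> emeasure P A * ennreal ((b - a) * (\<integral>x. bump k x \<partial>\<nu>))"
proof -
  let ?S = "\<lambda>n \<omega>. \<Sum>i<n. bump k (X (gridpt a b n (int i + 1)) \<omega> - X (gridpt a b n (int i)) \<omega>)"
  have AP[measurable]: "A \<in> sets P" using A sets_F_subset by auto
  have S[measurable]: "?S n \<in> borel_measurable P" for n
  proof (rule borel_measurable_sum)
    fix i assume "i \<in> {..<n}"
    then have "i < n" by simp
    from gridpt_props[OF ab this] have [measurable]: "X (gridpt a b n (int i + 1)) \<in> borel_measurable P" "X (gridpt a b n (int i)) \<in> borel_measurable P"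
      by (auto intro!: X_measurable_P)
    show "(\<lambda>\<omega>. bump k (X (gridpt a b n (int i + 1)) \<omega> - X (gridpt a b n (int i)) \<omega>)) \<in> borel_measurable P" by measurable
  qed
  have "(\<integral>\<^sup>+\<omega>. indicator A \<omega> * bump_sum k a b \<omega> \<partial>P) = (\<integral>\<^sup>+\<omega>. liminf (\<lambda>n. indicator A \<omega> * ennreal (?S n \<omega>)) \<partial>P)"
  proof (rule nn_integral_cong)
    fix \<omega> assume \<omega>: "\<omega> \<in> space P"
    have "(\<lambda>n. indicator A \<omega> * ennreal (?S n \<omega>)) \<longlonglongrightarrow> indicator A \<omega> * bump_sum k a b \<omega>"
      using increment_sum_tendsto[OF ab \<omega>, of k] by (cases "\<omega> \<in> A") auto
    then show "indicator A \<omega> * bump_sum k a b \<omega> = liminf (\<lambda>n. indicator A \<omega> * ennreal (?S n \<omega>))"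
      by (rule lim_imp_Liminf[OF sequentially_bot, symmetric])
  qed
  also have "\<dots> \<le> liminf (\<lambda>n. \<integral>\<^sup>+\<omega>. indicator A \<omega> * ennreal (?S n \<omega>) \<partial>P)"
    by (rule nn_integral_liminf) measurable
  also have "\<dots> = emeasure P A * ennreal ((b - a) * (\<integral>x. bump k x \<partial>\<nu>))"
  proof (rule lim_imp_Liminf[OF sequentially_bot])
    have T: "0 \<le> b - a" using ab by simp
    show "(\<lambda>n. \<integral>\<^sup>+\<omega>. indicator A \<omega> * ennreal (?S n \<omega>) \<partial>P) \<longlonglongrightarrow> emeasure P A * ennreal ((b - a) * (\<integral>x. bump k x \<partial>\<nu>))"
      unfolding nn_integral_increment_sum[OF ab A]
      by (rule tendsto_mult_ennreal[OF tendsto_const tendsto_ennrealI[OF law_bump_limit[OF T]]]) (simp add: emeasure_eq_measure)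
  qed
  finally show ?thesis .
qed

text \<open>Fatou leaves open whether mass is lost in the limit. The variables exp (- q S) are
  bounded, so their expectations do converge, and over a grid they factor into identical terms. This
  bounds E exp (- q S) from above, while 1 - q E S bounds it from below; dividing by q and letting q
  tend to 0 gives the claim.\<close>

lemma bump_sum_lower:
  assumes ab: "0 \<le> a" "a < b"
  shows "ennreal ((b - a) * (\<integral>x. bump k x \<partial>\<nu>)) \<le> (\<integral>\<^sup>+\<omega>. bump_sum k a b \<omega> \<partial>P)"
proof -
  define c where "c = (b - a) * (\<integral>x. bump k x \<partial>\<nu>)"
  have c0: "0 \<le> c" using ab bump_levy_nonneg by (simp add: c_def)
  have b0: "0 \<le> b" using ab by simp
  note meas[measurable] = bump_sum_measurable[OF ab(1) b0, of k]
  let ?S = "\<lambda>n \<omega>. \<Sum>i<n. bump k (X (gridpt a b n (int i + 1)) \<omega> - X (gridpt a b n (int i)) \<omega>)"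
  have Sm[measurable]: "?S n \<in> borel_measurable P" for n
  proof (rule borel_measurable_sum)
    fix i assume "i \<in> {..<n}"
    then have "i < n" by simp
    from gridpt_props[OF ab this] have [measurable]: "X (gridpt a b n (int i + 1)) \<in> borel_measurable P" "X (gridpt a b n (int i)) \<in> borel_measurable P"
      by (auto intro!: X_measurable_P)
    show "(\<lambda>\<omega>. bump k (X (gridpt a b n (int i + 1)) \<omega> - X (gridpt a b n (int i)) \<omega>)) \<in> borel_measurable P" by measurable
  qed
  have Spos: "0 \<le> ?S n \<omega>" if "\<omega> \<in> space P" for n \<omega>
    using gridpt_props[OF ab, of _ n] that by (intro sum_nonneg bump_bounds increment_nonneg) auto
  have fin: "(\<integral>\<^sup>+\<omega>. bump_sum k a b \<omega> \<partial>P) < \<infinity>"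
  proof -
    have "(\<integral>\<^sup>+\<omega>. bump_sum k a b \<omega> \<partial>P) = (\<integral>\<^sup>+\<omega>. indicator (space P) \<omega> * bump_sum k a b \<omega> \<partial>P)"
      by (intro nn_integral_cong) simp
    also have "\<dots> \<le> emeasure P (space P) * ennreal ((b - a) * (\<integral>x. bump k x \<partial>\<nu>))"
      using sets.top[of "F a"] by (intro bump_sum_upper ab) simp
    also have "\<dots> < \<infinity>" by (simp add: emeasure_space_1)
    finally show ?thesis .
  qed
  define S where "S \<omega> = enn2real (bump_sum k a b \<omega>)" for \<omega>
  have S0: "0 \<le> S \<omega>" for \<omega> by (simp add: S_def)
  have [measurable]: "S \<in> borel_measurable P" unfolding S_def by measurable
  have finAE: "AE \<omega> in P. bump_sum k a b \<omega> \<noteq> \<infinity>"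
    using fin by (intro nn_integral_noteq_infinite) auto
  have Seq: "AE \<omega> in P. ennreal (S \<omega>) = bump_sum k a b \<omega>"
    using finAE by eventually_elim (simp add: S_def top.not_eq_extremum)
  have "(\<integral>\<^sup>+\<omega>. ennreal (S \<omega>) \<partial>P) = (\<integral>\<^sup>+\<omega>. bump_sum k a b \<omega> \<partial>P)"
    by (rule nn_integral_cong_AE[OF Seq])
  then have intS: "integrable P S"
    using fin S0 by (intro integrableI_nonneg) auto
  have ES: "(\<integral>\<^sup>+\<omega>. bump_sum k a b \<omega> \<partial>P) = ennreal (\<integral>\<omega>. S \<omega> \<partial>P)"
    using nn_integral_eq_integral[OF intS] S0 \<open>(\<integral>\<^sup>+\<omega>. ennreal (S \<omega>) \<partial>P) = _\<close> by simp
  \<comment> \<open>The error is c/2 from replacing q by r, and c^2/2 from the second-order term of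
    exp (- r c).\<close>
  have key: "c - (\<integral>\<omega>. S \<omega> \<partial>P) \<le> q * (c / 2 + c^2 / 2)" if q: "0 < q" "q \<le> 1" for q
  proof -
    \<comment> \<open>Chosen so that exp (- q y) <= 1 - q y + q^2 y^2 / 2 <= 1 - r y for y =
      \<open>bump k\<close> of an increment, which satisfies y^2 <= y.\<close>
    define r where "r = q * (1 - q / 2)"
    have r: "0 \<le> r" "r \<le> q" using q by (auto simp: r_def mult_le_cancel_left1)
    have bound: "(\<integral>\<omega>. exp (- q * ?S n \<omega>) \<partial>P) \<le> exp (- r * (real n * (\<integral>y. bump k y \<partial>law ((b - a) / real n))))" for n
    proof -
      let ?t = "(b - a) / real n"
      have t: "0 \<le> ?t" using ab by simp
      interpret L: prob_space "law ?t" by (rule prob_space_law[OF t])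
      let ?v = "\<integral>y. bump k y \<partial>law ?t"
      have "ennreal (\<integral>\<omega>. exp (- q * ?S n \<omega>) \<partial>P) = (\<integral>\<^sup>+\<omega>. ennreal (exp (- q * ?S n \<omega>)) \<partial>P)"
      proof (rule nn_integral_eq_integral[symmetric])
        show "integrable P (\<lambda>\<omega>. exp (- q * ?S n \<omega>))"
          using Spos q by (intro integrable_const_bound[where B=1]) (auto intro!: AE_I2 mult_nonneg_nonneg)
      qed simp
      also have "\<dots> = (\<integral>\<^sup>+\<omega>. (\<Prod>i<n. ennreal (exp (- q * bump k (X (gridpt a b n (int i + 1)) \<omega> - X (gridpt a b n (int i)) \<omega>)))) \<partial>P)"
        by (simp add: prod_ennreal sum_distrib_left exp_sum)
      also have "\<dots> = (\<integral>\<^sup>+y. ennreal (exp (- q * bump k y)) \<partial>law ?t) ^ n"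
        by (rule nn_integral_grid_product[OF ab, where \<psi>="\<lambda>y. ennreal (exp (- q * bump k y))"]) auto
      also have "\<dots> \<le> ennreal (exp (- r * ?v)) ^ n"
      proof (rule power_mono)
        have i: "integrable (law ?t) (\<lambda>y. exp (- q * bump k y))"
        proof (rule L.integrable_const_bound[where B=1])
          show "AE y in law ?t. norm (exp (- q * bump k y)) \<le> 1"
            using law_nonneg[OF t]
          proof eventually_elim
            fix y :: real assume "0 \<le> y"
            then have "0 \<le> q * bump k y" using q bump_bounds(1) by simp
            then show "norm (exp (- q * bump k y)) \<le> 1" by simp
          qed
        qed simp
        have "(\<integral>\<^sup>+y. ennreal (exp (- q * bump k y)) \<partial>law ?t) = ennreal (\<integral>y. exp (- q * bump k y) \<partial>law ?t)"
          by (rule nn_integral_eq_integral[OF i]) simp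
        also have "(\<integral>y. exp (- q * bump k y) \<partial>law ?t) \<le> (\<integral>y. 1 - r * bump k y \<partial>law ?t)"
        proof (rule integral_mono_AE[OF i])
          show "integrable (law ?t) (\<lambda>y. 1 - r * bump k y)" using law_bump(1)[OF t] by simp
          show "AE y in law ?t. exp (- q * bump k y) \<le> 1 - r * bump k y"
            using law_nonneg[OF t]
          proof eventually_elim
            fix y :: real assume y: "0 \<le> y"
            have "exp (- (q * bump k y)) \<le> 1 - q * bump k y + (q * bump k y)^2 / 2"
              using q bump_bounds(1)[OF y] by (intro exp_minus_le_quadratic) auto
            also have "(q * bump k y)^2 \<le> q^2 * bump k y"
              using bump_bounds(5)[OF y] by (simp add: power_mult_distrib mult_left_mono)
            finally show "exp (- q * bump k y) \<le> 1 - r * bump k y"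
              by (simp add: r_def power2_eq_square algebra_simps)
          qed
        qed
        also have "(\<integral>y. 1 - r * bump k y \<partial>law ?t) = 1 - r * ?v"
          using law_bump(1)[OF t] L.prob_space by simp
        also have "\<dots> \<le> exp (- r * ?v)"
          using exp_ge_add_one_self[of "- r * ?v"] by simp
        finally show "(\<integral>\<^sup>+y. ennreal (exp (- q * bump k y)) \<partial>law ?t) \<le> ennreal (exp (- r * ?v))"
          by (simp add: ennreal_leI)
      qed simp
      also have "\<dots> = ennreal (exp (- r * (real n * ?v)))"
        by (simp add: ennreal_power exp_of_nat_mult[symmetric] mult_ac)
      finally show ?thesis by simp
    qed
    have "(\<lambda>n. \<integral>\<omega>. exp (- q * ?S n \<omega>) \<partial>P) \<longlonglongrightarrow> (\<integral>\<omega>. exp (- q * S \<omega>) \<partial>P)"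
    proof (rule integral_dominated_convergence[where w="\<lambda>_. 1"])
      show "AE \<omega> in P. (\<lambda>n. exp (- q * ?S n \<omega>)) \<longlonglongrightarrow> exp (- q * S \<omega>)"
        using Seq AE_space
      proof eventually_elim
        fix \<omega> assume \<omega>: "ennreal (S \<omega>) = bump_sum k a b \<omega>" "\<omega> \<in> space P"
        have "(\<lambda>n. ?S n \<omega>) \<longlonglongrightarrow> S \<omega>"
          using increment_sum_tendsto[OF ab \<omega>(2), of k] Spos[OF \<omega>(2)] S0 unfolding \<omega>(1)[symmetric]
          by (intro tendsto_ennrealD) auto
        then show "(\<lambda>n. exp (- q * ?S n \<omega>)) \<longlonglongrightarrow> exp (- q * S \<omega>)" by (intro tendsto_intros)
      qed
      show "AE \<omega> in P. norm (exp (- q * ?S n \<omega>)) \<le> 1" for n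
        using Spos q by (intro AE_I2) (auto intro!: mult_nonneg_nonneg)
    qed auto
    moreover have "(\<lambda>n. exp (- r * (real n * (\<integral>y. bump k y \<partial>law ((b - a) / real n))))) \<longlonglongrightarrow> exp (- r * c)"
      unfolding c_def using ab by (intro tendsto_intros law_bump_limit) auto
    ultimately have "(\<integral>\<omega>. exp (- q * S \<omega>) \<partial>P) \<le> exp (- r * c)"
      by (rule LIMSEQ_le) (use bound in blast)
    then have "(\<integral>\<omega>. exp (- q * S \<omega>) \<partial>P) \<le> exp (- (r * c))" by simp
    moreover have "1 - q * (\<integral>\<omega>. S \<omega> \<partial>P) \<le> (\<integral>\<omega>. exp (- q * S \<omega>) \<partial>P)"
    proof -
      have "1 - q * (\<integral>\<omega>. S \<omega> \<partial>P) = (\<integral>\<omega>. 1 - q * S \<omega> \<partial>P)" using intS prob_space by simp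
      also have "\<dots> \<le> (\<integral>\<omega>. exp (- q * S \<omega>) \<partial>P)"
      proof (rule integral_mono)
        show "integrable P (\<lambda>\<omega>. 1 - q * S \<omega>)" using intS by simp
        show "integrable P (\<lambda>\<omega>. exp (- q * S \<omega>))"
          using S0 q by (intro integrable_const_bound[where B=1]) (auto intro!: AE_I2 mult_nonneg_nonneg)
        show "1 - q * S \<omega> \<le> exp (- q * S \<omega>)" for \<omega>
          using exp_ge_add_one_self[of "- q * S \<omega>"] by simp
      qed
      finally show ?thesis .
    qed
    moreover have "exp (- (r * c)) \<le> 1 - r * c + (r * c)^2 / 2"
      using r c0 by (intro exp_minus_le_quadratic) auto
    moreover have "(r * c)^2 \<le> q^2 * c^2"
      using r by (simp add: power_mult_distrib mult_right_mono power_mono)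
    moreover have "r * c = q * c - q^2 * c / 2" by (simp add: r_def power2_eq_square algebra_simps)
    ultimately have "q * c - q * (\<integral>\<omega>. S \<omega> \<partial>P) \<le> q^2 * c / 2 + q^2 * c^2 / 2"
      by linarith
    then have "q * (c - (\<integral>\<omega>. S \<omega> \<partial>P)) \<le> q * (q * (c / 2 + c^2 / 2))"
      by (simp add: power2_eq_square algebra_simps)
    then show ?thesis using q(1) by simp
  qed
  have "c - (\<integral>\<omega>. S \<omega> \<partial>P) \<le> 0"
  proof (rule tendsto_lowerbound)
    show "((\<lambda>q. q * (c / 2 + c^2 / 2)) \<longlongrightarrow> 0) (at_right 0)"
      by (auto intro!: tendsto_eq_intros)
    show "\<forall>\<^sub>F q in at_right 0. c - (\<integral>\<omega>. S \<omega> \<partial>P) \<le> q * (c / 2 + c^2 / 2)"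
      using key by (intro eventually_at_rightI[of 0 1]) auto
  qed simp
  then show ?thesis unfolding ES c_def[symmetric] by (intro ennreal_leI) simp
qed

text \<open>The upper bounds for A and for its complement add up to the lower bound for the whole
  space. All values are finite, so neither upper bound can be strict.\<close>

lemma bump_sum_expectation:
  assumes ab: "0 \<le> a" "a < b" and A: "A \<in> sets (F a)"
  shows "(\<integral>\<^sup>+\<omega>. indicator A \<omega> * bump_sum k a b \<omega> \<partial>P) = emeasure P A * ennreal ((b - a) * (\<integral>x. bump k x \<partial>\<nu>))"
    (is "?I A = ?c A")
proof (rule antisym[OF bump_sum_upper[OF ab A]])
  let ?B = "space P - A"
  have AP[measurable]: "A \<in> sets P" using A sets_F_subset by auto
  have B: "?B \<in> sets (F a)" using sets.compl_sets[OF A] by simp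
  have b0: "0 \<le> b" using ab by simp
  note [measurable] = bump_sum_measurable[OF ab(1) b0, of k]
  have "?c A + ?c ?B = ennreal ((b - a) * (\<integral>x. bump k x \<partial>\<nu>))"
    by (simp add: distrib_right[symmetric] emeasure_eq_measure prob_compl ennreal_plus[symmetric] del: ennreal_plus)
  also have "\<dots> \<le> (\<integral>\<^sup>+\<omega>. bump_sum k a b \<omega> \<partial>P)" by (rule bump_sum_lower[OF ab])
  also have "\<dots> = (\<integral>\<^sup>+\<omega>. indicator A \<omega> * bump_sum k a b \<omega> + indicator ?B \<omega> * bump_sum k a b \<omega> \<partial>P)"
    by (intro nn_integral_cong) (auto split: split_indicator)
  also have "\<dots> = ?I A + ?I ?B" by (rule nn_integral_add) measurable
  also have "\<dots> \<le> ?I A + ?c ?B" by (intro add_left_mono bump_sum_upper ab B)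
  finally have "?c ?B + ?c A \<le> ?c ?B + ?I A" by (simp only: add.commute)
  moreover have "?c ?B \<noteq> \<top>" by (simp add: emeasure_eq_measure ennreal_mult_eq_top_iff)
  ultimately show "?c A \<le> ?I A" by (simp add: ennreal_add_left_cancel_le)
qed

end

context increasing_levy
begin

abbreviation PredB :: "((real \<times> 'a) \<times> real) measure" where "PredB \<equiv> Pred \<Otimes>\<^sub>M borel"

section \<open>The compensation formula\<close>

text \<open>The Doleans measure of the jumps up to time t: the expected number of jumps whose time,
  sample point and size lie in C, for C in the product of predictable and Borel sets.\<close>

definition jump_measure :: "real \<Rightarrow> ((real \<times> 'a) \<times> real) measure" where
  "jump_measure t = measure_of (space PredB) (sets PredB)
     (\<lambda>C. \<integral>\<^sup>+\<omega>. jsum \<omega> {0<..t} (\<lambda>s. indicator C ((s, \<omega>), jmp \<omega> s)) \<partial>P)"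

lemma sets_jump_measure[measurable_cong, simp]: "sets (jump_measure t) = sets PredB"
  unfolding jump_measure_def by (rule sets.sets_measure_of_eq)

lemma space_jump_measure[simp]: "space (jump_measure t) = space PredB"
  unfolding jump_measure_def by (rule sets.space_measure_of_eq)

lemma jump_sum_measurable_P:
  assumes "0 \<le> t" "K \<in> borel_measurable PredB"
  shows "(\<lambda>\<omega>. jsum \<omega> {0<..t} (\<lambda>s. K ((s, \<omega>), jmp \<omega> s))) \<in> borel_measurable P"
  using jump_sum_predictable_measurable[OF assms(1) _ _ assms(2), of "{0<..t}"] by (intro measurable_F_P) auto

lemma emeasure_jump_measure:
  assumes t: "0 \<le> t" and C: "C \<in> sets PredB"
  shows "emeasure (jump_measure t) C = (\<integral>\<^sup>+\<omega>. jsum \<omega> {0<..t} (\<lambda>s. indicator C ((s, \<omega>), jmp \<omega> s)) \<partial>P)"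
proof (unfold jump_measure_def, rule emeasure_measure_of_sigma[OF _ _ _ C])
  show "sigma_algebra (space PredB) (sets PredB)" by (rule sets.sigma_algebra_axioms)
  show "positive (sets PredB) (\<lambda>C. \<integral>\<^sup>+\<omega>. jsum \<omega> {0<..t} (\<lambda>s. indicator C ((s, \<omega>), jmp \<omega> s)) \<partial>P)"
    by (simp add: positive_def jump_sum_def)
  show "countably_additive (sets PredB) (\<lambda>C. \<integral>\<^sup>+\<omega>. jsum \<omega> {0<..t} (\<lambda>s. indicator C ((s, \<omega>), jmp \<omega> s)) \<partial>P)"
  proof (rule countably_additiveI)
    fix A :: "nat \<Rightarrow> _" assume A: "range A \<subseteq> sets PredB" "disjoint_family A"
    have m: "(\<lambda>\<omega>. jsum \<omega> {0<..t} (\<lambda>s. indicator (A i) ((s, \<omega>), jmp \<omega> s))) \<in> borel_measurable P" for i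
      using A(1) by (intro jump_sum_measurable_P[OF t, of "indicator (A i)"]) auto
    show "(\<Sum>i. \<integral>\<^sup>+\<omega>. jsum \<omega> {0<..t} (\<lambda>s. indicator (A i) ((s, \<omega>), jmp \<omega> s)) \<partial>P)
      = (\<integral>\<^sup>+\<omega>. jsum \<omega> {0<..t} (\<lambda>s. indicator (\<Union>i. A i) ((s, \<omega>), jmp \<omega> s)) \<partial>P)"
      by (subst nn_integral_suminf[symmetric, OF m])
        (simp add: jump_sum_suminf[symmetric] suminf_indicator[OF A(2)])
  qed
qed

lemma nn_integral_jump_measure:
  assumes t: "0 \<le> t" and K: "K \<in> borel_measurable PredB"
  shows "(\<integral>\<^sup>+p. K p \<partial>jump_measure t) = (\<integral>\<^sup>+\<omega>. jsum \<omega> {0<..t} (\<lambda>s. K ((s, \<omega>), jmp \<omega> s)) \<partial>P)"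
  using K
proof (induction rule: borel_measurable_induct)
  case (cong f h)
  have "(\<integral>\<^sup>+p. f p \<partial>jump_measure t) = (\<integral>\<^sup>+p. h p \<partial>jump_measure t)"
    using cong(3) by (intro nn_integral_cong) simp
  moreover have "(\<integral>\<^sup>+\<omega>. jsum \<omega> {0<..t} (\<lambda>s. f ((s, \<omega>), jmp \<omega> s)) \<partial>P)
    = (\<integral>\<^sup>+\<omega>. jsum \<omega> {0<..t} (\<lambda>s. h ((s, \<omega>), jmp \<omega> s)) \<partial>P)"
    using cong(3) by (intro nn_integral_cong jump_sum_cong) (auto simp: space_pair_measure space_Pred)
  ultimately show ?case using cong(4) by simp
next
  case (set A)
  then show ?case using emeasure_jump_measure[OF t set] by simp
next
  case (mult u c)
  show ?case
    using mult(1,2,4) jump_sum_measurable_P[OF t mult(2)]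
    by (simp add: nn_integral_cmult jump_sum_cmult)
next
  case (add u v)
  show ?case
    using add jump_sum_measurable_P[OF t] by (simp add: nn_integral_add jump_sum_add)
next
  case (seq U)
  have inc: "incseq (\<lambda>i. U i p)" for p using seq(3) unfolding incseq_def le_fun_def by blast
  have "(\<integral>\<^sup>+p. (SUP i. U i) p \<partial>jump_measure t) = (\<integral>\<^sup>+p. (SUP i. U i p) \<partial>jump_measure t)"
    by (simp add: image_comp)
  also have "\<dots> = (SUP i. \<integral>\<^sup>+p. U i p \<partial>jump_measure t)"
    using seq by (intro nn_integral_monotone_convergence_SUP) auto
  also have "\<dots> = (SUP i. \<integral>\<^sup>+\<omega>. jsum \<omega> {0<..t} (\<lambda>s. U i ((s, \<omega>), jmp \<omega> s)) \<partial>P)"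
    using seq(5) by simp
  also have "\<dots> = (\<integral>\<^sup>+\<omega>. (SUP i. jsum \<omega> {0<..t} (\<lambda>s. U i ((s, \<omega>), jmp \<omega> s))) \<partial>P)"
    using inc jump_sum_measurable_P[OF t seq(1)]
    by (intro nn_integral_monotone_convergence_SUP[symmetric]) (auto simp: incseq_def le_fun_def intro!: jump_sum_mono)
  also have "\<dots> = (\<integral>\<^sup>+\<omega>. jsum \<omega> {0<..t} (\<lambda>s. SUP i. U i ((s, \<omega>), jmp \<omega> s)) \<partial>P)"
    using inc by (intro nn_integral_cong jump_sum_SUP[symmetric]) simp
  finally show ?case by (simp add: image_comp)
qed

lemma AE_jump_measure_pos:
  assumes t: "0 \<le> t" shows "AE p in jump_measure t. 0 < snd p"
proof -
  let ?N = "{p \<in> space PredB. \<not> 0 < snd p}"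
  have N: "?N \<in> sets PredB" by measurable
  have "emeasure (jump_measure t) ?N = (\<integral>\<^sup>+\<omega>. jsum \<omega> {0<..t} (\<lambda>s. 0) \<partial>P)"
    unfolding emeasure_jump_measure[OF t N] by (intro nn_integral_cong jump_sum_cong) auto
  also have "\<dots> = 0" by (simp add: jump_sum_def)
  finally show ?thesis using N by (intro AE_I'[of ?N]) auto
qed

lemma sets_Pred: "sets Pred = sigma_sets ({0..} \<times> space P)
    ({{0} \<times> A |A. A \<in> sets (F 0)} \<union> {{s<..t} \<times> A |s t A. 0 \<le> s \<and> s < t \<and> A \<in> sets (F s)})"
  unfolding predictable_sigma_def by (rule sets_measure_of[OF predictable_generators])

lemma rectangle_predictable: "0 \<le> u \<Longrightarrow> u < v \<Longrightarrow> A \<in> sets (F u) \<Longrightarrow> {u<..v} \<times> A \<in> sets Pred"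
  unfolding sets_Pred by (intro sigma_sets.Basic) auto

lemma clamp_time_measurable_P[measurable]:
  assumes t: "0 \<le> t"
  shows "(\<lambda>p. clamp_time t (snd p, fst p)) \<in> P \<Otimes>\<^sub>M borel \<rightarrow>\<^sub>M Pred"
proof -
  note [measurable] = clamp_time_measurable[OF t] id_measurable_F[of t]
  have "(\<lambda>p. (snd p, (\<lambda>\<omega>. \<omega>) (fst p))) \<in> P \<Otimes>\<^sub>M borel \<rightarrow>\<^sub>M borel \<Otimes>\<^sub>M F t" by measurable
  from measurable_compose[OF this clamp_time_measurable[OF t]] show ?thesis by simp
qed

end

context class_L_process
begin

text \<open>The measure P(d\<omega>) ds \<nu>(dx) on times up to t. Pushing it through
  \<open>clamp_time\<close> places it on the predictable sigma-algebra, where it can be compared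
  with \<open>jump_measure\<close>.\<close>

definition compensator :: "real \<Rightarrow> ((real \<times> 'a) \<times> real) measure" where
  "compensator t = distr ((P \<Otimes>\<^sub>M density lborel (indicator {0<..t})) \<Otimes>\<^sub>M \<nu>) PredB (\<lambda>p. (clamp_time t (snd (fst p), fst (fst p)), snd p))"

lemma sets_compensator[measurable_cong, simp]: "sets (compensator t) = sets PredB"
  by (simp add: compensator_def)

lemma sigma_finite_time: "sigma_finite_measure (density lborel (indicator {0<..t::real}))"
  by (subst sigma_finite_measure.sigma_finite_iff_density_finite[OF sigma_finite_lborel]) (auto simp: indicator_def)

lemma nn_integral_compensator:
  assumes t: "0 \<le> t" and K[measurable]: "K \<in> borel_measurable PredB"
  shows "(\<integral>\<^sup>+p. K p \<partial>compensator t) = (\<integral>\<^sup>+\<omega>. \<integral>\<^sup>+s. (\<integral>\<^sup>+x. K ((s, \<omega>), x) \<partial>\<nu>) * indicator {0<..t} s \<partial>lborel \<partial>P)"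
proof -
  interpret L: sigma_finite_measure \<nu> by (rule sigma_finite_levy_measure)
  interpret T: sigma_finite_measure "density lborel (indicator {0<..t::real})" by (rule sigma_finite_time)
  note [measurable] = clamp_time_measurable_P[OF t]
  let ?K = "\<lambda>p. K (clamp_time t (snd (fst p), fst (fst p)), snd p)"
  have [measurable]: "(\<lambda>p. clamp_time t (snd p, fst p)) \<in> P \<Otimes>\<^sub>M density lborel (indicator {0<..t}) \<rightarrow>\<^sub>M Pred"
    using clamp_time_measurable_P[OF t] by (simp cong: measurable_cong_sets sets_pair_measure_cong)
  have km[measurable]: "?K \<in> borel_measurable ((P \<Otimes>\<^sub>M density lborel (indicator {0<..t})) \<Otimes>\<^sub>M \<nu>)" by measurable
  have km'[measurable]: "?K \<in> borel_measurable ((P \<Otimes>\<^sub>M borel) \<Otimes>\<^sub>M \<nu>)" by measurable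
  have "(\<integral>\<^sup>+p. K p \<partial>compensator t) = (\<integral>\<^sup>+p. ?K p \<partial>((P \<Otimes>\<^sub>M density lborel (indicator {0<..t})) \<Otimes>\<^sub>M \<nu>))"
    unfolding compensator_def by (rule nn_integral_distr) measurable
  also have "\<dots> = (\<integral>\<^sup>+q. \<integral>\<^sup>+x. ?K (q, x) \<partial>\<nu> \<partial>(P \<Otimes>\<^sub>M density lborel (indicator {0<..t})))"
    by (rule L.nn_integral_fst[symmetric, OF km])
  also have "\<dots> = (\<integral>\<^sup>+\<omega>. \<integral>\<^sup>+s. \<integral>\<^sup>+x. ?K ((\<omega>, s), x) \<partial>\<nu> \<partial>density lborel (indicator {0<..t}) \<partial>P)"
    by (rule T.nn_integral_fst[symmetric]) (rule L.borel_measurable_nn_integral_fst[OF km])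
  also have "\<dots> = (\<integral>\<^sup>+\<omega>. \<integral>\<^sup>+s. (\<integral>\<^sup>+x. K ((s, \<omega>), x) \<partial>\<nu>) * indicator {0<..t} s \<partial>lborel \<partial>P)"
  proof (rule nn_integral_cong)
    fix \<omega> assume \<omega>: "\<omega> \<in> space P"
    have "(\<lambda>s. \<integral>\<^sup>+x. ?K ((\<omega>, s), x) \<partial>\<nu>) \<in> borel_measurable borel"
      using measurable_compose[OF measurable_Pair1'[OF \<omega>] L.borel_measurable_nn_integral_fst[OF km']] by simp
    then show "(\<integral>\<^sup>+s. \<integral>\<^sup>+x. ?K ((\<omega>, s), x) \<partial>\<nu> \<partial>density lborel (indicator {0<..t}))
      = (\<integral>\<^sup>+s. (\<integral>\<^sup>+x. K ((s, \<omega>), x) \<partial>\<nu>) * indicator {0<..t} s \<partial>lborel)"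
      by (subst nn_integral_density) (auto intro!: nn_integral_cong simp: clamp_time_def split: split_indicator)
  qed
  finally show ?thesis .
qed

lemma AE_compensator_pos: assumes t: "0 \<le> t" shows "AE p in compensator t. 0 < snd p"
proof -
  let ?N = "{p \<in> space PredB. \<not> 0 < snd p}"
  have N: "?N \<in> sets PredB" by measurable
  have "emeasure (compensator t) ?N = (\<integral>\<^sup>+p. indicator ?N p \<partial>compensator t)" using N by simp
  also have "\<dots> = (\<integral>\<^sup>+\<omega>. \<integral>\<^sup>+s. (\<integral>\<^sup>+x. indicator ?N ((s, \<omega>), x) \<partial>\<nu>) * indicator {0<..t} s \<partial>lborel \<partial>P)"
    using N by (intro nn_integral_compensator[OF t]) auto
  also have "\<dots> = (\<integral>\<^sup>+\<omega>. \<integral>\<^sup>+s. 0 * indicator {0<..t} s \<partial>lborel \<partial>P)"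
  proof -
    have "(\<integral>\<^sup>+x. indicator ?N ((s, \<omega>), x) \<partial>\<nu>) = (\<integral>\<^sup>+x. 0 \<partial>\<nu>)" for s \<omega>
      by (rule nn_integral_cong_AE, rule eventually_mono[OF AE_levy_pos]) (auto split: split_indicator)
    then show ?thesis by simp
  qed
  finally have "emeasure (compensator t) ?N = 0" by simp
  then show ?thesis using N by (intro AE_I'[of ?N]) (auto simp: sets_eq_imp_space_eq[OF sets_compensator])
qed

lemma nn_integral_bump_levy: "(\<integral>\<^sup>+x. ennreal (bump k x) \<partial>\<nu>) = ennreal (\<integral>x. bump k x \<partial>\<nu>)"
  by (rule nn_integral_eq_integral[OF integrable_bump], rule eventually_mono[OF AE_levy_pos]) (auto intro!: bump_bounds)

text \<open>The weight \<open>bump 0\<close> makes the jump intensity finite, so that it is determined by its exponential moments.\<close>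

lemma rectangle_expectation:
  assumes ab: "0 \<le> a" "a < b" and A: "A \<in> sets (F a)" and B[measurable]: "B \<in> sets borel"
  shows "(\<integral>\<^sup>+\<omega>. indicator A \<omega> * jsum \<omega> {a<..b} (\<lambda>s. ennreal (bump 0 (jmp \<omega> s)) * indicator B (jmp \<omega> s)) \<partial>P)
    = emeasure P A * ennreal (b - a) * (\<integral>\<^sup>+x. ennreal (bump 0 x) * indicator B x \<partial>\<nu>)"
proof -
  have b: "0 \<le> b" using ab by simp
  have R[measurable]: "{a<..b} \<times> A \<in> sets Pred" by (rule rectangle_predictable[OF ab A])
  define c where "c = emeasure P A * ennreal (b - a)"
  have cfin: "c < \<top>" by (simp add: c_def emeasure_eq_measure ennreal_mult_less_top)
  define M where "M = distr (density (jump_measure b) (\<lambda>p. ennreal (bump 0 (snd p)) * indicator ({a<..b} \<times> A) (fst p))) borel snd"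
  define N where "N = density \<nu> (\<lambda>x. c * ennreal (bump 0 x))"
  have M_int: "(\<integral>\<^sup>+x. f x \<partial>M) = (\<integral>\<^sup>+\<omega>. indicator A \<omega> * jsum \<omega> {a<..b} (\<lambda>s. ennreal (bump 0 (jmp \<omega> s)) * f (jmp \<omega> s)) \<partial>P)"
    if [measurable]: "f \<in> borel_measurable borel" for f
  proof -
    have "(\<integral>\<^sup>+x. f x \<partial>M) = (\<integral>\<^sup>+p. ennreal (bump 0 (snd p)) * indicator ({a<..b} \<times> A) (fst p) * f (snd p) \<partial>jump_measure b)"
      unfolding M_def by (subst nn_integral_distr) (auto simp: nn_integral_density)
    also have "\<dots> = (\<integral>\<^sup>+\<omega>. jsum \<omega> {0<..b} (\<lambda>s. ennreal (bump 0 (jmp \<omega> s)) * indicator ({a<..b} \<times> A) (s, \<omega>) * f (jmp \<omega> s)) \<partial>P)"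
      by (subst nn_integral_jump_measure[OF b]) auto
    also have "\<dots> = (\<integral>\<^sup>+\<omega>. indicator A \<omega> * jsum \<omega> {a<..b} (\<lambda>s. ennreal (bump 0 (jmp \<omega> s)) * f (jmp \<omega> s)) \<partial>P)"
    proof (rule nn_integral_cong)
      fix \<omega> assume "\<omega> \<in> space P"
      have "jsum \<omega> {0<..b} (\<lambda>s. ennreal (bump 0 (jmp \<omega> s)) * indicator ({a<..b} \<times> A) (s, \<omega>) * f (jmp \<omega> s))
        = jsum \<omega> {0<..b} (\<lambda>s. indicator A \<omega> * (ennreal (bump 0 (jmp \<omega> s)) * f (jmp \<omega> s)) * indicator {a<..b} s)"
        by (intro jump_sum_cong) (auto split: split_indicator)
      also have "\<dots> = jsum \<omega> {a<..b} (\<lambda>s. indicator A \<omega> * (ennreal (bump 0 (jmp \<omega> s)) * f (jmp \<omega> s)))"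
      proof -
        have "{0<..b} \<inter> {a<..b} = {a<..b}" using ab by auto
        then show ?thesis by (simp only: jump_sum_restrict)
      qed
      finally show "jsum \<omega> {0<..b} (\<lambda>s. ennreal (bump 0 (jmp \<omega> s)) * indicator ({a<..b} \<times> A) (s, \<omega>) * f (jmp \<omega> s))
        = indicator A \<omega> * jsum \<omega> {a<..b} (\<lambda>s. ennreal (bump 0 (jmp \<omega> s)) * f (jmp \<omega> s))"
        by (simp add: jump_sum_cmult)
    qed
    finally show ?thesis .
  qed
  have N_int: "(\<integral>\<^sup>+x. f x \<partial>N) = c * (\<integral>\<^sup>+x. ennreal (bump 0 x) * f x \<partial>\<nu>)"
    if [measurable]: "f \<in> borel_measurable borel" for f
    unfolding N_def by (subst nn_integral_density) (auto simp: nn_integral_cmult mult.assoc)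
  \<comment> \<open>Hence the exponential moments of M are expected bump sums, which are already
    computed, and those of N are integrals of bumps.\<close>
  have bump_exp: "ennreal (bump 0 x) * ennreal (exp (- (real k * x))) = ennreal (bump k x)" for k x
    by (simp add: bump_def ennreal_mult[symmetric])
  have mom: "(\<integral>\<^sup>+x. ennreal (exp (- real k * x)) \<partial>M) = c * ennreal (\<integral>x. bump k x \<partial>\<nu>)"
    "(\<integral>\<^sup>+x. ennreal (exp (- real k * x)) \<partial>N) = c * ennreal (\<integral>x. bump k x \<partial>\<nu>)" for k
  proof -
    show "(\<integral>\<^sup>+x. ennreal (exp (- real k * x)) \<partial>M) = c * ennreal (\<integral>x. bump k x \<partial>\<nu>)"
      using ab bump_sum_expectation[OF ab A, of k]
      by (subst M_int) (auto simp: bump_exp c_def ennreal_mult bump_levy_nonneg mult.assoc)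
    show "(\<integral>\<^sup>+x. ennreal (exp (- real k * x)) \<partial>N) = c * ennreal (\<integral>x. bump k x \<partial>\<nu>)"
      by (subst N_int) (auto simp: bump_exp nn_integral_bump_levy)
  qed
  have [measurable_cong, simp]: "sets M = sets borel" "sets N = sets borel" by (auto simp: M_def N_def)
  have sp[simp]: "space M = UNIV" "space N = UNIV" by (auto simp: M_def N_def)
  have "M = N"
  proof (rule finite_measure_eqI_exp_moments)
    have "emeasure M (space M) = c * ennreal (\<integral>x. bump 0 x \<partial>\<nu>)" using mom(1)[of 0] by simp
    then show "finite_measure M" using cfin by (intro finite_measureI) (auto simp: ennreal_mult_eq_top_iff)
    have "emeasure N (space N) = c * ennreal (\<integral>x. bump 0 x \<partial>\<nu>)" using mom(2)[of 0] by simp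
    then show "finite_measure N" using cfin by (intro finite_measureI) (auto simp: ennreal_mult_eq_top_iff)
    show "AE x in M. 0 \<le> x"
      unfolding M_def using AE_jump_measure_pos[OF b]
      by (subst AE_distr_iff) (auto simp: AE_density elim!: eventually_mono)
    show "AE x in N. 0 \<le> x"
      unfolding N_def using AE_levy_pos by (subst AE_density) (auto elim!: eventually_mono)
    show "(\<integral>x. exp (- real k * x) \<partial>M) = (\<integral>x. exp (- real k * x) \<partial>N)" for k
      using mom[of k] by (simp add: integral_eq_nn_integral)
  qed auto
  then show ?thesis using M_int[of "indicator B"] N_int[of "indicator B"] by (simp add: c_def)
qed

text \<open>Products of generating predictable rectangles and Borel sets are stable under
  intersection. The weight makes both measures finite on the strips that exhaust the space, so
  agreement on these products suffices.\<close>

lemma jump_measure_eq_compensator_weighted: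
  assumes t: "0 \<le> t"
  shows "density (jump_measure t) (\<lambda>p. ennreal (bump 0 (snd p))) = density (compensator t) (\<lambda>p. ennreal (bump 0 (snd p)))"
    (is "?J = ?N")
proof -
  define G where "G = {{0} \<times> A |A. A \<in> sets (F 0)} \<union> {{s<..t} \<times> A |s t A. 0 \<le> s \<and> s < t \<and> A \<in> sets (F s)}"
  define E where "E = {R \<times> B | R B. R \<in> G \<and> B \<in> sets (borel :: real measure)}"
  have G0: "{0} \<times> A \<in> G" if "A \<in> sets (F 0)" for A using that by (auto simp: G_def)
  have G1: "{a<..b} \<times> A \<in> G" if "0 \<le> a" "a < b" "A \<in> sets (F a)" for a b A using that unfolding G_def by blast
  have GE: "(\<exists>A. R = {0} \<times> A \<and> A \<in> sets (F 0)) \<or> (\<exists>a b A. R = {a<..b} \<times> A \<and> 0 \<le> a \<and> a < b \<and> A \<in> sets (F a))"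
    if "R \<in> G" for R using that unfolding G_def by blast
  have EI: "R \<times> B \<in> E" if "R \<in> G" "B \<in> sets borel" for R B using that unfolding E_def by blast
  have EE: "\<exists>R B. Y = R \<times> B \<and> R \<in> G \<and> B \<in> sets borel" if "Y \<in> E" for Y using that unfolding E_def by blast
  have GP: "R \<in> sets Pred" if "R \<in> G" for R using that unfolding sets_Pred G_def by (intro sigma_sets.Basic)
  have J: "emeasure ?J (R \<times> B) = (\<integral>\<^sup>+\<omega>. jsum \<omega> {0<..t} (\<lambda>s. ennreal (bump 0 (jmp \<omega> s)) * indicator R (s, \<omega>) * indicator B (jmp \<omega> s)) \<partial>P)"
    if [measurable]: "R \<in> sets Pred" "B \<in> sets borel" for R B
  proof -
    have "emeasure ?J (R \<times> B) = (\<integral>\<^sup>+p. ennreal (bump 0 (snd p)) * indicator (R \<times> B) p \<partial>jump_measure t)"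
      by (rule emeasure_density) auto
    also have "\<dots> = (\<integral>\<^sup>+p. ennreal (bump 0 (snd p)) * indicator R (fst p) * indicator B (snd p) \<partial>jump_measure t)"
      by (intro nn_integral_cong) (auto split: split_indicator)
    finally show ?thesis by (simp add: nn_integral_jump_measure[OF t])
  qed
  have N: "emeasure ?N (R \<times> B) = (\<integral>\<^sup>+\<omega>. \<integral>\<^sup>+s. (indicator R (s, \<omega>) * indicator {0<..t} s) * (\<integral>\<^sup>+x. ennreal (bump 0 x) * indicator B x \<partial>\<nu>) \<partial>lborel \<partial>P)"
    if [measurable]: "R \<in> sets Pred" "B \<in> sets borel" for R B
  proof -
    have "emeasure ?N (R \<times> B) = (\<integral>\<^sup>+p. ennreal (bump 0 (snd p)) * indicator (R \<times> B) p \<partial>compensator t)"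
      by (rule emeasure_density) auto
    also have "\<dots> = (\<integral>\<^sup>+p. indicator R (fst p) * (ennreal (bump 0 (snd p)) * indicator B (snd p)) \<partial>compensator t)"
      by (intro nn_integral_cong) (auto split: split_indicator)
    also have "\<dots> = (\<integral>\<^sup>+\<omega>. \<integral>\<^sup>+s. (\<integral>\<^sup>+x. indicator R (s, \<omega>) * (ennreal (bump 0 x) * indicator B x) \<partial>\<nu>) * indicator {0<..t} s \<partial>lborel \<partial>P)"
      by (subst nn_integral_compensator[OF t]) auto
    also have "\<dots> = (\<integral>\<^sup>+\<omega>. \<integral>\<^sup>+s. (indicator R (s, \<omega>) * indicator {0<..t} s) * (\<integral>\<^sup>+x. ennreal (bump 0 x) * indicator B x \<partial>\<nu>) \<partial>lborel \<partial>P)"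
    proof -
      have "(\<integral>\<^sup>+x. indicator R (s, \<omega>) * (ennreal (bump 0 x) * indicator B x) \<partial>\<nu>) * indicator {0<..t} s
        = (indicator R (s, \<omega>) * indicator {0<..t} s) * (\<integral>\<^sup>+x. ennreal (bump 0 x) * indicator B x \<partial>\<nu>)" for s \<omega>
        by (subst nn_integral_cmult) (auto simp: mult_ac)
      then show ?thesis by (simp only:)
    qed
    finally show ?thesis .
  qed
  have eq: "emeasure ?J (R \<times> B) = emeasure ?N (R \<times> B)" if R: "R \<in> G" and B[measurable]: "B \<in> sets borel" for R B
  proof -
    let ?w = "\<integral>\<^sup>+x. ennreal (bump 0 x) * indicator B x \<partial>\<nu>"
    consider A where "R = {0} \<times> A" "A \<in> sets (F 0)"
      | a b A where "R = {a<..b} \<times> A" "0 \<le> a" "a < b" "A \<in> sets (F a)" using GE[OF R] by blast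
    then show ?thesis
    proof cases
      case 1
      have "emeasure ?J (R \<times> B) = (\<integral>\<^sup>+\<omega>. jsum \<omega> {0<..t} (\<lambda>s. 0) \<partial>P)"
        unfolding J[OF GP[OF R] B] by (intro nn_integral_cong jump_sum_cong) (auto simp: 1)
      moreover have "emeasure ?N (R \<times> B) = (\<integral>\<^sup>+\<omega>. \<integral>\<^sup>+s. 0 \<partial>(lborel :: real measure) \<partial>P)"
      proof -
        have z: "indicator ({0} \<times> A) (s, \<omega>) * indicator {0<..t} s = (0 :: ennreal)" for s \<omega>
          by (auto split: split_indicator)
        show ?thesis using N[OF GP[OF R] B] unfolding 1(1) z mult_zero_left .
      qed
      ultimately show ?thesis by (simp add: jump_sum_def)
    next
      case 2
      have AP[measurable]: "A \<in> sets P" using 2(4) sets_F_subset by auto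
      \<comment> \<open>Only the part of the rectangle up to the horizon t counts, hence the end
        point \<open>min b t\<close>.\<close>
      have J': "emeasure ?J (R \<times> B) = (\<integral>\<^sup>+\<omega>. indicator A \<omega> * jsum \<omega> {a<..min b t} (\<lambda>s. ennreal (bump 0 (jmp \<omega> s)) * indicator B (jmp \<omega> s)) \<partial>P)"
        unfolding J[OF GP[OF R] B]
      proof (rule nn_integral_cong)
        fix \<omega> assume "\<omega> \<in> space P"
        have "jsum \<omega> {0<..t} (\<lambda>s. ennreal (bump 0 (jmp \<omega> s)) * indicator R (s, \<omega>) * indicator B (jmp \<omega> s))
          = jsum \<omega> {0<..t} (\<lambda>s. indicator A \<omega> * (ennreal (bump 0 (jmp \<omega> s)) * indicator B (jmp \<omega> s)) * indicator {a<..b} s)"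
          by (intro jump_sum_cong) (auto simp: 2(1) split: split_indicator)
        also have "\<dots> = jsum \<omega> {a<..min b t} (\<lambda>s. indicator A \<omega> * (ennreal (bump 0 (jmp \<omega> s)) * indicator B (jmp \<omega> s)))"
        proof -
          have "{0<..t} \<inter> {a<..b} = {a<..min b t}" using 2 by auto
          then show ?thesis by (simp only: jump_sum_restrict)
        qed
        finally show "jsum \<omega> {0<..t} (\<lambda>s. ennreal (bump 0 (jmp \<omega> s)) * indicator R (s, \<omega>) * indicator B (jmp \<omega> s))
          = indicator A \<omega> * jsum \<omega> {a<..min b t} (\<lambda>s. ennreal (bump 0 (jmp \<omega> s)) * indicator B (jmp \<omega> s))"
          by (simp only: jump_sum_cmult)
      qed
      have N': "emeasure ?N (R \<times> B) = emeasure P A * emeasure lborel {a<..min b t} * ?w"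
      proof -
        have "emeasure ?N (R \<times> B) = (\<integral>\<^sup>+\<omega>. \<integral>\<^sup>+s. (indicator A \<omega> * ?w) * indicator {a<..min b t} s \<partial>lborel \<partial>P)"
          unfolding N[OF GP[OF R] B] by (intro nn_integral_cong) (use 2 in \<open>auto split: split_indicator\<close>)
        also have "\<dots> = (\<integral>\<^sup>+\<omega>. (emeasure lborel {a<..min b t} * ?w) * indicator A \<omega> \<partial>P)"
          by (intro nn_integral_cong) (subst nn_integral_cmult_indicator, auto simp: mult_ac)
        also have "\<dots> = (emeasure lborel {a<..min b t} * ?w) * emeasure P A"
          by (rule nn_integral_cmult_indicator) simp
        finally show ?thesis by (simp add: mult_ac)
      qed
      show ?thesis
      proof (cases "a < t")
        case True
        then have "a < min b t" using 2 by simp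
        then show ?thesis
          unfolding J' N' rectangle_expectation[OF 2(2) \<open>a < min b t\<close> 2(4) B] by simp
      next
        case False
        then have e: "{a<..min b t} = {}" by auto
        show ?thesis unfolding J' N' e by (simp add: jump_sum_def)
      qed
    qed
  qed
  \<comment> \<open>Time 0 and unit time strips: an exhaustion made of generating rectangles, as
    both the product sigma-algebra and the uniqueness argument require.\<close>
  define C where "C i = (if i = 0 then {0} \<times> space P else {real i - 1<..real i} \<times> space P)" for i :: nat
  have CG: "C i \<in> G" for i
  proof (cases "i = 0")
    case False
    then have "0 \<le> real i - 1" "real i - 1 < real i" by auto
    then show ?thesis using False sets.top[of "F (real i - 1)"] G1 by (simp add: C_def)
  qed (use sets.top[of "F 0"] G0 in \<open>auto simp: C_def\<close>)
  have CU: "(\<Union>i. C i) = {0..} \<times> space P"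
  proof (intro equalityI subsetI)
    fix p :: "real \<times> 'a" assume p: "p \<in> {0..} \<times> space P"
    show "p \<in> (\<Union>i. C i)"
    proof (cases "fst p = 0")
      case False
      define i where "i = nat \<lceil>fst p\<rceil>"
      have "0 < fst p" using p False by auto
      then have "0 < \<lceil>fst p\<rceil>" by simp
      then have "0 < i" "real i = of_int \<lceil>fst p\<rceil>" unfolding i_def by auto
      then have "p \<in> C i" using p ceiling_correct[of "fst p"] by (auto simp: C_def)
      then show ?thesis by blast
    qed (use p in \<open>auto simp: C_def intro!: exI[of _ 0]\<close>)
  qed (auto simp: C_def split: if_splits)
  have GS: "R \<subseteq> {0..} \<times> space P" if "R \<in> G" for R using predictable_generators that unfolding G_def by blast
  have U: "UNIV \<in> sets (borel :: real measure)" by simp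
  have EP: "E \<subseteq> Pow (({0..} \<times> space P) \<times> UNIV)"
  proof
    fix Y assume "Y \<in> E"
    then obtain R B where "Y = R \<times> B" "R \<in> G" using EE by blast
    then show "Y \<in> Pow (({0..} \<times> space P) \<times> UNIV)" using GS[of R] by auto
  qed
  have sig: "sets PredB = sigma_sets (({0..} \<times> space P) \<times> UNIV) E"
  proof -
    have "sets PredB = sets (sigma (space Pred \<times> space (borel :: real measure)) E)"
      unfolding E_def
    proof (rule sets_pair_eq)
      show "sets Pred = sigma_sets (space Pred) G" unfolding space_Pred G_def by (rule sets_Pred)
      show "G \<subseteq> Pow (space Pred)" unfolding space_Pred G_def by (rule predictable_generators)
      show "countable (range C)" "range C \<subseteq> G" "\<Union> (range C) = space Pred"
        using CG CU by (auto simp: space_Pred)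
      show "sets borel = sigma_sets (space (borel :: real measure)) (sets borel)"
        by (metis sets.sigma_sets_eq)
      show "countable {UNIV :: real set}" "{UNIV} \<subseteq> sets (borel :: real measure)" "\<Union>{UNIV} = space (borel :: real measure)"
        by auto
    qed auto
    also have "\<dots> = sigma_sets (({0..} \<times> space P) \<times> UNIV) E"
      unfolding space_Pred space_borel by (rule sets_measure_of[OF EP])
    finally show ?thesis .
  qed
  show ?thesis
  proof (rule measure_eqI_generator_eq[where E="E" and \<Omega>="({0..} \<times> space P) \<times> UNIV" and A="\<lambda>i. C i \<times> UNIV"])
    show "Int_stable E"
    proof (rule Int_stableI)
      fix x y assume "x \<in> E" "y \<in> E"
      then obtain R B R' B' where *: "x = R \<times> B" "y = R' \<times> B'" "R \<in> G" "R' \<in> G" "B \<in> sets borel" "B' \<in> sets borel"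
        using EE[of x] EE[of y] by blast
      have "R \<inter> R' \<in> G"
      proof -
        have e: "{} \<in> G" using G0[of "{}"] by simp
        consider (z) A A' where "R = {0} \<times> A" "A \<in> sets (F 0)" "R' = {0} \<times> A'" "A' \<in> sets (F 0)"
          | (d) "R \<inter> R' = {}"
          | (i) a b A a' b' A' where "R = {a<..b} \<times> A" "0 \<le> a" "a < b" "A \<in> sets (F a)" "R' = {a'<..b'} \<times> A'" "A' \<in> sets (F a')"
          using GE[OF *(3)] GE[OF *(4)] by fastforce
        then show ?thesis
        proof cases
          case z
          then have "R \<inter> R' = {0} \<times> (A \<inter> A')" by auto
          then show ?thesis using G0[of "A \<inter> A'"] z by simp
        next
          case i
          show ?thesis
          proof (cases "max a a' < min b b'")
            case True
            have r: "R \<inter> R' = {max a a'<..min b b'} \<times> (A \<inter> A')" using i by auto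
            have "A \<inter> A' \<in> sets (F (max a a'))"
              using i(4,6) sets_F_mono[of a "max a a'"] sets_F_mono[of a' "max a a'"] by auto
            moreover have "0 \<le> max a a'" using i by simp
            ultimately show ?thesis unfolding r using True G1 by blast
          next
            case False
            then have "R \<inter> R' = {}" using i by auto
            then show ?thesis using e by simp
          qed
        qed (use e in simp)
      qed
      moreover have "x \<inter> y = (R \<inter> R') \<times> (B \<inter> B')" using * by auto
      moreover have "B \<inter> B' \<in> sets borel" using * by auto
      ultimately show "x \<inter> y \<in> E" using EI by simp
    qed
    show "E \<subseteq> Pow (({0..} \<times> space P) \<times> UNIV)" by (rule EP)
    show "emeasure ?J Y = emeasure ?N Y" if YE: "Y \<in> E" for Y
    proof -
      obtain R B where "Y = R \<times> B" "R \<in> G" "B \<in> sets borel" using EE[OF YE] by blast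
      then show ?thesis using eq by simp
    qed
    show "sets ?J = sigma_sets (({0..} \<times> space P) \<times> UNIV) E" "sets ?N = sigma_sets (({0..} \<times> space P) \<times> UNIV) E"
      using sig by auto
    show "range (\<lambda>i. C i \<times> UNIV) \<subseteq> E" using CG EI by auto
    show "(\<Union>i. C i \<times> UNIV) = ({0..} \<times> space P) \<times> UNIV" using CU by blast
    fix i
    have "emeasure ?J (C i \<times> UNIV) = emeasure ?N (C i \<times> UNIV)" by (rule eq[OF CG]) simp
    also have "\<dots> \<le> (\<integral>\<^sup>+\<omega>. \<integral>\<^sup>+s. ennreal (\<integral>x. bump 0 x \<partial>\<nu>) * indicator {0<..t} s \<partial>lborel \<partial>P)"
      unfolding N[OF GP[OF CG] U]
      by (intro nn_integral_mono) (auto simp: nn_integral_bump_levy split: split_indicator)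
    also have "\<dots> < \<infinity>" using t
      by (simp add: nn_integral_cmult emeasure_space_1 ennreal_mult_less_top)
    finally show "emeasure ?J (C i \<times> UNIV) \<noteq> \<infinity>" by simp
  qed
qed

text \<open>Both measures are carried by x > 0, where the weight \<open>bump 0\<close> is positive
  and finite and can be divided out.\<close>

theorem compensation:
  assumes t: "0 \<le> t" and K[measurable]: "K \<in> borel_measurable PredB"
  shows "(\<integral>\<^sup>+\<omega>. jsum \<omega> {0<..t} (\<lambda>s. K ((s, \<omega>), jmp \<omega> s)) \<partial>P)
    = (\<integral>\<^sup>+\<omega>. \<integral>\<^sup>+s. (\<integral>\<^sup>+x. K ((s, \<omega>), x) \<partial>\<nu>) * indicator {0<..t} s \<partial>lborel \<partial>P)"
proof -
  let ?w = "\<lambda>p :: (real \<times> 'a) \<times> real. ennreal (bump 0 (snd p))"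
  have w: "?w p * (K p / ?w p) = K p" if "0 < snd p" for p
  proof -
    have "0 < bump 0 (snd p)" using that by (simp add: bump_def)
    then have "?w p \<noteq> 0" "?w p \<noteq> \<top>" by auto
    then show ?thesis by (metis ennreal_times_divide ennreal_mult_divide_eq mult.commute)
  qed
  have "(\<integral>\<^sup>+\<omega>. jsum \<omega> {0<..t} (\<lambda>s. K ((s, \<omega>), jmp \<omega> s)) \<partial>P) = (\<integral>\<^sup>+p. K p \<partial>jump_measure t)"
    by (rule nn_integral_jump_measure[OF t K, symmetric])
  also have "\<dots> = (\<integral>\<^sup>+p. ?w p * (K p / ?w p) \<partial>jump_measure t)"
    by (rule nn_integral_cong_AE, rule eventually_mono[OF AE_jump_measure_pos[OF t]]) (rule w[symmetric])
  also have "\<dots> = (\<integral>\<^sup>+p. K p / ?w p \<partial>density (jump_measure t) ?w)"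
    by (subst nn_integral_density) auto
  also have "\<dots> = (\<integral>\<^sup>+p. ?w p * (K p / ?w p) \<partial>compensator t)"
    unfolding jump_measure_eq_compensator_weighted[OF t] by (subst nn_integral_density) auto
  also have "\<dots> = (\<integral>\<^sup>+p. K p \<partial>compensator t)"
    by (rule nn_integral_cong_AE, rule eventually_mono[OF AE_compensator_pos[OF t]]) (rule w)
  finally show ?thesis by (simp only: nn_integral_compensator[OF t K])
qed

end

lemma exp_neg_taylor:
  fixes h :: real assumes "\<bar>h\<bar> \<le> 1/2" shows "\<bar>exp (- h) - 1 + h\<bar> \<le> 2 * h^2"
proof -
  have 1: "1 - h \<le> exp (- h)" using exp_ge_add_one_self[of "- h"] by simp
  have p: "0 < 1 + h" using assms by linarith
  have "1 + h \<le> exp h" by (rule exp_ge_add_one_self)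
  then have "1 / exp h \<le> 1 / (1 + h)" using p by (intro divide_left_mono mult_pos_pos) auto
  then have "exp (- h) \<le> 1 / (1 + h)" by (simp only: exp_minus inverse_eq_divide)
  moreover have "1 / (1 + h) - 1 + h = h^2 / (1 + h)" using p by (simp add: field_simps power2_eq_square)
  moreover have "h^2 / (1 + h) \<le> h^2 / (1/2)" using p assms by (intro divide_left_mono) auto
  ultimately have "exp (- h) - 1 + h \<le> 2 * h^2" by simp
  then show ?thesis using 1 by simp
qed

lemma abs_exp_diff_le:
  fixes a b :: real assumes "a \<le> m" "b \<le> m" shows "\<bar>exp a - exp b\<bar> \<le> exp m * \<bar>a - b\<bar>"
  using assms
proof (induction a b rule: linorder_wlog)
  case (le a b)
  have "exp b - exp a = exp b * (1 - exp (a - b))" by (simp add: exp_diff algebra_simps)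
  also have "\<dots> \<le> exp b * (b - a)"
  proof (rule mult_left_mono)
    show "1 - exp (a - b) \<le> b - a" using exp_ge_add_one_self[of "a - b"] by linarith
  qed simp
  also have "\<dots> \<le> exp m * (b - a)" using le by (intro mult_right_mono) auto
  finally show ?case using le by simp
next
  case (sym a b) then show ?case by (simp add: abs_minus_commute)
qed

section \<open>Products over jump times\<close>

text \<open>The integrand is merely measurable; the two sides differ by a function of \<open>t\<close> whose increments are quadratically small.\<close>

lemma exp_integral_identity:
  fixes q :: "real \<Rightarrow> real"
  assumes q[measurable]: "q \<in> borel_measurable borel" and bnd: "\<And>x. \<bar>q x\<bar> \<le> C"
    and supp: "\<And>x. x \<notin> {0<..T} \<Longrightarrow> q x = 0" and T: "0 \<le> T" and st: "0 \<le> s" "s \<le> t"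
  defines "G \<equiv> \<lambda>r. \<integral>x. indicator {0<..r} x * q x \<partial>lborel"
  defines "e \<equiv> \<lambda>r. exp (- G r)"
  shows "(\<integral>x. indicator {s<..t} x * (e x * q x) \<partial>lborel) = e s - e t"
    and "e \<in> borel_measurable borel" and "\<And>r. e r \<le> exp (C * T)"
proof -
  have C: "0 \<le> C" using bnd[of 0] abs_ge_zero[of "q 0"] by linarith
  have int_bdd: "integrable lborel (\<lambda>x. indicator S x * (k x * q x))"
    if [measurable]: "S \<in> sets borel" "k \<in> borel_measurable borel" and k: "\<And>x. \<bar>k x\<bar> \<le> K" for S k K
  proof (rule Bochner_Integration.integrable_bound)
    show "integrable lborel (\<lambda>x. K * C * indicator {0<..T} x)"
      by (intro integrable_mult_right integrable_real_indicator) (use T in auto)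
    have K: "0 \<le> K" using k[of 0] abs_ge_zero[of "k 0"] by linarith
    have "norm (indicator S x * (k x * q x)) \<le> norm (K * C * indicator {0<..T} x)" for x
    proof (cases "x \<in> {0<..T}")
      case True
      have "\<bar>k x\<bar> * \<bar>q x\<bar> \<le> K * C" using k bnd K by (intro mult_mono) auto
      then show ?thesis using True K C by (auto simp: abs_mult split: split_indicator)
    qed (simp add: supp)
    then show "AE x in lborel. norm (indicator S x * (k x * q x)) \<le> norm (K * C * indicator {0<..T} x)" by simp
  qed measurable
  have int1: "integrable lborel (\<lambda>x. indicator S x * q x)" if "S \<in> sets borel" for S
    using int_bdd[OF that, of "\<lambda>_. 1" 1] by simp
  have split: "(\<integral>x. indicator {0<..v} x * f x \<partial>lborel) - (\<integral>x. indicator {0<..u} x * f x \<partial>lborel) = (\<integral>x. indicator {u<..v} x * f x \<partial>lborel)"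
    if "u \<le> v" and i: "\<And>S. S \<in> sets borel \<Longrightarrow> integrable lborel (\<lambda>x. indicator S x * f x :: real)" and z: "\<And>x. x \<le> 0 \<Longrightarrow> f x = 0" for u v and f :: "real \<Rightarrow> real"
  proof -
    have "(\<integral>x. indicator {0<..v} x * f x \<partial>lborel) - (\<integral>x. indicator {0<..u} x * f x \<partial>lborel) = (\<integral>x. indicator {0<..v} x * f x - indicator {0<..u} x * f x \<partial>lborel)"
      by (rule Bochner_Integration.integral_diff[symmetric]) (auto intro!: i)
    also have "\<dots> = (\<integral>x. indicator {u<..v} x * f x \<partial>lborel)"
      using that(1) z by (intro Bochner_Integration.integral_cong) (auto simp: not_less split: split_indicator)
    finally show ?thesis .
  qed
  have bound_int: "\<bar>\<integral>x. indicator {u<..v} x * (k x * q x) \<partial>lborel\<bar> \<le> K * C * (v - u)"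
    if uv: "u \<le> v" and [measurable]: "k \<in> borel_measurable borel" and k: "\<And>x. \<bar>k x\<bar> \<le> K'" and k': "\<And>x. u < x \<Longrightarrow> x \<le> v \<Longrightarrow> \<bar>k x\<bar> \<le> K" and K: "0 \<le> K" for u v k K K'
  proof -
    have "\<bar>\<integral>x. indicator {u<..v} x * (k x * q x) \<partial>lborel\<bar> \<le> (\<integral>x. \<bar>indicator {u<..v} x * (k x * q x)\<bar> \<partial>lborel)"
      by (rule integral_abs_bound)
    also have "\<dots> \<le> (\<integral>x. (K * C) * indicator {u<..v} x \<partial>lborel)"
    proof (rule integral_mono)
      show "integrable lborel (\<lambda>x. \<bar>indicator {u<..v} x * (k x * q x)\<bar>)" by (intro integrable_abs int_bdd[OF _ _ k]) auto
      show "integrable lborel (\<lambda>x. K * C * indicator {u<..v} x)" using uv by (intro integrable_mult_right integrable_real_indicator) auto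
      fix x
      show "\<bar>indicator {u<..v} x * (k x * q x)\<bar> \<le> K * C * indicator {u<..v} x"
      proof (cases "x \<in> {u<..v}")
        case True
        then have "\<bar>k x\<bar> * \<bar>q x\<bar> \<le> K * C" using k' bnd K by (intro mult_mono) auto
        then show ?thesis using True by (simp add: abs_mult)
      qed simp
    qed
    also have "\<dots> = K * C * (v - u)" using uv by simp
    finally show ?thesis .
  qed
  have Gd: "G v - G u = (\<integral>x. indicator {u<..v} x * q x \<partial>lborel)" if "u \<le> v" for u v
    unfolding G_def by (rule split[OF that int1]) (auto simp: supp)
  have Gl: "\<bar>G v - G u\<bar> \<le> C * (v - u)" if "u \<le> v" for u v
    unfolding Gd[OF that] using bound_int[OF that, of "\<lambda>_. 1" 1 1] by simp
  have Gb: "\<bar>G r\<bar> \<le> C * T" for r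
  proof -
    have "G r = (\<integral>x. indicator {0<..min r T} x * (1 * q x) \<partial>lborel)"
      unfolding G_def using supp by (intro Bochner_Integration.integral_cong) (auto split: split_indicator)
    also have "\<bar>\<dots>\<bar> \<le> C * T"
    proof (cases "0 \<le> min r T")
      case True
      have "\<bar>\<integral>x. indicator {0<..min r T} x * (1 * q x) \<partial>lborel\<bar> \<le> 1 * C * (min r T - 0)"
        by (rule bound_int[OF True, of _ 1]) auto
      also have "\<dots> \<le> C * T" using C by (simp add: mult_left_mono)
      finally show ?thesis .
    next
      case False
      then have "{0<..min r T} = {}" by auto
      then show ?thesis using C T by simp
    qed
    finally show ?thesis .
  qed
  have Gcont: "continuous_on UNIV G"
  proof (rule lipschitz_on_continuous_on[where L=C], rule lipschitz_onI)
    show "dist (G u) (G v) \<le> C * dist u v" for u v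
      using Gl[of u v] Gl[of v u] by (cases "u \<le> v") (auto simp: dist_real_def abs_minus_commute)
  qed (rule C)
  have [measurable]: "G \<in> borel_measurable borel" by (rule borel_measurable_continuous_onI[OF Gcont])
  show em[measurable]: "e \<in> borel_measurable borel" unfolding e_def by measurable
  define M where "M = exp (C * T)"
  have M: "0 < M" by (simp add: M_def)
  have eb: "0 < e r" "e r \<le> M" "\<bar>e r\<bar> \<le> M" for r using Gb[of r] by (auto simp: e_def M_def)
  show "e r \<le> exp (C * T)" for r using eb(2)[of r] by (simp add: M_def)
  have el: "\<bar>e v - e u\<bar> \<le> M * (C * (v - u))" if "u \<le> v" for u v
  proof -
    have "\<bar>e v - e u\<bar> \<le> M * \<bar>- G v - - G u\<bar>"
      unfolding e_def M_def using Gb[of v] Gb[of u] by (intro abs_exp_diff_le) auto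
    also have "\<dots> \<le> M * (C * (v - u))" using Gl[OF that] M by (intro mult_left_mono) auto
    finally show ?thesis .
  qed
  define I where "I r = (\<integral>x. indicator {0<..r} x * (e x * q x) \<partial>lborel)" for r
  have Id: "I v - I u = (\<integral>x. indicator {u<..v} x * (e x * q x) \<partial>lborel)" if "u \<le> v" for u v
    unfolding I_def by (rule split[OF that int_bdd[OF _ em eb(3)]]) (auto simp: supp)
  \<comment> \<open>The first term is the Taylor remainder of exp at the increment of G; the second
    is the error of replacing \<open>e x\<close> by \<open>e u\<close> under the integral.\<close>
  define K where "K = 2 * M * C^2 + M * C^2"
  have K: "0 \<le> K" using M by (simp add: K_def)
  have quad: "\<bar>(e v + I v) - (e u + I u)\<bar> \<le> K * (v - u)^2" if uv: "u \<le> v" "C * (v - u) \<le> 1/2" for u v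
  proof -
    let ?h = "G v - G u"
    have h: "\<bar>?h\<bar> \<le> C * (v - u)" by (rule Gl[OF uv(1)])
    have ev: "e v = e u * exp (- ?h)" unfolding e_def by (simp add: exp_add[symmetric])
    have "\<bar>e v - e u + e u * ?h\<bar> = e u * \<bar>exp (- ?h) - 1 + ?h\<bar>"
      using eb(1)[of u] unfolding ev by (simp add: abs_mult[symmetric] algebra_simps abs_mult_pos')
    also have "\<dots> \<le> M * (2 * ?h^2)"
      using exp_neg_taylor[of ?h] h uv(2) eb[of u] by (intro mult_mono) auto
    also have "\<dots> \<le> M * (2 * (C * (v - u))^2)"
    proof -
      have "?h^2 \<le> (C * (v - u))^2" using h by (metis abs_le_square_iff abs_of_nonneg abs_ge_zero order_trans)
      then show ?thesis using M by simp
    qed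
    finally have 1: "\<bar>e v - e u + e u * ?h\<bar> \<le> M * (2 * (C * (v - u))^2)" .
    have "(\<integral>x. indicator {u<..v} x * (e x * q x) \<partial>lborel) - e u * ?h = (\<integral>x. indicator {u<..v} x * ((e x - e u) * q x) \<partial>lborel)"
    proof -
      have "e u * ?h = (\<integral>x. e u * (indicator {u<..v} x * q x) \<partial>lborel)" unfolding Gd[OF uv(1)] by simp
      moreover have "(\<integral>x. indicator {u<..v} x * (e x * q x) \<partial>lborel) - (\<integral>x. e u * (indicator {u<..v} x * q x) \<partial>lborel)
        = (\<integral>x. indicator {u<..v} x * (e x * q x) - e u * (indicator {u<..v} x * q x) \<partial>lborel)"
        by (rule Bochner_Integration.integral_diff[symmetric]) (auto intro!: int_bdd[OF _ em eb(3)] int1 integrable_mult_right)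
      moreover have "\<dots> = (\<integral>x. indicator {u<..v} x * ((e x - e u) * q x) \<partial>lborel)"
        by (intro Bochner_Integration.integral_cong) (auto simp: algebra_simps)
      ultimately show ?thesis by (simp only:)
    qed
    also have "\<bar>\<dots>\<bar> \<le> (M * (C * (v - u))) * C * (v - u)"
    proof (rule bound_int[OF uv(1)])
      show "\<bar>e x - e u\<bar> \<le> 2 * M" for x using eb[of x] eb[of u] by linarith
      show "\<bar>e x - e u\<bar> \<le> M * (C * (v - u))" if "u < x" "x \<le> v" for x
      proof -
        have "\<bar>e x - e u\<bar> \<le> M * (C * (x - u))" using that by (intro el) simp
        also have "\<dots> \<le> M * (C * (v - u))" using that M C by (intro mult_left_mono) auto
        finally show ?thesis .
      qed
      show "0 \<le> M * (C * (v - u))" using M C uv by simp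
    qed measurable
    finally have 2: "\<bar>I v - I u - e u * ?h\<bar> \<le> (M * (C * (v - u))) * C * (v - u)" unfolding Id[OF uv(1)] .
    have "K * (v - u)^2 = M * (2 * (C * (v - u))^2) + (M * (C * (v - u))) * C * (v - u)"
      by (simp add: K_def power2_eq_square algebra_simps)
    then show ?thesis using 1 2 by linarith
  qed
  \<comment> \<open>Keeps C d below 1/2, the range of the Taylor estimate; the added 1 covers C =
    0.\<close>
  define \<delta> where "\<delta> = 1 / (2 * (C + 1))"
  have \<delta>: "0 < \<delta>" using C by (simp add: \<delta>_def)
  have C\<delta>: "C * d \<le> 1/2" if "0 \<le> d" "d \<le> \<delta>" for d
  proof -
    have "C * d \<le> (C + 1) * \<delta>" using that C by (intro mult_mono) auto
    also have "\<dots> = 1/2" using C by (simp add: \<delta>_def field_simps)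
    finally show ?thesis .
  qed
  have quad': "\<bar>(e (r + d) + I (r + d)) - (e r + I r)\<bar> \<le> K * d^2" if "\<bar>d\<bar> \<le> \<delta>" for r d
  proof (cases "0 \<le> d")
    case True
    then show ?thesis using quad[of r "r + d"] C\<delta>[of d] that by simp
  next
    case False
    then show ?thesis using quad[of "r + d" r] C\<delta>[of "- d"] that by (simp add: abs_minus_commute)
  qed
  \<comment> \<open>Increments of size O(d^2) force derivative 0 at every point, so the sum is
    constant although neither summand need be differentiable.\<close>
  have "DERIV (\<lambda>r. e r + I r) r :> 0" for r
    unfolding DERIV_def
  proof (rule Lim_null_comparison)
    show "\<forall>\<^sub>F d in at 0. norm ((e (r + d) + I (r + d) - (e r + I r)) / d) \<le> K * \<bar>d\<bar>"
    proof -
      have "\<forall>\<^sub>F d in at 0. \<bar>d\<bar> < \<delta> \<and> d \<noteq> 0"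
        using \<delta> by (auto simp: eventually_at dist_real_def intro!: exI[of _ \<delta>])
      then show ?thesis
      proof eventually_elim
        fix d assume d: "\<bar>d\<bar> < \<delta> \<and> d \<noteq> 0"
        have "\<bar>e (r + d) + I (r + d) - (e r + I r)\<bar> \<le> (K * \<bar>d\<bar>) * \<bar>d\<bar>"
          using quad'[of d r] d by (simp add: power2_eq_square)
        then show "norm ((e (r + d) + I (r + d) - (e r + I r)) / d) \<le> K * \<bar>d\<bar>"
          using d by (simp add: pos_divide_le_eq)
      qed
    qed
    show "((\<lambda>d. K * \<bar>d\<bar>) \<longlongrightarrow> 0) (at 0)" by (auto intro!: tendsto_eq_intros)
  qed
  then have "e t + I t = e s + I s" using DERIV_isconst_all[of "\<lambda>r. e r + I r"] by blast
  then show "(\<integral>x. indicator {s<..t} x * (e x * q x) \<partial>lborel) = e s - e t"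
    using Id[OF st(2)] by linarith
qed

definition partial_product :: "(real \<Rightarrow> real) \<Rightarrow> real set \<Rightarrow> real \<Rightarrow> real" where
  "partial_product b G r = (\<Prod>s\<in>G. if s < r then 1 + b s else 1)"

text \<open>The product telescopes over its successive factors: this is the discrete equation dZ =
  Z_before * b. In the induction the largest time m affects only values after m.\<close>

lemma partial_product_expand:
  assumes "finite G"
  shows "partial_product b G r = 1 + (\<Sum>s\<in>G. if s < r then b s * partial_product b G s else 0)"
  using assms
proof (induction G arbitrary: r rule: finite_linorder_max_induct)
  case empty
  then show ?case by (simp add: partial_product_def)
next
  case (insert m G)
  have m: "m \<notin> G" using insert by auto
  have 1: "partial_product b (insert m G) s = partial_product b G s" if "s \<le> m" for s
    using that insert m by (simp add: partial_product_def)
  have 2: "partial_product b (insert m G) r = partial_product b G r + (if m < r then b m * partial_product b G m else 0)"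
  proof (cases "m < r")
    case True
    have "partial_product b G r = partial_product b G m"
      unfolding partial_product_def using insert True by (intro prod.cong) auto
    then show ?thesis using True insert m by (simp add: partial_product_def algebra_simps)
  next
    case False
    then show ?thesis using 1[of r] by simp
  qed
  have "(\<Sum>s\<in>insert m G. if s < r then b s * partial_product b (insert m G) s else 0)
    = (if m < r then b m * partial_product b G m else 0) + (\<Sum>s\<in>G. if s < r then b s * partial_product b G s else 0)"
  proof -
    have "(\<Sum>s\<in>G. if s < r then b s * partial_product b (insert m G) s else 0) = (\<Sum>s\<in>G. if s < r then b s * partial_product b G s else 0)"
      using insert.hyps(2) by (intro sum.cong refl) (simp add: 1 less_imp_le)
    then show ?thesis using insert.hyps(1) m 1[of m] by simp
  qed
  then show ?case using 2 insert.IH[of r] by simp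
qed

lemma partial_product_abs_le:
  assumes "finite G" shows "\<bar>partial_product b G r\<bar> \<le> exp (\<Sum>s\<in>G. \<bar>b s\<bar>)"
proof -
  have "\<bar>partial_product b G r\<bar> = (\<Prod>s\<in>G. \<bar>if s < r then 1 + b s else 1\<bar>)"
    unfolding partial_product_def by (rule abs_prod)
  also have "\<dots> \<le> (\<Prod>s\<in>G. exp \<bar>b s\<bar>)"
  proof (rule prod_mono)
    fix s
    have "1 + \<bar>b s\<bar> \<le> exp \<bar>b s\<bar>" by (rule exp_ge_add_one_self)
    then have "\<bar>1 + b s\<bar> \<le> exp \<bar>b s\<bar>" by linarith
    then show "0 \<le> \<bar>if s < r then 1 + b s else 1\<bar> \<and> \<bar>if s < r then 1 + b s else 1\<bar> \<le> exp \<bar>b s\<bar>"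
      by auto
  qed
  also have "\<dots> = exp (\<Sum>s\<in>G. \<bar>b s\<bar>)" by (simp add: exp_sum assms)
  finally show ?thesis .
qed

lemma abs_ln_one_plus_le:
  fixes y :: real assumes "\<bar>y\<bar> \<le> 1/2" shows "\<bar>ln (1 + y)\<bar> \<le> 2 * \<bar>y\<bar>"
proof -
  have p: "0 < 1 + y" using assms by linarith
  have 1: "ln (1 + y) \<le> y" using p ln_le_minus_one[OF p] by simp
  have "- ln (1 + y) = ln (1 / (1 + y))" using p by (simp add: ln_div)
  also have "\<dots> \<le> 1 / (1 + y) - 1" using p by (intro ln_le_minus_one) simp
  also have "\<dots> = - y / (1 + y)" using p by (simp add: field_simps)
  finally have 2: "- ln (1 + y) \<le> - y / (1 + y)" .
  have "- y / (1 + y) \<le> \<bar>y\<bar> / (1/2)" using p assms by (intro frac_le) auto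
  then have "- y / (1 + y) \<le> 2 * \<bar>y\<bar>" by simp
  with 1 2 show ?thesis unfolding abs_le_iff using abs_ge_self[of y] abs_ge_zero[of y] by linarith
qed

text \<open>By Markov's inequality only finitely many terms exceed 1/2 in absolute value; for the
  others the logarithm is at most 2 * |b|.\<close>

lemma integrable_ln_one_plus:
  fixes b :: "'i \<Rightarrow> real"
  assumes b: "integrable (count_space D) b"
  shows "integrable (count_space D) (\<lambda>s. ln (1 + b s))"
proof -
  let ?A = "{s\<in>D. 1/2 < \<bar>b s\<bar>}"
  have fin: "finite ?A"
  proof -
    have "emeasure (count_space D) {s\<in>D. 1 \<le> 2 * ennreal \<bar>b s\<bar>} \<le> 2 * (\<integral>\<^sup>+s. ennreal \<bar>b s\<bar> * indicator D s \<partial>count_space D)"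
      using nn_integral_Markov_inequality[where u="\<lambda>s. ennreal \<bar>b s\<bar>" and M="count_space D" and A=D and c=2] by simp
    also have "(\<integral>\<^sup>+s. ennreal \<bar>b s\<bar> * indicator D s \<partial>count_space D) = (\<integral>\<^sup>+s. ennreal (norm (b s)) \<partial>count_space D)"
      by (intro nn_integral_cong) simp
    also have "2 * \<dots> < \<infinity>" using b by (simp add: integrable_iff_bounded ennreal_mult_less_top)
    finally have "emeasure (count_space D) {s\<in>D. 1 \<le> 2 * ennreal \<bar>b s\<bar>} < \<infinity>" .
    then have "finite {s\<in>D. 1 \<le> 2 * ennreal \<bar>b s\<bar>}" by (subst (asm) emeasure_count_space) (auto split: if_splits)
    moreover have "?A \<subseteq> {s\<in>D. 1 \<le> 2 * ennreal \<bar>b s\<bar>}"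
    proof safe
      fix s assume "1/2 < \<bar>b s\<bar>"
      then have "ennreal 1 \<le> ennreal (2 * \<bar>b s\<bar>)" by (intro ennreal_leI) simp
      then show "1 \<le> 2 * ennreal \<bar>b s\<bar>" by (simp add: ennreal_mult)
    qed
    ultimately show ?thesis by (rule finite_subset[rotated])
  qed
  have 1: "integrable (count_space D) (\<lambda>s. ln (1 + b s) * indicator ?A s)"
  proof (rule integrableI_bounded)
    have "(\<integral>\<^sup>+s. ennreal (norm (ln (1 + b s) * indicator ?A s)) \<partial>count_space D) = (\<Sum>s\<in>?A. ennreal (norm (ln (1 + b s))))"
      using fin by (subst nn_integral_count_space'[of ?A]) (auto intro!: sum.cong split: split_indicator)
    also have "\<dots> < \<infinity>" using fin by (simp add: ennreal_sum_less_top)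
    finally show "(\<integral>\<^sup>+s. ennreal (norm (ln (1 + b s) * indicator ?A s)) \<partial>count_space D) < \<infinity>" .
  qed simp
  have 2: "integrable (count_space D) (\<lambda>s. ln (1 + b s) * indicator (- ?A) s)"
  proof (rule Bochner_Integration.integrable_bound)
    show "integrable (count_space D) (\<lambda>s. 2 * \<bar>b s\<bar>)" using b by simp
    show "AE s in count_space D. norm (ln (1 + b s) * indicator (- ?A) s) \<le> norm (2 * \<bar>b s\<bar>)"
      using abs_ln_one_plus_le by (auto simp: AE_count_space not_less split: split_indicator)
  qed simp
  have "(\<lambda>s. ln (1 + b s)) = (\<lambda>s. ln (1 + b s) * indicator ?A s + ln (1 + b s) * indicator (- ?A) s)"
    by (auto split: split_indicator)
  then show ?thesis using Bochner_Integration.integrable_add[OF 1 2] by simp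
qed

lemma countable_exhaustion:
  assumes "countable D"
  obtains G :: "nat \<Rightarrow> 'i set" where "\<And>n. finite (G n)" "\<And>n. G n \<subseteq> D" "\<And>s. s \<in> D \<Longrightarrow> \<forall>\<^sub>F n in sequentially. s \<in> G n"
proof (cases "D = {}")
  case True
  then show ?thesis by (intro that[of "\<lambda>_. {}"]) auto
next
  case False
  show ?thesis
  proof (rule that[of "\<lambda>n. from_nat_into D ` {..n}"])
    show "from_nat_into D ` {..n} \<subseteq> D" for n using from_nat_into[OF False] by auto
    fix s assume "s \<in> D"
    then obtain k where "s = from_nat_into D k" using from_nat_into_surj[OF assms] by metis
    then show "\<forall>\<^sub>F n in sequentially. s \<in> from_nat_into D ` {..n}"
      by (auto intro!: eventually_sequentiallyI[of k])
  qed simp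
qed

lemma integral_count_space_indicator_finite:
  fixes f :: "'i \<Rightarrow> real"
  assumes "finite G" "G \<subseteq> D" shows "(\<integral>s. f s * indicator G s \<partial>count_space D) = (\<Sum>s\<in>G. f s)"
proof -
  have sub: "{a \<in> D. f a * indicator G a \<noteq> 0} \<subseteq> G" by (auto split: split_indicator_asm)
  have "(\<integral>s. f s * indicator G s \<partial>count_space D) = (\<Sum>a | a \<in> D \<and> f a * indicator G a \<noteq> 0. f a * indicator G a)"
    by (rule lebesgue_integral_count_space_finite_support) (rule finite_subset[OF sub assms(1)])
  also have "\<dots> = (\<Sum>s\<in>G. f s)"
    using assms sub by (intro sum.mono_neutral_cong_left) auto
  finally show ?thesis .
qed

section \<open>The pathwise integral equation of a product over jumps\<close>

locale jump_product =
  fixes D :: "real set" and b :: "real \<Rightarrow> real"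
  assumes D: "countable D" and b: "integrable (count_space D) b" "\<And>s. s \<in> D \<Longrightarrow> -1 < b s"
begin

definition product_before :: "real \<Rightarrow> real" where
  "product_before r = exp (\<integral>s. ln (1 + b s) * indicator {..<r} s \<partial>count_space D)"

lemma integrable_indicator_ln: "integrable (count_space D) (\<lambda>s. ln (1 + b s) * indicator S s)"
  by (rule Bochner_Integration.integrable_bound[OF integrable_ln_one_plus[OF b(1)]]) (auto split: split_indicator)

lemma partial_product_exp:
  assumes G: "finite G" "G \<subseteq> D"
  shows "partial_product b G r = exp (\<integral>s. (ln (1 + b s) * indicator {..<r} s) * indicator G s \<partial>count_space D)"
proof -
  have "exp (\<integral>s. (ln (1 + b s) * indicator {..<r} s) * indicator G s \<partial>count_space D) = (\<Prod>s\<in>G. exp (ln (1 + b s) * indicator {..<r} s))"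
    by (simp only: integral_count_space_indicator_finite[OF G] exp_sum[OF G(1)])
  also have "\<dots> = partial_product b G r"
    unfolding partial_product_def
  proof (rule prod.cong[OF refl])
    fix s assume "s \<in> G"
    then have "0 < 1 + b s" using b(2)[of s] G by auto
    then show "exp (ln (1 + b s) * indicator {..<r} s) = (if s < r then 1 + b s else 1)" by simp
  qed
  finally show ?thesis by simp
qed

lemma partial_product_tendsto:
  assumes G: "\<And>n. finite (G n)" "\<And>n. G n \<subseteq> D" "\<And>s. s \<in> D \<Longrightarrow> \<forall>\<^sub>F n in sequentially. s \<in> G n"
  shows "(\<lambda>n. partial_product b (G n) r) \<longlonglongrightarrow> product_before r"
  unfolding partial_product_exp[OF G(1,2)] product_before_def
proof (intro tendsto_exp integral_dominated_convergence[where w="\<lambda>s. \<bar>ln (1 + b s)\<bar>"])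
  show "integrable (count_space D) (\<lambda>s. \<bar>ln (1 + b s)\<bar>)" by (intro integrable_abs integrable_ln_one_plus b)
  show "AE s in count_space D. (\<lambda>n. ln (1 + b s) * indicator {..<r} s * indicator (G n) s) \<longlonglongrightarrow> ln (1 + b s) * indicator {..<r} s"
    unfolding AE_count_space
  proof
    fix s assume "s \<in> D"
    show "(\<lambda>n. ln (1 + b s) * indicator {..<r} s * indicator (G n) s) \<longlonglongrightarrow> ln (1 + b s) * indicator {..<r} s"
      by (rule tendsto_eventually, rule eventually_mono[OF G(3)[OF \<open>s \<in> D\<close>]]) simp
  qed
qed (auto simp: AE_count_space split: split_indicator)

lemma sum_abs_le:
  assumes G: "finite G" "G \<subseteq> D" shows "(\<Sum>s\<in>G. \<bar>b s\<bar>) \<le> (\<integral>s. \<bar>b s\<bar> \<partial>count_space D)"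
proof -
  have "(\<Sum>s\<in>G. \<bar>b s\<bar>) = (\<integral>s. \<bar>b s\<bar> * indicator G s \<partial>count_space D)"
    by (rule integral_count_space_indicator_finite[OF G, symmetric])
  also have "\<dots> \<le> (\<integral>s. \<bar>b s\<bar> \<partial>count_space D)"
    using b(1) by (intro integral_mono Bochner_Integration.integrable_bound[OF integrable_abs[OF b(1)]])
      (auto simp: AE_count_space split: split_indicator)
  finally show ?thesis .
qed

lemma partial_product_bound:
  assumes G: "finite G" "G \<subseteq> D" shows "\<bar>partial_product b G r\<bar> \<le> exp (\<integral>s. \<bar>b s\<bar> \<partial>count_space D)"
  using partial_product_abs_le[OF G(1), of b r] sum_abs_le[OF G] by (auto intro: order_trans)

lemma product_before_pos: "0 < product_before r" by (simp add: product_before_def)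

lemma partial_product_measurable[measurable]:
  "finite G \<Longrightarrow> partial_product b G \<in> borel_measurable borel"
  unfolding partial_product_def by measurable

lemma product_before_measurable[measurable]: "product_before \<in> borel_measurable borel"
proof -
  obtain G where G: "\<And>n. finite (G n)" "\<And>n. G n \<subseteq> D" "\<And>s. s \<in> D \<Longrightarrow> \<forall>\<^sub>F n in sequentially. s \<in> G n"
    using countable_exhaustion[OF D] by blast
  show ?thesis
    by (rule borel_measurable_LIMSEQ_real[OF partial_product_tendsto[OF G]]) (auto intro!: partial_product_measurable G)
qed

lemma product_before_bound: "product_before r \<le> exp (\<integral>s. \<bar>b s\<bar> \<partial>count_space D)"
proof -
  obtain G where G: "\<And>n. finite (G n)" "\<And>n. G n \<subseteq> D" "\<And>s. s \<in> D \<Longrightarrow> \<forall>\<^sub>F n in sequentially. s \<in> G n"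
    using countable_exhaustion[OF D] by blast
  show ?thesis
    by (rule LIMSEQ_le_const2[OF partial_product_tendsto[OF G]])
      (use partial_product_bound[OF G(1,2)] in \<open>auto intro!: exI[of _ 0] dest: abs_le_D1\<close>)
qed

text \<open>Integration by parts for the product of a pure jump function and an absolutely
  continuous one, without a Stieltjes calculus: it is checked for finitely many jumps and passes to
  the limit by domination with exp (sum of |b|) * exp (C t). \<open>product_before\<close> omits the
  factor at its own time, so the product up to and including t is read off at t + 1.\<close>

lemma product_identity:
  assumes Dt: "D \<subseteq> {0<..t}" and t: "0 \<le> t"
    and \<gamma>[measurable]: "\<gamma> \<in> borel_measurable borel" and bnd: "\<And>x. \<bar>\<gamma> x\<bar> \<le> C"
    and supp: "\<And>x. x \<notin> {0<..t} \<Longrightarrow> \<gamma> x = 0"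
  defines "e \<equiv> \<lambda>r. exp (- (\<integral>x. indicator {0<..r} x * \<gamma> x \<partial>lborel))"
  shows "product_before (t + 1) * e t = 1 + (\<integral>s. product_before s * e s * b s \<partial>count_space D)
      - (\<integral>r. product_before r * e r * \<gamma> r \<partial>lborel)"
    and "integrable (count_space D) (\<lambda>s. product_before s * e s * b s)"
    and "integrable lborel (\<lambda>r. product_before r * e r * \<gamma> r)"
proof -
  have E: "(\<integral>x. indicator {s<..u} x * (e x * \<gamma> x) \<partial>lborel) = e s - e u" if "0 \<le> s" "s \<le> u" for s u
    unfolding e_def by (rule exp_integral_identity(1)[OF \<gamma> bnd _ t that]) (rule supp)
  have em[measurable]: "e \<in> borel_measurable borel"
    unfolding e_def by (rule exp_integral_identity(2)[OF \<gamma> bnd _ t order_refl order_refl]) (rule supp)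
  have eb: "e r \<le> exp (C * t)" for r
    unfolding e_def by (rule exp_integral_identity(3)[OF \<gamma> bnd _ t order_refl order_refl]) (rule supp)
  have ep: "0 < e r" for r by (simp add: e_def)
  have e0: "e 0 = 1" by (simp add: e_def)
  have C: "0 \<le> C" using bnd[of 0] abs_ge_zero[of "\<gamma> 0"] by linarith
  define N where "N = exp (\<integral>s. \<bar>b s\<bar> \<partial>count_space D)"
  have N: "0 < N" by (simp add: N_def)
  obtain G where G: "\<And>n. finite (G n)" "\<And>n. G n \<subseteq> D" "\<And>s. s \<in> D \<Longrightarrow> \<forall>\<^sub>F n in sequentially. s \<in> G n"
    using countable_exhaustion[OF D] by blast
  note [measurable] = partial_product_measurable[OF G(1)]
  have int_e\<gamma>: "integrable lborel (\<lambda>x. indicator S x * (e x * \<gamma> x))" if [measurable]: "S \<in> sets borel" for S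
  proof (rule Bochner_Integration.integrable_bound)
    show "integrable lborel (\<lambda>x. exp (C * t) * C * indicator {0<..t} x)"
      using t by (intro integrable_mult_right integrable_real_indicator) auto
    have "norm (indicator S x * (e x * \<gamma> x)) \<le> norm (exp (C * t) * C * indicator {0<..t} x)" for x
    proof (cases "x \<in> {0<..t}")
      case True
      have "e x * \<bar>\<gamma> x\<bar> \<le> exp (C * t) * C" using eb bnd ep[of x] by (intro mult_mono) auto
      then show ?thesis using True C ep[of x] by (auto simp: abs_mult split: split_indicator)
    qed (simp add: supp)
    then show "AE x in lborel. norm (indicator S x * (e x * \<gamma> x)) \<le> norm (exp (C * t) * C * indicator {0<..t} x)" by simp
  qed measurable
  have int_e: "integrable lborel (\<lambda>x. e x * \<gamma> x)" using int_e\<gamma>[of UNIV] by simp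
  have finite_id: "partial_product b G (t + 1) * e t = 1 + (\<Sum>s\<in>G. partial_product b G s * e s * b s)
      - (\<integral>r. partial_product b G r * e r * \<gamma> r \<partial>lborel)" if G: "finite G" "G \<subseteq> D" for G
  proof -
    let ?p = "partial_product b G"
    have Gt: "0 < s" "s \<le> t" if "s \<in> G" for s using that G Dt by auto
    \<comment> \<open>Substituting the telescoped form of the product leaves one integral of
      \<open>e\<close> against \<gamma> from each jump time to t, and each equals
      \<open>e s - e t\<close>.\<close>
    have "(\<integral>r. ?p r * e r * \<gamma> r \<partial>lborel) = (\<integral>r. e r * \<gamma> r + (\<Sum>s\<in>G. (b s * ?p s) * (indicator {s<..t} r * (e r * \<gamma> r))) \<partial>lborel)"
    proof (rule Bochner_Integration.integral_cong[OF refl])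
      fix r
      show "?p r * e r * \<gamma> r = e r * \<gamma> r + (\<Sum>s\<in>G. (b s * ?p s) * (indicator {s<..t} r * (e r * \<gamma> r)))"
      proof (cases "r \<le> t")
        case True
        have "(\<Sum>s\<in>G. (b s * ?p s) * (indicator {s<..t} r * (e r * \<gamma> r))) = (\<Sum>s\<in>G. if s < r then b s * ?p s else 0) * (e r * \<gamma> r)"
          unfolding sum_distrib_right using True by (intro sum.cong) auto
        then show ?thesis by (subst partial_product_expand[OF G(1)]) (simp add: algebra_simps)
      qed (use supp in simp)
    qed
    also have "\<dots> = (\<integral>r. e r * \<gamma> r \<partial>lborel) + (\<Sum>s\<in>G. (b s * ?p s) * (\<integral>r. indicator {s<..t} r * (e r * \<gamma> r) \<partial>lborel))"
      using int_e int_e\<gamma> by simp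
    also have "(\<integral>r. e r * \<gamma> r \<partial>lborel) = (\<integral>r. indicator {0<..t} r * (e r * \<gamma> r) \<partial>lborel)"
      using supp by (intro Bochner_Integration.integral_cong) (auto split: split_indicator)
    also have "\<dots> = 1 - e t" using E[of 0 t] t e0 by simp
    also have "(\<Sum>s\<in>G. (b s * ?p s) * (\<integral>r. indicator {s<..t} r * (e r * \<gamma> r) \<partial>lborel)) = (\<Sum>s\<in>G. (b s * ?p s) * (e s - e t))"
      using Gt E by (intro sum.cong refl arg_cong2[where f="(*)"]) (auto simp: less_imp_le)
    also have "\<dots> = (\<Sum>s\<in>G. ?p s * e s * b s) - (\<Sum>s\<in>G. b s * ?p s) * e t"
      by (simp only: right_diff_distrib sum_subtractf sum_distrib_right sum_distrib_left mult_ac)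
    also have "(\<Sum>s\<in>G. b s * ?p s) = ?p (t + 1) - 1"
    proof -
      have "?p (t + 1) = 1 + (\<Sum>s\<in>G. if s < t + 1 then b s * ?p s else 0)"
        by (rule partial_product_expand[OF G(1)])
      also have "(\<Sum>s\<in>G. if s < t + 1 then b s * ?p s else 0) = (\<Sum>s\<in>G. b s * ?p s)"
        using Gt(2) by (intro sum.cong) force+
      finally show ?thesis by simp
    qed
    finally show ?thesis by (simp add: algebra_simps)
  qed
  have bd1: "\<bar>p * e s * b s\<bar> \<le> N * exp (C * t) * \<bar>b s\<bar>" if "\<bar>p\<bar> \<le> N" for p s
    using that eb[of s] ep[of s] N by (auto simp: abs_mult intro!: mult_right_mono mult_mono)
  have bd2: "\<bar>p * e r * \<gamma> r\<bar> \<le> N * (exp (C * t) * (C * indicator {0<..t} r))" if "\<bar>p\<bar> \<le> N" for p r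
  proof (cases "r \<in> {0<..t}")
    case True
    have "\<bar>p\<bar> * e r * \<bar>\<gamma> r\<bar> \<le> N * exp (C * t) * C"
      using that eb[of r] ep[of r] N bnd[of r] by (intro mult_mono) auto
    then show ?thesis using True ep[of r] by (simp add: abs_mult mult.assoc)
  qed (simp add: supp)
  have i1: "integrable (count_space D) (\<lambda>s. N * exp (C * t) * \<bar>b s\<bar>)" using b(1) by simp
  have i2: "integrable lborel (\<lambda>r. N * (exp (C * t) * (C * indicator {0<..t} r)))"
    using t by (intro integrable_mult_right integrable_real_indicator) auto
  have pb: "\<bar>product_before s\<bar> \<le> N" for s
    using product_before_bound[of s] product_before_pos[of s] by (simp add: N_def)
  show "integrable (count_space D) (\<lambda>s. product_before s * e s * b s)"
    by (rule Bochner_Integration.integrable_bound[OF i1]) (use bd1[OF pb] N in \<open>auto simp: AE_count_space\<close>)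
  show "integrable lborel (\<lambda>r. product_before r * e r * \<gamma> r)"
    by (rule Bochner_Integration.integrable_bound[OF i2]) (use bd2[OF pb] N C in \<open>auto simp: abs_mult\<close>)
  have ppb: "\<bar>partial_product b (G n) s\<bar> \<le> N" for n s unfolding N_def by (rule partial_product_bound[OF G(1,2)])
  have "(\<lambda>n. \<integral>s. (partial_product b (G n) s * e s * b s) * indicator (G n) s \<partial>count_space D) \<longlonglongrightarrow> (\<integral>s. product_before s * e s * b s \<partial>count_space D)"
  proof (rule integral_dominated_convergence[OF _ _ i1])
    show "AE s in count_space D. (\<lambda>n. (partial_product b (G n) s * e s * b s) * indicator (G n) s) \<longlonglongrightarrow> product_before s * e s * b s"
      unfolding AE_count_space
    proof
      fix s assume s: "s \<in> D"
      have "(\<lambda>n. indicator (G n) s :: real) \<longlonglongrightarrow> 1"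
        by (rule tendsto_eventually, rule eventually_mono[OF G(3)[OF s]]) simp
      then have "(\<lambda>n. (partial_product b (G n) s * e s * b s) * indicator (G n) s) \<longlonglongrightarrow> (product_before s * e s * b s) * 1"
        by (intro tendsto_intros partial_product_tendsto G)
      then show "(\<lambda>n. (partial_product b (G n) s * e s * b s) * indicator (G n) s) \<longlonglongrightarrow> product_before s * e s * b s" by simp
    qed
    show "AE s in count_space D. norm ((partial_product b (G n) s * e s * b s) * indicator (G n) s) \<le> N * exp (C * t) * \<bar>b s\<bar>" for n
      using bd1[OF ppb] N by (auto simp: AE_count_space split: split_indicator)
  qed auto
  then have l1: "(\<lambda>n. \<Sum>s\<in>G n. partial_product b (G n) s * e s * b s) \<longlonglongrightarrow> (\<integral>s. product_before s * e s * b s \<partial>count_space D)"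
    by (simp only: integral_count_space_indicator_finite[OF G(1,2)])
  have l2: "(\<lambda>n. \<integral>r. partial_product b (G n) r * e r * \<gamma> r \<partial>lborel) \<longlonglongrightarrow> (\<integral>r. product_before r * e r * \<gamma> r \<partial>lborel)"
  proof (rule integral_dominated_convergence[OF _ _ i2])
    show "AE r in lborel. (\<lambda>n. partial_product b (G n) r * e r * \<gamma> r) \<longlonglongrightarrow> product_before r * e r * \<gamma> r"
      by (intro AE_I2 tendsto_intros partial_product_tendsto G)
    show "AE r in lborel. norm (partial_product b (G n) r * e r * \<gamma> r) \<le> N * (exp (C * t) * (C * indicator {0<..t} r))" for n
      using bd2[OF ppb] by simp
  qed measurable
  have "(\<lambda>n. partial_product b (G n) (t + 1) * e t) \<longlonglongrightarrow> 1 + (\<integral>s. product_before s * e s * b s \<partial>count_space D) - (\<integral>r. product_before r * e r * \<gamma> r \<partial>lborel)"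
    unfolding finite_id[OF G(1,2)] by (intro tendsto_intros l1 l2)
  moreover have "(\<lambda>n. partial_product b (G n) (t + 1) * e t) \<longlonglongrightarrow> product_before (t + 1) * e t"
    by (intro tendsto_intros partial_product_tendsto G)
  ultimately show "product_before (t + 1) * e t = 1 + (\<integral>s. product_before s * e s * b s \<partial>count_space D)
      - (\<integral>r. product_before r * e r * \<gamma> r \<partial>lborel)"
    using LIMSEQ_unique by blast
qed

end

lemma SUP_indicator_Ioc:
  fixes S :: "nat \<Rightarrow> real" and c :: ennreal
  assumes S: "\<And>n. S n < s" "S \<longlonglongrightarrow> s"
  shows "(SUP n. c * indicator {0<..S n} r) = c * indicator {0<..<s} r"
proof (cases "r \<in> {0<..<s}")
  case True
  then obtain N where N: "r < S N" using order_tendstoD(1)[OF S(2), of r] by (auto dest: eventually_happens)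
  show ?thesis
  proof (rule antisym)
    show "(SUP n. c * indicator {0<..S n} r) \<le> c * indicator {0<..<s} r"
      using True by (intro SUP_least) (auto split: split_indicator)
    show "c * indicator {0<..<s} r \<le> (SUP n. c * indicator {0<..S n} r)"
      using True N by (intro SUP_upper2[of N]) auto
  qed
next
  case False
  have z: "c * indicator {0<..S n} r = 0" for n using False S(1)[of n] by (auto split: split_indicator)
  show ?thesis unfolding z using False by simp
qed

lemma incseq_indicator_Ioc:
  fixes S :: "nat \<Rightarrow> real" and c :: ennreal
  assumes "incseq S" shows "incseq (\<lambda>n. c * indicator {0<..S n} r)"
proof (rule incseq_SucI)
  fix n have "S n \<le> S (Suc n)" using assms by (simp add: incseq_SucD)
  then show "c * indicator {0<..S n} r \<le> c * indicator {0<..S (Suc n)} r" by (auto split: split_indicator)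
qed

section \<open>Predictability of sums and integrals before the current time\<close>

context class_L_process
begin

text \<open>Excluding the jump at the current time makes the sum the left limit of an adapted
  process.\<close>

lemma jump_sum_before_predictable:
  assumes K[measurable]: "K \<in> borel_measurable PredB"
  shows "(\<lambda>p. jump_sum (path (snd p)) {0<..<fst p} (\<lambda>r. K ((r, snd p), jump (path (snd p)) r))) \<in> borel_measurable Pred"
proof (rule left_limit_predictable[where Y="\<lambda>t \<omega>. jsum \<omega> {0<..t} (\<lambda>r. K ((r, \<omega>), jmp \<omega> r))" and c=0])
  show "(\<lambda>\<omega>. jsum \<omega> {0<..t} (\<lambda>r. K ((r, \<omega>), jmp \<omega> r))) \<in> borel_measurable (F t)" if "0 \<le> t" for t
    by (rule jump_sum_predictable_measurable[OF that]) auto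
  fix s :: real and \<omega> assume s: "0 < s" and \<omega>: "\<omega> \<in> space P"
  let ?f = "\<lambda>r. K ((r, \<omega>), jmp \<omega> r)"
  show "((\<lambda>r. jsum \<omega> {0<..r} ?f) \<longlongrightarrow> jump_sum (path (snd (s, \<omega>))) {0<..<fst (s, \<omega>)} (\<lambda>r. K ((r, snd (s, \<omega>)), jump (path (snd (s, \<omega>))) r))) (at_left s)"
  proof (rule tendsto_at_left_sequentially[OF s], simp)
    fix S :: "nat \<Rightarrow> real" assume S: "\<And>n. S n < s" "\<And>n. 0 < S n" "incseq S" "S \<longlonglongrightarrow> s"
    let ?U = "\<lambda>n r. ?f r * indicator {0<..S n} r"
    have "(\<lambda>n. jsum \<omega> UNIV (?U n)) \<longlonglongrightarrow> (SUP n. jsum \<omega> UNIV (?U n))"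
      using incseq_indicator_Ioc[OF S(3)] by (intro LIMSEQ_SUP) (auto simp: incseq_def intro!: jump_sum_mono)
    also have "(SUP n. jsum \<omega> UNIV (?U n)) = jsum \<omega> UNIV (\<lambda>r. SUP n. ?U n r)"
      by (rule jump_sum_SUP[symmetric]) (rule incseq_indicator_Ioc[OF S(3)])
    finally show "(\<lambda>n. jsum \<omega> {0<..S n} ?f) \<longlonglongrightarrow> jsum \<omega> {0<..<s} ?f"
      by (simp only: SUP_indicator_Ioc[OF S(1,4)] jump_sum_restrict Int_UNIV_left)
  qed
qed (simp add: jump_sum_def)

lemma time_integral_adapted:
  assumes t: "0 \<le> t" and K[measurable]: "K \<in> borel_measurable PredB"
  shows "(\<lambda>\<omega>. \<integral>\<^sup>+r. (\<integral>\<^sup>+x. K ((r, \<omega>), x) \<partial>\<nu>) * indicator {0<..t} r \<partial>lborel) \<in> borel_measurable (F t)"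
proof -
  interpret L: sigma_finite_measure \<nu> by (rule sigma_finite_levy_measure)
  note [measurable] = clamp_time_measurable[OF t]
  let ?k = "\<lambda>p. \<integral>\<^sup>+x. K (clamp_time t (snd p, fst p), x) \<partial>\<nu>"
  have "(\<lambda>p. clamp_time t (snd p, fst p)) \<in> F t \<Otimes>\<^sub>M borel \<rightarrow>\<^sub>M Pred"
    by (rule measurable_compose[OF _ clamp_time_measurable[OF t]]) measurable
  then have [measurable]: "(\<lambda>p. clamp_time t (snd p, fst p)) \<in> F t \<Otimes>\<^sub>M lborel \<rightarrow>\<^sub>M Pred"
    by (simp cong: measurable_cong_sets sets_pair_measure_cong)
  have "(\<lambda>q. K (clamp_time t (snd (fst q), fst (fst q)), snd q)) \<in> borel_measurable ((F t \<Otimes>\<^sub>M lborel) \<Otimes>\<^sub>M \<nu>)" by measurable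
  from L.borel_measurable_nn_integral_fst[OF this] have [measurable]: "?k \<in> borel_measurable (F t \<Otimes>\<^sub>M lborel)" by simp
  have "(\<lambda>p. ?k p * indicator {0<..t} (snd p)) \<in> borel_measurable (F t \<Otimes>\<^sub>M lborel)" by measurable
  from lborel.borel_measurable_nn_integral_fst[OF this]
  have "(\<lambda>\<omega>. \<integral>\<^sup>+r. ?k (\<omega>, r) * indicator {0<..t} r \<partial>lborel) \<in> borel_measurable (F t)" by simp
  also have "?this \<longleftrightarrow> ?thesis"
    by (intro measurable_cong nn_integral_cong) (auto simp: clamp_time_def split: split_indicator)
  finally show ?thesis .
qed

lemma AE_lborel_neq: "AE r in lborel. r \<noteq> (s::real)"
  by (rule AE_I'[of "{s}"]) auto

lemma inner_integral_measurable:
  assumes K[measurable]: "K \<in> borel_measurable PredB"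
  shows "(\<lambda>p. \<integral>\<^sup>+x. K (p, x) \<partial>\<nu>) \<in> borel_measurable Pred"
proof -
  interpret L: sigma_finite_measure \<nu> by (rule sigma_finite_levy_measure)
  have "K \<in> borel_measurable (Pred \<Otimes>\<^sub>M \<nu>)"
    using K by (simp cong: measurable_cong_sets sets_pair_measure_cong)
  from L.borel_measurable_nn_integral_fst[OF this] show ?thesis .
qed

lemma predictable_section_measurable:
  assumes f: "f \<in> borel_measurable Pred" and \<omega>: "\<omega> \<in> space P" and t: "0 \<le> t"
  shows "(\<lambda>r. f (min t (max 0 r), \<omega>)) \<in> borel_measurable borel"
proof -
  have "(\<lambda>r. (r, \<omega>)) \<in> borel \<rightarrow>\<^sub>M borel \<Otimes>\<^sub>M F t" using \<omega> by (intro measurable_Pair) auto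
  from measurable_compose[OF measurable_compose[OF this clamp_time_measurable[OF t]] f]
  show ?thesis by (simp add: clamp_time_def)
qed

lemma predictable_section_indicator:
  fixes f :: "real \<times> 'a \<Rightarrow> ennreal"
  assumes f: "f \<in> borel_measurable Pred" and \<omega>: "\<omega> \<in> space P" and S: "S \<in> sets borel" "S \<subseteq> {0<..t}"
  shows "(\<lambda>r. f (r, \<omega>) * indicator S r) \<in> borel_measurable borel"
proof (cases "0 \<le> t")
  case True
  have [measurable]: "(\<lambda>r. f (min t (max 0 r), \<omega>)) \<in> borel_measurable borel"
    by (rule predictable_section_measurable[OF f \<omega> True])
  have "(\<lambda>r. f (min t (max 0 r), \<omega>) * indicator S r) \<in> borel_measurable borel" using S by measurable
  also have "(\<lambda>r. f (min t (max 0 r), \<omega>) * indicator S r) = (\<lambda>r. f (r, \<omega>) * indicator S r)"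
    using S by (auto simp: fun_eq_iff split: split_indicator)
  finally show ?thesis .
next
  case False
  then have "S = {}" using S by auto
  then show ?thesis by simp
qed

text \<open>The integral over times strictly before s is again a left limit; the end point s is a
  Lebesgue null set.\<close>

lemma time_integral_predictable:
  assumes K[measurable]: "K \<in> borel_measurable PredB"
  shows "(\<lambda>p. \<integral>\<^sup>+r. (\<integral>\<^sup>+x. K ((r, snd p), x) \<partial>\<nu>) * indicator {0<..fst p} r \<partial>lborel) \<in> borel_measurable Pred"
proof (rule left_limit_predictable[where Y="\<lambda>t \<omega>. \<integral>\<^sup>+r. (\<integral>\<^sup>+x. K ((r, \<omega>), x) \<partial>\<nu>) * indicator {0<..t} r \<partial>lborel" and c=0])
  show "(\<lambda>\<omega>. \<integral>\<^sup>+r. (\<integral>\<^sup>+x. K ((r, \<omega>), x) \<partial>\<nu>) * indicator {0<..t} r \<partial>lborel) \<in> borel_measurable (F t)" if "0 \<le> t" for t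
    by (rule time_integral_adapted[OF that K])
  fix s :: real and \<omega> assume s: "0 < s" and \<omega>: "\<omega> \<in> space P"
  let ?f = "\<lambda>r. \<integral>\<^sup>+x. K ((r, \<omega>), x) \<partial>\<nu>"
  show "((\<lambda>t. \<integral>\<^sup>+r. ?f r * indicator {0<..t} r \<partial>lborel) \<longlongrightarrow> (\<integral>\<^sup>+r. (\<integral>\<^sup>+x. K ((r, snd (s, \<omega>)), x) \<partial>\<nu>) * indicator {0<..fst (s, \<omega>)} r \<partial>lborel)) (at_left s)"
  proof (rule tendsto_at_left_sequentially[OF s], simp)
    fix S :: "nat \<Rightarrow> real" assume S: "\<And>n. S n < s" "\<And>n. 0 < S n" "incseq S" "S \<longlonglongrightarrow> s"
    let ?U = "\<lambda>n r. ?f r * indicator {0<..S n} r"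
    have m: "?U n \<in> borel_measurable lborel" for n
      using predictable_section_indicator[OF inner_integral_measurable[OF K] \<omega>, of "{0<..S n}" "S n"] by simp
    have inc: "incseq ?U" using incseq_indicator_Ioc[OF S(3)] by (auto simp: incseq_def le_fun_def)
    have "(\<lambda>n. \<integral>\<^sup>+r. ?U n r \<partial>lborel) \<longlonglongrightarrow> (SUP n. \<integral>\<^sup>+r. ?U n r \<partial>lborel)"
      using inc by (intro LIMSEQ_SUP) (auto simp: incseq_def le_fun_def intro!: nn_integral_mono)
    also have "(SUP n. \<integral>\<^sup>+r. ?U n r \<partial>lborel) = (\<integral>\<^sup>+r. (SUP n. ?U n r) \<partial>lborel)"
      by (rule nn_integral_monotone_convergence_SUP[OF inc m, symmetric])
    also have "\<dots> = (\<integral>\<^sup>+r. ?f r * indicator {0<..s} r \<partial>lborel)"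
      unfolding SUP_indicator_Ioc[OF S(1,4)]
      by (rule nn_integral_cong_AE, rule eventually_mono[OF AE_lborel_neq[of s]]) (auto split: split_indicator)
    finally show "(\<lambda>n. \<integral>\<^sup>+r. ?f r * indicator {0<..S n} r \<partial>lborel) \<longlonglongrightarrow> (\<integral>\<^sup>+r. ?f r * indicator {0<..s} r \<partial>lborel)" .
  qed
qed simp

end

section \<open>The stochastic exponential\<close>

text \<open>The bounds on \<beta> hold at every sample point. The application secures this by a
  predictable truncation, which lets measurability be argued without exceptional sets.\<close>

locale jump_density = class_L_process +
  fixes \<beta> :: "(real \<times> 'a) \<times> real \<Rightarrow> real" and C :: real
  assumes \<beta>[measurable]: "\<beta> \<in> borel_measurable PredB"
    and \<beta>_gt: "\<And>p. -1 < \<beta> p"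
    and \<beta>_bound: "\<And>s \<omega>. 0 \<le> s \<Longrightarrow> \<omega> \<in> space P \<Longrightarrow> (\<integral>\<^sup>+x. ennreal \<bar>\<beta> ((s, \<omega>), x)\<bar> \<partial>\<nu>) \<le> ennreal C"
    and C: "0 \<le> C"
begin

definition \<beta>J :: "'a \<Rightarrow> real \<Rightarrow> real" where "\<beta>J \<omega> s = \<beta> ((s, \<omega>), jmp \<omega> s)"

text \<open>The iterated sums \<open>\<Sum> |\<beta>(s\<^sub>1)| \<dots> |\<beta>(s\<^sub>n)|\<close> over jump times \<open>s\<^sub>1 < \<dots> < s\<^sub>n\<close> before the given time;
  they expand the product of \<open>1 + |\<beta>|\<close>.\<close>

primrec iterated_sum :: "nat \<Rightarrow> real \<times> 'a \<Rightarrow> ennreal" where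
  "iterated_sum 0 = (\<lambda>p. 1)"
| "iterated_sum (Suc n) = (\<lambda>p. jump_sum (path (snd p)) {0<..<fst p} (\<lambda>r. iterated_sum n (r, snd p) * ennreal \<bar>\<beta>J (snd p) r\<bar>))"

lemma iterated_sum_measurable[measurable]: "iterated_sum n \<in> borel_measurable Pred"
proof (induction n)
  case (Suc n)
  note [measurable] = Suc
  have "(\<lambda>q. iterated_sum n (fst q) * ennreal \<bar>\<beta> q\<bar>) \<in> borel_measurable PredB" by measurable
  from jump_sum_before_predictable[OF this] show ?case by (simp add: \<beta>J_def)
qed simp

lemma predictable_time_measurable:
  assumes [measurable]: "f \<in> borel_measurable Pred" and s: "0 \<le> s"
  shows "(\<lambda>\<omega>. f (s, \<omega>)) \<in> borel_measurable P"
proof -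
  have "(\<lambda>\<omega>. (\<omega>, s)) \<in> P \<rightarrow>\<^sub>M P \<Otimes>\<^sub>M borel" by measurable
  from measurable_compose[OF measurable_compose[OF this clamp_time_measurable_P[OF s]] assms(1)]
  show ?thesis using s by (simp add: clamp_time_def)
qed

lemma predictable_swap:
  fixes f :: "real \<times> 'a \<Rightarrow> ennreal"
  assumes f[measurable]: "f \<in> borel_measurable Pred" and t: "0 \<le> t"
  shows "(\<integral>\<^sup>+\<omega>. \<integral>\<^sup>+s. f (s, \<omega>) * indicator {0<..t} s \<partial>lborel \<partial>P) = (\<integral>\<^sup>+s. (\<integral>\<^sup>+\<omega>. f (s, \<omega>) \<partial>P) * indicator {0<..t} s \<partial>lborel)"
proof -
  interpret pair_sigma_finite P lborel by unfold_locales
  have [measurable]: "(\<lambda>p. clamp_time t (snd p, fst p)) \<in> P \<Otimes>\<^sub>M lborel \<rightarrow>\<^sub>M Pred"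
    using clamp_time_measurable_P[OF t] by (simp cong: measurable_cong_sets sets_pair_measure_cong)
  have "(\<integral>\<^sup>+\<omega>. \<integral>\<^sup>+s. f (s, \<omega>) * indicator {0<..t} s \<partial>lborel \<partial>P)
    = (\<integral>\<^sup>+\<omega>. \<integral>\<^sup>+s. f (clamp_time t (s, \<omega>)) * indicator {0<..t} s \<partial>lborel \<partial>P)"
    by (intro nn_integral_cong) (auto simp: clamp_time_def split: split_indicator)
  also have "\<dots> = (\<integral>\<^sup>+s. \<integral>\<^sup>+\<omega>. f (clamp_time t (s, \<omega>)) * indicator {0<..t} s \<partial>P \<partial>lborel)"
    by (rule Fubini'[symmetric]) measurable
  also have "\<dots> = (\<integral>\<^sup>+s. (\<integral>\<^sup>+\<omega>. f (s, \<omega>) \<partial>P) * indicator {0<..t} s \<partial>lborel)"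
    by (intro nn_integral_cong) (auto simp: clamp_time_def split: split_indicator)
  finally show ?thesis .
qed

text \<open>The compensation formula gives E_(n+1)(t) <= C times the integral of E_n over the time
  up to t, since \<open>iterated_sum n\<close> is predictable. Induction yields the exponential
  series.\<close>

lemma iterated_sum_expectation:
  "0 \<le> t \<Longrightarrow> (\<integral>\<^sup>+\<omega>. iterated_sum n (t, \<omega>) \<partial>P) \<le> ennreal ((C * t) ^ n / fact n)"
proof (induction n arbitrary: t)
  case 0
  then show ?case by (simp add: emeasure_space_1)
next
  case (Suc n)
  have "(\<integral>\<^sup>+\<omega>. iterated_sum (Suc n) (t, \<omega>) \<partial>P) \<le> (\<integral>\<^sup>+\<omega>. jsum \<omega> {0<..t} (\<lambda>r. iterated_sum n (r, \<omega>) * ennreal \<bar>\<beta>J \<omega> r\<bar>) \<partial>P)"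
    by (simp, intro nn_integral_mono jump_sum_mono_set) auto
  also have "\<dots> = (\<integral>\<^sup>+\<omega>. \<integral>\<^sup>+s. (\<integral>\<^sup>+x. iterated_sum n (s, \<omega>) * ennreal \<bar>\<beta> ((s, \<omega>), x)\<bar> \<partial>\<nu>) * indicator {0<..t} s \<partial>lborel \<partial>P)"
    using compensation[OF Suc.prems, of "\<lambda>q. iterated_sum n (fst q) * ennreal \<bar>\<beta> q\<bar>"] by (simp add: \<beta>J_def)
  also have "\<dots> \<le> (\<integral>\<^sup>+\<omega>. \<integral>\<^sup>+s. (ennreal C * iterated_sum n (s, \<omega>)) * indicator {0<..t} s \<partial>lborel \<partial>P)"
  proof (intro nn_integral_mono)
    fix \<omega> s assume \<omega>: "\<omega> \<in> space P"
    show "(\<integral>\<^sup>+x. iterated_sum n (s, \<omega>) * ennreal \<bar>\<beta> ((s, \<omega>), x)\<bar> \<partial>\<nu>) * indicator {0<..t} s \<le> ennreal C * iterated_sum n (s, \<omega>) * indicator {0<..t} s"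
    proof (cases "s \<in> {0<..t}")
      case True
      then have s: "0 \<le> s" by simp
      have "(s, \<omega>) \<in> space Pred" using s \<omega> by (simp add: space_Pred)
      then have [measurable]: "(\<lambda>x. \<beta> ((s, \<omega>), x)) \<in> borel_measurable \<nu>"
        using measurable_compose[OF measurable_Pair1' \<beta>] by (simp cong: measurable_cong_sets)
      have "(\<integral>\<^sup>+x. iterated_sum n (s, \<omega>) * ennreal \<bar>\<beta> ((s, \<omega>), x)\<bar> \<partial>\<nu>) = iterated_sum n (s, \<omega>) * (\<integral>\<^sup>+x. ennreal \<bar>\<beta> ((s, \<omega>), x)\<bar> \<partial>\<nu>)"
        by (rule nn_integral_cmult) measurable
      also have "\<dots> \<le> iterated_sum n (s, \<omega>) * ennreal C" by (intro mult_left_mono \<beta>_bound s \<omega>) simp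
      finally show ?thesis using True by (simp add: mult.commute)
    qed simp
  qed
  also have "\<dots> = (\<integral>\<^sup>+s. (\<integral>\<^sup>+\<omega>. ennreal C * iterated_sum n (s, \<omega>) \<partial>P) * indicator {0<..t} s \<partial>lborel)"
    by (rule predictable_swap[OF _ Suc.prems]) measurable
  also have "\<dots> \<le> (\<integral>\<^sup>+s. ennreal (C ^ Suc n / fact n * s ^ n) * indicator {0..t} s \<partial>lborel)"
  proof (rule nn_integral_mono)
    fix s
    show "(\<integral>\<^sup>+\<omega>. ennreal C * iterated_sum n (s, \<omega>) \<partial>P) * indicator {0<..t} s \<le> ennreal (C ^ Suc n / fact n * s ^ n) * indicator {0..t} s"
    proof (cases "s \<in> {0<..t}")
      case True
      then have s: "0 \<le> s" by simp
      have "(\<integral>\<^sup>+\<omega>. ennreal C * iterated_sum n (s, \<omega>) \<partial>P) = ennreal C * (\<integral>\<^sup>+\<omega>. iterated_sum n (s, \<omega>) \<partial>P)"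
        by (rule nn_integral_cmult) (rule predictable_time_measurable[OF iterated_sum_measurable s])
      also have "\<dots> \<le> ennreal C * ennreal ((C * s) ^ n / fact n)" by (intro mult_left_mono Suc.IH s) simp
      also have "\<dots> = ennreal (C ^ Suc n / fact n * s ^ n)"
        using C s by (simp add: ennreal_mult[symmetric] power_mult_distrib mult_ac)
      finally show ?thesis using True by simp
    qed simp
  qed
  also have "\<dots> = ennreal (C ^ Suc n / fact n * t ^ Suc n / real (Suc n) - C ^ Suc n / fact n * 0 ^ Suc n / real (Suc n))"
  proof (rule nn_integral_FTC_Icc[where F="\<lambda>s. C ^ Suc n / fact n * s ^ Suc n / real (Suc n)"])
    show "DERIV (\<lambda>s. C ^ Suc n / fact n * s ^ Suc n / real (Suc n)) x :> C ^ Suc n / fact n * x ^ n" for x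
      by (auto intro!: derivative_eq_intros simp del: power_Suc of_nat_Suc)
    show "0 \<le> C ^ Suc n / fact n * x ^ n" if "x \<in> {0..t}" for x using C that by simp
  qed (use Suc.prems in auto)
  also have "C ^ Suc n / fact n * t ^ Suc n / real (Suc n) - C ^ Suc n / fact n * 0 ^ Suc n / real (Suc n) = (C * t) ^ Suc n / fact (Suc n)"
    by (simp add: power_mult_distrib fact_Suc field_simps del: of_nat_Suc)
  finally show ?case .
qed

text \<open>Dominates the product of 1 + |\<beta>| over jumps. Bounding its expectation term by term
  replaces a Gronwall argument, which would presuppose that the expectation is finite.\<close>

definition majorant :: "real \<times> 'a \<Rightarrow> ennreal" where "majorant p = (\<Sum>n. iterated_sum n p)"

lemma majorant_measurable[measurable]: "majorant \<in> borel_measurable Pred"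
  unfolding majorant_def[abs_def] by measurable

lemma majorant_expectation:
  assumes t: "0 \<le> t" shows "(\<integral>\<^sup>+\<omega>. majorant (t, \<omega>) \<partial>P) \<le> ennreal (exp (C * t))"
proof -
  have "(\<integral>\<^sup>+\<omega>. majorant (t, \<omega>) \<partial>P) = (\<Sum>n. \<integral>\<^sup>+\<omega>. iterated_sum n (t, \<omega>) \<partial>P)"
    unfolding majorant_def by (intro nn_integral_suminf predictable_time_measurable t) measurable
  also have "\<dots> \<le> (\<Sum>n. ennreal ((C * t) ^ n / fact n))"
    by (intro suminf_le iterated_sum_expectation t) auto
  also have "\<dots> = ennreal (exp (C * t))"
  proof (rule suminf_ennreal_eq)
    show "(\<lambda>n. (C * t) ^ n / fact n) sums exp (C * t)" using exp_converges[of "C * t"] by (simp add: divide_inverse mult.commute)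
  qed (use C t in simp)
  finally show ?thesis .
qed

lemma majorant_eq: "majorant (t, \<omega>) = 1 + jsum \<omega> {0<..<t} (\<lambda>r. majorant (r, \<omega>) * ennreal \<bar>\<beta>J \<omega> r\<bar>)"
proof -
  have "majorant (t, \<omega>) = iterated_sum 0 (t, \<omega>) + (\<Sum>n. iterated_sum (Suc n) (t, \<omega>))"
    unfolding majorant_def by (subst suminf_offset[of _ 1]) auto
  also have "(\<Sum>n. iterated_sum (Suc n) (t, \<omega>)) = jsum \<omega> {0<..<t} (\<lambda>r. majorant (r, \<omega>) * ennreal \<bar>\<beta>J \<omega> r\<bar>)"
    by (simp add: majorant_def jump_sum_suminf[symmetric] ennreal_suminf_multc)
  finally show ?thesis by simp
qed

text \<open>Expand the product by its telescoping equation: the coefficient at s is the product over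
  the earlier times of G, a set of smaller cardinality, and \<open>majorant\<close> satisfies the
  same equation over all jumps.\<close>

lemma partial_product_le_majorant:
  assumes G: "finite G" "G \<subseteq> {s\<in>{0<..<t}. 0 < jmp \<omega> s}"
  shows "ennreal (\<Prod>s\<in>G. 1 + \<bar>\<beta>J \<omega> s\<bar>) \<le> majorant (t, \<omega>)"
  using G
proof (induction "card G" arbitrary: G t rule: less_induct)
  case less
  let ?b = "\<lambda>s. \<bar>\<beta>J \<omega> s\<bar>"
  have prod_eq: "partial_product ?b G r = (\<Prod>s\<in>{s\<in>G. s < r}. 1 + ?b s)" for r
    unfolding partial_product_def using less(2) by (simp add: prod.inter_filter)
  have "(\<Prod>s\<in>G. 1 + ?b s) = partial_product ?b G t"
    unfolding prod_eq using less(3) by (intro prod.cong) auto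
  also have "\<dots> = 1 + (\<Sum>s\<in>G. if s < t then ?b s * partial_product ?b G s else 0)"
    by (rule partial_product_expand[OF less(2)])
  also have "\<dots> = 1 + (\<Sum>s\<in>G. partial_product ?b G s * ?b s)"
    using less(3) by (intro arg_cong2[where f="(+)"] sum.cong) auto
  finally have eq: "(\<Prod>s\<in>G. 1 + ?b s) = 1 + (\<Sum>s\<in>G. partial_product ?b G s * ?b s)" .
  have "ennreal (\<Prod>s\<in>G. 1 + ?b s) = 1 + (\<Sum>s\<in>G. ennreal (partial_product ?b G s) * ennreal (?b s))"
  proof -
    have nn: "0 \<le> partial_product ?b G s" for s unfolding prod_eq by (intro prod_nonneg) simp
    have "ennreal (1 + (\<Sum>s\<in>G. partial_product ?b G s * ?b s)) = 1 + (\<Sum>s\<in>G. ennreal (partial_product ?b G s * ?b s))"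
      using nn by (subst ennreal_plus) (auto simp: sum_nonneg sum_ennreal)
    also have "(\<Sum>s\<in>G. ennreal (partial_product ?b G s * ?b s)) = (\<Sum>s\<in>G. ennreal (partial_product ?b G s) * ennreal (?b s))"
      by (intro sum.cong refl ennreal_mult nn) simp
    finally show ?thesis by (simp only: eq)
  qed
  also have "\<dots> \<le> 1 + (\<Sum>s\<in>G. majorant (s, \<omega>) * ennreal (?b s))"
  proof (intro add_left_mono sum_mono mult_right_mono)
    fix s assume s: "s \<in> G"
    have "{r\<in>G. r < s} \<subset> G" using s by auto
    then have "card {r\<in>G. r < s} < card G" using less(2) by (intro psubset_card_mono)
    then show "ennreal (partial_product ?b G s) \<le> majorant (s, \<omega>)"
      unfolding prod_eq using less(2,3) by (intro less(1)) auto
  qed simp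
  also have "(\<Sum>s\<in>G. majorant (s, \<omega>) * ennreal (?b s)) = (\<integral>\<^sup>+s. (majorant (s, \<omega>) * ennreal (?b s)) * indicator G s \<partial>count_space UNIV)"
    using less(2) by (subst nn_integral_count_space'[of G]) (auto intro!: sum.cong)
  also have "\<dots> \<le> jsum \<omega> {0<..<t} (\<lambda>r. majorant (r, \<omega>) * ennreal (?b r))"
    unfolding jump_sum_def using less(3) by (intro nn_integral_mono) (auto split: split_indicator)
  finally show ?case unfolding majorant_eq[of t] by simp
qed

definition summable_jumps :: "real set \<Rightarrow> 'a \<Rightarrow> bool" where
  "summable_jumps T \<omega> \<longleftrightarrow> jsum \<omega> T (\<lambda>s. ennreal \<bar>\<beta>J \<omega> s\<bar>) < \<top>"

text \<open>The exponential of the sum of logarithms, split into two nonnegative sums that are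
  measurable for the uncompleted filtration; where the jumps are not summable the value is set to
  0.\<close>

definition jump_product_over :: "real set \<Rightarrow> 'a \<Rightarrow> real" where
  "jump_product_over T \<omega> = (if summable_jumps T \<omega>
     then exp (enn2real (jsum \<omega> T (\<lambda>s. ennreal (ln (1 + \<beta>J \<omega> s)))) - enn2real (jsum \<omega> T (\<lambda>s. ennreal (- ln (1 + \<beta>J \<omega> s)))))
     else 0)"

text \<open>As \<open>ennreal\<close> sends negative numbers to 0, the identity and
  \<open>uminus\<close> yield the integrals of the positive and the negative part of
  \<beta>.\<close>

definition rate :: "(real \<Rightarrow> real) \<Rightarrow> real \<Rightarrow> 'a \<Rightarrow> ennreal" where
  "rate f s \<omega> = (\<integral>\<^sup>+x. ennreal (f (\<beta> ((s, \<omega>), x))) \<partial>\<nu>)"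

definition total_rate :: "real \<Rightarrow> 'a \<Rightarrow> real" where
  "total_rate t \<omega> = enn2real (\<integral>\<^sup>+r. rate (\<lambda>b. b) r \<omega> * indicator {0<..t} r \<partial>lborel) - enn2real (\<integral>\<^sup>+r. rate uminus r \<omega> * indicator {0<..t} r \<partial>lborel)"

definition Z :: "real \<Rightarrow> 'a \<Rightarrow> real" where
  "Z t \<omega> = jump_product_over {0<..t} \<omega> * exp (- total_rate t \<omega>)"

text \<open>The left limit of Z: the jump at the current time is left out, which makes the process
  predictable and thus admissible in the compensation formula.\<close>

definition Z_before :: "real \<times> 'a \<Rightarrow> real" where
  "Z_before p = jump_product_over {0<..<fst p} (snd p) * exp (- total_rate (fst p) (snd p))"

lemma Z_nonneg: "0 \<le> Z t \<omega>" and Z_before_nonneg: "0 \<le> Z_before p"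
  by (auto simp: Z_def Z_before_def jump_product_over_def)

lemma Z_adapted: assumes t: "0 \<le> t" shows "Z t \<in> borel_measurable (F t)"
proof -
  have j: "(\<lambda>\<omega>. jsum \<omega> {0<..t} (\<lambda>s. ennreal (f (\<beta>J \<omega> s)))) \<in> borel_measurable (F t)"
    if [measurable]: "f \<in> borel_measurable borel" for f
    using jump_sum_predictable_measurable[OF t, of "{0<..t}" "\<lambda>q. ennreal (f (\<beta> q))"] by (simp add: \<beta>J_def)
  have r: "(\<lambda>\<omega>. \<integral>\<^sup>+r. rate f r \<omega> * indicator {0<..t} r \<partial>lborel) \<in> borel_measurable (F t)"
    if [measurable]: "f \<in> borel_measurable borel" for f
    using time_integral_adapted[OF t, of "\<lambda>q. ennreal (f (\<beta> q))"] by (simp add: rate_def)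
  note [measurable] = j[of "\<lambda>b. ln (1 + b)", simplified] j[of "\<lambda>b. - ln (1 + b)", simplified] j[of abs, simplified]
    r[of "\<lambda>b. b", simplified] r[of uminus, simplified]
  show ?thesis
    unfolding Z_def[abs_def] jump_product_over_def summable_jumps_def total_rate_def by measurable
qed

lemma Z_before_predictable[measurable]: "Z_before \<in> borel_measurable Pred"
proof -
  have j: "(\<lambda>p. jump_sum (path (snd p)) {0<..<fst p} (\<lambda>s. ennreal (f (\<beta>J (snd p) s)))) \<in> borel_measurable Pred"
    if [measurable]: "f \<in> borel_measurable borel" for f
    using jump_sum_before_predictable[of "\<lambda>q. ennreal (f (\<beta> q))"] by (simp add: \<beta>J_def)
  have r: "(\<lambda>p. \<integral>\<^sup>+r. rate f r (snd p) * indicator {0<..fst p} r \<partial>lborel) \<in> borel_measurable Pred"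
    if [measurable]: "f \<in> borel_measurable borel" for f
    using time_integral_predictable[of "\<lambda>q. ennreal (f (\<beta> q))"] by (simp add: rate_def)
  note [measurable] = j[of "\<lambda>b. ln (1 + b)", simplified] j[of "\<lambda>b. - ln (1 + b)", simplified] j[of abs, simplified]
    r[of "\<lambda>b. b", simplified] r[of uminus, simplified]
  show ?thesis
    unfolding Z_before_def[abs_def] jump_product_over_def summable_jumps_def total_rate_def by measurable
qed

text \<open>By compensation the expected sum of |\<beta>| over jumps up to t is at most C t.\<close>

lemma AE_summable_jumps:
  assumes t: "0 \<le> t" shows "AE \<omega> in P. summable_jumps {0<..t} \<omega>"
proof -
  have m: "(\<lambda>\<omega>. jsum \<omega> {0<..t} (\<lambda>s. ennreal \<bar>\<beta>J \<omega> s\<bar>)) \<in> borel_measurable P"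
    using jump_sum_measurable_P[OF t, of "\<lambda>q. ennreal \<bar>\<beta> q\<bar>"] by (simp add: \<beta>J_def)
  have "(\<integral>\<^sup>+\<omega>. jsum \<omega> {0<..t} (\<lambda>s. ennreal \<bar>\<beta>J \<omega> s\<bar>) \<partial>P)
    = (\<integral>\<^sup>+\<omega>. \<integral>\<^sup>+s. (\<integral>\<^sup>+x. ennreal \<bar>\<beta> ((s, \<omega>), x)\<bar> \<partial>\<nu>) * indicator {0<..t} s \<partial>lborel \<partial>P)"
    using compensation[OF t, of "\<lambda>q. ennreal \<bar>\<beta> q\<bar>"] by (simp add: \<beta>J_def)
  also have "\<dots> \<le> (\<integral>\<^sup>+\<omega>. \<integral>\<^sup>+s. ennreal C * indicator {0<..t} s \<partial>lborel \<partial>P)"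
    using \<beta>_bound by (intro nn_integral_mono) (auto split: split_indicator)
  also have "\<dots> < \<infinity>" using t by (simp add: nn_integral_cmult emeasure_space_1 ennreal_mult_less_top)
  finally have "AE \<omega> in P. jsum \<omega> {0<..t} (\<lambda>s. ennreal \<bar>\<beta>J \<omega> s\<bar>) \<noteq> \<infinity>"
    by (intro nn_integral_noteq_infinite[OF m]) simp
  then show ?thesis by eventually_elim (simp add: summable_jumps_def top.not_eq_extremum)
qed

section \<open>The equation of the stochastic exponential along one path\<close>

context
  fixes \<omega> assumes \<omega>: "\<omega> \<in> space P"
begin

lemma rate_section_measurable:
  assumes [measurable]: "f \<in> borel_measurable borel" and S: "S \<in> sets borel" "S \<subseteq> {0<..t}"
  shows "(\<lambda>r. rate f r \<omega> * indicator S r) \<in> borel_measurable borel"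
proof -
  have "(\<lambda>q. ennreal (f (\<beta> q))) \<in> borel_measurable PredB" by measurable
  from predictable_section_indicator[OF inner_integral_measurable[OF this] \<omega> S]
  show ?thesis by (simp add: rate_def)
qed

lemma \<beta>_section_measurable: "0 \<le> s \<Longrightarrow> (\<lambda>x. \<beta> ((s, \<omega>), x)) \<in> borel_measurable borel"
  using measurable_compose[OF measurable_Pair1' \<beta>, of "(s, \<omega>)"] \<omega> by (simp add: space_Pred)

lemma rate_sum_le: "0 \<le> s \<Longrightarrow> rate (\<lambda>b. b) s \<omega> + rate uminus s \<omega> \<le> ennreal C"
proof -
  assume s: "0 \<le> s"
  note [measurable] = \<beta>_section_measurable[OF s]
  have "rate (\<lambda>b. b) s \<omega> + rate uminus s \<omega> = (\<integral>\<^sup>+x. ennreal (\<beta> ((s, \<omega>), x)) + ennreal (- \<beta> ((s, \<omega>), x)) \<partial>\<nu>)"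
    unfolding rate_def by (rule nn_integral_add[symmetric]) measurable
  also have "\<dots> = (\<integral>\<^sup>+x. ennreal \<bar>\<beta> ((s, \<omega>), x)\<bar> \<partial>\<nu>)"
    by (intro nn_integral_cong) (auto simp: abs_if ennreal_neg)
  also have "\<dots> \<le> ennreal C" by (rule \<beta>_bound[OF s \<omega>])
  finally show ?thesis .
qed

lemma rate_le: "0 \<le> s \<Longrightarrow> rate (\<lambda>b. b) s \<omega> \<le> ennreal C" "0 \<le> s \<Longrightarrow> rate uminus s \<omega> \<le> ennreal C"
  using rate_sum_le[of s] by (auto intro: order_trans[rotated] simp: add_increasing2 add_increasing)

definition net_rate :: "real \<Rightarrow> real" where "net_rate r = enn2real (rate (\<lambda>b. b) r \<omega>) - enn2real (rate uminus r \<omega>)"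

lemma net_rate_le: assumes r: "0 \<le> r" shows "\<bar>net_rate r\<bar> \<le> C"
proof -
  have "enn2real (rate (\<lambda>b. b) r \<omega>) \<le> C" "enn2real (rate uminus r \<omega>) \<le> C"
    using rate_le[OF r] C by (auto intro: enn2real_leI)
  moreover have "0 \<le> enn2real (rate (\<lambda>b. b) r \<omega>)" "0 \<le> enn2real (rate uminus r \<omega>)" by auto
  ultimately show ?thesis unfolding net_rate_def by linarith
qed

lemma rate_real_measurable[measurable]:
  "(\<lambda>r. indicator {0<..t} r * enn2real (rate (\<lambda>b. b) r \<omega>)) \<in> borel_measurable borel"
  "(\<lambda>r. indicator {0<..t} r * enn2real (rate uminus r \<omega>)) \<in> borel_measurable borel"
proof -
  have "(\<lambda>r. enn2real (rate f r \<omega> * indicator {0<..t} r)) \<in> borel_measurable borel"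
    if [measurable]: "f \<in> borel_measurable borel" for f
    using rate_section_measurable[of f "{0<..t}" t] by measurable
  moreover have "enn2real (rate f r \<omega> * indicator {0<..t} r) = indicator {0<..t} r * enn2real (rate f r \<omega>)" for f r
    by (auto split: split_indicator)
  ultimately show "(\<lambda>r. indicator {0<..t} r * enn2real (rate (\<lambda>b. b) r \<omega>)) \<in> borel_measurable borel"
  "(\<lambda>r. indicator {0<..t} r * enn2real (rate uminus r \<omega>)) \<in> borel_measurable borel" by auto
qed

text \<open>Translates the Bochner integral of the pathwise equation into the two nonnegative
  integrals to which the compensation formula applies.\<close>

lemma weighted_rate_integral:
  assumes t: "0 \<le> t" and w[measurable]: "w \<in> borel_measurable borel" and wb: "\<And>r. 0 \<le> w r" "\<And>r. w r \<le> B"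
  shows "(\<integral>r. indicator {0<..t} r * (w r * net_rate r) \<partial>lborel)
    = enn2real (\<integral>\<^sup>+r. ennreal (w r) * rate (\<lambda>b. b) r \<omega> * indicator {0<..t} r \<partial>lborel) - enn2real (\<integral>\<^sup>+r. ennreal (w r) * rate uminus r \<omega> * indicator {0<..t} r \<partial>lborel)"
    and "(\<integral>\<^sup>+r. ennreal (w r) * rate (\<lambda>b. b) r \<omega> * indicator {0<..t} r \<partial>lborel) < \<top>"
    and "(\<integral>\<^sup>+r. ennreal (w r) * rate uminus r \<omega> * indicator {0<..t} r \<partial>lborel) < \<top>"
proof -
  have B: "0 \<le> B" using wb[of 0] by simp
  have key: "integrable lborel (\<lambda>r. w r * (indicator {0<..t} r * enn2real (rate f r \<omega>))) \<and>
    (\<integral>r. w r * (indicator {0<..t} r * enn2real (rate f r \<omega>)) \<partial>lborel) = enn2real (\<integral>\<^sup>+r. ennreal (w r) * rate f r \<omega> * indicator {0<..t} r \<partial>lborel)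
    \<and> (\<integral>\<^sup>+r. ennreal (w r) * rate f r \<omega> * indicator {0<..t} r \<partial>lborel) < \<top>"
    if m[measurable]: "(\<lambda>r. indicator {0<..t} r * enn2real (rate f r \<omega>)) \<in> borel_measurable borel"
      and le: "\<And>r. 0 \<le> r \<Longrightarrow> rate f r \<omega> \<le> ennreal C" for f
  proof -
    have eq: "ennreal (w r * (indicator {0<..t} r * enn2real (rate f r \<omega>))) = ennreal (w r) * rate f r \<omega> * indicator {0<..t} r" for r
    proof (cases "r \<in> {0<..t}")
      case True
      then have "rate f r \<omega> < \<top>" using le[of r] by (auto intro: le_less_trans)
      then show ?thesis using True wb by (simp add: ennreal_mult)
    qed simp
    have "(\<integral>\<^sup>+r. ennreal (w r) * rate f r \<omega> * indicator {0<..t} r \<partial>lborel) \<le> (\<integral>\<^sup>+r. (ennreal B * ennreal C) * indicator {0<..t} r \<partial>lborel)"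
    proof (rule nn_integral_mono)
      fix r
      show "ennreal (w r) * rate f r \<omega> * indicator {0<..t} r \<le> (ennreal B * ennreal C) * indicator {0<..t} r"
      proof (cases "r \<in> {0<..t}")
        case True
        then have "rate f r \<omega> \<le> ennreal C" by (intro le) simp
        then show ?thesis using True wb(2)[of r] by (simp add: mult_mono ennreal_leI)
      qed simp
    qed
    also have "\<dots> < \<top>" using t by (simp add: nn_integral_cmult ennreal_mult_less_top)
    finally have fin: "(\<integral>\<^sup>+r. ennreal (w r) * rate f r \<omega> * indicator {0<..t} r \<partial>lborel) < \<top>" .
    have "integrable lborel (\<lambda>r. w r * (indicator {0<..t} r * enn2real (rate f r \<omega>)))"
      using fin wb by (intro integrableI_nonneg) (auto simp: eq)
    then show ?thesis using fin wb by (simp add: integral_eq_nn_integral eq)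
  qed
  note k1 = key[OF rate_real_measurable(1) rate_le(1)] and k2 = key[OF rate_real_measurable(2) rate_le(2)]
  have "(\<integral>r. indicator {0<..t} r * (w r * net_rate r) \<partial>lborel) = (\<integral>r. w r * (indicator {0<..t} r * enn2real (rate (\<lambda>b. b) r \<omega>)) - w r * (indicator {0<..t} r * enn2real (rate uminus r \<omega>)) \<partial>lborel)"
    by (intro Bochner_Integration.integral_cong) (auto simp: net_rate_def algebra_simps)
  also have "\<dots> = (\<integral>r. w r * (indicator {0<..t} r * enn2real (rate (\<lambda>b. b) r \<omega>)) \<partial>lborel) - (\<integral>r. w r * (indicator {0<..t} r * enn2real (rate uminus r \<omega>)) \<partial>lborel)"
    using k1 k2 by (intro Bochner_Integration.integral_diff) auto
  finally show "(\<integral>r. indicator {0<..t} r * (w r * net_rate r) \<partial>lborel)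
    = enn2real (\<integral>\<^sup>+r. ennreal (w r) * rate (\<lambda>b. b) r \<omega> * indicator {0<..t} r \<partial>lborel) - enn2real (\<integral>\<^sup>+r. ennreal (w r) * rate uminus r \<omega> * indicator {0<..t} r \<partial>lborel)"
    using k1 k2 by simp
  show "(\<integral>\<^sup>+r. ennreal (w r) * rate (\<lambda>b. b) r \<omega> * indicator {0<..t} r \<partial>lborel) < \<top>"
    "(\<integral>\<^sup>+r. ennreal (w r) * rate uminus r \<omega> * indicator {0<..t} r \<partial>lborel) < \<top>" using k1 k2 by auto
qed

lemma total_rate_integral: "0 \<le> t \<Longrightarrow> total_rate t \<omega> = (\<integral>r. indicator {0<..t} r * net_rate r \<partial>lborel)"
  using weighted_rate_integral(1)[of t "\<lambda>_. 1" 1] by (simp add: total_rate_def)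

lemma net_rate_measurable[measurable]: "(\<lambda>r. indicator {0<..t} r * net_rate r) \<in> borel_measurable borel"
proof -
  have "(\<lambda>r. indicator {0<..t} r * enn2real (rate (\<lambda>b. b) r \<omega>) - indicator {0<..t} r * enn2real (rate uminus r \<omega>)) \<in> borel_measurable borel"
    by (intro borel_measurable_diff rate_real_measurable)
  then show ?thesis by (simp add: net_rate_def right_diff_distrib)
qed

lemma total_rate_bound: assumes t: "0 \<le> t" shows "\<bar>total_rate t \<omega>\<bar> \<le> C * t"
proof -
  have "\<bar>total_rate t \<omega>\<bar> \<le> (\<integral>r. \<bar>indicator {0<..t} r * net_rate r\<bar> \<partial>lborel)"
    unfolding total_rate_integral[OF t] by (rule integral_abs_bound)
  also have "\<dots> \<le> (\<integral>r. C * indicator {0<..t} r \<partial>lborel)"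
  proof (rule integral_mono)
    show i: "integrable lborel (\<lambda>r. C * indicator {0<..t} r)" using t by (intro integrable_mult_right integrable_real_indicator) auto
    show le: "\<bar>indicator {0<..t} r * net_rate r\<bar> \<le> C * indicator {0<..t} r" for r
      using net_rate_le[of r] by (auto split: split_indicator)
    show "integrable lborel (\<lambda>r. \<bar>indicator {0<..t} r * net_rate r\<bar>)"
    proof (rule integrable_abs, rule Bochner_Integration.integrable_bound[OF i])
      show "AE r in lborel. norm (indicator {0<..t} r * net_rate r) \<le> norm (C * indicator {0<..t} r)"
        using le C by (intro AE_I2) (simp add: abs_mult)
      show "(\<lambda>r. indicator {0<..t} r * net_rate r) \<in> borel_measurable lborel" using net_rate_measurable[of t] by simp
    qed
  qed
  also have "\<dots> = C * t" using t by simp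
  finally show ?thesis .
qed

lemma summable_jumps_mono: "S \<subseteq> T \<Longrightarrow> summable_jumps T \<omega> \<Longrightarrow> summable_jumps S \<omega>"
  unfolding summable_jumps_def using jump_sum_mono_set[of S T "path \<omega>"] by (rule le_less_trans)

lemma nn_integral_count_space_jumps:
  assumes "S \<subseteq> T"
  shows "(\<integral>\<^sup>+s. f s * indicator S s \<partial>count_space {s\<in>T. 0 < jmp \<omega> s}) = jsum \<omega> S f"
  using assms unfolding jump_sum_def
  by (subst nn_integral_count_space_indicator) (auto intro!: nn_integral_cong split: split_indicator)

lemma integral_count_space_jumps:
  fixes f :: "real \<Rightarrow> real"
  assumes S: "S \<subseteq> T" and f: "integrable (count_space {s\<in>T. 0 < jmp \<omega> s}) (\<lambda>s. f s * indicator S s)"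
  shows "(\<integral>s. f s * indicator S s \<partial>count_space {s\<in>T. 0 < jmp \<omega> s}) =
      enn2real (jsum \<omega> S (\<lambda>s. ennreal (f s))) - enn2real (jsum \<omega> S (\<lambda>s. ennreal (- f s)))"
    and "jsum \<omega> S (\<lambda>s. ennreal (f s)) < \<top>" and "jsum \<omega> S (\<lambda>s. ennreal (- f s)) < \<top>"
proof -
  let ?C = "count_space {s\<in>T. 0 < jmp \<omega> s}"
  have 1: "(\<integral>\<^sup>+s. ennreal (f s * indicator S s) \<partial>?C) = jsum \<omega> S (\<lambda>s. ennreal (f s))"
    unfolding nn_integral_count_space_jumps[OF S, symmetric] by (intro nn_integral_cong) (auto split: split_indicator)
  have 2: "(\<integral>\<^sup>+s. ennreal (- (f s * indicator S s)) \<partial>?C) = jsum \<omega> S (\<lambda>s. ennreal (- f s))"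
    unfolding nn_integral_count_space_jumps[OF S, symmetric] by (intro nn_integral_cong) (auto split: split_indicator)
  show "(\<integral>s. f s * indicator S s \<partial>?C) = enn2real (jsum \<omega> S (\<lambda>s. ennreal (f s))) - enn2real (jsum \<omega> S (\<lambda>s. ennreal (- f s)))"
    unfolding real_lebesgue_integral_def[OF f] 1 2 ..
  have "(\<integral>\<^sup>+s. ennreal (norm (f s * indicator S s)) \<partial>?C) < \<infinity>" using f by (simp add: integrable_iff_bounded)
  moreover have "(\<integral>\<^sup>+s. ennreal (f s * indicator S s) \<partial>?C) \<le> (\<integral>\<^sup>+s. ennreal (norm (f s * indicator S s)) \<partial>?C)"
    "(\<integral>\<^sup>+s. ennreal (- (f s * indicator S s)) \<partial>?C) \<le> (\<integral>\<^sup>+s. ennreal (norm (f s * indicator S s)) \<partial>?C)"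
    by (intro nn_integral_mono ennreal_leI; simp)+
  ultimately show "jsum \<omega> S (\<lambda>s. ennreal (f s)) < \<top>" "jsum \<omega> S (\<lambda>s. ennreal (- f s)) < \<top>"
    unfolding 1 2 by (auto intro: le_less_trans)
qed

lemma jump_product_interpretation:
  assumes T: "summable_jumps T \<omega>"
  shows "jump_product {s\<in>T. 0 < jmp \<omega> s} (\<beta>J \<omega>)"
proof
  show "countable {s\<in>T. 0 < jmp \<omega> s}"
    by (rule countable_subset[OF _ countable_jumps[OF path[OF \<omega>]]]) auto
  show "integrable (count_space {s\<in>T. 0 < jmp \<omega> s}) (\<beta>J \<omega>)"
  proof (rule integrableI_bounded)
    have "(\<integral>\<^sup>+s. ennreal (norm (\<beta>J \<omega> s)) \<partial>count_space {s\<in>T. 0 < jmp \<omega> s}) = (\<integral>\<^sup>+s. ennreal \<bar>\<beta>J \<omega> s\<bar> * indicator T s \<partial>count_space {s\<in>T. 0 < jmp \<omega> s})"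
      by (intro nn_integral_cong) simp
    then show "(\<integral>\<^sup>+s. ennreal (norm (\<beta>J \<omega> s)) \<partial>count_space {s\<in>T. 0 < jmp \<omega> s}) < \<infinity>"
      using T by (simp add: nn_integral_count_space_jumps summable_jumps_def)
  qed simp
qed (simp add: \<beta>J_def \<beta>_gt)

lemma product_before_eq:
  assumes T: "summable_jumps T \<omega>" and S: "S = T \<inter> {..<r}"
  shows "jump_product.product_before {s\<in>T. 0 < jmp \<omega> s} (\<beta>J \<omega>) r = jump_product_over S \<omega>"
proof -
  interpret jump_product "{s\<in>T. 0 < jmp \<omega> s}" "\<beta>J \<omega>" by (rule jump_product_interpretation[OF T])
  have ST: "S \<subseteq> T" using S by auto
  have e: "(\<integral>s. ln (1 + \<beta>J \<omega> s) * indicator {..<r} s \<partial>count_space {s\<in>T. 0 < jmp \<omega> s}) = (\<integral>s. ln (1 + \<beta>J \<omega> s) * indicator S s \<partial>count_space {s\<in>T. 0 < jmp \<omega> s})"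
    by (intro Bochner_Integration.integral_cong) (auto simp: S split: split_indicator)
  show ?thesis
    unfolding product_before_def e integral_count_space_jumps(1)[OF ST integrable_indicator_ln]
    using summable_jumps_mono[OF ST T] by (simp add: jump_product_over_def)
qed

lemma jump_product_le_majorant:
  "ennreal (jump_product_over {0<..<s} \<omega>) \<le> majorant (s, \<omega>)"
proof (cases "summable_jumps {0<..<s} \<omega>")
  case True
  let ?D = "{r\<in>{0<..<s}. 0 < jmp \<omega> r}"
  interpret jump_product ?D "\<beta>J \<omega>" by (rule jump_product_interpretation[OF True])
  obtain G where G: "\<And>n. finite (G n)" "\<And>n. G n \<subseteq> ?D" "\<And>r. r \<in> ?D \<Longrightarrow> \<forall>\<^sub>F n in sequentially. r \<in> G n"
    using countable_exhaustion[OF D] by blast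
  have "(\<lambda>n. ennreal (partial_product (\<beta>J \<omega>) (G n) s)) \<longlonglongrightarrow> ennreal (product_before s)"
    by (intro tendsto_ennrealI partial_product_tendsto G)
  moreover have "ennreal (partial_product (\<beta>J \<omega>) (G n) s) \<le> majorant (s, \<omega>)" for n
  proof -
    have "partial_product (\<beta>J \<omega>) (G n) s \<le> (\<Prod>r\<in>G n. 1 + \<bar>\<beta>J \<omega> r\<bar>)"
      unfolding partial_product_def
    proof (rule prod_mono)
      fix r
      have "-1 < \<beta>J \<omega> r" by (simp add: \<beta>J_def \<beta>_gt)
      then show "0 \<le> (if r < s then 1 + \<beta>J \<omega> r else 1) \<and> (if r < s then 1 + \<beta>J \<omega> r else 1) \<le> 1 + \<bar>\<beta>J \<omega> r\<bar>" by auto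
    qed
    then have "ennreal (partial_product (\<beta>J \<omega>) (G n) s) \<le> ennreal (\<Prod>r\<in>G n. 1 + \<bar>\<beta>J \<omega> r\<bar>)" by (rule ennreal_leI)
    also have "\<dots> \<le> majorant (s, \<omega>)" by (rule partial_product_le_majorant[OF G(1,2)])
    finally show ?thesis .
  qed
  ultimately have "ennreal (product_before s) \<le> majorant (s, \<omega>)"
    by (intro LIMSEQ_le_const2) auto
  moreover have "product_before s = jump_product_over {0<..<s} \<omega>" by (rule product_before_eq[OF True]) auto
  ultimately show ?thesis by simp
qed (simp add: jump_product_over_def)

lemma Z_before_le_majorant: "0 \<le> s \<Longrightarrow> s \<le> t \<Longrightarrow> ennreal (Z_before (s, \<omega>)) \<le> ennreal (exp (C * t)) * majorant (s, \<omega>)"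
proof -
  assume s: "0 \<le> s" "s \<le> t"
  have "- total_rate s \<omega> \<le> C * s" using total_rate_bound[OF s(1)] by linarith
  also have "\<dots> \<le> C * t" using s C by (intro mult_left_mono)
  finally have "exp (- total_rate s \<omega>) \<le> exp (C * t)" by simp
  then have "ennreal (Z_before (s, \<omega>)) \<le> ennreal (exp (C * t) * jump_product_over {0<..<s} \<omega>)"
    unfolding Z_before_def by (intro ennreal_leI) (auto simp: jump_product_over_def mult.commute intro!: mult_right_mono)
  also have "\<dots> = ennreal (exp (C * t)) * ennreal (jump_product_over {0<..<s} \<omega>)" by (rule ennreal_mult) (auto simp: jump_product_over_def)
  also have "\<dots> \<le> ennreal (exp (C * t)) * majorant (s, \<omega>)" by (intro mult_left_mono jump_product_le_majorant) simp
  finally show ?thesis .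
qed

abbreviation jump_part :: "(real \<Rightarrow> real) \<Rightarrow> real set \<Rightarrow> ennreal" where
  "jump_part f T \<equiv> jsum \<omega> T (\<lambda>s. ennreal (Z_before (s, \<omega>) * f (\<beta>J \<omega> s)))"

abbreviation time_part :: "(real \<Rightarrow> real) \<Rightarrow> real set \<Rightarrow> ennreal" where
  "time_part f T \<equiv> (\<integral>\<^sup>+r. ennreal (Z_before (r, \<omega>)) * rate f r \<omega> * indicator T r \<partial>lborel)"

text \<open>\<open>product_identity\<close> for this path, with \<open>net_rate\<close> as the
  integrand in time. The four nonnegative parts are shown finite separately, so their real
  differences carry no default values.\<close>

lemma Z_identity:
  assumes t: "0 \<le> t" and fin: "summable_jumps {0<..t} \<omega>"
  shows "Z t \<omega> = 1 + (enn2real (jump_part (\<lambda>b. b) {0<..t}) - enn2real (jump_part uminus {0<..t}))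
     - (enn2real (time_part (\<lambda>b. b) {0<..t}) - enn2real (time_part uminus {0<..t}))"
    and "jump_part (\<lambda>b. b) {0<..t} < \<top>" "jump_part uminus {0<..t} < \<top>" "time_part (\<lambda>b. b) {0<..t} < \<top>" "time_part uminus {0<..t} < \<top>"
proof -
  define Dt where "Dt = {s\<in>{0<..t}. 0 < jmp \<omega> s}"
  have Dt: "0 < s" "s \<le> t" if "s \<in> Dt" for s using that by (auto simp: Dt_def)
  interpret jump_product Dt "\<beta>J \<omega>" unfolding Dt_def by (rule jump_product_interpretation[OF fin])
  let ?q = "\<lambda>r. indicator {0<..t} r * net_rate r"
  define e where "e r = exp (- (\<integral>x. indicator {0<..r} x * ?q x \<partial>lborel))" for r
  have bnd: "\<bar>?q x\<bar> \<le> C" for x using net_rate_le[of x] C by (auto split: split_indicator)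
  note id = product_identity[of t ?q C, OF _ t net_rate_measurable bnd, folded e_def]
  have e_eq: "e r = exp (- total_rate r \<omega>)" if "0 \<le> r" "r \<le> t" for r
  proof -
    have "(\<integral>x. indicator {0<..r} x * ?q x \<partial>lborel) = total_rate r \<omega>"
      unfolding total_rate_integral[OF that(1)] using that by (intro Bochner_Integration.integral_cong) (auto split: split_indicator)
    then show ?thesis by (simp add: e_def)
  qed
  have pe: "product_before r * e r = Z_before (r, \<omega>)" if "0 < r" "r \<le> t" for r
  proof -
    have "product_before r = jump_product_over {0<..<r} \<omega>" using that by (intro product_before_eq[OF fin, folded Dt_def]) auto
    then show ?thesis using that by (simp add: e_eq Z_before_def)
  qed
  have pt: "product_before (t + 1) * e t = Z t \<omega>"
  proof -
    have "product_before (t + 1) = jump_product_over {0<..t} \<omega>" by (intro product_before_eq[OF fin, folded Dt_def]) auto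
    then show ?thesis using t by (simp add: e_eq Z_def)
  qed
  have i0: "integrable (count_space Dt) (\<lambda>s. product_before s * e s * \<beta>J \<omega> s)"
    by (rule id(2)) (use Dt in auto)
  have i1: "integrable (count_space Dt) (\<lambda>s. (Z_before (s, \<omega>) * \<beta>J \<omega> s) * indicator {0<..t} s)"
    by (rule Bochner_Integration.integrable_cong[THEN iffD1, OF refl _ i0]) (use Dt pe in simp)
  have s_eq: "(\<integral>s. product_before s * e s * \<beta>J \<omega> s \<partial>count_space Dt) = (\<integral>s. (Z_before (s, \<omega>) * \<beta>J \<omega> s) * indicator {0<..t} s \<partial>count_space Dt)"
    by (rule Bochner_Integration.integral_cong[OF refl]) (use Dt pe in simp)
  note J = integral_count_space_jumps[OF subset_refl i1[unfolded Dt_def], folded Dt_def]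
  show "jump_part (\<lambda>b. b) {0<..t} < \<top>" "jump_part uminus {0<..t} < \<top>" using J(2,3) by auto
  define w where "w r = product_before r * e r * indicator {0<..t} r" for r
  have em[measurable]: "e \<in> borel_measurable borel"
    unfolding e_def[abs_def] by (rule exp_integral_identity(2)[OF net_rate_measurable bnd _ t order_refl order_refl]) auto
  have eb: "e r \<le> exp (C * t)" for r
    unfolding e_def by (rule exp_integral_identity(3)[OF net_rate_measurable bnd _ t order_refl order_refl]) auto
  have wm: "w \<in> borel_measurable borel" unfolding w_def[abs_def] by measurable
  have w0: "0 \<le> w r" for r using product_before_pos[of r] by (simp add: w_def e_def)
  have wb: "w r \<le> exp (\<integral>s. \<bar>\<beta>J \<omega> s\<bar> \<partial>count_space Dt) * exp (C * t)" for r
  proof -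
    have "w r \<le> product_before r * e r" using product_before_pos[of r] by (auto simp: w_def e_def split: split_indicator)
    also have "\<dots> \<le> exp (\<integral>s. \<bar>\<beta>J \<omega> s\<bar> \<partial>count_space Dt) * exp (C * t)"
      using product_before_pos[of r] by (intro mult_mono product_before_bound eb) (auto simp: e_def)
    finally show ?thesis .
  qed
  have wZ: "ennreal (w r) * rate f r \<omega> * indicator {0<..t} r = ennreal (Z_before (r, \<omega>)) * rate f r \<omega> * indicator {0<..t} r" for f r
    using pe[of r] by (auto simp: w_def split: split_indicator)
  note K = weighted_rate_integral[OF t wm w0 wb, unfolded wZ]
  show "time_part (\<lambda>b. b) {0<..t} < \<top>" "time_part uminus {0<..t} < \<top>" by (rule K(2), rule K(3))
  have k_eq: "(\<integral>r. product_before r * e r * ?q r \<partial>lborel) = (\<integral>r. indicator {0<..t} r * (w r * net_rate r) \<partial>lborel)"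
    by (intro Bochner_Integration.integral_cong) (auto simp: w_def split: split_indicator)
  have "product_before (t + 1) * e t = 1 + (\<integral>s. product_before s * e s * \<beta>J \<omega> s \<partial>count_space Dt) - (\<integral>r. product_before r * e r * ?q r \<partial>lborel)"
    by (rule id(1)) (use Dt in auto)
  then show "Z t \<omega> = 1 + (enn2real (jump_part (\<lambda>b. b) {0<..t}) - enn2real (jump_part uminus {0<..t}))
     - (enn2real (time_part (\<lambda>b. b) {0<..t}) - enn2real (time_part uminus {0<..t}))"
    unfolding pt s_eq k_eq J(1) K(1) by simp
qed

text \<open>Arranged without subtraction, so that expectations can be taken term by term before
  anything is known to be integrable.\<close>

lemma Z_increment_identity:
  assumes u: "0 \<le> u" "u \<le> t" and fin: "summable_jumps {0<..t} \<omega>"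
  shows "ennreal (Z t \<omega>) + jump_part uminus {u<..t} + time_part (\<lambda>b. b) {u<..t} = ennreal (Z u \<omega>) + jump_part (\<lambda>b. b) {u<..t} + time_part uminus {u<..t}"
proof -
  have t: "0 \<le> t" using u by simp
  have finu: "summable_jumps {0<..u} \<omega>" using u by (intro summable_jumps_mono[OF _ fin]) auto
  note It = Z_identity[OF t fin] and Iu = Z_identity[OF u(1) finu]
  have ind: "indicator {0<..t} s = indicator {0<..u} s + (indicator {u<..t} s :: ennreal)" for s
    using u by (auto split: split_indicator)
  have J: "jump_part f {0<..t} = jump_part f {0<..u} + jump_part f {u<..t}" for f
  proof -
    have "jump_part f {0<..t} = jsum \<omega> UNIV (\<lambda>s. ennreal (Z_before (s, \<omega>) * f (\<beta>J \<omega> s)) * indicator {0<..u} s + ennreal (Z_before (s, \<omega>) * f (\<beta>J \<omega> s)) * indicator {u<..t} s)"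
      unfolding distrib_left[symmetric] ind[symmetric] by (simp add: jump_sum_restrict)
    then show ?thesis by (simp add: jump_sum_add jump_sum_restrict)
  qed
  have K: "time_part f {0<..t} = time_part f {0<..u} + time_part f {u<..t}"
    if [measurable]: "f \<in> borel_measurable borel" for f
  proof -
    have m: "(\<lambda>r. ennreal (Z_before (r, \<omega>)) * rate f r \<omega> * indicator S r) \<in> borel_measurable lborel" if S: "S \<in> sets borel" "S \<subseteq> {0<..t}" for S
    proof -
      have "(\<lambda>q. ennreal (f (\<beta> q))) \<in> borel_measurable PredB" by measurable
      note [measurable] = inner_integral_measurable[OF this]
      have "(\<lambda>p. ennreal (Z_before p) * (\<integral>\<^sup>+x. ennreal (f (\<beta> (p, x))) \<partial>\<nu>)) \<in> borel_measurable Pred" by measurable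
      from predictable_section_indicator[OF this \<omega> S] show ?thesis by (simp add: rate_def)
    qed
    show ?thesis unfolding ind distrib_left using u by (intro nn_integral_add m) auto
  qed
  define a where "a f = enn2real (jump_part f {u<..t})" for f
  define k where "k f = enn2real (time_part f {u<..t})" for f
  have le: "jump_part f {u<..t} \<le> jump_part f {0<..t}" for f using J[of f] by (simp add: add_increasing)
  have fa: "jump_part (\<lambda>b. b) {u<..t} = ennreal (a (\<lambda>b. b))" "jump_part uminus {u<..t} = ennreal (a uminus)"
    unfolding a_def using le_less_trans[OF le It(2)] le_less_trans[OF le It(3)] by auto
  have kt: "time_part (\<lambda>b. b) {u<..t} < \<top>" "time_part uminus {u<..t} < \<top>"
    using It(4,5) K[of "\<lambda>b. b"] K[of uminus] by (auto simp: less_top[symmetric])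
  have fk: "time_part (\<lambda>b. b) {u<..t} = ennreal (k (\<lambda>b. b))" "time_part uminus {u<..t} = ennreal (k uminus)"
    unfolding k_def using kt by auto
  have e1: "enn2real (jump_part (\<lambda>b. b) {0<..t}) = enn2real (jump_part (\<lambda>b. b) {0<..u}) + a (\<lambda>b. b)"
    "enn2real (jump_part uminus {0<..t}) = enn2real (jump_part uminus {0<..u}) + a uminus"
    unfolding J[of "\<lambda>b. b"] J[of uminus] a_def using Iu(2,3) le_less_trans[OF le It(2)] le_less_trans[OF le It(3)] by (auto simp: enn2real_plus)
  have e2: "enn2real (time_part (\<lambda>b. b) {0<..t}) = enn2real (time_part (\<lambda>b. b) {0<..u}) + k (\<lambda>b. b)"
    "enn2real (time_part uminus {0<..t}) = enn2real (time_part uminus {0<..u}) + k uminus"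
    using K[of "\<lambda>b. b"] K[of uminus] Iu(4,5) kt unfolding k_def by (auto simp: enn2real_plus)
  have "Z t \<omega> + a uminus + k (\<lambda>b. b) = Z u \<omega> + a (\<lambda>b. b) + k uminus"
    using It(1) Iu(1) e1 e2 by linarith
  moreover have "0 \<le> a f" "0 \<le> k f" for f by (auto simp: a_def k_def)
  ultimately show ?thesis
    unfolding fa fk using Z_nonneg by (simp add: ennreal_plus[symmetric] del: ennreal_plus)
qed

end

text \<open>The integrand consists of an indicator of a predictable rectangle, since A lies in F u,
  the predictable left limit of Z, and a function of \<beta>; the compensation formula exchanges
  jumps for time.\<close>

lemma part_expectation:
  assumes u: "0 \<le> u" "u < t" and A: "A \<in> sets (F u)" and f[measurable]: "f \<in> borel_measurable borel"
  shows "(\<integral>\<^sup>+\<omega>. indicator A \<omega> * jump_part \<omega> f {u<..t} \<partial>P) = (\<integral>\<^sup>+\<omega>. indicator A \<omega> * time_part \<omega> f {u<..t} \<partial>P)"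
proof -
  have t: "0 \<le> t" using u by simp
  have [measurable]: "{u<..t} \<times> A \<in> sets Pred" by (rule rectangle_predictable[OF u A])
  let ?K = "\<lambda>q. indicator ({u<..t} \<times> A) (fst q) * ennreal (Z_before (fst q) * f (\<beta> q))"
  have "(\<integral>\<^sup>+\<omega>. indicator A \<omega> * jump_part \<omega> f {u<..t} \<partial>P) = (\<integral>\<^sup>+\<omega>. jsum \<omega> {0<..t} (\<lambda>s. ?K ((s, \<omega>), jmp \<omega> s)) \<partial>P)"
  proof (rule nn_integral_cong)
    fix \<omega>
    have "jsum \<omega> {0<..t} (\<lambda>s. ?K ((s, \<omega>), jmp \<omega> s)) = jsum \<omega> {0<..t} (\<lambda>s. (indicator A \<omega> * ennreal (Z_before (s, \<omega>) * f (\<beta>J \<omega> s))) * indicator {u<..t} s)"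
      by (intro jump_sum_cong) (auto simp: \<beta>J_def split: split_indicator)
    also have "\<dots> = indicator A \<omega> * jump_part \<omega> f {u<..t}"
    proof -
      have "{0<..t} \<inter> {u<..t} = {u<..t}" using u by auto
      then show ?thesis by (simp only: jump_sum_restrict jump_sum_cmult)
    qed
    finally show "indicator A \<omega> * jump_part \<omega> f {u<..t} = jsum \<omega> {0<..t} (\<lambda>s. ?K ((s, \<omega>), jmp \<omega> s))" by simp
  qed
  also have "\<dots> = (\<integral>\<^sup>+\<omega>. \<integral>\<^sup>+s. (\<integral>\<^sup>+x. ?K ((s, \<omega>), x) \<partial>\<nu>) * indicator {0<..t} s \<partial>lborel \<partial>P)"
    by (rule compensation[OF t]) measurable
  also have "\<dots> = (\<integral>\<^sup>+\<omega>. indicator A \<omega> * time_part \<omega> f {u<..t} \<partial>P)"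
  proof (rule nn_integral_cong)
    fix \<omega> assume \<omega>: "\<omega> \<in> space P"
    have e: "(\<integral>\<^sup>+x. ?K ((s, \<omega>), x) \<partial>\<nu>) * indicator {0<..t} s = indicator A \<omega> * (ennreal (Z_before (s, \<omega>)) * rate f s \<omega> * indicator {u<..t} s)" for s
    proof (cases "s \<in> {u<..t}")
      case True
      then have s: "0 \<le> s" using u by simp
      note [measurable] = \<beta>_section_measurable[OF \<omega> s]
      have "(\<integral>\<^sup>+x. ?K ((s, \<omega>), x) \<partial>\<nu>) = (\<integral>\<^sup>+x. (indicator A \<omega> * ennreal (Z_before (s, \<omega>))) * ennreal (f (\<beta> ((s, \<omega>), x))) \<partial>\<nu>)"
        using True Z_before_nonneg by (intro nn_integral_cong) (auto simp: ennreal_mult'' ennreal_mult' split: split_indicator)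
      also have "\<dots> = indicator A \<omega> * ennreal (Z_before (s, \<omega>)) * rate f s \<omega>"
        unfolding rate_def by (rule nn_integral_cmult) measurable
      finally show ?thesis using True u by (simp add: mult.assoc)
    next
      case False
      have "?K ((s, \<omega>), x) * indicator {0<..t} s = 0" for x using False by (auto split: split_indicator)
      then have "indicator {0<..t} s = (0::ennreal) \<or> (\<forall>x. ?K ((s, \<omega>), x) = 0)" by (metis mult_eq_0_iff)
      then show ?thesis using False by auto
    qed
    have m: "(\<lambda>r. ennreal (Z_before (r, \<omega>)) * rate f r \<omega> * indicator {u<..t} r) \<in> borel_measurable lborel"
    proof -
      have "(\<lambda>q. ennreal (f (\<beta> q))) \<in> borel_measurable PredB" by measurable
      note [measurable] = inner_integral_measurable[OF this]
      have "(\<lambda>p. ennreal (Z_before p) * (\<integral>\<^sup>+x. ennreal (f (\<beta> (p, x))) \<partial>\<nu>)) \<in> borel_measurable Pred" by measurable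
      moreover have "{u<..t} \<subseteq> {0<..t}" using u by auto
      ultimately have "(\<lambda>r. (\<lambda>p. ennreal (Z_before p) * (\<integral>\<^sup>+x. ennreal (f (\<beta> (p, x))) \<partial>\<nu>)) (r, \<omega>) * indicator {u<..t} r) \<in> borel_measurable borel"
        using \<omega> by (intro predictable_section_indicator) auto
      then show ?thesis by (simp add: rate_def)
    qed
    show "(\<integral>\<^sup>+s. (\<integral>\<^sup>+x. ?K ((s, \<omega>), x) \<partial>\<nu>) * indicator {0<..t} s \<partial>lborel) = indicator A \<omega> * time_part \<omega> f {u<..t}"
      unfolding e by (rule nn_integral_cmult[OF m])
  qed
  finally show ?thesis .
qed

text \<open>The bound by \<open>majorant\<close> in expectation enters here; it is what separates a
  true martingale from a local one.\<close>

lemma time_part_finite: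
  assumes t: "0 \<le> t" and u: "0 \<le> u" and le: "\<And>s \<omega>. 0 \<le> s \<Longrightarrow> \<omega> \<in> space P \<Longrightarrow> rate f s \<omega> \<le> ennreal C"
  shows "(\<integral>\<^sup>+\<omega>. indicator A \<omega> * time_part \<omega> f {u<..t} \<partial>P) < \<top>"
proof -
  have "(\<integral>\<^sup>+\<omega>. indicator A \<omega> * time_part \<omega> f {u<..t} \<partial>P) \<le> (\<integral>\<^sup>+\<omega>. \<integral>\<^sup>+s. (ennreal (exp (C * t)) * majorant (s, \<omega>) * ennreal C) * indicator {0<..t} s \<partial>lborel \<partial>P)"
  proof (rule nn_integral_mono)
    fix \<omega> assume \<omega>: "\<omega> \<in> space P"
    have "indicator A \<omega> * time_part \<omega> f {u<..t} \<le> time_part \<omega> f {u<..t}" by (auto split: split_indicator)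
    also have "\<dots> \<le> (\<integral>\<^sup>+s. (ennreal (exp (C * t)) * majorant (s, \<omega>) * ennreal C) * indicator {0<..t} s \<partial>lborel)"
      using u Z_before_le_majorant[OF \<omega>] le[OF _ \<omega>]
      by (intro nn_integral_mono) (auto split: split_indicator intro!: mult_mono)
    finally show "indicator A \<omega> * time_part \<omega> f {u<..t} \<le> (\<integral>\<^sup>+s. (ennreal (exp (C * t)) * majorant (s, \<omega>) * ennreal C) * indicator {0<..t} s \<partial>lborel)" .
  qed
  also have "\<dots> = (\<integral>\<^sup>+s. (\<integral>\<^sup>+\<omega>. ennreal (exp (C * t)) * majorant (s, \<omega>) * ennreal C \<partial>P) * indicator {0<..t} s \<partial>lborel)"
    by (rule predictable_swap[OF _ t]) measurable
  also have "\<dots> \<le> (\<integral>\<^sup>+s. (ennreal (exp (C * t)) * ennreal (exp (C * t)) * ennreal C) * indicator {0<..t} s \<partial>lborel)"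
  proof (rule nn_integral_mono)
    fix s
    show "(\<integral>\<^sup>+\<omega>. ennreal (exp (C * t)) * majorant (s, \<omega>) * ennreal C \<partial>P) * indicator {0<..t} s \<le> (ennreal (exp (C * t)) * ennreal (exp (C * t)) * ennreal C) * indicator {0<..t} s"
    proof (cases "s \<in> {0<..t}")
      case True
      then have s: "0 \<le> s" "s \<le> t" by auto
      note [measurable] = predictable_time_measurable[OF majorant_measurable s(1)]
      have "(\<integral>\<^sup>+\<omega>. majorant (s, \<omega>) \<partial>P) \<le> ennreal (exp (C * s))" by (rule majorant_expectation[OF s(1)])
      also have "\<dots> \<le> ennreal (exp (C * t))" using s C by (intro ennreal_leI) (simp add: mult_left_mono)
      finally show ?thesis using True by (simp add: nn_integral_cmult nn_integral_multc mult_right_mono mult_left_mono)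
    qed simp
  qed
  also have "\<dots> < \<top>" using t by (simp add: nn_integral_cmult ennreal_mult_less_top)
  finally show ?thesis .
qed

text \<open>On both sides of the increment equation the jump parts have the expectations of the
  corresponding time parts; these are finite and cancel.\<close>

lemma Z_martingale_set:
  assumes u: "0 \<le> u" "u \<le> t" and A: "A \<in> sets (F u)"
  shows "(\<integral>\<^sup>+\<omega>. indicator A \<omega> * ennreal (Z t \<omega>) \<partial>P) = (\<integral>\<^sup>+\<omega>. indicator A \<omega> * ennreal (Z u \<omega>) \<partial>P)"
proof (cases "u = t")
  case False
  then have ut: "u < t" using u by simp
  have t: "0 \<le> t" using u by simp
  have AP[measurable]: "A \<in> sets P" using A sets_F_subset by auto
  have [measurable]: "Z t \<in> borel_measurable P" "Z u \<in> borel_measurable P"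
    using measurable_F_P[OF Z_adapted] t u by auto
  have mJ: "(\<lambda>\<omega>. jump_part \<omega> f {u<..t}) \<in> borel_measurable P" if [measurable]: "f \<in> borel_measurable borel" for f
  proof -
    have "{u<..t} \<subseteq> {0<..t}" using u by auto
    from jump_sum_predictable_measurable[OF t _ this, of "\<lambda>q. ennreal (Z_before (fst q) * f (\<beta> q))"]
    have "(\<lambda>\<omega>. jump_part \<omega> f {u<..t}) \<in> borel_measurable (F t)" by (simp add: \<beta>J_def)
    then show ?thesis by (rule measurable_F_P)
  qed
  have mK: "(\<lambda>\<omega>. time_part \<omega> f {u<..t}) \<in> borel_measurable P" if [measurable]: "f \<in> borel_measurable borel" for f
  proof -
    have r: "{u<..t} \<times> space P \<in> sets Pred" using rectangle_predictable[OF u(1) ut, of "space P"] sets.top[of "F u"] by simp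
    note [measurable] = r
    have "(\<lambda>q. indicator ({u<..t} \<times> space P) (fst q) * ennreal (Z_before (fst q)) * ennreal (f (\<beta> q))) \<in> borel_measurable PredB" by measurable
    from measurable_F_P[OF time_integral_adapted[OF t this]]
    have m: "(\<lambda>\<omega>. \<integral>\<^sup>+r. (\<integral>\<^sup>+x. indicator ({u<..t} \<times> space P) (r, \<omega>) * ennreal (Z_before (r, \<omega>)) * ennreal (f (\<beta> ((r, \<omega>), x))) \<partial>\<nu>) * indicator {0<..t} r \<partial>lborel) \<in> borel_measurable P" by simp
    show ?thesis
    proof (rule measurable_cong[THEN iffD1, OF _ m], rule nn_integral_cong)
      fix \<omega> r assume \<omega>: "\<omega> \<in> space P"
      show "(\<integral>\<^sup>+x. indicator ({u<..t} \<times> space P) (r, \<omega>) * ennreal (Z_before (r, \<omega>)) * ennreal (f (\<beta> ((r, \<omega>), x))) \<partial>\<nu>) * indicator {0<..t} r = ennreal (Z_before (r, \<omega>)) * rate f r \<omega> * indicator {u<..t} r"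
      proof (cases "r \<in> {u<..t}")
        case True
        then have "0 \<le> r" using u by simp
        note [measurable] = \<beta>_section_measurable[OF \<omega> this]
        show ?thesis using True u \<omega> unfolding rate_def by (subst nn_integral_cmult) auto
      qed (auto simp: \<omega>)
    qed
  qed
  note [measurable] = mJ[of "\<lambda>b. b", simplified] mJ[of uminus, simplified] mK[of "\<lambda>b. b", simplified] mK[of uminus, simplified]
  let ?I = "\<lambda>Y. \<integral>\<^sup>+\<omega>. indicator A \<omega> * Y \<omega> \<partial>P"
  have "?I (\<lambda>\<omega>. ennreal (Z t \<omega>) + jump_part \<omega> uminus {u<..t} + time_part \<omega> (\<lambda>b. b) {u<..t})
      = ?I (\<lambda>\<omega>. ennreal (Z u \<omega>) + jump_part \<omega> (\<lambda>b. b) {u<..t} + time_part \<omega> uminus {u<..t})"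
  proof (rule nn_integral_cong_AE, use AE_summable_jumps[OF t] AE_space[of P] in eventually_elim)
    fix \<omega> assume "summable_jumps {0<..t} \<omega>" "\<omega> \<in> space P"
    from Z_increment_identity[OF this(2) u this(1)]
    show "indicator A \<omega> * (ennreal (Z t \<omega>) + jump_part \<omega> uminus {u<..t} + time_part \<omega> (\<lambda>b. b) {u<..t})
      = indicator A \<omega> * (ennreal (Z u \<omega>) + jump_part \<omega> (\<lambda>b. b) {u<..t} + time_part \<omega> uminus {u<..t})"
      by (rule arg_cong)
  qed
  then have main: "?I (\<lambda>\<omega>. ennreal (Z t \<omega>)) + ?I (\<lambda>\<omega>. jump_part \<omega> uminus {u<..t}) + ?I (\<lambda>\<omega>. time_part \<omega> (\<lambda>b. b) {u<..t})
      = ?I (\<lambda>\<omega>. ennreal (Z u \<omega>)) + ?I (\<lambda>\<omega>. jump_part \<omega> (\<lambda>b. b) {u<..t}) + ?I (\<lambda>\<omega>. time_part \<omega> uminus {u<..t})"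
    by (simp add: distrib_left nn_integral_add)
  have parts: "?I (\<lambda>\<omega>. jump_part \<omega> (\<lambda>b. b) {u<..t}) = ?I (\<lambda>\<omega>. time_part \<omega> (\<lambda>b. b) {u<..t})"
    "?I (\<lambda>\<omega>. jump_part \<omega> uminus {u<..t}) = ?I (\<lambda>\<omega>. time_part \<omega> uminus {u<..t})"
    by (intro part_expectation u(1) ut A; simp)+
  have fin: "?I (\<lambda>\<omega>. time_part \<omega> (\<lambda>b. b) {u<..t}) < \<top>" "?I (\<lambda>\<omega>. time_part \<omega> uminus {u<..t}) < \<top>"
    using rate_le by (intro time_part_finite t u; simp)+
  have cancel: "a = b" if "a + j + k = b + k + j" "k < \<top>" "j < \<top>" for a b j k :: ennreal
  proof -
    have "(j + k) + a = (j + k) + b" using that(1) by (simp add: ac_simps)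
    then show ?thesis unfolding ennreal_add_left_cancel using that by auto
  qed
  show ?thesis by (rule cancel[OF main[unfolded parts] fin])
qed simp

text \<open>Nonnegative weights without a bound are allowed because the weight used later is the
  indicator of A times exp (k * \<Xi> u).\<close>

theorem exponential_martingale:
  assumes u: "0 \<le> u" "u \<le> t" and W: "W \<in> borel_measurable (F u)"
  shows "(\<integral>\<^sup>+\<omega>. W \<omega> * ennreal (Z t \<omega>) \<partial>P) = (\<integral>\<^sup>+\<omega>. W \<omega> * ennreal (Z u \<omega>) \<partial>P)"
proof -
  have t: "0 \<le> t" using u by simp
  have Zm[measurable]: "Z t \<in> borel_measurable P" "Z u \<in> borel_measurable P"
    using measurable_F_P[OF Z_adapted] t u by auto
  show ?thesis using W
  proof (induction rule: borel_measurable_induct)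
    case (cong f h)
    have "(\<integral>\<^sup>+\<omega>. f \<omega> * ennreal (Z s \<omega>) \<partial>P) = (\<integral>\<^sup>+\<omega>. h \<omega> * ennreal (Z s \<omega>) \<partial>P)" for s
      using cong(3) by (intro nn_integral_cong) simp
    then show ?case using cong(4) by simp
  next
    case (set A)
    then show ?case by (rule Z_martingale_set[OF u])
  next
    case (mult v c)
    have [measurable]: "v \<in> borel_measurable P" using measurable_F_P[OF mult(2)] .
    show ?case using mult(4) by (simp add: mult.assoc nn_integral_cmult)
  next
    case (add v w)
    have [measurable]: "v \<in> borel_measurable P" "w \<in> borel_measurable P" using add by (auto intro: measurable_F_P)
    show ?case using add by (simp add: distrib_right nn_integral_add)
  next
    case (seq U)
    have [measurable]: "U i \<in> borel_measurable P" for i using measurable_F_P[OF seq(1)] .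
    have e: "(\<integral>\<^sup>+\<omega>. (SUP i. U i) \<omega> * ennreal (Z s \<omega>) \<partial>P) = (SUP i. \<integral>\<^sup>+\<omega>. U i \<omega> * ennreal (Z s \<omega>) \<partial>P)"
      if [measurable]: "Z s \<in> borel_measurable P" for s
    proof -
      have "(\<integral>\<^sup>+\<omega>. (SUP i. U i) \<omega> * ennreal (Z s \<omega>) \<partial>P) = (\<integral>\<^sup>+\<omega>. (SUP i. U i \<omega> * ennreal (Z s \<omega>)) \<partial>P)"
        by (simp add: SUP_mult_right_ennreal image_comp)
      also have "\<dots> = (SUP i. \<integral>\<^sup>+\<omega>. U i \<omega> * ennreal (Z s \<omega>) \<partial>P)"
        using seq(3) by (intro nn_integral_monotone_convergence_SUP) (auto simp: incseq_def le_fun_def intro!: mult_right_mono)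
      finally show ?thesis .
    qed
    show ?case unfolding e[OF Zm(1)] e[OF Zm(2)] seq(5) ..
  qed
qed

lemma Z_zero: "\<omega> \<in> space P \<Longrightarrow> Z 0 \<omega> = 1"
  by (simp add: Z_def jump_product_over_def summable_jumps_def total_rate_def jump_sum_def)

end

text \<open>The bridge between Bochner integrals over \<open>lborel\<close> and the gauge integral,
  in which the substitution rule for injective maps is stated.\<close>

lemma lborel_integrable_iff:
  fixes f :: "real \<Rightarrow> real"
  assumes "(\<lambda>x. indicator S x * f x) \<in> borel_measurable borel"
  shows "integrable lborel (\<lambda>x. indicator S x * f x) \<longleftrightarrow> f absolutely_integrable_on S"
    and "f absolutely_integrable_on S \<Longrightarrow> (\<integral>x. indicator S x * f x \<partial>lborel) = integral S f"
proof -
  have m: "(\<lambda>x. indicator S x * f x) \<in> borel_measurable lborel" using assms by simp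
  show *: "integrable lborel (\<lambda>x. indicator S x * f x) \<longleftrightarrow> f absolutely_integrable_on S"
    unfolding set_integrable_def using integrable_completion[OF m] by simp
  assume a: "f absolutely_integrable_on S"
  have "(\<integral>x. indicator S x * f x \<partial>lborel) = (\<integral>x. indicator S x * f x \<partial>lebesgue)"
    by (rule integral_completion[OF m, symmetric])
  also have "\<dots> = integral S f"
    using set_lebesgue_integral_eq_integral(2)[OF a] by (simp add: set_lebesgue_integral_def)
  finally show "(\<integral>x. indicator S x * f x \<partial>lborel) = integral S f" .
qed

section \<open>Change of variables in the Levy density\<close>

locale hoelder_density =
  fixes f :: "real \<Rightarrow> real" and \<kappa> \<alpha> :: real
  assumes \<kappa>: "1 < \<kappa>" and \<alpha>: "0 < \<alpha>"
    and hoelder: "\<And>x y. 0 \<le> x \<Longrightarrow> 0 \<le> y \<Longrightarrow> \<bar>f x - f y\<bar> \<le> \<kappa> * \<bar>x - y\<bar> powr \<alpha>"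
    and bounds: "\<And>x. 0 \<le> x \<Longrightarrow> 1 / \<kappa> \<le> f x" "\<And>x. 0 \<le> x \<Longrightarrow> f x \<le> \<kappa>"
begin

definition primitive :: "real \<Rightarrow> real" where "primitive x = (LBINT y:{0..x}. f y)"

lemma continuous_f: "continuous_on {0..} f"
proof (rule continuous_onI)
  fix x e :: real assume x: "x \<in> {0..}" and e: "0 < e"
  \<comment> \<open>The solution of \<kappa> * d powr \<alpha> = e.\<close>
  define d where "d = (e / \<kappa>) powr (1 / \<alpha>)"
  have ek: "0 < e / \<kappa>" using e \<kappa> by simp
  have d: "0 < d" using e \<kappa> by (simp add: d_def)
  have "dist (f y) (f x) \<le> e" if y: "y \<in> {0..}" "dist y x < d" for y
  proof -
    have "\<bar>y - x\<bar> powr \<alpha> \<le> d powr \<alpha>" using y(2) \<alpha> by (intro powr_mono2) (auto simp: dist_real_def)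
    also have "d powr \<alpha> = e / \<kappa>" using e \<kappa> \<alpha> by (simp add: d_def powr_powr)
    finally have "\<kappa> * \<bar>y - x\<bar> powr \<alpha> \<le> \<kappa> * (e / \<kappa>)" using \<kappa> by (intro mult_left_mono) auto
    then show ?thesis using hoelder[of y x] x y \<kappa> by (simp add: dist_real_def)
  qed
  then show "\<exists>d>0. \<forall>y\<in>{0..}. dist y x < d \<longrightarrow> dist (f y) (f x) \<le> e" using d by blast
qed

lemma continuous_f_Icc: "continuous_on {0..x} f"
  by (rule continuous_on_subset[OF continuous_f]) auto

lemma f_pos: "0 \<le> x \<Longrightarrow> 0 < f x"
  using bounds(1)[of x] \<kappa> by (auto intro: less_le_trans[of _ "1 / \<kappa>"])

lemma primitive_eq_integral: "primitive x = integral {0..x} f"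
  unfolding primitive_def by (rule set_borel_integral_eq_integral(2)) (rule borel_integrable_atLeastAtMost'[OF continuous_f_Icc])

lemma primitive_nonpos: "x \<le> 0 \<Longrightarrow> primitive x = 0"
proof -
  assume "x \<le> 0"
  then consider "x = 0" | "{0..x} = {}" by fastforce
  then show ?thesis by cases (auto simp: primitive_eq_integral)
qed

text \<open>The interval reaches beyond x so that x = 0 is covered as a one-sided derivative and x >
  0 as an interior point.\<close>

lemma primitive_derivative:
  assumes x: "0 \<le> x" shows "(primitive has_real_derivative f x) (at x within {0..x+1})"
  using integral_has_real_derivative[OF continuous_f_Icc[of "x+1"], of x] x
  unfolding primitive_eq_integral[abs_def] by simp

lemma primitive_derivative_at: "0 < x \<Longrightarrow> (primitive has_real_derivative f x) (at x)"
proof -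
  assume x: "0 < x"
  have "at x within {0..x+1} = at x" using x by (intro at_within_interior) auto
  then show ?thesis using primitive_derivative[of x] x by simp
qed

lemma primitive_diff:
  assumes "0 \<le> x" "x \<le> y" shows "primitive y - primitive x = integral {x..y} f"
  using Henstock_Kurzweil_Integration.integral_combine[where a=0 and c=x and b=y and f=f] assms integrable_continuous_real[OF continuous_f_Icc[of y]]
  by (simp add: primitive_eq_integral)

lemma primitive_bounds:
  assumes xy: "0 \<le> x" "x \<le> y"
  shows "(y - x) / \<kappa> \<le> primitive y - primitive x" "primitive y - primitive x \<le> \<kappa> * (y - x)"
proof -
  have i: "f integrable_on {x..y}"
    using xy by (intro integrable_continuous_real continuous_on_subset[OF continuous_f]) auto
  have "integral {x..y} (\<lambda>_. 1 / \<kappa>) \<le> integral {x..y} f"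
    using xy bounds by (intro integral_le i) auto
  then show "(y - x) / \<kappa> \<le> primitive y - primitive x" using xy by (simp add: primitive_diff)
  have "integral {x..y} f \<le> integral {x..y} (\<lambda>_. \<kappa>)"
    using xy bounds by (intro integral_le i) auto
  then show "primitive y - primitive x \<le> \<kappa> * (y - x)" using xy by (simp add: primitive_diff mult.commute)
qed

lemma primitive_0: "primitive 0 = 0" by (rule primitive_nonpos) simp

lemma primitive_between: assumes "0 \<le> x" shows "x / \<kappa> \<le> primitive x" "primitive x \<le> \<kappa> * x"
  using primitive_bounds[of 0 x] assms by (auto simp: primitive_0)

lemma primitive_pos: "0 < x \<Longrightarrow> 0 < primitive x"
  using primitive_between(1)[of x] \<kappa> by (auto intro: less_le_trans[of _ "x / \<kappa>"])

lemma primitive_strict_mono: "0 \<le> x \<Longrightarrow> x < y \<Longrightarrow> primitive x < primitive y"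
proof -
  assume xy: "0 \<le> x" "x < y"
  then have "0 < (y - x) / \<kappa>" using \<kappa> by simp
  then show ?thesis using primitive_bounds(1)[of x y] xy by linarith
qed

lemma primitive_continuous: "continuous_on UNIV primitive"
proof (rule lipschitz_on_continuous_on[where L=\<kappa>], rule lipschitz_onI)
  have *: "\<bar>primitive y - primitive x\<bar> \<le> \<kappa> * (y - x)" if xy: "x \<le> y" for x y
  proof -
    have "primitive y - primitive x = primitive (max 0 y) - primitive (max 0 x)"
      by (auto simp: max_def primitive_0 primitive_nonpos)
    moreover have "0 \<le> max 0 x" "max 0 x \<le> max 0 y" "max 0 y - max 0 x \<le> y - x" using xy by auto
    moreover have "0 \<le> (max 0 y - max 0 x) / \<kappa>" using xy \<kappa> by auto
    moreover have "\<kappa> * (max 0 y - max 0 x) \<le> \<kappa> * (y - x)" using \<kappa> calculation(4) by (intro mult_left_mono) auto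
    ultimately show ?thesis using primitive_bounds[of "max 0 x" "max 0 y"] by linarith
  qed
  show "dist (primitive x) (primitive y) \<le> \<kappa> * dist x y" for x y
    using *[of x y] *[of y x] by (cases "x \<le> y") (auto simp: dist_real_def abs_minus_commute)
qed (use \<kappa> in simp)

lemma primitive_measurable[measurable]: "primitive \<in> borel_measurable borel"
  by (rule borel_measurable_continuous_onI[OF primitive_continuous])

lemma f_measurable[measurable]: "(\<lambda>x. indicator {0..} x * f x) \<in> borel_measurable borel"
  using borel_measurable_continuous_on_indicator[OF _ continuous_f] by simp

lemma f_measurable': "q \<ge> 0 \<Longrightarrow> (\<lambda>x. indicator {q<..} x * f x) \<in> borel_measurable borel"
proof -
  assume "q \<ge> 0"
  then have "(\<lambda>x. indicator {q<..} x * f x) = (\<lambda>x. indicator {q<..} x * (indicator {0..} x * f x))"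
    by (auto split: split_indicator)
  then show ?thesis by simp
qed

lemma primitive_image: assumes e: "0 \<le> q" shows "primitive ` {q<..} = {primitive q<..}"
proof (intro equalityI subsetI)
  fix y assume y: "y \<in> {primitive q<..}"
  \<comment> \<open>Since the primitive at b is at least b/\<kappa>, it is at least y, which gives
    the upper bracket for the intermediate value theorem.\<close>
  define b where "b = max q (\<kappa> * y)"
  have "primitive q < y" using y by simp
  moreover have "0 \<le> primitive q" using primitive_bounds(1)[of 0 q] e \<kappa> by (auto simp: primitive_0 intro: order_trans[rotated])
  ultimately have y0: "0 < y" by simp
  have "y = (\<kappa> * y) / \<kappa>" using \<kappa> by simp
  also have "\<dots> \<le> b / \<kappa>" using \<kappa> by (intro divide_right_mono) (auto simp: b_def)
  also have "\<dots> \<le> primitive b" using e by (intro primitive_between) (auto simp: b_def)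
  finally have "y \<le> primitive b" .
  then obtain x where x: "q \<le> x" "x \<le> b" "primitive x = y"
    using IVT'[of primitive q y b] y by (auto simp: b_def intro: continuous_on_subset[OF primitive_continuous])
  then have "q < x" using y by (cases "x = q") auto
  then show "y \<in> primitive ` {q<..}" using x by auto
qed (use e primitive_strict_mono in auto)

text \<open>The substitution y = \<open>primitive x\<close>, injective on the half-line because its
  derivative is bounded below by 1/\<kappa>. A start q > 0 keeps away from the singularity at
  0.\<close>

lemma change_of_variables:
  assumes e: "0 \<le> q" and F[measurable]: "F \<in> borel_measurable borel"
    and i: "integrable lborel (\<lambda>y. indicator {primitive q<..} y * F y)"
  shows "integrable lborel (\<lambda>x. indicator {q<..} x * (f x * F (primitive x)))"
    and "(\<integral>x. indicator {q<..} x * (f x * F (primitive x)) \<partial>lborel) = (\<integral>y. indicator {primitive q<..} y * F y \<partial>lborel)"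
proof -
  let ?S = "{q<..}"
  have m1: "(\<lambda>y. indicator {primitive q<..} y * F y) \<in> borel_measurable borel" by measurable
  have m2: "(\<lambda>x. indicator ?S x * (\<bar>f x\<bar> * F (primitive x))) \<in> borel_measurable borel"
  proof -
    note [measurable] = f_measurable'[OF e]
    have "(\<lambda>x. \<bar>indicator ?S x * f x\<bar> * F (primitive x)) \<in> borel_measurable borel" by measurable
    also have "(\<lambda>x. \<bar>indicator ?S x * f x\<bar> * F (primitive x)) = (\<lambda>x. indicator ?S x * (\<bar>f x\<bar> * F (primitive x)))"
      by (auto simp: abs_mult)
    finally show ?thesis .
  qed
  have abs: "indicator ?S x * (\<bar>f x\<bar> * F (primitive x)) = indicator ?S x * (f x * F (primitive x))" for x
    using f_pos[of x] e by (auto split: split_indicator)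
  have "F absolutely_integrable_on (primitive ` ?S)"
    using i unfolding lborel_integrable_iff(1)[OF m1] primitive_image[OF e] .
  moreover have "inj_on primitive ?S"
    using primitive_strict_mono e by (intro linorder_inj_onI) (auto simp: less_le)
  moreover have "(primitive has_field_derivative f x) (at x within ?S)" if "x \<in> ?S" for x
    using that e by (intro DERIV_subset[OF primitive_derivative_at]) auto
  ultimately have cv: "(\<lambda>x. \<bar>f x\<bar> * F (primitive x)) absolutely_integrable_on ?S"
    "integral ?S (\<lambda>x. \<bar>f x\<bar> * F (primitive x)) = integral (primitive ` ?S) F"
    using has_absolute_integral_change_of_variables_1'[of ?S primitive f F "integral (primitive ` ?S) F"] by auto
  show "integrable lborel (\<lambda>x. indicator ?S x * (f x * F (primitive x)))"
    using cv(1) lborel_integrable_iff(1)[OF m2] by (simp add: abs)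
  have "(\<integral>x. indicator ?S x * (\<bar>f x\<bar> * F (primitive x)) \<partial>lborel) = integral ?S (\<lambda>x. \<bar>f x\<bar> * F (primitive x))"
    by (rule lborel_integrable_iff(2)[OF m2 cv(1)])
  also have "\<dots> = (\<integral>y. indicator {primitive q<..} y * F y \<partial>lborel)"
    unfolding cv(2) primitive_image[OF e]
    using i by (intro lborel_integrable_iff(2)[symmetric] m1) (simp add: lborel_integrable_iff(1)[OF m1])
  finally show "(\<integral>x. indicator {q<..} x * (f x * F (primitive x)) \<partial>lborel) = (\<integral>y. indicator {primitive q<..} y * F y \<partial>lborel)"
    by (simp add: abs)
qed

text \<open>The numerator x f(x) - H(x), with H the primitive, is the integral of f(x) - f(y) over y
  from 0 to x, at most \<kappa> x^(\<alpha>+1) by the Hoelder bound; the denominator x H(x) is at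
  least x^2/\<kappa>. The exponent \<alpha> - 1 is integrable at 0.\<close>

lemma slope_error:
  assumes x: "0 < x" shows "\<bar>f x / primitive x - 1 / x\<bar> \<le> \<kappa>^2 * x powr (\<alpha> - 1)"
proof -
  have H: "0 < primitive x" "x / \<kappa> \<le> primitive x" using primitive_pos[OF x] primitive_between[of x] x by auto
  have i: "f integrable_on {0..x}" by (intro integrable_continuous_real continuous_f_Icc)
  have "x * f x - primitive x = integral {0..x} (\<lambda>y. f x - f y)"
    using x i by (subst Henstock_Kurzweil_Integration.integral_diff) (auto simp: primitive_eq_integral)
  also have "norm \<dots> \<le> (\<kappa> * x powr \<alpha>) * (x - 0)"
  proof (rule integral_bound)
    show "continuous_on {0..x} (\<lambda>y. f x - f y)" by (intro continuous_intros continuous_f_Icc)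
    fix y assume y: "y \<in> {0..x}"
    have "norm (f x - f y) \<le> \<kappa> * \<bar>x - y\<bar> powr \<alpha>" using hoelder[of x y] x y by simp
    also have "\<dots> \<le> \<kappa> * x powr \<alpha>" using y \<kappa> \<alpha> by (intro mult_left_mono powr_mono2) auto
    finally show "norm (f x - f y) \<le> \<kappa> * x powr \<alpha>" .
  qed (use x in simp)
  finally have num: "\<bar>x * f x - primitive x\<bar> \<le> \<kappa> * x powr \<alpha> * x" by simp
  have "f x / primitive x - 1 / x = (x * f x - primitive x) / (x * primitive x)"
    using x H by (simp add: field_simps)
  then have "\<bar>f x / primitive x - 1 / x\<bar> = \<bar>x * f x - primitive x\<bar> / (x * primitive x)"
    using x H by (simp add: abs_mult)
  also have "\<dots> \<le> (\<kappa> * x powr \<alpha> * x) / (x * (x / \<kappa>))"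
    using num x H \<kappa> by (intro frac_le mult_left_mono mult_pos_pos) auto
  also have "\<dots> = \<kappa>^2 * x powr (\<alpha> - 1)"
    using x \<kappa> by (simp add: powr_diff power2_eq_square field_simps)
  finally show ?thesis .
qed

lemma primitive_slope_0: "(\<lambda>n. primitive (1 / real (Suc n)) / (1 / real (Suc n))) \<longlonglongrightarrow> f 0"
proof -
  have "((\<lambda>y. (primitive y - primitive 0) / (y - 0)) \<longlongrightarrow> f 0) (at 0 within {0..0+1})"
    using primitive_derivative[of 0] by (simp add: has_field_derivative_iff)
  moreover have "filterlim (\<lambda>n. 1 / real (Suc n)) (at 0 within {0..0+1}) sequentially"
    using LIMSEQ_inverse_real_of_nat unfolding filterlim_at by (auto simp: inverse_eq_divide intro!: always_eventually)
  ultimately show ?thesis using filterlim_compose by (fastforce simp: primitive_0)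
qed

end

section \<open>Tails of the Levy density near the origin\<close>

context class_L_process
begin

abbreviation levy_density :: "real \<Rightarrow> real" where "levy_density x \<equiv> indicator {0<..} x * g x"

lemma levy_density_nonneg: "0 \<le> levy_density x"
  using g_pos[of x] by (auto split: split_indicator)

lemma integrable_levy_iff:
  assumes [measurable]: "\<phi> \<in> borel_measurable borel"
  shows "integrable \<nu> \<phi> \<longleftrightarrow> integrable lborel (\<lambda>x. levy_density x * \<phi> x)"
    and "(\<integral>x. \<phi> x \<partial>\<nu>) = (\<integral>x. levy_density x * \<phi> x \<partial>lborel)"
  unfolding \<nu>_def using levy_density_nonneg
  by (subst integrable_density integral_density; simp add: real_scaleR_def)+

text \<open>Beyond c the function 1 - exp (- x), which is \<nu>-integrable, is bounded below by 1 -
  exp (- c).\<close>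

lemma levy_density_tail: "0 < c \<Longrightarrow> integrable lborel (\<lambda>x. indicator {c<..} x * levy_density x)"
proof -
  assume c: "0 < c"
  have i: "integrable lborel (\<lambda>x. levy_density x * (1 - exp (- 1 * x)))"
    by (rule integrable_levy_iff(1)[THEN iffD1, OF _ integrable_levy]) auto
  show ?thesis
  proof (rule Bochner_Integration.integrable_bound[OF integrable_mult_right[OF i, of "1 / (1 - exp (- c))"]])
    have d: "0 < 1 - exp (- c)" using c by simp
    show "AE x in lborel. norm (indicator {c<..} x * levy_density x) \<le> norm (1 / (1 - exp (- c)) * (levy_density x * (1 - exp (- 1 * x))))"
    proof (rule AE_I2)
      fix x
      show "norm (indicator {c<..} x * levy_density x) \<le> norm (1 / (1 - exp (- c)) * (levy_density x * (1 - exp (- 1 * x))))"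
      proof (cases "c < x")
        case True
        have "1 \<le> (1 - exp (- x)) / (1 - exp (- c))" using True d by simp
        then have "levy_density x * 1 \<le> levy_density x * ((1 - exp (- x)) / (1 - exp (- c)))"
          using levy_density_nonneg[of x] by (intro mult_left_mono)
        then show ?thesis using True c levy_density_nonneg[of x] by simp
      qed simp
    qed
  qed measurable
qed

text \<open>A fixed version of the integrable remainder, recovered from g and extended by 0, in
  place of the existentially quantified one.\<close>

definition zeta :: "real \<Rightarrow> real" where
  "zeta x = indicator {0<..1} x * (g x - g0 / x)"

lemma zeta_integrable: "integrable lborel zeta" and g_split: "0 < x \<Longrightarrow> x \<le> 1 \<Longrightarrow> g x = g0 / x + zeta x"
  and g0_nonneg: "0 \<le> g0"
proof -
  show "0 \<le> g0" using class_L by (simp add: class_L_def)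
  show "0 < x \<Longrightarrow> x \<le> 1 \<Longrightarrow> g x = g0 / x + zeta x" by (simp add: zeta_def)
  obtain \<zeta> where z: "set_integrable lborel {0..1} \<zeta>" "\<And>x. x \<in> {0<..1} \<Longrightarrow> g x = g0 / x + \<zeta> x"
    using class_L unfolding class_L_def by blast
  have "set_integrable lborel {0<..1} \<zeta>" by (rule set_integrable_subset[OF z(1)]) auto
  then have i: "integrable lborel (\<lambda>x. indicator {0<..1} x * \<zeta> x)" by (simp add: set_integrable_def)
  have e: "zeta = (\<lambda>x. indicator {0<..1} x * \<zeta> x)" using z(2) by (auto simp: zeta_def fun_eq_iff split: split_indicator)
  show "integrable lborel zeta" unfolding e by (rule i)
qed

lemma zeta_measurable[measurable]: "zeta \<in> borel_measurable borel"
  using borel_measurable_integrable[OF zeta_integrable] by simp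

definition tail :: "real \<Rightarrow> real" where "tail a = (\<integral>x. indicator {a<..} x * levy_density x \<partial>lborel)"

definition zeta_mass :: "real \<Rightarrow> real" where "zeta_mass a = (\<integral>x. indicator {0<..a} x * zeta x \<partial>lborel)"

lemma integrable_indicator_zeta: "S \<in> sets borel \<Longrightarrow> integrable lborel (\<lambda>x. indicator S x * zeta x)"
  using integrable_mult_indicator[OF _ zeta_integrable] by simp

text \<open>Integrates g between a and b: g0/x gives the logarithm and \<open>zeta\<close> the
  remainder. The identity is antisymmetric under exchange of a and b, so a <= b may be
  assumed.\<close>

lemma tail_diff:
  assumes a: "0 < a" "a \<le> 1" and b: "0 < b" "b \<le> 1"
  shows "tail a - tail b = g0 * (ln b - ln a) + zeta_mass b - zeta_mass a"
  using a b
proof (induction a b rule: linorder_wlog)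
  case (sym a b)
  then show ?case by (simp add: algebra_simps)
next
  case (le a b)
  have h: "has_bochner_integral lborel (\<lambda>x. (g0 / x) * indicator {a..b} x) (g0 * ln b - g0 * ln a)"
  proof (rule has_bochner_integral_FTC_Icc_nonneg)
    show "((\<lambda>x. g0 * ln x) has_real_derivative g0 / x) (at x)" if "x \<in> {a..b}" for x
      using that le by (auto intro!: derivative_eq_intros)
    show "0 \<le> g0 / x" if "x \<in> {a..b}" for x using that le g0_nonneg by auto
  qed (use le in auto)
  have "tail a - tail b = (\<integral>x. indicator {a<..} x * levy_density x - indicator {b<..} x * levy_density x \<partial>lborel)"
    unfolding tail_def using le by (intro Bochner_Integration.integral_diff[symmetric] levy_density_tail)
  also have "\<dots> = (\<integral>x. (g0 / x) * indicator {a..b} x + indicator {a<..b} x * zeta x \<partial>lborel)"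
  proof (rule integral_cong_AE)
    show "AE x in lborel. indicator {a<..} x * levy_density x - indicator {b<..} x * levy_density x = (g0 / x) * indicator {a..b} x + indicator {a<..b} x * zeta x"
      using AE_lborel_neq[of a]
    proof eventually_elim
      fix x assume "x \<noteq> a"
      then show "indicator {a<..} x * levy_density x - indicator {b<..} x * levy_density x = (g0 / x) * indicator {a..b} x + indicator {a<..b} x * zeta x"
        using le g_split[of x] by (auto simp: not_less split: split_indicator)
    qed
  qed measurable
  also have "\<dots> = (g0 * ln b - g0 * ln a) + (\<integral>x. indicator {a<..b} x * zeta x \<partial>lborel)"
    using h by (subst Bochner_Integration.integral_add) (auto simp: has_bochner_integral_iff intro!: integrable_indicator_zeta)
  also have "(\<integral>x. indicator {a<..b} x * zeta x \<partial>lborel) = (\<integral>x. indicator {0<..b} x * zeta x - indicator {0<..a} x * zeta x \<partial>lborel)"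
    using le by (intro Bochner_Integration.integral_cong) (auto split: split_indicator)
  also have "\<dots> = zeta_mass b - zeta_mass a"
    unfolding zeta_mass_def by (intro Bochner_Integration.integral_diff integrable_indicator_zeta) auto
  finally show ?case by (simp add: algebra_simps)
qed

lemma zeta_mass_tendsto_0:
  assumes a: "a \<longlonglongrightarrow> 0" shows "(\<lambda>n. zeta_mass (a n)) \<longlonglongrightarrow> 0"
proof -
  have "(\<lambda>n. \<integral>x. indicator {0<..a n} x * zeta x \<partial>lborel) \<longlonglongrightarrow> (\<integral>x. 0 \<partial>(lborel :: real measure))"
  proof (rule integral_dominated_convergence[where w="\<lambda>x. \<bar>zeta x\<bar>"])
    show "integrable lborel (\<lambda>x. \<bar>zeta x\<bar>)" by (intro integrable_abs zeta_integrable)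
    show "AE x in lborel. (\<lambda>n. indicator {0<..a n} x * zeta x) \<longlonglongrightarrow> 0"
    proof (intro AE_I2)
      fix x :: real
      show "(\<lambda>n. indicator {0<..a n} x * zeta x) \<longlonglongrightarrow> 0"
      proof (cases "0 < x")
        case True
        have "\<forall>\<^sub>F n in sequentially. a n < x" using order_tendstoD(2)[OF a True] .
        then have "\<forall>\<^sub>F n in sequentially. indicator {0<..a n} x * zeta x = 0" by eventually_elim auto
        then show ?thesis by (rule tendsto_eventually)
      qed simp
    qed
    show "AE x in lborel. norm (indicator {0<..a n} x * zeta x) \<le> \<bar>zeta x\<bar>" for n
      by (intro AE_I2) (auto split: split_indicator)
  qed measurable
  then show ?thesis by (simp add: zeta_mass_def)
qed

text \<open>A bound on the integral of |gap| that is independent of f, hence uniform in time and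
  sample point. The first term integrates the slope error up to 1/\<kappa>; |zeta| occurs once at x
  and once at \<open>primitive x\<close>; each of the two densities adds a tail, and both tails
  start at 1/\<kappa>^2 or later.\<close>

definition cost :: "real \<Rightarrow> real \<Rightarrow> real" where
  "cost \<kappa> \<alpha> = g0 * \<kappa>^2 / \<alpha> + 2 * (\<integral>x. \<bar>zeta x\<bar> \<partial>lborel) + 2 * tail (1 / \<kappa>^2)"

end

section \<open>Integrating the tilted density against the Levy measure\<close>

locale tilt = class_L_process + hoelder_density
begin

text \<open>Lebesgue density of the signed measure (f g(H)/g - 1) d\<nu>, where H is
  \<open>primitive\<close>: the pull-back of \<nu> under H minus \<nu> itself.\<close>

definition gap :: "real \<Rightarrow> real" where
  "gap x = indicator {0<..} x * (f x * levy_density (primitive x) - levy_density x)"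

lemma gap_measurable[measurable]: "gap \<in> borel_measurable borel"
proof -
  note [measurable] = f_measurable'[of 0, simplified]
  have "(\<lambda>x. (indicator {0<..} x * f x) * levy_density (primitive x) - indicator {0<..} x * levy_density x) \<in> borel_measurable borel" by measurable
  then show ?thesis by (simp add: gap_def[abs_def] algebra_simps)
qed

lemma gap_integrable: "integrable lborel gap" and gap_cost: "(\<integral>x. \<bar>gap x\<bar> \<partial>lborel) \<le> cost \<kappa> \<alpha>"
proof -
  \<comment> \<open>For x up to 1/\<kappa> both x and \<open>primitive x\<close> are at most 1, so
    the decomposition of g applies to both.\<close>
  define \<delta> where "\<delta> = 1 / \<kappa>"
  have \<delta>: "0 < \<delta>" "\<delta> < 1" using \<kappa> by (auto simp: \<delta>_def)
  define d1 where "d1 x = g0 * \<kappa>^2 * (indicator {0<..\<delta>} x * x powr (\<alpha> - 1))" for x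
  define d2 where "d2 x = indicator {0<..} x * (f x * \<bar>zeta (primitive x)\<bar>)" for x
  define d3 where "d3 x = \<bar>zeta x\<bar>" for x
  define d4 where "d4 x = indicator {\<delta><..} x * (f x * levy_density (primitive x))" for x
  define d5 where "d5 x = indicator {\<delta><..} x * levy_density x" for x
  have P\<delta>: "1 / \<kappa>^2 \<le> primitive \<delta>" using primitive_between(1)[of \<delta>] \<delta> by (simp add: \<delta>_def power2_eq_square)
  have \<kappa>2: "0 < 1 / \<kappa>^2" using \<kappa> by simp
  have i1: "integrable lborel d1" and v1: "(\<integral>x. d1 x \<partial>lborel) \<le> g0 * \<kappa>^2 / \<alpha>"
  proof -
    have hi: "((\<lambda>x. x powr (\<alpha> - 1)) has_integral (\<delta> powr (\<alpha> - 1 + 1) / (\<alpha> - 1 + 1))) {0..\<delta>}"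
      using \<alpha> \<delta> by (intro has_integral_powr_from_0) auto
    have ai: "(\<lambda>x. x powr (\<alpha> - 1)) absolutely_integrable_on {0..\<delta>}"
      using hi by (intro nonnegative_absolutely_integrable_1) (auto simp: integrable_on_def)
    have m: "(\<lambda>x. indicator {0..\<delta>} x * x powr (\<alpha> - 1)) \<in> borel_measurable borel" by measurable
    have i: "integrable lborel (\<lambda>x. indicator {0..\<delta>} x * x powr (\<alpha> - 1))"
      using ai by (simp add: lborel_integrable_iff(1)[OF m])
    have v: "(\<integral>x. indicator {0..\<delta>} x * x powr (\<alpha> - 1) \<partial>lborel) = \<delta> powr \<alpha> / \<alpha>"
      using lborel_integrable_iff(2)[OF m ai] integral_unique[OF hi] by simp
    have e: "d1 = (\<lambda>x. g0 * \<kappa>^2 * (indicator {0..\<delta>} x * x powr (\<alpha> - 1)))"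
      by (auto simp: d1_def fun_eq_iff split: split_indicator)
    show "integrable lborel d1" unfolding e by (intro integrable_mult_right i)
    have "\<delta> powr \<alpha> \<le> 1" using \<delta> \<alpha> by (intro powr_le1) auto
    then have "\<delta> powr \<alpha> / \<alpha> \<le> 1 / \<alpha>" using \<alpha> by (intro divide_right_mono) auto
    then have "g0 * \<kappa>^2 * (\<delta> powr \<alpha> / \<alpha>) \<le> g0 * \<kappa>^2 * (1 / \<alpha>)" using g0_nonneg by (intro mult_left_mono) auto
    then show "(\<integral>x. d1 x \<partial>lborel) \<le> g0 * \<kappa>^2 / \<alpha>" unfolding e using v by simp
  qed
  have i2: "integrable lborel d2" and v2: "(\<integral>x. d2 x \<partial>lborel) = (\<integral>x. \<bar>zeta x\<bar> \<partial>lborel)"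
  proof -
    have z: "(\<lambda>y. indicator {primitive 0<..} y * \<bar>zeta y\<bar>) = (\<lambda>y. \<bar>zeta y\<bar>)"
      by (auto simp: primitive_0 zeta_def fun_eq_iff split: split_indicator)
    have "integrable lborel (\<lambda>y. indicator {primitive 0<..} y * \<bar>zeta y\<bar>)"
      unfolding z by (intro integrable_abs zeta_integrable)
    from change_of_variables[OF order_refl _ this] show "integrable lborel d2" "(\<integral>x. d2 x \<partial>lborel) = (\<integral>x. \<bar>zeta x\<bar> \<partial>lborel)"
      unfolding z d2_def[abs_def] by auto
  qed
  have i3: "integrable lborel d3" unfolding d3_def[abs_def] by (intro integrable_abs zeta_integrable)
  have tail_mono: "tail b \<le> tail a" if "0 < a" "a \<le> b" for a b
    unfolding tail_def using that
    by (intro integral_mono levy_density_tail mult_right_mono levy_density_nonneg) (auto split: split_indicator)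
  have i4: "integrable lborel d4" and v4: "(\<integral>x. d4 x \<partial>lborel) \<le> tail (1 / \<kappa>^2)"
  proof -
    have i: "integrable lborel (\<lambda>y. indicator {primitive \<delta><..} y * levy_density y)"
      by (intro levy_density_tail primitive_pos \<delta>)
    from change_of_variables[OF _ _ this] \<delta> show "integrable lborel d4" unfolding d4_def[abs_def] by auto
    have "(\<integral>x. d4 x \<partial>lborel) = tail (primitive \<delta>)"
      unfolding d4_def tail_def using \<delta> by (intro change_of_variables[OF _ _ i]) auto
    then show "(\<integral>x. d4 x \<partial>lborel) \<le> tail (1 / \<kappa>^2)" using tail_mono[OF \<kappa>2 P\<delta>] by simp
  qed
  have i5: "integrable lborel d5" and v5: "(\<integral>x. d5 x \<partial>lborel) \<le> tail (1 / \<kappa>^2)"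
  proof -
    show "integrable lborel d5" unfolding d5_def[abs_def] by (intro levy_density_tail \<delta>)
    have "1 / \<kappa>^2 \<le> \<delta>" using \<kappa> by (simp add: \<delta>_def power2_eq_square field_simps)
    then show "(\<integral>x. d5 x \<partial>lborel) \<le> tail (1 / \<kappa>^2)" using tail_mono[OF \<kappa>2] by (simp add: d5_def tail_def)
  qed
  have le: "\<bar>gap x\<bar> \<le> d1 x + d2 x + d3 x + d4 x + d5 x" for x
  proof -
    have nn: "0 \<le> d1 x" "0 \<le> d2 x" "0 \<le> d3 x" "0 \<le> d4 x" "0 \<le> d5 x"
    proof -
      have fx: "0 \<le> f x" if "0 < x" using f_pos[of x] that by simp
      show "0 \<le> d1 x" using g0_nonneg by (simp add: d1_def)
      show "0 \<le> d2 x" using fx by (cases "0 < x") (simp_all add: d2_def)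
      show "0 \<le> d3 x" by (simp add: d3_def)
      show "0 \<le> d4 x"
      proof (cases "\<delta> < x")
        case True
        then have "0 \<le> f x * levy_density (primitive x)" using \<delta> by (intro mult_nonneg_nonneg[OF fx levy_density_nonneg]) simp
        then show ?thesis using True by (simp add: d4_def)
      qed (simp add: d4_def)
      show "0 \<le> d5 x" unfolding d5_def by (intro mult_nonneg_nonneg levy_density_nonneg) simp
    qed
    consider "x \<le> 0" | "0 < x" "x \<le> \<delta>" | "\<delta> < x" by linarith
    then show ?thesis
    proof cases
      case 1 then show ?thesis using nn by (simp add: gap_def)
    next
      case 2
      have H: "0 < primitive x" "primitive x \<le> 1"
      proof -
        show "0 < primitive x" using 2 by (intro primitive_pos)
        have "primitive x \<le> \<kappa> * x" using 2 by (intro primitive_between) simp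
        also have "\<dots> \<le> \<kappa> * \<delta>" using 2 \<kappa> by (intro mult_left_mono) auto
        finally show "primitive x \<le> 1" using \<kappa> by (simp add: \<delta>_def)
      qed
      have abs_triangle3: "\<bar>a + b - c\<bar> \<le> \<bar>a\<bar> + \<bar>b\<bar> + \<bar>c\<bar>" for a b c :: real by linarith
      have "gap x = g0 * (f x / primitive x - 1 / x) + f x * zeta (primitive x) - zeta x"
        using 2 H \<delta> g_split[of x] g_split[of "primitive x"] by (simp add: gap_def algebra_simps)
      then have "\<bar>gap x\<bar> \<le> \<bar>g0 * (f x / primitive x - 1 / x)\<bar> + \<bar>f x * zeta (primitive x)\<bar> + \<bar>zeta x\<bar>"
        using abs_triangle3 by simp
      also have "\<bar>g0 * (f x / primitive x - 1 / x)\<bar> \<le> g0 * (\<kappa>^2 * x powr (\<alpha> - 1))"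
        using slope_error[OF 2(1)] g0_nonneg by (simp add: abs_mult mult_left_mono)
      also have "g0 * (\<kappa>^2 * x powr (\<alpha> - 1)) = d1 x" using 2 by (simp add: d1_def)
      also have "\<bar>f x * zeta (primitive x)\<bar> = d2 x" using 2 f_pos[of x] by (simp add: d2_def abs_mult)
      also have "\<bar>zeta x\<bar> = d3 x" by (simp add: d3_def)
      finally show ?thesis using nn by simp
    next
      case 3
      then have x: "0 < x" using \<delta> by simp
      have "\<bar>gap x\<bar> \<le> \<bar>f x * levy_density (primitive x)\<bar> + \<bar>levy_density x\<bar>"
        using x unfolding gap_def by simp
      also have "\<dots> = d4 x + d5 x"
      proof -
        have "0 \<le> f x * levy_density (primitive x)"
          using x f_pos[of x] by (intro mult_nonneg_nonneg levy_density_nonneg) simp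
        then show ?thesis
          unfolding abs_of_nonneg[OF levy_density_nonneg] using 3 by (simp add: d4_def d5_def)
      qed
      finally show ?thesis using nn by simp
    qed
  qed
  have i: "integrable lborel (\<lambda>x. d1 x + d2 x + d3 x + d4 x + d5 x)"
    by (intro Bochner_Integration.integrable_add i1 i2 i3 i4 i5)
  show gi: "integrable lborel gap"
  proof (rule Bochner_Integration.integrable_bound[OF i])
    show "AE x in lborel. norm (gap x) \<le> norm (d1 x + d2 x + d3 x + d4 x + d5 x)"
      using le by (intro AE_I2) (metis abs_ge_self order_trans real_norm_def)
  qed measurable
  have "(\<integral>x. \<bar>gap x\<bar> \<partial>lborel) \<le> (\<integral>x. d1 x + d2 x + d3 x + d4 x + d5 x \<partial>lborel)"
    by (intro integral_mono i integrable_abs gi le)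
  also have "\<dots> = (\<integral>x. d1 x \<partial>lborel) + (\<integral>x. d2 x \<partial>lborel) + (\<integral>x. d3 x \<partial>lborel) + (\<integral>x. d4 x \<partial>lborel) + (\<integral>x. d5 x \<partial>lborel)"
    using i1 i2 i3 i4 i5 by simp
  also have "\<dots> \<le> cost \<kappa> \<alpha>"
    unfolding cost_def using v1 v2 v4 v5 by (simp add: d3_def)
  finally show "(\<integral>x. \<bar>gap x\<bar> \<partial>lborel) \<le> cost \<kappa> \<alpha>" .
qed

text \<open>Near 0 the two halves of \<open>gap\<close> need not be integrable separately. Beyond
  \<epsilon> the substitution gives the difference of tails at \<open>primitive\<close> \<epsilon>
  and at \<epsilon>, which is - g0 * ln of the slope there, up to vanishing masses of
  \<open>zeta\<close>; the slope tends to f 0.\<close>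

lemma gap_integral: "(\<integral>x. gap x \<partial>lborel) = - g0 * ln (f 0)"
proof -
  let ?\<epsilon> = "\<lambda>n. 1 / real (Suc n)"
  have \<epsilon>: "0 < ?\<epsilon> n" "?\<epsilon> n \<le> 1" for n by auto
  have \<epsilon>0: "?\<epsilon> \<longlonglongrightarrow> 0" using LIMSEQ_inverse_real_of_nat by (simp add: inverse_eq_divide)
  have H0: "(\<lambda>n. primitive (?\<epsilon> n)) \<longlonglongrightarrow> 0"
  proof -
    have "(\<lambda>n. primitive (?\<epsilon> n)) \<longlonglongrightarrow> primitive 0"
      by (rule continuous_on_tendsto_compose[OF primitive_continuous \<epsilon>0]) auto
    then show ?thesis by (simp add: primitive_0)
  qed
  have lim: "(\<lambda>n. \<integral>x. indicator {?\<epsilon> n<..} x * gap x \<partial>lborel) \<longlonglongrightarrow> (\<integral>x. gap x \<partial>lborel)"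
  proof (rule integral_dominated_convergence[where w="\<lambda>x. \<bar>gap x\<bar>"])
    show "integrable lborel (\<lambda>x. \<bar>gap x\<bar>)" by (intro integrable_abs gap_integrable)
    show "AE x in lborel. (\<lambda>n. indicator {?\<epsilon> n<..} x * gap x) \<longlonglongrightarrow> gap x"
    proof (intro AE_I2)
      fix x :: real
      show "(\<lambda>n. indicator {?\<epsilon> n<..} x * gap x) \<longlonglongrightarrow> gap x"
      proof (cases "0 < x")
        case True
        have "\<forall>\<^sub>F n in sequentially. ?\<epsilon> n < x" using order_tendstoD(2)[OF \<epsilon>0 True] .
        then have "\<forall>\<^sub>F n in sequentially. indicator {?\<epsilon> n<..} x * gap x = gap x" by eventually_elim auto
        then show ?thesis by (rule tendsto_eventually)
      qed (simp add: gap_def)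
    qed
    show "AE x in lborel. norm (indicator {?\<epsilon> n<..} x * gap x) \<le> \<bar>gap x\<bar>" for n
      by (intro AE_I2) (auto split: split_indicator)
  qed measurable
  have val: "(\<integral>x. indicator {?\<epsilon> n<..} x * gap x \<partial>lborel) = tail (primitive (?\<epsilon> n)) - tail (?\<epsilon> n)" for n
  proof -
    have i: "integrable lborel (\<lambda>y. indicator {primitive (?\<epsilon> n)<..} y * levy_density y)"
      by (intro levy_density_tail primitive_pos \<epsilon>)
    note cv = change_of_variables[OF less_imp_le[OF \<epsilon>(1)] g_measurable i]
    have "(\<integral>x. indicator {?\<epsilon> n<..} x * gap x \<partial>lborel) = (\<integral>x. indicator {?\<epsilon> n<..} x * (f x * levy_density (primitive x)) - indicator {?\<epsilon> n<..} x * levy_density x \<partial>lborel)"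
    proof (rule Bochner_Integration.integral_cong[OF refl])
      fix x
      have "0 < x" if "?\<epsilon> n < x" using that \<epsilon>(1)[of n] by linarith
      then show "indicator {?\<epsilon> n<..} x * gap x = indicator {?\<epsilon> n<..} x * (f x * levy_density (primitive x)) - indicator {?\<epsilon> n<..} x * levy_density x"
        by (auto simp: gap_def split: split_indicator)
    qed
    also have "\<dots> = (\<integral>x. indicator {?\<epsilon> n<..} x * (f x * levy_density (primitive x)) \<partial>lborel) - (\<integral>x. indicator {?\<epsilon> n<..} x * levy_density x \<partial>lborel)"
      by (intro Bochner_Integration.integral_diff cv(1) levy_density_tail \<epsilon>)
    finally show ?thesis unfolding cv(2) by (simp add: tail_def)
  qed
  have "(\<lambda>n. tail (primitive (?\<epsilon> n)) - tail (?\<epsilon> n)) \<longlonglongrightarrow> g0 * (- ln (f 0)) + 0 - 0"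
  proof (rule Lim_transform_eventually)
    have L: "(\<lambda>n. ln (primitive (?\<epsilon> n) / ?\<epsilon> n)) \<longlonglongrightarrow> ln (f 0)"
      using f_pos[of 0] by (intro tendsto_ln primitive_slope_0) auto
    show "(\<lambda>n. g0 * (- ln (primitive (?\<epsilon> n) / ?\<epsilon> n)) + zeta_mass (?\<epsilon> n) - zeta_mass (primitive (?\<epsilon> n))) \<longlonglongrightarrow> g0 * (- ln (f 0)) + 0 - 0"
      by (intro tendsto_add tendsto_diff tendsto_mult tendsto_const tendsto_minus L zeta_mass_tendsto_0 \<epsilon>0 H0)
    have "\<forall>\<^sub>F n in sequentially. primitive (?\<epsilon> n) < 1" using order_tendstoD(2)[OF H0, of 1] by simp
    then show "\<forall>\<^sub>F n in sequentially. g0 * (- ln (primitive (?\<epsilon> n) / ?\<epsilon> n)) + zeta_mass (?\<epsilon> n) - zeta_mass (primitive (?\<epsilon> n)) = tail (primitive (?\<epsilon> n)) - tail (?\<epsilon> n)"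
    proof eventually_elim
      fix n assume n: "primitive (?\<epsilon> n) < 1"
      have p: "0 < primitive (?\<epsilon> n)" by (intro primitive_pos \<epsilon>)
      have "ln (primitive (?\<epsilon> n) / ?\<epsilon> n) = ln (primitive (?\<epsilon> n)) - ln (?\<epsilon> n)"
        using ln_div[of "primitive (?\<epsilon> n)" "?\<epsilon> n"] p \<epsilon>(1)[of n] by auto
      then show "g0 * (- ln (primitive (?\<epsilon> n) / ?\<epsilon> n)) + zeta_mass (?\<epsilon> n) - zeta_mass (primitive (?\<epsilon> n)) = tail (primitive (?\<epsilon> n)) - tail (?\<epsilon> n)"
        using tail_diff[OF p less_imp_le[OF n] \<epsilon>(1)[of n] \<epsilon>(2)[of n]] by simp
    qed
  qed
  with lim show ?thesis unfolding val using LIMSEQ_unique by fastforce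
qed

definition gap_exp :: "real \<Rightarrow> real \<Rightarrow> real" where
  "gap_exp q x = indicator {0<..} x * (f x * levy_density (primitive x) * exp (- q * primitive x) - levy_density x)"

lemma gap_exp:
  assumes q: "0 \<le> q"
  shows "integrable lborel (gap_exp q)" "(\<integral>x. \<bar>gap_exp q x\<bar> \<partial>lborel) \<le> cost \<kappa> \<alpha> + \<Psi> q"
    "(\<integral>x. gap_exp q x \<partial>lborel) = - g0 * ln (f 0) - \<Psi> q"
proof -
  \<comment> \<open>\<open>gap_exp q\<close> is \<open>gap\<close> minus r, and the substitution
    turns the integral of r into the Laplace exponent at q.\<close>
  define r where "r x = indicator {0<..} x * (f x * (levy_density (primitive x) * (1 - exp (- q * primitive x))))" for x
  have i: "integrable lborel (\<lambda>y. indicator {primitive 0<..} y * (levy_density y * (1 - exp (- q * y))))"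
    and v: "(\<integral>y. indicator {primitive 0<..} y * (levy_density y * (1 - exp (- q * y))) \<partial>lborel) = \<Psi> q"
  proof -
    have e: "(\<lambda>y. indicator {primitive 0<..} y * (levy_density y * (1 - exp (- q * y)))) = (\<lambda>y. levy_density y * (1 - exp (- q * y)))"
      by (auto simp: primitive_0 fun_eq_iff split: split_indicator)
    show "integrable lborel (\<lambda>y. indicator {primitive 0<..} y * (levy_density y * (1 - exp (- q * y))))"
      unfolding e by (rule integrable_levy_iff(1)[THEN iffD1, OF _ integrable_levy[OF q]]) simp
    show "(\<integral>y. indicator {primitive 0<..} y * (levy_density y * (1 - exp (- q * y))) \<partial>lborel) = \<Psi> q"
      unfolding e \<Psi>_def by (subst integrable_levy_iff(2)) auto
  qed
  have ri: "integrable lborel r" and rv: "(\<integral>x. r x \<partial>lborel) = \<Psi> q"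
    using change_of_variables[OF order_refl _ i] v unfolding r_def[abs_def] by auto
  have r0: "0 \<le> r x" for x
    using f_pos[of x] levy_density_nonneg[of "primitive x"] primitive_pos[of x] q
    by (auto simp: r_def split: split_indicator intro!: mult_nonneg_nonneg)
  have e: "gap_exp q = (\<lambda>x. gap x - r x)"
    by (auto simp: gap_exp_def gap_def r_def fun_eq_iff algebra_simps split: split_indicator)
  show "integrable lborel (gap_exp q)" unfolding e by (intro Bochner_Integration.integrable_diff gap_integrable ri)
  have "(\<integral>x. \<bar>gap_exp q x\<bar> \<partial>lborel) \<le> (\<integral>x. \<bar>gap x\<bar> + r x \<partial>lborel)"
    unfolding e using r0
    by (intro integral_mono integrable_abs Bochner_Integration.integrable_diff Bochner_Integration.integrable_add gap_integrable ri) (smt (verit))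
  also have "\<dots> = (\<integral>x. \<bar>gap x\<bar> \<partial>lborel) + \<Psi> q"
    using gap_integrable ri rv by simp
  finally show "(\<integral>x. \<bar>gap_exp q x\<bar> \<partial>lborel) \<le> cost \<kappa> \<alpha> + \<Psi> q" using gap_cost by simp
  show "(\<integral>x. gap_exp q x \<partial>lborel) = - g0 * ln (f 0) - \<Psi> q"
    unfolding e using gap_integrable ri rv gap_integral by simp
qed

end

section \<open>Unordered products\<close>

lemma tendsto_sum_count_space:
  fixes f :: "'i \<Rightarrow> real"
  assumes f: "integrable (count_space A) f"
  shows "(sum f \<longlongrightarrow> (\<integral>s. f s \<partial>count_space A)) (finite_subsets_at_top A)"
proof -
  have 1: "Infinite_Set_Sum.abs_summable_on f A" using f by (simp add: Infinite_Set_Sum.abs_summable_on_def)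
  then have "f summable_on A" by (metis abs_summable_equivalent abs_summable_summable)
  then have "(f has_sum infsum f A) A" by (rule has_sum_infsum)
  moreover have "infsum f A = (\<integral>s. f s \<partial>count_space A)"
    using infsetsum_infsum[OF 1] by (simp add: infsetsum_def)
  ultimately show ?thesis by (simp add: has_sum_def)
qed

lemma infprod_eqI:
  assumes "(prod f \<longlongrightarrow> p) (finite_subsets_at_top A)" shows "infprod f A = p"
proof -
  have "Lim (finite_subsets_at_top A) (prod f) = p"
    using assms by (intro tendsto_Lim) (auto simp: finite_subsets_at_top_neq_bot)
  then show ?thesis using assms by (auto simp: infprod_def)
qed

text \<open>A negative factor differs from 1 by more than 1, so there are only finitely many; once a
  finite set contains them all, its sign is fixed and the absolute values converge through their
  logarithms.\<close>

lemma prod_tendsto_signed: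
  fixes f :: "'i \<Rightarrow> real"
  assumes f: "integrable (count_space A) (\<lambda>s. f s - 1)" and nz: "\<And>s. s \<in> A \<Longrightarrow> f s \<noteq> 0"
  shows "finite {s\<in>A. f s < 0}" and "integrable (count_space A) (\<lambda>s. ln \<bar>f s\<bar>)"
    and "(prod f \<longlongrightarrow> (-1) ^ card {s\<in>A. f s < 0} * exp (\<integral>s. ln \<bar>f s\<bar> \<partial>count_space A)) (finite_subsets_at_top A)"
proof -
  let ?N = "{s\<in>A. f s < 0}"
  show N: "finite ?N"
  proof -
    have "(\<integral>\<^sup>+s. indicator ?N s \<partial>count_space A) \<le> (\<integral>\<^sup>+s. ennreal (norm (f s - 1)) \<partial>count_space A)"
    proof (rule nn_integral_mono)
      fix s
      show "indicator ?N s \<le> ennreal (norm (f s - 1))"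
      proof (cases "s \<in> ?N")
        case True
        then have "1 \<le> norm (f s - 1)" by auto
        then show ?thesis using True ennreal_leI[of 1] by simp
      qed simp
    qed
    also have "\<dots> < \<infinity>" using f by (simp add: integrable_iff_bounded)
    finally have "emeasure (count_space A) ?N < \<infinity>" by (subst (asm) nn_integral_indicator) auto
    then show ?thesis by (subst (asm) emeasure_count_space) (auto split: if_splits)
  qed
  have "integrable (count_space A) (\<lambda>s. \<bar>f s\<bar> - 1)"
    by (rule Bochner_Integration.integrable_bound[OF f]) (auto simp: AE_count_space)
  from integrable_ln_one_plus[OF this] show i: "integrable (count_space A) (\<lambda>s. ln \<bar>f s\<bar>)" by simp
  have "((\<lambda>F. (-1) ^ card ?N * exp (\<Sum>s\<in>F. ln \<bar>f s\<bar>)) \<longlongrightarrow> (-1) ^ card ?N * exp (\<integral>s. ln \<bar>f s\<bar> \<partial>count_space A)) (finite_subsets_at_top A)"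
    by (intro tendsto_mult tendsto_const tendsto_exp tendsto_sum_count_space i)
  then show "(prod f \<longlongrightarrow> (-1) ^ card ?N * exp (\<integral>s. ln \<bar>f s\<bar> \<partial>count_space A)) (finite_subsets_at_top A)"
  proof (rule Lim_transform_eventually)
    show "\<forall>\<^sub>F F in finite_subsets_at_top A. (-1) ^ card ?N * exp (\<Sum>s\<in>F. ln \<bar>f s\<bar>) = prod f F"
    proof (rule eventually_finite_subsets_at_top[THEN iffD2], intro exI conjI allI impI)
      show "finite ?N" by (rule N)
      show "?N \<subseteq> A" by auto
      fix F assume F: "finite F \<and> ?N \<subseteq> F \<and> F \<subseteq> A"
      have "f s = (if f s < 0 then -1 else 1) * exp (ln \<bar>f s\<bar>)" if "s \<in> A" for s
        using nz[OF that] by (cases "f s" "0 :: real" rule: linorder_cases) auto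
      then have "prod f F = (\<Prod>s\<in>F. (if f s < 0 then -1 else 1) * exp (ln \<bar>f s\<bar>))"
        by (rule prod.cong[OF refl]) (use F in blast)
      also have "\<dots> = (\<Prod>s\<in>F. if f s < 0 then -1 else 1) * exp (\<Sum>s\<in>F. ln \<bar>f s\<bar>)"
        using F by (simp add: prod.distrib exp_sum)
      also have "(\<Prod>s\<in>F. if f s < 0 then -1 else 1) = (\<Prod>s\<in>?N. (-1::real))"
        using F by (intro prod.mono_neutral_cong_right) auto
      finally show "(-1) ^ card ?N * exp (\<Sum>s\<in>F. ln \<bar>f s\<bar>) = prod f F" by simp
    qed
  qed
qed

text \<open>The converse: convergence along all finite subsets is so strong that a nonzero limit
  forces absolute summability. Disjointly from a finite set E every finite subproduct is close to 1,
  in particular the one over the factors above 1 and the one over those below 1.\<close>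

lemma prod_tendsto_nonzero_imp_summable:
  fixes f :: "'i \<Rightarrow> real"
  assumes lim: "(prod f \<longlongrightarrow> p) (finite_subsets_at_top A)" and p: "p \<noteq> 0"
  shows "\<And>s. s \<in> A \<Longrightarrow> f s \<noteq> 0" and "integrable (count_space A) (\<lambda>s. f s - 1)"
proof -
  have "\<forall>\<^sub>F F in finite_subsets_at_top A. dist (prod f F) p < \<bar>p\<bar> / 4"
    using p by (intro tendstoD[OF lim]) simp
  then obtain E where E: "finite E" "E \<subseteq> A" "\<And>F. finite F \<Longrightarrow> E \<subseteq> F \<Longrightarrow> F \<subseteq> A \<Longrightarrow> \<bar>prod f F - p\<bar> < \<bar>p\<bar> / 4"
    unfolding eventually_finite_subsets_at_top dist_real_def by (elim exE conjE) simp
  show nz: "f s \<noteq> 0" if s: "s \<in> A" for s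
  proof
    assume "f s = 0"
    then have "prod f (insert s E) = 0" using E(1) by (simp add: prod_zero)
    moreover have "\<bar>prod f (insert s E) - p\<bar> < \<bar>p\<bar> / 4" using s E by (intro E(3)) auto
    ultimately show False using p by simp
  qed
  let ?e = "prod f E"
  have e: "\<bar>?e - p\<bar> < \<bar>p\<bar> / 4" by (rule E(3)[OF E(1) _ E(2)]) simp
  have e0: "?e \<noteq> 0" using e p by auto
  \<comment> \<open>The subproduct over G is a quotient of two products within a relative distance
    1/4 of p, hence between (3/4)/(5/4) and (5/4)/(3/4).\<close>
  have ratio: "3/5 < prod f G" "prod f G < 5/3" if G: "finite G" "G \<subseteq> A - E" for G
  proof -
    have "prod f (E \<union> G) = ?e * prod f G" using E(1) G by (intro prod.union_disjoint) auto
    moreover have "\<bar>prod f (E \<union> G) - p\<bar> < \<bar>p\<bar> / 4" using E G by (intro E(3)) auto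
    ultimately have *: "\<bar>?e * prod f G - p\<bar> < \<bar>p\<bar> / 4" by simp
    show "3/5 < prod f G" "prod f G < 5/3"
    proof -
      define a where "a = ?e / p"
      have a: "\<bar>a - 1\<bar> < 1/4"
      proof -
        have "\<bar>a - 1\<bar> = \<bar>?e - p\<bar> / \<bar>p\<bar>" using p by (simp add: a_def abs_divide[symmetric] diff_divide_distrib)
        also have "\<dots> < 1/4" using e p by (simp add: divide_less_eq)
        finally show ?thesis .
      qed
      have b: "\<bar>a * prod f G - 1\<bar> < 1/4"
      proof -
        have "\<bar>a * prod f G - 1\<bar> = \<bar>?e * prod f G - p\<bar> / \<bar>p\<bar>" using p by (simp add: a_def abs_divide[symmetric] diff_divide_distrib)
        also have "\<dots> < 1/4" using * p by (simp add: divide_less_eq)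
        finally show ?thesis .
      qed
      have a': "3/4 < a" "a < 5/4" using a by linarith+
      have b': "3/4 < a * prod f G" "a * prod f G < 5/4" using b by linarith+
      have pos: "0 < prod f G"
      proof -
        have "0 < a * prod f G" "0 < a" using b'(1) a'(1) by linarith+
        then show ?thesis by (rule zero_less_mult_pos)
      qed
      show "3/5 < prod f G"
      proof (rule ccontr)
        assume "\<not> 3/5 < prod f G"
        then have "a * prod f G \<le> 5/4 * (3/5)" using a' pos by (intro mult_mono) auto
        then show False using b' by simp
      qed
      show "prod f G < 5/3"
      proof (rule ccontr)
        assume "\<not> prod f G < 5/3"
        then have "3/4 * (5/3) \<le> a * prod f G" using a' pos by (intro mult_mono) auto
        then show False using b' by simp
      qed
    qed
  qed
  have single: "3/5 < f s" "f s < 5/3" if "s \<in> A - E" for s using ratio[of "{s}"] that by auto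
  define L where "L = ln (5/3 :: real)"
  have L0: "0 \<le> L" unfolding L_def by simp
  have lnG: "\<bar>\<Sum>s\<in>G. ln (f s)\<bar> \<le> L" if G: "finite G" "G \<subseteq> A - E" for G
  proof -
    have pos: "0 < f s" if "s \<in> G" for s using single(1)[of s] that G by force
    have "(\<Sum>s\<in>G. ln (f s)) = ln (prod f G)" using G by (intro ln_prod[symmetric]) (auto dest: pos)
    moreover have "ln (3/5) \<le> ln (prod f G)" "ln (prod f G) \<le> ln (5/3)" using ratio[OF G] by auto
    moreover have "ln (3/5 :: real) = - L"
    proof -
      have "(3/5 :: real) = inverse (5/3)" by simp
      then show ?thesis unfolding L_def by (simp only: ln_inverse)
    qed
    ultimately show ?thesis by (simp add: L_def)
  qed
  \<comment> \<open>The factor 5/3 compares |f - 1| with |ln f|; the factors above and below 1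
    contribute at most L each.\<close>
  have bound: "(\<Sum>s\<in>G. \<bar>f s - 1\<bar>) \<le> 10/3 * L" if G: "finite G" "G \<subseteq> A - E" for G
  proof -
    let ?P = "{s\<in>G. 1 \<le> f s}" and ?Q = "{s\<in>G. f s < 1}"
    have le: "\<bar>f s - 1\<bar> \<le> 5/3 * \<bar>ln (f s)\<bar>" if "s \<in> G" for s
    proof (cases "1 \<le> f s")
      case True
      have "1 - inverse (f s) \<le> ln (f s)" using True ln_le_minus_one[of "inverse (f s)"] by (simp add: ln_inverse)
      moreover have "f s - 1 = f s * (1 - inverse (f s))" using True by (simp add: algebra_simps)
      moreover have "0 \<le> 1 - inverse (f s)" using True by (simp add: inverse_le_1_iff)
      moreover have "f s * (1 - inverse (f s)) \<le> 5/3 * (1 - inverse (f s))"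
        using single(2)[of s] that G calculation(3) by (intro mult_right_mono) force+
      ultimately show ?thesis using True by simp
    next
      case False
      have "0 < f s" using single(1)[of s] that G by force
      then have "ln (f s) \<le> f s - 1" by (rule ln_le_minus_one)
      then show ?thesis using False by simp
    qed
    have "(\<Sum>s\<in>G. \<bar>f s - 1\<bar>) \<le> (\<Sum>s\<in>G. 5/3 * \<bar>ln (f s)\<bar>)" by (intro sum_mono le)
    also have "\<dots> = 5/3 * (\<Sum>s\<in>G. \<bar>ln (f s)\<bar>)" by (simp add: sum_distrib_left)
    also have "(\<Sum>s\<in>G. \<bar>ln (f s)\<bar>) = (\<Sum>s\<in>?P. \<bar>ln (f s)\<bar>) + (\<Sum>s\<in>?Q. \<bar>ln (f s)\<bar>)"
      using G by (subst sum.union_disjoint[symmetric]) (auto intro!: sum.cong)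
    also have "(\<Sum>s\<in>?P. \<bar>ln (f s)\<bar>) = (\<Sum>s\<in>?P. ln (f s))" by (intro sum.cong) auto
    also have "(\<Sum>s\<in>?Q. \<bar>ln (f s)\<bar>) = - (\<Sum>s\<in>?Q. ln (f s))"
    proof -
      have "\<bar>ln (f s)\<bar> = - ln (f s)" if "s \<in> ?Q" for s
      proof -
        have "0 < f s" using single(1)[of s] that G by force
        then show ?thesis using that by simp
      qed
      then show ?thesis by (simp add: sum_negf[symmetric])
    qed
    also have "(\<Sum>s\<in>?P. ln (f s)) + - (\<Sum>s\<in>?Q. ln (f s)) \<le> L + L"
    proof -
      have "\<bar>\<Sum>s\<in>?P. ln (f s)\<bar> \<le> L" "\<bar>\<Sum>s\<in>?Q. ln (f s)\<bar> \<le> L" using G by (auto intro!: lnG)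
      then show ?thesis by (simp only: abs_le_iff) linarith
    qed
    finally show ?thesis by simp
  qed
  have s1: "(\<lambda>s. \<bar>f s - 1\<bar>) summable_on (A - E)"
  proof (rule nonneg_bdd_above_summable_on)
    show "bdd_above (sum (\<lambda>s. \<bar>f s - 1\<bar>) ` {G. G \<subseteq> A - E \<and> finite G})"
      by (rule bdd_aboveI2[where M="10/3 * L"]) (rule bound, simp_all)
  qed simp
  then have s2: "(\<lambda>s. \<bar>f s - 1\<bar>) summable_on A"
  proof -
    have "(\<lambda>s. \<bar>f s - 1\<bar>) summable_on ((A - E) \<union> E)"
      by (rule summable_on_Un_disjoint[OF s1 summable_on_finite[OF E(1)]]) auto
    then show ?thesis using E(2) by (simp add: Un_absorb2)
  qed
  then have "Infinite_Set_Sum.abs_summable_on (\<lambda>s. f s - 1) A"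
    by (simp add: abs_summable_equivalent[symmetric])
  then show "integrable (count_space A) (\<lambda>s. f s - 1)" by (simp add: Infinite_Set_Sum.abs_summable_on_def)
qed

text \<open>Equals \<open>infprod\<close> over jump times, written with sums whose measurability is
  known. Zero and negative factors have to be covered: off a null set of sample points is not
  enough, and in general h may vanish and g 0 may have any sign.\<close>

definition signed_product :: "(real \<Rightarrow> real) \<Rightarrow> real \<Rightarrow> (real \<Rightarrow> real) \<Rightarrow> real" where
  "signed_product x t f = (if jump_sum x {0<..t} (\<lambda>s. indicator {0} (f s)) = 0 \<and> jump_sum x {0<..t} (\<lambda>s. ennreal \<bar>f s - 1\<bar>) < \<top>
     then (-1) ^ nat \<lfloor>enn2real (jump_sum x {0<..t} (\<lambda>s. indicator {..<0} (f s)))\<rfloor> *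
       exp (enn2real (jump_sum x {0<..t} (\<lambda>s. ennreal (ln \<bar>f s\<bar>))) - enn2real (jump_sum x {0<..t} (\<lambda>s. ennreal (- ln \<bar>f s\<bar>))))
     else 0)"

lemma nn_integral_count_space_Icc:
  assumes x: "increasing_path x" and z: "\<And>s. \<not> 0 < jump x s \<Longrightarrow> f s = 0"
  shows "(\<integral>\<^sup>+s. f s \<partial>count_space {0..t}) = jump_sum x {0<..t} f"
  unfolding jump_sum_def
  by (subst nn_integral_count_space_indicator)
    (use z jump_nonpos[OF x] in \<open>auto intro!: nn_integral_cong simp: less_le split: split_indicator\<close>)

text \<open>A nonzero limit exists exactly when no factor vanishes and the deviations from 1 are
  absolutely summable. Otherwise the limit is 0 or absent, and both sides are 0.\<close>

lemma infprod_jumps: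
  assumes x: "increasing_path x" and one: "\<And>s. \<not> 0 < jump x s \<Longrightarrow> f s = 1"
  shows "infprod f {0..t} = signed_product x t f"
proof -
  let ?A = "{0..t}"
  note cs = nn_integral_count_space_Icc[OF x]
  have int_iff: "integrable (count_space ?A) (\<lambda>s. f s - 1) \<longleftrightarrow> jump_sum x {0<..t} (\<lambda>s. ennreal \<bar>f s - 1\<bar>) < \<top>"
    using cs[of "\<lambda>s. ennreal \<bar>f s - 1\<bar>"] one by (simp add: integrable_iff_bounded)
  have nz_iff: "(\<forall>s\<in>?A. f s \<noteq> 0) \<longleftrightarrow> jump_sum x {0<..t} (\<lambda>s. indicator {0} (f s)) = 0"
  proof -
    have "jump_sum x {0<..t} (\<lambda>s. indicator {0} (f s)) = 0 \<longleftrightarrow> (\<integral>\<^sup>+s. indicator {0} (f s) \<partial>count_space ?A) = 0"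
      using cs[of "\<lambda>s. indicator {0} (f s)"] one by simp
    also have "\<dots> \<longleftrightarrow> (AE s in count_space ?A. indicator {0} (f s) = (0::ennreal))"
      by (rule nn_integral_0_iff_AE) simp
    also have "\<dots> \<longleftrightarrow> (\<forall>s\<in>?A. f s \<noteq> 0)" by (auto simp: AE_count_space split: split_indicator_asm)
    finally show ?thesis by simp
  qed
  show ?thesis
  proof (cases "(\<forall>s\<in>?A. f s \<noteq> 0) \<and> integrable (count_space ?A) (\<lambda>s. f s - 1)")
    case True
    then have nz: "\<And>s. s \<in> ?A \<Longrightarrow> f s \<noteq> 0" and i: "integrable (count_space ?A) (\<lambda>s. f s - 1)" by auto
    have S: "finite {s\<in>?A. f s < 0}" "integrable (count_space ?A) (\<lambda>s. ln \<bar>f s\<bar>)"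
      "(prod f \<longlongrightarrow> (-1) ^ card {s\<in>?A. f s < 0} * exp (\<integral>s. ln \<bar>f s\<bar> \<partial>count_space ?A)) (finite_subsets_at_top ?A)"
      by (rule prod_tendsto_signed[OF i]; erule nz)+
    have c: "card {s\<in>?A. f s < 0} = nat \<lfloor>enn2real (jump_sum x {0<..t} (\<lambda>s. indicator {..<0} (f s)))\<rfloor>"
    proof -
      have "jump_sum x {0<..t} (\<lambda>s. indicator {..<0} (f s)) = (\<integral>\<^sup>+s. indicator {..<0} (f s) \<partial>count_space ?A)"
        using cs[of "\<lambda>s. indicator {..<0} (f s)"] one by simp
      also have "\<dots> = (\<integral>\<^sup>+s. indicator {s\<in>?A. f s < 0} s \<partial>count_space ?A)"
        by (intro nn_integral_cong) (auto split: split_indicator)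
      also have "\<dots> = of_nat (card {s\<in>?A. f s < 0})"
        using emeasure_count_space_finite[OF _ S(1), of ?A] nn_integral_indicator[of "{s\<in>?A. f s < 0}" "count_space ?A"] by (metis (no_types, lifting) Collect_subset Pow_iff mem_Collect_eq sets_count_space subsetI)
      finally show ?thesis by simp
    qed
    have v: "(\<integral>s. ln \<bar>f s\<bar> \<partial>count_space ?A) = enn2real (jump_sum x {0<..t} (\<lambda>s. ennreal (ln \<bar>f s\<bar>))) - enn2real (jump_sum x {0<..t} (\<lambda>s. ennreal (- ln \<bar>f s\<bar>)))"
      by (subst real_lebesgue_integral_def[OF S(2)], subst cs, simp add: one, subst cs) (simp_all add: one)
    show ?thesis
      using infprod_eqI[OF S(3)] True unfolding signed_product_def c v int_iff nz_iff by simp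
  next
    case False
    have "infprod f ?A = 0"
    proof (cases "\<exists>p. (prod f \<longlongrightarrow> p) (finite_subsets_at_top ?A)")
      case True
      then obtain p where p: "(prod f \<longlongrightarrow> p) (finite_subsets_at_top ?A)" by blast
      have "p = 0" using prod_tendsto_nonzero_imp_summable[OF p] False by blast
      then show ?thesis using infprod_eqI[OF p] by simp
    qed (simp add: infprod_def)
    then show ?thesis using False unfolding signed_product_def int_iff nz_iff by auto
  qed
qed

lemma infsum_jumps:
  assumes x: "increasing_path x" and f: "\<And>s. s \<in> {0..t} \<Longrightarrow> 0 \<le> f s" and zero: "\<And>s. \<not> 0 < jump x s \<Longrightarrow> f s = 0"
  shows "infsum f {0..t} = enn2real (jump_sum x {0<..t} (\<lambda>s. ennreal (f s)))"
proof -
  have cs: "(\<integral>\<^sup>+s. ennreal (f s) \<partial>count_space {0..t}) = jump_sum x {0<..t} (\<lambda>s. ennreal (f s))"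
    using zero by (intro nn_integral_count_space_Icc[OF x]) simp
  have n: "(\<integral>\<^sup>+s. ennreal (norm (f s)) \<partial>count_space {0..t}) = (\<integral>\<^sup>+s. ennreal (f s) \<partial>count_space {0..t})"
    using f by (intro nn_integral_cong) auto
  show ?thesis
  proof (cases "integrable (count_space {0..t}) f")
    case True
    have 1: "Infinite_Set_Sum.abs_summable_on f {0..t}" using True by (simp add: Infinite_Set_Sum.abs_summable_on_def)
    have "infsum f {0..t} = (\<integral>s. f s \<partial>count_space {0..t})"
      using infsetsum_infsum[OF 1] by (simp add: infsetsum_def)
    also have "\<dots> = enn2real (\<integral>\<^sup>+s. ennreal (f s) \<partial>count_space {0..t})"
      using f by (intro integral_eq_nn_integral) (auto simp: AE_count_space)
    finally show ?thesis unfolding cs .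
  next
    \<comment> \<open>Both sides take their default value: \<open>infsum\<close> of a divergent
      series is 0, and so is \<open>enn2real\<close> of infinity.\<close>
    case False
    then have "jump_sum x {0<..t} (\<lambda>s. ennreal (f s)) = \<top>"
      using cs n by (simp add: integrable_iff_bounded not_less top_unique)
    moreover have "\<not> f summable_on {0..t}"
    proof
      assume "f summable_on {0..t}"
      then have "(\<lambda>s. norm (f s)) summable_on {0..t}" by (rule summable_on_cong[THEN iffD1, rotated]) (use f in auto)
      then have "Infinite_Set_Sum.abs_summable_on f {0..t}" by (simp add: abs_summable_equivalent[symmetric])
      then show False using False by (simp add: Infinite_Set_Sum.abs_summable_on_def)
    qed
    ultimately show ?thesis by (simp add: infsum_not_exists)
  qed
qed

section \<open>The change of measure\<close>

locale girsanov = class_L_process +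
  fixes h :: "real \<Rightarrow> 'a \<Rightarrow> real \<Rightarrow> real" and \<kappa> \<alpha> :: real
  assumes h_nonneg: "\<And>s \<omega> x. 0 \<le> s \<Longrightarrow> \<omega> \<in> space P \<Longrightarrow> 0 \<le> x \<Longrightarrow> 0 \<le> h s \<omega> x"
    and h_predictable: "(\<lambda>((s, \<omega>), x). h s \<omega> x) \<in> borel_measurable (Pred \<Otimes>\<^sub>M restrict_space borel {0..})"
    and \<kappa>: "1 < \<kappa>" and \<alpha>: "0 < \<alpha>"
    and h_hoelder: "AE \<omega> in P. \<forall>s\<ge>0. \<forall>x\<ge>0. \<forall>y\<ge>0. \<bar>h s \<omega> x - h s \<omega> y\<bar> \<le> \<kappa> * \<bar>x - y\<bar> powr \<alpha>"
    and h_bounds: "AE \<omega> in P. \<forall>s\<ge>0. \<forall>x\<ge>0. 1 / \<kappa> \<le> h s \<omega> x \<and> h s \<omega> x \<le> \<kappa>"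
begin

abbreviation M where "M \<equiv> M_H X g g0 h"
abbreviation \<Xi> where "\<Xi> \<equiv> xi_H X h"

definition h_ext :: "(real \<times> 'a) \<times> real \<Rightarrow> real" where
  "h_ext p = h (fst (fst p)) (snd (fst p)) (max 0 (snd p))"

lemma h_ext_measurable[measurable]: "h_ext \<in> borel_measurable PredB"
proof -
  have "(\<lambda>p. (fst p, max 0 (snd p))) \<in> PredB \<rightarrow>\<^sub>M Pred \<Otimes>\<^sub>M restrict_space borel {0::real..}"
    by (intro measurable_Pair measurable_fst measurable_restrict_space2) auto
  from measurable_compose[OF this h_predictable] show ?thesis
    by (simp add: h_ext_def[abs_def] split_beta)
qed

definition H_ext :: "(real \<times> 'a) \<times> real \<Rightarrow> real" where
  "H_ext p = (\<integral>y. indicator {0..snd p} y * h_ext (fst p, y) \<partial>lborel)"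

lemma H_ext_measurable[measurable]: "H_ext \<in> borel_measurable PredB"
proof -
  have [measurable]: "(\<lambda>z. h_ext (fst (fst z), snd z)) \<in> borel_measurable (PredB \<Otimes>\<^sub>M lborel)"
    by (rule measurable_compose[OF _ h_ext_measurable]) (simp cong: measurable_cong_sets sets_pair_measure_cong)
  have "(\<lambda>z. (if 0 \<le> snd z \<and> snd z \<le> snd (fst z) then 1 else 0) * h_ext (fst (fst z), snd z)) \<in> borel_measurable (PredB \<Otimes>\<^sub>M lborel)"
    by measurable
  then have "(\<lambda>(p, y). indicator {0..snd p} y * h_ext (fst p, y)) \<in> borel_measurable (PredB \<Otimes>\<^sub>M lborel)"
    by (simp add: split_beta indicator_def)
  from lborel.borel_measurable_lebesgue_integral[OF this] show ?thesis by (simp add: H_ext_def[abs_def])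
qed

lemma H_of_eq: "H_of h s \<omega> x = H_ext ((s, \<omega>), x)"
  unfolding H_of_def H_ext_def set_lebesgue_integral_def
  by (intro Bochner_Integration.integral_cong) (auto simp: h_ext_def split: split_indicator)

lemma H_of_0: "H_of h s \<omega> 0 = 0"
  unfolding H_of_def set_lebesgue_integral_def
  by (rule integral_eq_zero_AE) (use AE_lborel_neq[of 0] in \<open>auto elim!: eventually_mono\<close>)

lemma H_nonneg: "0 \<le> s \<Longrightarrow> \<omega> \<in> space P \<Longrightarrow> 0 \<le> H_of h s \<omega> x"
  unfolding H_of_def set_lebesgue_integral_def
  by (intro Bochner_Integration.integral_nonneg) (auto simp: h_nonneg split: split_indicator)

text \<open>The density g is measurable on the open half-line only, so its value at 0 enters as a
  constant on the set where H is not positive.\<close>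

definition factor :: "(real \<times> 'a) \<times> real \<Rightarrow> real" where
  "factor p = (if snd p = 0 then 1 else h_ext p *
     ((indicator {0<..} (H_ext p) * g (H_ext p) + indicator {..0} (H_ext p) * g 0) / (indicator {0<..} (snd p) * g (snd p))))"

lemma factor_measurable[measurable]: "factor \<in> borel_measurable PredB"
proof -
  have [measurable]: "(\<lambda>p. indicator {0<..} (H_ext p) * g (H_ext p)) \<in> borel_measurable PredB"
    "(\<lambda>p. indicator {0<..} (snd p) * g (snd p)) \<in> borel_measurable PredB"
    by (rule measurable_compose[OF _ g_measurable], measurable)+
  show ?thesis unfolding factor_def[abs_def] by measurable
qed

lemma jump_factor_eq:
  assumes "0 \<le> s" "\<omega> \<in> space P" "0 \<le> x" shows "jump_factor g h s \<omega> x = factor ((s, \<omega>), x)"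
  using H_nonneg[OF assms(1,2), of x] assms(3)
  by (auto simp: jump_factor_def factor_def H_of_eq h_ext_def less_le split: split_indicator)

lemma M_eq:
  assumes \<omega>: "\<omega> \<in> space P"
  shows "M t \<omega> = exp (g0 * (LBINT s:{0..t}. ln (h s \<omega> 0))) * signed_product (path \<omega>) t (\<lambda>s. jump_factor g h s \<omega> (jmp \<omega> s))"
  unfolding M_H_def
  by (subst infprod_jumps[OF path[OF \<omega>]]) (auto simp: jump_factor_def jump_pos_iff[OF path[OF \<omega>]])

lemma jump_sum_factor:
  assumes \<omega>: "\<omega> \<in> space P"
  shows "jsum \<omega> {0<..t} (\<lambda>s. u (jump_factor g h s \<omega> (jmp \<omega> s))) = jsum \<omega> {0<..t} (\<lambda>s. u (factor ((s, \<omega>), jmp \<omega> s)))"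
  by (rule jump_sum_cong) (simp add: jump_factor_eq[OF _ \<omega>])

text \<open>The formula for \<open>signed_product\<close> is rewritten through \<open>factor\<close>
  at every sample point, including those where the almost sure bounds on h fail.\<close>

lemma M_adapted: assumes t: "0 \<le> t" shows "M t \<in> borel_measurable (F t)"
proof -
  note [measurable] = clamp_time_measurable[OF t]
  have js[measurable]: "(\<lambda>\<omega>. jsum \<omega> {0<..t} (\<lambda>s. u (factor ((s, \<omega>), jmp \<omega> s)))) \<in> borel_measurable (F t)"
    if [measurable]: "u \<in> borel_measurable borel" for u
    using jump_sum_predictable_measurable[OF t, of "{0<..t}" "\<lambda>q. u (factor q)"] by simp
  have "(\<lambda>z. (if 0 \<le> snd z \<and> snd z \<le> t then 1 else 0) * ln (h_ext (clamp_time t (snd z, fst z), 0))) \<in> borel_measurable (F t \<Otimes>\<^sub>M lborel)"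
  proof -
    have "(\<lambda>z. (clamp_time t (snd z, fst z), 0 :: real)) \<in> F t \<Otimes>\<^sub>M lborel \<rightarrow>\<^sub>M PredB"
      by measurable
    from measurable_compose[OF this h_ext_measurable]
    have [measurable]: "(\<lambda>z. h_ext (clamp_time t (snd z, fst z), 0)) \<in> borel_measurable (F t \<Otimes>\<^sub>M lborel)" .
    show ?thesis by measurable
  qed
  then have "(\<lambda>(\<omega>, s). indicator {0..t} s * ln (h_ext (clamp_time t (s, \<omega>), 0))) \<in> borel_measurable (F t \<Otimes>\<^sub>M lborel)"
    by (simp add: split_beta indicator_def)
  from lborel.borel_measurable_lebesgue_integral[OF this]
  have [measurable]: "(\<lambda>\<omega>. \<integral>s. indicator {0..t} s * ln (h_ext (clamp_time t (s, \<omega>), 0)) \<partial>lborel) \<in> borel_measurable (F t)" .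
  have I: "(\<integral>s. indicator {0..t} s * ln (h_ext (clamp_time t (s, \<omega>), 0)) \<partial>lborel) = (LBINT s:{0..t}. ln (h s \<omega> 0))" for \<omega>
    unfolding set_lebesgue_integral_def
    by (intro Bochner_Integration.integral_cong) (auto simp: h_ext_def clamp_time_def split: split_indicator)
  let ?J = "\<lambda>u \<omega>. jsum \<omega> {0<..t} (\<lambda>s. u (factor ((s, \<omega>), jmp \<omega> s)))"
  have "(\<lambda>\<omega>. exp (g0 * (\<integral>s. indicator {0..t} s * ln (h_ext (clamp_time t (s, \<omega>), 0)) \<partial>lborel)) *
     (if ?J (indicator {0}) \<omega> = 0 \<and> ?J (\<lambda>b. ennreal \<bar>b - 1\<bar>) \<omega> < \<top>
      then (-1) ^ nat \<lfloor>enn2real (?J (indicator {..<0}) \<omega>)\<rfloor> * exp (enn2real (?J (\<lambda>b. ennreal (ln \<bar>b\<bar>)) \<omega>) - enn2real (?J (\<lambda>b. ennreal (- ln \<bar>b\<bar>)) \<omega>))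
      else 0)) \<in> borel_measurable (F t)"
    by measurable
  then show ?thesis
    unfolding I
    by (rule measurable_cong[THEN iffD1, rotated]) (simp add: M_eq signed_product_def jump_sum_factor[where u="indicator {0}"] jump_sum_factor[where u="\<lambda>b. ennreal \<bar>b - 1\<bar>"]
      jump_sum_factor[where u="indicator {..<0}"] jump_sum_factor[where u="\<lambda>b. ennreal (ln \<bar>b\<bar>)"] jump_sum_factor[where u="\<lambda>b. ennreal (- ln \<bar>b\<bar>)"])
qed

lemma \<Xi>_eq:
  assumes \<omega>: "\<omega> \<in> space P"
  shows "\<Xi> t \<omega> = enn2real (jsum \<omega> {0<..t} (\<lambda>s. ennreal (H_ext ((s, \<omega>), jmp \<omega> s))))"
  unfolding xi_H_def
proof (subst infsum_jumps[OF path[OF \<omega>]])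
  show "0 \<le> H_of h s \<omega> (jmp \<omega> s)" if "s \<in> {0..t}" for s using that \<omega> by (intro H_nonneg) auto
  show "H_of h s \<omega> (jmp \<omega> s) = 0" if "\<not> 0 < jmp \<omega> s" for s
    using that by (simp add: jump_pos_iff[OF path[OF \<omega>]] H_of_0)
qed (simp add: H_of_eq)

lemma \<Xi>_adapted: assumes t: "0 \<le> t" shows "\<Xi> t \<in> borel_measurable (F t)"
proof -
  have [measurable]: "(\<lambda>\<omega>. jsum \<omega> {0<..t} (\<lambda>s. ennreal (H_ext ((s, \<omega>), jmp \<omega> s)))) \<in> borel_measurable (F t)"
    using jump_sum_predictable_measurable[OF t, of "{0<..t}" "\<lambda>q. ennreal (H_ext q)"] by simp
  have "(\<lambda>\<omega>. enn2real (jsum \<omega> {0<..t} (\<lambda>s. ennreal (H_ext ((s, \<omega>), jmp \<omega> s))))) \<in> borel_measurable (F t)"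
    by measurable
  then show ?thesis by (rule measurable_cong[THEN iffD1, rotated]) (simp add: \<Xi>_eq)
qed

definition good :: "'a \<Rightarrow> bool" where
  "good \<omega> \<longleftrightarrow> \<omega> \<in> space P \<and> (\<forall>s\<ge>0. hoelder_density (h s \<omega>) \<kappa> \<alpha>)"

lemma AE_good: "AE \<omega> in P. good \<omega>"
  using h_hoelder h_bounds AE_space
  by eventually_elim (auto simp: good_def hoelder_density_def \<kappa> \<alpha>)

definition bound :: "real \<Rightarrow> real" where "bound q = cost \<kappa> \<alpha> + \<Psi> q"

definition tilted :: "real \<Rightarrow> (real \<times> 'a) \<times> real \<Rightarrow> real" where
  "tilted q p = factor p * exp (- q * H_ext p) - 1"

text \<open>The integral condition depends on time and sample point only and is predictable.
  Together with positivity of \<open>factor\<close> it enforces the bounds of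
  \<open>jump_density\<close> everywhere; on good paths nothing is cut off at positive
  sizes.\<close>

definition \<beta> :: "real \<Rightarrow> (real \<times> 'a) \<times> real \<Rightarrow> real" where
  "\<beta> q p = (if (\<integral>\<^sup>+x. ennreal \<bar>indicator {0<..} x * tilted q (fst p, x)\<bar> \<partial>\<nu>) \<le> ennreal (bound q) \<and> 0 < snd p \<and> 0 < factor p
     then tilted q p else 0)"

lemma bound_nonneg: "0 \<le> q \<Longrightarrow> 0 \<le> bound q"
proof -
  assume q: "0 \<le> q"
  have "0 \<le> \<Psi> q" unfolding \<Psi>_def
    by (rule integral_nonneg_AE) (use AE_levy_pos q in \<open>auto elim!: eventually_mono\<close>)
  moreover have "0 \<le> tail a" for a unfolding tail_def using levy_density_nonneg
    by (intro Bochner_Integration.integral_nonneg) auto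
  moreover have "0 \<le> g0 * \<kappa>^2 / \<alpha>" using g0_nonneg \<alpha> by simp
  ultimately show ?thesis by (auto simp: bound_def cost_def intro!: add_nonneg_nonneg)
qed

lemma tilted_measurable[measurable]: "tilted q \<in> borel_measurable PredB"
  unfolding tilted_def[abs_def] by measurable

lemma jump_density_\<beta>:
  assumes q: "0 \<le> q" shows "jump_density P X g g0 (\<beta> q) (bound q)"
proof
  have "(\<lambda>p. \<integral>\<^sup>+x. ennreal \<bar>indicator {0<..} x * tilted q (p, x)\<bar> \<partial>\<nu>) \<in> borel_measurable Pred"
    using inner_integral_measurable[of "\<lambda>p. ennreal \<bar>indicator {0<..} (snd p) * tilted q p\<bar>"] by simp
  from measurable_compose[OF measurable_fst this]
  have [measurable]: "(\<lambda>p. \<integral>\<^sup>+x. ennreal \<bar>indicator {0<..} x * tilted q (fst p, x)\<bar> \<partial>\<nu>) \<in> borel_measurable PredB" .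
  show "\<beta> q \<in> borel_measurable PredB" unfolding \<beta>_def[abs_def] by measurable
  show "-1 < \<beta> q p" for p by (simp add: \<beta>_def tilted_def)
  show "0 \<le> bound q" by (rule bound_nonneg[OF q])
  show "(\<integral>\<^sup>+x. ennreal \<bar>\<beta> q ((s, \<omega>), x)\<bar> \<partial>\<nu>) \<le> ennreal (bound q)" for s \<omega>
  proof (cases "(\<integral>\<^sup>+x. ennreal \<bar>indicator {0<..} x * tilted q ((s, \<omega>), x)\<bar> \<partial>\<nu>) \<le> ennreal (bound q)")
    case True
    have "(\<integral>\<^sup>+x. ennreal \<bar>\<beta> q ((s, \<omega>), x)\<bar> \<partial>\<nu>) \<le> (\<integral>\<^sup>+x. ennreal \<bar>indicator {0<..} x * tilted q ((s, \<omega>), x)\<bar> \<partial>\<nu>)"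
      by (intro nn_integral_mono ennreal_leI) (auto simp: \<beta>_def)
    with True show ?thesis by simp
  qed (simp add: \<beta>_def)
qed

section \<open>Identification of the density on good paths\<close>

context
  fixes \<omega> :: 'a and s :: real assumes good: "good \<omega>" and s: "0 \<le> s"
begin

interpretation tilt P X g g0 "h s \<omega>" \<kappa> \<alpha>
  using good s by (auto simp: good_def tilt_def intro: class_L_process_axioms)

lemma primitive_H: "primitive x = H_ext ((s, \<omega>), x)"
  by (simp add: primitive_def H_of_def H_of_eq[symmetric])

lemma H_le: "0 \<le> x \<Longrightarrow> H_ext ((s, \<omega>), x) \<le> \<kappa> * x"
  using primitive_between(2)[of x] by (simp add: primitive_H)

lemma factor_good: "0 < x \<Longrightarrow> factor ((s, \<omega>), x) = h s \<omega> x * g (H_ext ((s, \<omega>), x)) / g x"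
  and factor_pos: "0 < x \<Longrightarrow> 0 < factor ((s, \<omega>), x)"
proof -
  assume x: "0 < x"
  have "0 < H_ext ((s, \<omega>), x)" using primitive_pos[OF x] by (simp add: primitive_H)
  then show *: "factor ((s, \<omega>), x) = h s \<omega> x * g (H_ext ((s, \<omega>), x)) / g x"
    using x by (simp add: factor_def h_ext_def)
  show "0 < factor ((s, \<omega>), x)" unfolding * using f_pos[of x] x g_pos \<open>0 < H_ext ((s, \<omega>), x)\<close> by simp
qed

text \<open>Multiplying by g removes the quotient, so \<nu>-integrals of the tilted density are
  Lebesgue integrals of \<open>gap_exp\<close>.\<close>

lemma tilted_gap: "levy_density x * (indicator {0<..} x * tilted q ((s, \<omega>), x)) = gap_exp q x"
proof (cases "0 < x")
  case True
  then have "0 < H_ext ((s, \<omega>), x)" using primitive_pos[OF True] by (simp add: primitive_H)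
  then show ?thesis using True g_pos[OF True] by (simp add: gap_exp_def tilted_def factor_good primitive_H field_simps)
qed (simp add: gap_exp_def)

lemma \<beta>_good:
  assumes q: "0 \<le> q" shows "\<beta> q ((s, \<omega>), x) = indicator {0<..} x * tilted q ((s, \<omega>), x)"
proof -
  have m: "(\<lambda>x. indicator {0<..} x * tilted q ((s, \<omega>), x)) \<in> borel_measurable borel"
    using measurable_compose[OF measurable_Pair1' tilted_measurable, of "(s, \<omega>)"] good s
    by (simp add: space_Pred good_def)
  have "(\<integral>\<^sup>+x. ennreal \<bar>indicator {0<..} x * tilted q ((s, \<omega>), x)\<bar> \<partial>\<nu>)
      = (\<integral>\<^sup>+x. ennreal (levy_density x) * ennreal \<bar>indicator {0<..} x * tilted q ((s, \<omega>), x)\<bar> \<partial>lborel)"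
    unfolding \<nu>_def using m by (subst nn_integral_density) auto
  also have "\<dots> = (\<integral>\<^sup>+x. ennreal \<bar>gap_exp q x\<bar> \<partial>lborel)"
    unfolding tilted_gap[symmetric] abs_mult[of "levy_density _"] using levy_density_nonneg by (simp add: ennreal_mult)
  also have "\<dots> = ennreal (\<integral>x. \<bar>gap_exp q x\<bar> \<partial>lborel)"
    by (rule nn_integral_eq_integral) (auto intro: gap_exp(1)[OF q])
  also have "\<dots> \<le> ennreal (bound q)" using gap_exp(2)[OF q] by (intro ennreal_leI) (simp add: bound_def)
  finally show ?thesis using factor_pos by (auto simp: \<beta>_def split: split_indicator)
qed

lemma \<beta>_good_integral:
  assumes q: "0 \<le> q"
  shows "integrable \<nu> (\<lambda>x. \<beta> q ((s, \<omega>), x))"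
    and "(\<integral>x. \<beta> q ((s, \<omega>), x) \<partial>\<nu>) = - g0 * ln (h s \<omega> 0) - \<Psi> q"
proof -
  have m: "(\<lambda>x. indicator {0<..} x * tilted q ((s, \<omega>), x)) \<in> borel_measurable borel"
    using measurable_compose[OF measurable_Pair1' tilted_measurable, of "(s, \<omega>)"] good s
    by (simp add: space_Pred good_def)
  note integrable_levy_iff[OF m] tilted_gap gap_exp[OF q]
  then show "integrable \<nu> (\<lambda>x. \<beta> q ((s, \<omega>), x))"
    "(\<integral>x. \<beta> q ((s, \<omega>), x) \<partial>\<nu>) = - g0 * ln (h s \<omega> 0) - \<Psi> q"
    by (simp_all add: \<beta>_good[OF q])
qed

end

lemma integral_eq_off_null:
  fixes f f' :: "real \<Rightarrow> real"
  assumes "f' \<in> borel_measurable lborel" and "\<And>r. r \<noteq> a \<Longrightarrow> f r = f' r" shows "integral\<^sup>L lborel f = integral\<^sup>L lborel f'"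
proof (rule integral_cong_AE)
  show "f \<in> borel_measurable lborel"
    by (rule measurable_discrete_difference[OF assms(1), of "{a}"]) (use assms(2) in auto)
  show "AE r in lborel. f r = f' r" using AE_lborel_neq[of a] by eventually_elim (rule assms(2))
qed (rule assms(1))

lemma laplace_exponent_0[simp]: "\<Psi> 0 = 0" by (simp add: \<Psi>_def)

lemma H_ext_nonneg: "\<omega> \<in> space P \<Longrightarrow> s \<in> {0<..t} \<Longrightarrow> 0 \<le> H_ext ((s, \<omega>), x)"
  using H_nonneg[of s \<omega> x] by (simp add: H_of_eq)

lemma jump_sum_H_finite:
  assumes \<omega>: "good \<omega>" and t: "0 \<le> t"
  shows "jsum \<omega> {0<..t} (\<lambda>s. ennreal (H_ext ((s, \<omega>), jmp \<omega> s))) < \<top>"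
proof -
  have "jsum \<omega> {0<..t} (\<lambda>s. ennreal (H_ext ((s, \<omega>), jmp \<omega> s))) \<le> jsum \<omega> {0<..t} (\<lambda>s. ennreal \<kappa> * ennreal (jmp \<omega> s))"
    using H_le[OF \<omega>] \<kappa> by (intro jump_sum_mono) (simp add: ennreal_mult[symmetric] ennreal_leI)
  also have "\<dots> = ennreal \<kappa> * jsum \<omega> {0<..t} (\<lambda>s. ennreal (jmp \<omega> s))" by (rule jump_sum_cmult)
  also have "\<dots> \<le> ennreal \<kappa> * ennreal (X t \<omega>)" using \<omega> by (intro mult_left_mono jump_sum_jump_le[OF path t]) (auto simp: good_def)
  also have "\<dots> < \<top>" by (simp add: ennreal_mult_less_top)
  finally show ?thesis .
qed

lemma \<Xi>_mono:
  assumes \<omega>: "good \<omega>" and u: "0 \<le> u" "u \<le> w" shows "\<Xi> u \<omega> \<le> \<Xi> w \<omega>"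
proof -
  have "\<omega> \<in> space P" using \<omega> by (simp add: good_def)
  then show ?thesis using u jump_sum_H_finite[OF \<omega>, of w]
    unfolding \<Xi>_eq[OF \<open>\<omega> \<in> space P\<close>] by (intro enn2real_mono jump_sum_mono_set) auto
qed

context
  fixes q :: real assumes q: "0 \<le> q"
begin

interpretation D: jump_density P X g g0 "\<beta> q" "bound q" by (rule jump_density_\<beta>[OF q])
interpretation D0: jump_density P X g g0 "\<beta> 0" "bound 0" by (rule jump_density_\<beta>) simp

text \<open>Here the drift factor of \<open>M\<close> appears: the time integral of \<integral>
  \<beta> d\<nu> = - g0 ln h(s,0) - \<Psi> q.\<close>

lemma total_rate_good:
  assumes \<omega>: "good \<omega>" and t: "0 \<le> t"
  shows "D.total_rate t \<omega> = - g0 * (LBINT s:{0..t}. ln (h s \<omega> 0)) - t * \<Psi> q"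
proof -
  have \<omega>P: "\<omega> \<in> space P" using \<omega> by (simp add: good_def)
  have n: "D.net_rate \<omega> r = - g0 * ln (h r \<omega> 0) - \<Psi> q" if "0 \<le> r" for r
    unfolding D.net_rate_def[OF \<omega>P] D.rate_def \<beta>_good_integral(2)[OF \<omega> that q, symmetric]
    by (rule real_lebesgue_integral_def[OF \<beta>_good_integral(1)[OF \<omega> that q], symmetric])
  have i1: "integrable lborel (\<lambda>r. indicator {0<..t} r * c)" for c :: real
    using t by (intro integrable_mult_left integrable_real_indicator) auto
  have i: "integrable lborel (\<lambda>r. indicator {0<..t} r * D.net_rate \<omega> r)"
  proof (rule Bochner_Integration.integrable_bound)
    show "integrable lborel (\<lambda>r. indicator {0<..t} r * bound q)" by (rule i1)
    show "(\<lambda>r. indicator {0<..t} r * D.net_rate \<omega> r) \<in> borel_measurable lborel"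
      using D.net_rate_measurable[OF \<omega>P] by simp
    show "AE r in lborel. norm (indicator {0<..t} r * D.net_rate \<omega> r) \<le> norm (indicator {0<..t} r * bound q)"
      using D.net_rate_le[OF \<omega>P] bound_nonneg[OF q] by (intro AE_I2) (auto split: split_indicator)
  qed
  have i2: "integrable lborel (\<lambda>r. indicator {0<..t} r * \<Psi> q)" by (rule i1)
  have "- g0 * (LBINT s:{0..t}. ln (h s \<omega> 0)) = (\<integral>s. - g0 * (indicator {0..t} s * ln (h s \<omega> 0)) \<partial>lborel)"
    by (simp add: set_lebesgue_integral_def)
  also have "\<dots> = (\<integral>s. indicator {0..t} s * D.net_rate \<omega> s + indicator {0..t} s * \<Psi> q \<partial>lborel)"
    by (intro Bochner_Integration.integral_cong) (auto simp: n split: split_indicator)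
  \<comment> \<open>The statement's time interval is closed at 0, the stochastic exponential's is
    open there; the point 0 carries no Lebesgue mass.\<close>
  also have "\<dots> = (\<integral>s. indicator {0<..t} s * D.net_rate \<omega> s + indicator {0<..t} s * \<Psi> q \<partial>lborel)"
    using i i2 by (intro integral_eq_off_null[where a=0] borel_measurable_integrable) (auto split: split_indicator)
  also have "\<dots> = D.total_rate t \<omega> + t * \<Psi> q"
    using t i i2 by (simp add: D.total_rate_integral[OF \<omega>P t])
  finally show ?thesis by simp
qed

text \<open>On a good path all factors at jumps are positive and equal 1 + \<beta> for q = 0, so the
  sign in \<open>signed_product\<close> is trivial and its two conventions for divergence
  agree.\<close>

lemma M_eq_Z:
  assumes \<omega>: "good \<omega>" and t: "0 \<le> t"
  shows "M t \<omega> = D0.jump_product_over {0<..t} \<omega> * exp (g0 * (LBINT s:{0..t}. ln (h s \<omega> 0)))"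
proof -
  have \<omega>P: "\<omega> \<in> space P" using \<omega> by (simp add: good_def)
  have f: "0 < jump_factor g h s \<omega> (jmp \<omega> s)" "jump_factor g h s \<omega> (jmp \<omega> s) = 1 + D0.\<beta>J \<omega> s"
    if "s \<in> {0<..t}" "0 < jmp \<omega> s" for s
    using that \<omega>P factor_pos[OF \<omega>, of s] by (auto simp: jump_factor_eq D0.\<beta>J_def \<beta>_good[OF \<omega>] tilted_def)
  have j: "jsum \<omega> {0<..t} (\<lambda>s. u (jump_factor g h s \<omega> (jmp \<omega> s))) = jsum \<omega> {0<..t} (\<lambda>s. u (1 + D0.\<beta>J \<omega> s))" for u
    by (rule jump_sum_cong) (simp add: f)
  have p: "0 < 1 + D0.\<beta>J \<omega> s" for s using D0.\<beta>_gt[of "((s, \<omega>), jmp \<omega> s)"] by (simp add: D0.\<beta>J_def)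
  have z: "jsum \<omega> {0<..t} (\<lambda>s. indicator {0} (1 + D0.\<beta>J \<omega> s)) = 0" "jsum \<omega> {0<..t} (\<lambda>s. indicator {..<0} (1 + D0.\<beta>J \<omega> s)) = 0"
    using less_imp_neq[OF p] p[THEN less_imp_le, THEN leD] by (simp_all add: jump_sum_def indicator_def)
  have a: "\<bar>1 + D0.\<beta>J \<omega> s\<bar> = 1 + D0.\<beta>J \<omega> s" for s using p[of s] by simp
  show ?thesis unfolding M_eq[OF \<omega>P] signed_product_def D0.jump_product_over_def D0.summable_jumps_def
    j[of "indicator {0}"] j[of "\<lambda>b. ennreal \<bar>b - 1\<bar>"]
    j[of "indicator {..<0}"] j[of "\<lambda>b. ennreal (ln \<bar>b\<bar>)"] j[of "\<lambda>b. ennreal (- ln \<bar>b\<bar>)"] z a by simp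
qed

text \<open>At each jump ln (1 + \<beta>) for q is that for 0 minus q times H. Summing over jumps
  separates exp (- q \<Xi>), and the Laplace exponent comes from the time integral.\<close>

lemma Z_eq:
  assumes \<omega>: "good \<omega>" and t: "0 \<le> t" and s: "D.summable_jumps {0<..t} \<omega>" "D0.summable_jumps {0<..t} \<omega>"
  shows "D.Z t \<omega> = M t \<omega> * exp (- q * \<Xi> t \<omega>) * exp (t * \<Psi> q)"
proof -
  have \<omega>P: "\<omega> \<in> space P" using \<omega> by (simp add: good_def)
  let ?T = "{0<..t}" let ?C = "count_space {s\<in>?T. 0 < jmp \<omega> s}"
  let ?H = "\<lambda>s. H_ext ((s, \<omega>), jmp \<omega> s)"
  have l: "integrable ?C (\<lambda>s. ln (1 + D.\<beta>J \<omega> s) * indicator ?T s)" "integrable ?C (\<lambda>s. ln (1 + D0.\<beta>J \<omega> s) * indicator ?T s)"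
    by (rule jump_product.integrable_indicator_ln D.jump_product_interpretation[OF \<omega>P s(1)] D0.jump_product_interpretation[OF \<omega>P s(2)])+
  note H0 = H_ext_nonneg[OF \<omega>P] and js = jump_sum_H_finite[OF \<omega> t]
  have iH: "integrable ?C (\<lambda>s. ?H s * indicator ?T s)"
  proof (rule integrableI_bounded)
    have "(\<integral>\<^sup>+s. ennreal (norm (?H s * indicator ?T s)) \<partial>?C) = (\<integral>\<^sup>+s. ennreal (?H s) * indicator ?T s \<partial>?C)"
      using H0 by (intro nn_integral_cong) auto
    also have "\<dots> = jsum \<omega> ?T (\<lambda>s. ennreal (?H s))" by (rule D.nn_integral_count_space_jumps[OF \<omega>P order_refl])
    finally show "(\<integral>\<^sup>+s. ennreal (norm (?H s * indicator ?T s)) \<partial>?C) < \<infinity>" using js by (simp only: infinity_ennreal_def)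
  qed simp
  have vH: "(\<integral>s. ?H s * indicator ?T s \<partial>?C) = \<Xi> t \<omega>"
  proof -
    have "jsum \<omega> ?T (\<lambda>s. ennreal (- ?H s)) = 0"
      using H0 by (subst jump_sum_cong[where h="\<lambda>_. 0"]) (auto simp: jump_sum_def ennreal_neg)
    then show ?thesis unfolding D.integral_count_space_jumps(1)[OF \<omega>P order_refl iH] \<Xi>_eq[OF \<omega>P] by simp
  qed
  have "ln (1 + D.\<beta>J \<omega> s) = ln (1 + D0.\<beta>J \<omega> s) - q * ?H s" if "s \<in> ?T" "0 < jmp \<omega> s" for s
    using that factor_pos[OF \<omega>, of s "jmp \<omega> s"]
    by (simp add: D.\<beta>J_def D0.\<beta>J_def \<beta>_good[OF \<omega>] tilted_def q ln_mult)
  then have "(\<integral>s. ln (1 + D.\<beta>J \<omega> s) * indicator ?T s \<partial>?C) = (\<integral>s. ln (1 + D0.\<beta>J \<omega> s) * indicator ?T s - q * (?H s * indicator ?T s) \<partial>?C)"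
    by (intro Bochner_Integration.integral_cong) auto
  also have "\<dots> = (\<integral>s. ln (1 + D0.\<beta>J \<omega> s) * indicator ?T s \<partial>?C) - q * \<Xi> t \<omega>"
    unfolding vH[symmetric] using l(2) iH by (subst Bochner_Integration.integral_diff) auto
  finally have "D.jump_product_over ?T \<omega> = D0.jump_product_over ?T \<omega> * exp (- q * \<Xi> t \<omega>)"
    unfolding D.integral_count_space_jumps(1)[OF \<omega>P order_refl l(1)] D0.integral_count_space_jumps(1)[OF \<omega>P order_refl l(2)]
    using s by (simp add: D.jump_product_over_def D0.jump_product_over_def exp_add[symmetric])
  then show ?thesis
    unfolding D.Z_def M_eq_Z[OF \<omega> t] total_rate_good[OF \<omega> t] by (simp add: exp_add[symmetric] algebra_simps)
qed

lemma AE_Z_eq: "0 \<le> t \<Longrightarrow> AE \<omega> in P. D.Z t \<omega> = M t \<omega> * exp (- q * \<Xi> t \<omega>) * exp (t * \<Psi> q)"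
  using D.AE_summable_jumps[of t] D0.AE_summable_jumps[of t] AE_good by (auto simp: Z_eq elim!: eventually_elim2)

text \<open>The deterministic factors exp (t \<Psi> q) and exp (u \<Psi> q) are moved out of the
  martingale property of Z.\<close>

lemma tilted_martingale:
  assumes u: "0 \<le> u" "u \<le> t" and W: "W \<in> borel_measurable (F u)"
  shows "(\<integral>\<^sup>+\<omega>. W \<omega> * ennreal (M t \<omega> * exp (- q * \<Xi> t \<omega>)) \<partial>P) =
    ennreal (exp (- (t - u) * \<Psi> q)) * (\<integral>\<^sup>+\<omega>. W \<omega> * ennreal (M u \<omega> * exp (- q * \<Xi> u \<omega>)) \<partial>P)"
proof -
  let ?m = "\<lambda>s. \<integral>\<^sup>+\<omega>. W \<omega> * ennreal (M s \<omega> * exp (- q * \<Xi> s \<omega>)) \<partial>P"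
  have Z: "(\<integral>\<^sup>+\<omega>. W \<omega> * ennreal (D.Z s \<omega>) \<partial>P) = ennreal (exp (s * \<Psi> q)) * ?m s" if s: "u \<le> s" for s
  proof -
    have s0: "0 \<le> s" using u s by simp
    have [measurable]: "W \<in> borel_measurable P" "M s \<in> borel_measurable P" "\<Xi> s \<in> borel_measurable P"
      using measurable_F_P W M_adapted \<Xi>_adapted s0 by blast+
    have "(\<integral>\<^sup>+\<omega>. W \<omega> * ennreal (D.Z s \<omega>) \<partial>P) = (\<integral>\<^sup>+\<omega>. ennreal (exp (s * \<Psi> q)) * (W \<omega> * ennreal (M s \<omega> * exp (- q * \<Xi> s \<omega>))) \<partial>P)"
      using AE_Z_eq[OF s0] by (intro nn_integral_cong_AE) (auto elim!: eventually_mono simp: ennreal_mult' ac_simps)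
    then show ?thesis by (simp add: nn_integral_cmult)
  qed
  have "?m t = ennreal (exp (- (t * \<Psi> q))) * (ennreal (exp (t * \<Psi> q)) * ?m t)"
    by (simp add: mult.assoc[symmetric] ennreal_mult[symmetric] exp_add[symmetric])
  also have "ennreal (exp (t * \<Psi> q)) * ?m t = ennreal (exp (u * \<Psi> q)) * ?m u"
    using D.exponential_martingale[OF u W] Z[of t] Z[of u] u by simp
  finally show ?thesis
    by (simp add: mult.assoc[symmetric] ennreal_mult[symmetric] exp_add[symmetric] algebra_simps)
qed

end

lemma M_zero: "good \<omega> \<Longrightarrow> M 0 \<omega> = 1"
proof -
  interpret D0: jump_density P X g g0 "\<beta> 0" "bound 0" by (rule jump_density_\<beta>) simp
  show "good \<omega> \<Longrightarrow> M 0 \<omega> = 1"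
    using D0.Z_zero[of \<omega>] total_rate_good[of 0 \<omega> 0] by (simp add: M_eq_Z[of 0] D0.Z_def good_def)
qed

lemma \<Xi>_zero: "\<omega> \<in> space P \<Longrightarrow> \<Xi> 0 \<omega> = 0" by (simp add: \<Xi>_eq jump_sum_def)

lemma M_nonneg: "good \<omega> \<Longrightarrow> 0 \<le> t \<Longrightarrow> 0 \<le> M t \<omega>"
proof -
  interpret D0: jump_density P X g g0 "\<beta> 0" "bound 0" by (rule jump_density_\<beta>) simp
  show "good \<omega> \<Longrightarrow> 0 \<le> t \<Longrightarrow> 0 \<le> M t \<omega>" by (simp add: M_eq_Z[of 0] D0.jump_product_over_def)
qed

lemma AE_M_pos: "AE \<omega> in P. \<forall>t\<ge>0. 0 < M t \<omega>"
proof -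
  interpret D0: jump_density P X g g0 "\<beta> 0" "bound 0" by (rule jump_density_\<beta>) simp
  \<comment> \<open>Integer horizons give one null set for all times, since summability up to n
    implies summability up to every t <= n.\<close>
  have "AE \<omega> in P. \<forall>n. D0.summable_jumps {0<..real n} \<omega>"
    by (subst AE_all_countable) (intro allI D0.AE_summable_jumps, simp)
  with AE_good show ?thesis
  proof eventually_elim
    case (elim \<omega>)
    show ?case
    proof (intro allI impI)
      fix t :: real assume t: "0 \<le> t"
      obtain n where "t \<le> real n" using real_arch_simple by blast
      then have "{0<..t} \<subseteq> {0<..real n}" by auto
      from le_less_trans[OF jump_sum_mono_set[OF this] elim(2)[rule_format, of n, unfolded D0.summable_jumps_def]]
      have "D0.summable_jumps {0<..t} \<omega>" unfolding D0.summable_jumps_def .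
      then show "0 < M t \<omega>" using t elim(1) by (simp add: M_eq_Z[of 0] D0.jump_product_over_def)
    qed
  qed
qed

lemma M_martingale:
  "0 \<le> u \<Longrightarrow> u \<le> t \<Longrightarrow> W \<in> borel_measurable (F u) \<Longrightarrow> (\<integral>\<^sup>+\<omega>. W \<omega> * ennreal (M t \<omega>) \<partial>P) = (\<integral>\<^sup>+\<omega>. W \<omega> * ennreal (M u \<omega>) \<partial>P)"
  using tilted_martingale[of 0 u t W] by simp

end

section \<open>Laws of processes with independent increments\<close>

text \<open>Instantiated for X under P and for \<Xi> under the new measure, with the same increment
  laws K.\<close>

locale independent_increments = prob_space P for P :: "'a measure" +
  fixes Fi :: "real \<Rightarrow> 'a measure" and Y :: "real \<Rightarrow> 'a \<Rightarrow> real" and K :: "real \<Rightarrow> real measure"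
  assumes Y_adapted: "\<And>s u. 0 \<le> s \<Longrightarrow> s \<le> u \<Longrightarrow> Y s \<in> borel_measurable (Fi u)"
    and Fi: "\<And>u. 0 \<le> u \<Longrightarrow> subalgebra P (Fi u)"
    and Y_0: "\<And>\<omega>. \<omega> \<in> space P \<Longrightarrow> Y 0 \<omega> = 0"
    and K: "\<And>t. 0 \<le> t \<Longrightarrow> prob_space (K t)" "\<And>t. 0 \<le> t \<Longrightarrow> sets (K t) = sets borel"
    and indep: "\<And>u w A C. 0 \<le> u \<Longrightarrow> u \<le> w \<Longrightarrow> A \<in> sets (Fi u) \<Longrightarrow> C \<in> sets borel \<Longrightarrow>
      emeasure P (A \<inter> ((\<lambda>\<omega>. Y w \<omega> - Y u \<omega>) -` C \<inter> space P)) = emeasure P A * emeasure (K (w - u)) C"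
begin

lemma Y_measurable: "0 \<le> s \<Longrightarrow> Y s \<in> borel_measurable P"
  using measurable_from_subalg[OF Fi Y_adapted] by blast

definition fdd :: "real set \<Rightarrow> (real \<Rightarrow> real) measure" where
  "fdd J = distr P (PiM J (\<lambda>_. borel)) (\<lambda>\<omega>. \<lambda>j\<in>J. Y j \<omega>)"

lemma sets_fdd: "sets (fdd J) = sets (PiM J (\<lambda>_. borel))" by (simp add: fdd_def)

lemma vec_measurable: "J \<subseteq> {0..u} \<Longrightarrow> (\<lambda>\<omega>. \<lambda>j\<in>J. Y j \<omega>) \<in> Fi u \<rightarrow>\<^sub>M PiM J (\<lambda>_. borel)"
  by (rule measurable_restrict) (auto intro!: Y_adapted)

lemma vec_measurable_P: "J \<subseteq> {0..} \<Longrightarrow> (\<lambda>\<omega>. \<lambda>j\<in>J. Y j \<omega>) \<in> P \<rightarrow>\<^sub>M PiM J (\<lambda>_. borel)"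
  by (rule measurable_restrict) (auto intro!: Y_measurable)

lemma fdd_increment:
  assumes J: "J \<subseteq> {0..u}" and u: "0 \<le> u" "u \<le> w"
  shows "fdd J \<Otimes>\<^sub>M K (w - u) = distr P (PiM J (\<lambda>_. borel) \<Otimes>\<^sub>M borel) (\<lambda>\<omega>. (\<lambda>j\<in>J. Y j \<omega>, Y w \<omega> - Y u \<omega>))"
proof (rule pair_measure_eqI)
  have J0: "J \<subseteq> {0..}" using J by auto
  note [measurable] = vec_measurable_P[OF J0]
  have [measurable]: "(\<lambda>\<omega>. Y w \<omega> - Y u \<omega>) \<in> borel_measurable P" using u Y_measurable by (intro borel_measurable_diff) auto
  have KS: "sets (K (w - u)) = sets borel" using u by (intro K) simp
  show "sigma_finite_measure (fdd J)" unfolding fdd_def by (intro prob_space_imp_sigma_finite prob_space_distr) simp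
  show "sigma_finite_measure (K (w - u))" using u by (intro prob_space_imp_sigma_finite K) simp
  show "sets (fdd J \<Otimes>\<^sub>M K (w - u)) = sets (distr P (PiM J (\<lambda>_. borel) \<Otimes>\<^sub>M borel) (\<lambda>\<omega>. (\<lambda>j\<in>J. Y j \<omega>, Y w \<omega> - Y u \<omega>)))"
    by (simp cong: sets_pair_measure_cong add: sets_fdd KS)
  fix A B assume "A \<in> sets (fdd J)" "B \<in> sets (K (w - u))"
  then have A[measurable]: "A \<in> sets (PiM J (\<lambda>_. borel))" and B[measurable]: "B \<in> sets borel" by (auto simp: sets_fdd KS)
  let ?A = "(\<lambda>\<omega>. \<lambda>j\<in>J. Y j \<omega>) -` A \<inter> space P"
  have "space (Fi u) = space P" using Fi[OF u(1)] by (simp add: subalgebra_def)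
  with measurable_sets[OF vec_measurable[OF J] A] have "?A \<in> sets (Fi u)" by simp
  from indep[OF u this B] show "emeasure (fdd J) A * emeasure (K (w - u)) B =
      emeasure (distr P (PiM J (\<lambda>_. borel) \<Otimes>\<^sub>M borel) (\<lambda>\<omega>. (\<lambda>j\<in>J. Y j \<omega>, Y w \<omega> - Y u \<omega>))) (A \<times> B)"
    by (simp add: fdd_def emeasure_distr vimage_Times Int_ac vimage_def Collect_conj_eq[symmetric] Int_def conj_ac)
qed

lemma fdd_restrict:
  assumes "J \<subseteq> H" "H \<subseteq> {0..}" shows "fdd J = distr (fdd H) (PiM J (\<lambda>_. borel)) (\<lambda>v. restrict v J)"
  unfolding fdd_def using assms(1)
  by (subst distr_distr[OF measurable_restrict_subset[OF assms(1)] vec_measurable_P[OF assms(2)]])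
    (auto intro!: distr_cong simp: fun_eq_iff)

lemma extend_measurable:
  assumes "u \<in> J" shows "(\<lambda>(v, y). \<lambda>j\<in>insert b J. if j = b then v u + y else v j) \<in> PiM J (\<lambda>_. borel) \<Otimes>\<^sub>M borel \<rightarrow>\<^sub>M PiM (insert b J) (\<lambda>_. borel :: real measure)"
proof -
  have "(\<lambda>p. \<lambda>j\<in>insert b J. if j = b then fst p u + snd p else fst p j) \<in> PiM J (\<lambda>_. borel) \<Otimes>\<^sub>M borel \<rightarrow>\<^sub>M PiM (insert b J) (\<lambda>_. borel :: real measure)"
  proof (rule measurable_restrict)
    fix j assume j: "j \<in> insert b J"
    have m[measurable]: "(\<lambda>p. fst p i) \<in> borel_measurable (PiM J (\<lambda>_. borel) \<Otimes>\<^sub>M (borel :: real measure))" if "i \<in> J" for i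
      using that by measurable
    show "(\<lambda>p. if j = b then fst p u + snd p else fst p j) \<in> borel_measurable (PiM J (\<lambda>_. borel) \<Otimes>\<^sub>M (borel :: real measure))"
      using j assms by (cases "j = b") auto
  qed
  then show ?thesis by (simp add: split_beta)
qed

lemma fdd_extend:
  assumes J: "J \<subseteq> {0..u}" "u \<in> J" and u: "0 \<le> u" "u < b"
  shows "fdd (insert b J) = distr (fdd J \<Otimes>\<^sub>M K (b - u)) (PiM (insert b J) (\<lambda>_. borel)) (\<lambda>(v, y). \<lambda>j\<in>insert b J. if j = b then v u + y else v j)"
proof -
  have m: "(\<lambda>\<omega>. (\<lambda>j\<in>J. Y j \<omega>, Y b \<omega> - Y u \<omega>)) \<in> P \<rightarrow>\<^sub>M PiM J (\<lambda>_. borel) \<Otimes>\<^sub>M borel"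
    using J u by (intro measurable_Pair vec_measurable_P borel_measurable_diff Y_measurable) auto
  show ?thesis unfolding fdd_increment[OF J(1) u(1) less_imp_le[OF u(2)]]
    by (subst distr_distr[OF extend_measurable[OF J(2)] m]) (use J(2) u in \<open>auto simp: fdd_def fun_eq_iff intro!: distr_cong\<close>)
qed

end

text \<open>Finite-dimensional laws are built up by appending the largest time, which adds an
  independent increment with law K. Time 0 is kept in the index set so that every new time has a
  predecessor; other index sets follow by restriction.\<close>

lemma same_law_independent_increments:
  assumes P: "independent_increments P Fi Y K" and Q: "independent_increments Q Gi Z K"
  shows "same_law P Y Q Z"
proof -
  interpret P: independent_increments P Fi Y K by fact
  interpret Q: independent_increments Q Gi Z K by fact
  have base: "P.fdd {0} = Q.fdd {0}"
  proof -
    let ?z = "\<lambda>j\<in>{0::real}. 0 :: real" and ?N = "PiM {0::real} (\<lambda>_. borel :: real measure)"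
    have z: "?z \<in> space ?N" by (simp add: space_PiM)
    have "P.fdd {0} = distr P ?N (\<lambda>_. ?z)" unfolding P.fdd_def by (rule distr_cong) (auto simp: P.Y_0)
    moreover have "Q.fdd {0} = distr Q ?N (\<lambda>_. ?z)" unfolding Q.fdd_def by (rule distr_cong) (auto simp: Q.Y_0)
    ultimately show ?thesis using P.distr_const[OF z] Q.distr_const[OF z] by simp
  qed
  have pos: "P.fdd (insert 0 J) = Q.fdd (insert 0 J)" if "finite J" "J \<subseteq> {0<..}" for J
    using that
  proof (induction J rule: finite_linorder_max_induct)
    case (insert b J)
    define u where "u = Max (insert 0 J)"
    have u: "u \<in> insert 0 J" "\<And>j. j \<in> insert 0 J \<Longrightarrow> j \<le> u" unfolding u_def
      using insert.hyps(1) Max_in[of "insert 0 J"] Max_ge[of "insert 0 J"] by blast+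
    have J: "insert 0 J \<subseteq> {0..u}" using u(2) insert.prems by (auto intro: less_imp_le)
    have b: "0 \<le> u" "u < b" using u insert.hyps insert.prems by auto
    have "P.fdd (insert b (insert 0 J)) = Q.fdd (insert b (insert 0 J))"
      unfolding P.fdd_extend[OF J u(1) b] Q.fdd_extend[OF J u(1) b] using insert by simp
    then show ?case by (simp add: insert_commute)
  qed (rule base)
  have fdd: "P.fdd J = Q.fdd J" if J: "finite J" "J \<subseteq> {0..}" for J
  proof -
    have s: "J \<subseteq> insert 0 (J - {0})" "insert 0 (J - {0}) \<subseteq> {0..}" "J - {0} \<subseteq> {0<..}" using J by (auto simp: less_le)
    show ?thesis unfolding P.fdd_restrict[OF s(1,2)] Q.fdd_restrict[OF s(1,2)] using pos[OF _ s(3)] J by simp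
  qed
  let ?N = "PiM {0..} (\<lambda>_. borel :: real measure)"
  note m = P.vec_measurable_P[OF order_refl] Q.vec_measurable_P[OF order_refl]
  have "distr P ?N (\<lambda>\<omega>. \<lambda>t\<in>{0..}. Y t \<omega>) = distr Q ?N (\<lambda>\<omega>. \<lambda>t\<in>{0..}. Z t \<omega>)"
  proof (rule measure_eqI_PiM_infinite)
    fix A and J :: "real set" assume J: "finite J" "J \<subseteq> {0..}" and A: "\<And>i. i \<in> J \<Longrightarrow> A i \<in> sets (borel :: real measure)"
    have B: "Pi\<^sub>E J A \<in> sets (PiM J (\<lambda>_. borel))" using A J by (intro sets_PiM_I_finite)
    have S: "prod_emb {0..} (\<lambda>_. borel) J (Pi\<^sub>E J A) \<in> sets ?N" using J A by (intro sets_PiM_I) auto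
    have "emeasure (distr P ?N (\<lambda>\<omega>. \<lambda>t\<in>{0..}. Y t \<omega>)) (prod_emb {0..} (\<lambda>_. borel) J (Pi\<^sub>E J A)) = emeasure (P.fdd J) (Pi\<^sub>E J A)"
      unfolding P.fdd_def emeasure_distr[OF m(1) S] emeasure_distr[OF P.vec_measurable_P[OF J(2)] B]
      using J(2) by (intro arg_cong[where f="emeasure P"]) (auto simp: prod_emb_def restrict_restrict Int_absorb1)
    moreover have "emeasure (distr Q ?N (\<lambda>\<omega>. \<lambda>t\<in>{0..}. Z t \<omega>)) (prod_emb {0..} (\<lambda>_. borel) J (Pi\<^sub>E J A)) = emeasure (Q.fdd J) (Pi\<^sub>E J A)"
      unfolding Q.fdd_def emeasure_distr[OF m(2) S] emeasure_distr[OF Q.vec_measurable_P[OF J(2)] B]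
      using J(2) by (intro arg_cong[where f="emeasure Q"]) (auto simp: prod_emb_def restrict_restrict Int_absorb1)
    ultimately show "emeasure (distr P ?N (\<lambda>\<omega>. \<lambda>t\<in>{0..}. Y t \<omega>)) (prod_emb {0..} (\<lambda>_. borel) J (Pi\<^sub>E J A)) =
      emeasure (distr Q ?N (\<lambda>\<omega>. \<lambda>t\<in>{0..}. Z t \<omega>)) (prod_emb {0..} (\<lambda>_. borel) J (Pi\<^sub>E J A))"
      using fdd[OF J] by simp
  qed (auto intro!: prob_space.finite_measure P.prob_space_distr m)
  then show ?thesis unfolding same_law_def using P.Y_measurable Q.Y_measurable by auto
qed

lemma (in increasing_levy) independent_increments_X: "independent_increments P F X law"
proof (intro independent_increments.intro independent_increments_axioms.intro prob_space_axioms)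
  fix u w A C assume u: "0 \<le> u" "u \<le> w" and A: "A \<in> sets (F u)" and C: "C \<in> sets (borel :: real measure)"
  have [measurable]: "(\<lambda>\<omega>. X w \<omega> - X u \<omega>) \<in> borel_measurable P" using u by (intro borel_measurable_diff X_measurable_P) auto
  have "emeasure (law (w - u)) C = prob ((\<lambda>\<omega>. X w \<omega> - X u \<omega>) -` C \<inter> space P)"
    using C by (simp add: increment_law[OF u, symmetric] emeasure_distr emeasure_eq_measure)
  then show "emeasure P (A \<inter> ((\<lambda>\<omega>. X w \<omega> - X u \<omega>) -` C \<inter> space P)) = emeasure P A * emeasure (law (w - u)) C"
    by (simp add: emeasure_eq_measure increment_indep[OF u A C] ennreal_mult)
qed (simp_all add: X_adapted subalgebra_F X_0 prob_space_law)

lemma (in increasing_levy) space_gen[simp]: "space (generated_sigma (space P) X T) = space P"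
  unfolding generated_sigma_def by (rule space_measure_of) auto

context increasing_levy
begin

abbreviation F_inf where "F_inf \<equiv> generated_sigma (space P) X {0..}"

lemma sets_F_inf: "sets F_inf = sigma_sets (space P) (\<Union>t\<in>{0..}. sets (F t))"
proof -
  have "sets F_inf = sigma_sets (space P) {X s -` A \<inter> space P |s A. s \<in> {0..} \<and> A \<in> sets borel}"
    unfolding generated_sigma_def by (rule sets_measure_of) auto
  also have "\<dots> = sigma_sets (space P) (\<Union>t\<in>{0..}. sets (F t))"
  proof (rule sigma_sets_eqI)
    fix a assume "a \<in> {X s -` A \<inter> space P |s A. s \<in> {0..} \<and> A \<in> sets (borel :: real measure)}"
    then obtain s A where a: "a = X s -` A \<inter> space P" "0 \<le> s" "A \<in> sets borel" by auto
    then have "a \<in> sets (F s)" using measurable_sets[OF X_adapted[of s s], of A] by simp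
    then show "a \<in> sigma_sets (space P) (\<Union>t\<in>{0..}. sets (F t))" using a by (intro sigma_sets.Basic) auto
  next
    fix b assume "b \<in> (\<Union>t\<in>{0..}. sets (F t))"
    then obtain t where "b \<in> sets (F t)" by auto
    then show "b \<in> sigma_sets (space P) {X s -` A \<inter> space P |s A. s \<in> {0..} \<and> A \<in> sets borel}"
      unfolding sets_F by (rule rev_subsetD) (rule sigma_sets_mono', auto)
  qed
  finally show ?thesis .
qed

lemma sets_F_F_inf: "0 \<le> t \<Longrightarrow> sets (F t) \<subseteq> sets F_inf"
  unfolding sets_F_inf by (auto intro: sigma_sets.Basic)

lemma Int_stable_F: "Int_stable (\<Union>t\<in>{0..}. sets (F t))"
proof (rule Int_stableI)
  fix a b assume "a \<in> (\<Union>t\<in>{0..}. sets (F t))" "b \<in> (\<Union>t\<in>{0..}. sets (F t))"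
  then obtain s t where "0 \<le> s" "a \<in> sets (F s)" "0 \<le> t" "b \<in> sets (F t)" by auto
  then have "a \<in> sets (F (max s t))" "b \<in> sets (F (max s t))" "0 \<le> max s t"
    using sets_F_mono[of s "max s t"] sets_F_mono[of t "max s t"] by auto
  then show "a \<inter> b \<in> (\<Union>t\<in>{0..}. sets (F t))" by (intro UN_I[of "max s t"]) auto
qed

end

section \<open>Martingale property, uniqueness and the law under the new measure\<close>

context girsanov
begin

lemma M_measurable_P: "0 \<le> t \<Longrightarrow> M t \<in> borel_measurable P"
  using measurable_F_P[OF M_adapted] .

lemma M_nn_integral: "0 \<le> t \<Longrightarrow> (\<integral>\<^sup>+\<omega>. ennreal (M t \<omega>) \<partial>P) = 1"
proof -
  assume t: "0 \<le> t"
  have "(\<integral>\<^sup>+\<omega>. ennreal (M t \<omega>) \<partial>P) = (\<integral>\<^sup>+\<omega>. ennreal (M 0 \<omega>) \<partial>P)"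
    using M_martingale[of 0 t "\<lambda>_. 1"] t by simp
  also have "\<dots> = (\<integral>\<^sup>+\<omega>. 1 \<partial>P)" using AE_good by (intro nn_integral_cong_AE) (auto elim!: eventually_mono simp: M_zero)
  finally show ?thesis by (simp add: emeasure_space_1)
qed

lemma AE_M_nonneg: "0 \<le> t \<Longrightarrow> AE \<omega> in P. 0 \<le> M t \<omega>"
  using AE_good by eventually_elim (rule M_nonneg)

lemma M_integrable: "0 \<le> t \<Longrightarrow> integrable P (M t)"
  by (rule integrableI_nonneg) (auto simp: M_nn_integral AE_M_nonneg M_measurable_P)

lemma M_expectation: "0 \<le> t \<Longrightarrow> (\<integral>\<omega>. M t \<omega> \<partial>P) = 1"
  using integral_eq_nn_integral[of "M t" P] by (simp add: M_nn_integral AE_M_nonneg M_measurable_P)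

lemma martingale_M: "martingale P F M"
  unfolding martingale_def
proof (intro conjI allI impI)
  fix s t :: real assume s: "0 \<le> s" and t: "s \<le> t"
  interpret S: finite_measure_subalgebra P "F s" by unfold_locales (rule subalgebra_F)
  show "AE \<omega> in P. real_cond_exp P (F s) (M t) \<omega> = M s \<omega>"
  proof (rule S.real_cond_exp_charact)
    fix A assume A: "A \<in> sets (F s)"
    then have AP[measurable]: "A \<in> sets P" using sets_F_subset by auto
    have v: "(\<integral>\<omega>\<in>A. M r \<omega> \<partial>P) = enn2real (\<integral>\<^sup>+\<omega>. indicator A \<omega> * ennreal (M r \<omega>) \<partial>P)" if r: "0 \<le> r" for r
    proof -
      have [measurable]: "M r \<in> borel_measurable P" by (rule M_measurable_P[OF r])
      have "(\<integral>\<omega>\<in>A. M r \<omega> \<partial>P) = enn2real (\<integral>\<^sup>+\<omega>. ennreal (indicator A \<omega> * M r \<omega>) \<partial>P)"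
        unfolding set_lebesgue_integral_def real_scaleR_def using AE_M_nonneg[OF r]
        by (intro integral_eq_nn_integral) (auto elim!: eventually_mono)
      then show ?thesis by (simp add: ennreal_mult' ennreal_indicator)
    qed
    show "(\<integral>\<omega>\<in>A. M t \<omega> \<partial>P) = (\<integral>\<omega>\<in>A. M s \<omega> \<partial>P)"
      using s t M_martingale[OF s t, of "indicator A"] A by (simp add: v)
  qed (use s t M_integrable M_adapted in auto)
qed (simp_all add: filtration_F subalgebra_F M_adapted M_integrable)

lemma nn_integral_local_density:
  assumes Q: "local_density_measure P X M Q" and t: "0 \<le> t" and f[measurable]: "f \<in> borel_measurable (F t)"
  shows "(\<integral>\<^sup>+\<omega>. f \<omega> \<partial>Q) = (\<integral>\<^sup>+\<omega>. f \<omega> * ennreal (M t \<omega>) \<partial>P)"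
proof -
  have sub: "subalgebra Q (F t)" using Q sets_F_F_inf[OF t] by (simp add: subalgebra_def local_density_measure_def)
  note [measurable_cong] = sets_restr_to_subalg[OF subalgebra_F[of t]]
  note [measurable] = M_adapted[OF t]
  have "(\<integral>\<^sup>+\<omega>. f \<omega> \<partial>Q) = (\<integral>\<^sup>+\<omega>. f \<omega> \<partial>restr_to_subalg Q (F t))"
    by (rule nn_integral_subalgebra2[OF sub f, symmetric])
  also have "restr_to_subalg Q (F t) = density (restr_to_subalg P (F t)) (\<lambda>\<omega>. ennreal (M t \<omega>))"
    using Q t by (simp add: local_density_measure_def)
  also have "(\<integral>\<^sup>+\<omega>. f \<omega> \<partial>\<dots>) = (\<integral>\<^sup>+\<omega>. ennreal (M t \<omega>) * f \<omega> \<partial>restr_to_subalg P (F t))"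
    by (rule nn_integral_density) measurable
  also have "\<dots> = (\<integral>\<^sup>+\<omega>. ennreal (M t \<omega>) * f \<omega> \<partial>P)"
    by (rule nn_integral_subalgebra2[OF subalgebra_F]) measurable
  finally show ?thesis by (simp add: mult.commute)
qed

lemma emeasure_local_density:
  assumes Q: "local_density_measure P X M Q" and t: "0 \<le> t" and A: "A \<in> sets (F t)"
  shows "emeasure Q A = (\<integral>\<^sup>+\<omega>. indicator A \<omega> * ennreal (M t \<omega>) \<partial>P)"
proof -
  have "A \<in> sets Q" using Q A sets_F_F_inf[OF t] by (auto simp: local_density_measure_def)
  then show ?thesis using nn_integral_local_density[OF Q t, of "indicator A"] A by simp
qed

lemma local_density_unique:
  assumes Q: "local_density_measure P X M Q" and R: "local_density_measure P X M R"
  shows "Q = R"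
proof (rule measure_eqI_generator_eq[OF Int_stable_F])
  interpret Q: prob_space Q using Q by (simp add: local_density_measure_def)
  show "(\<Union>t\<in>{0..}. sets (F t)) \<subseteq> Pow (space P)" using sets.sets_into_space[of _ "F _"] by fastforce
  show "emeasure Q A = emeasure R A" if "A \<in> (\<Union>t\<in>{0..}. sets (F t))" for A
    using that emeasure_local_density[OF Q] emeasure_local_density[OF R] by fastforce
  show "sets Q = sigma_sets (space P) (\<Union>t\<in>{0..}. sets (F t))" "sets R = sigma_sets (space P) (\<Union>t\<in>{0..}. sets (F t))"
    using Q R by (simp_all add: local_density_measure_def sets_F_inf)
  have "space P \<in> sets (F 0)" using sets.top[of "F 0"] by simp
  then show "range (\<lambda>_ :: nat. space P) \<subseteq> (\<Union>t\<in>{0..}. sets (F t))" by force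
  show "(\<Union>i :: nat. space P) = space P" by simp
  show "emeasure Q (space P) \<noteq> \<infinity>" for i :: nat by simp
qed

lemma laplace_law: "0 \<le> t \<Longrightarrow> (\<integral>\<^sup>+y. ennreal (exp (- real k * y)) \<partial>law t) = ennreal (exp (- t * \<Psi> (real k)))"
proof -
  assume t: "0 \<le> t"
  have [measurable]: "X t \<in> borel_measurable P" using t by simp
  have "integrable P (\<lambda>\<omega>. exp (- real k * X t \<omega>))"
    by (rule integrable_const_bound[where B=1]) (auto intro!: AE_I2 mult_nonneg_nonneg path_nonneg[OF path t])
  then have "(\<integral>\<^sup>+\<omega>. ennreal (exp (- real k * X t \<omega>)) \<partial>P) = ennreal (\<integral>\<omega>. exp (- real k * X t \<omega>) \<partial>P)"
    by (intro nn_integral_eq_integral) auto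
  then show ?thesis unfolding law_def laplace[OF t of_nat_0_le_iff] by (subst nn_integral_distr) auto
qed

text \<open>With the weight exp (k * \<Xi> u) on A, the tilted martingale for q = k gives the k-th
  exponential moment of the increment on A, equal to Q(A) times that of the subordinator's law. Such
  moments for all natural k determine a finite measure on the half-line.\<close>

lemma increment_local_density:
  assumes Q: "local_density_measure P X M Q" and u: "0 \<le> u" "u \<le> w" and A: "A \<in> sets (F u)" and C: "C \<in> sets borel"
  shows "emeasure Q (A \<inter> ((\<lambda>\<omega>. \<Xi> w \<omega> - \<Xi> u \<omega>) -` C \<inter> space Q)) = emeasure Q A * emeasure (law (w - u)) C"
proof -
  let ?D = "\<lambda>\<omega>. \<Xi> w \<omega> - \<Xi> u \<omega>"
  have w: "0 \<le> w" "0 \<le> w - u" using u by auto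
  have spQ: "space Q = space P" using Q by (simp add: local_density_measure_def)
  interpret Q: prob_space Q using Q by (simp add: local_density_measure_def)
  have FQ: "f \<in> borel_measurable Q" if "f \<in> borel_measurable (F w)" for f :: "'a \<Rightarrow> real"
    by (rule measurable_from_subalg[OF _ that]) (use Q sets_F_F_inf[OF w(1)] in \<open>simp add: subalgebra_def local_density_measure_def\<close>)
  have A': "A \<in> sets (F w)" using A sets_F_mono[OF u(2)] by auto
  then have AQ[measurable]: "A \<in> sets Q" using Q sets_F_F_inf[OF w(1)] by (auto simp: local_density_measure_def)
  note [measurable] = \<Xi>_adapted[OF w(1)] \<Xi>_adapted[OF u(1)] measurable_F_mono[OF u(2) \<Xi>_adapted[OF u(1)]]
  have DF[measurable]: "?D \<in> borel_measurable (F w)" by measurable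
  note DQ[measurable] = FQ[OF DF]
  define M1 where "M1 = distr (density Q (indicator A)) borel ?D"
  define M2 where "M2 = density (law (w - u)) (\<lambda>_. emeasure Q A)"
  interpret L: prob_space "law (w - u)" by (rule prob_space_law[OF w(2)])
  have e1: "(\<integral>\<^sup>+x. f x \<partial>M1) = (\<integral>\<^sup>+\<omega>. indicator A \<omega> * f (?D \<omega>) \<partial>Q)" if [measurable]: "f \<in> borel_measurable borel" for f
    unfolding M1_def by (subst nn_integral_distr) (auto simp: nn_integral_density)
  have e2: "(\<integral>\<^sup>+x. f x \<partial>M2) = emeasure Q A * (\<integral>\<^sup>+y. f y \<partial>law (w - u))" if [measurable]: "f \<in> borel_measurable borel" for f
    unfolding M2_def by (subst nn_integral_density) (auto simp: nn_integral_cmult)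
  have "M1 = M2"
  proof (rule finite_measure_eqI_exp_moments)
    have "emeasure M1 (space M1) = emeasure Q A" using e1[of "\<lambda>_. 1"] by simp
    then show "finite_measure M1" by (intro finite_measureI) simp
    have "emeasure M2 (space M2) = emeasure Q A" using e2[of "\<lambda>_. 1"] by (simp add: L.emeasure_space_1)
    then show "finite_measure M2" by (intro finite_measureI) simp
    show "AE x in M2. 0 \<le> x" unfolding M2_def using law_nonneg[OF w(2)] by (subst AE_density) auto
    \<comment> \<open>Monotonicity of \<Xi> on good paths is an almost sure statement under P; it is
      carried to Q by the density at time w.\<close>
    have "(\<integral>\<^sup>+x. indicator {..<0} x \<partial>M1) = (\<integral>\<^sup>+\<omega>. indicator A \<omega> * indicator {..<0} (?D \<omega>) * ennreal (M w \<omega>) \<partial>P)"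
      using A' by (subst e1, simp, subst nn_integral_local_density[OF Q w(1)]) auto
    also have "\<dots> = (\<integral>\<^sup>+\<omega>. 0 \<partial>P)"
      by (rule nn_integral_cong_AE, use AE_good in eventually_elim) (use \<Xi>_mono[OF _ u] in \<open>auto split: split_indicator dest: leD\<close>)
    finally show "AE x in M1. 0 \<le> x" by (subst (asm) nn_integral_indicator) (auto simp: M1_def AE_iff_measurable[OF _ refl] not_le lessThan_def)
    fix k :: nat
    have "(\<integral>\<^sup>+x. ennreal (exp (- real k * x)) \<partial>M1) = (\<integral>\<^sup>+\<omega>. indicator A \<omega> * ennreal (exp (- real k * ?D \<omega>)) * ennreal (M w \<omega>) \<partial>P)"
      using A' by (subst e1, simp, subst nn_integral_local_density[OF Q w(1)]) auto
    also have "\<dots> = (\<integral>\<^sup>+\<omega>. (indicator A \<omega> * ennreal (exp (real k * \<Xi> u \<omega>))) * ennreal (M w \<omega> * exp (- real k * \<Xi> w \<omega>)) \<partial>P)"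
    proof (intro nn_integral_cong)
      fix \<omega>
      have e: "exp (- real k * ?D \<omega>) = exp (real k * \<Xi> u \<omega>) * exp (- real k * \<Xi> w \<omega>)"
        by (simp add: exp_add[symmetric] algebra_simps)
      show "indicator A \<omega> * ennreal (exp (- real k * ?D \<omega>)) * ennreal (M w \<omega>) = indicator A \<omega> * ennreal (exp (real k * \<Xi> u \<omega>)) * ennreal (M w \<omega> * exp (- real k * \<Xi> w \<omega>))"
        unfolding e ennreal_mult''[OF exp_ge_zero] by (simp only: ac_simps)
    qed
    also have "\<dots> = ennreal (exp (- (w - u) * \<Psi> (real k))) * (\<integral>\<^sup>+\<omega>. (indicator A \<omega> * ennreal (exp (real k * \<Xi> u \<omega>))) * ennreal (M u \<omega> * exp (- real k * \<Xi> u \<omega>)) \<partial>P)"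
      using A by (intro tilted_martingale u) auto
    also have "(\<integral>\<^sup>+\<omega>. (indicator A \<omega> * ennreal (exp (real k * \<Xi> u \<omega>))) * ennreal (M u \<omega> * exp (- real k * \<Xi> u \<omega>)) \<partial>P) = emeasure Q A"
      unfolding emeasure_local_density[OF Q u(1) A]
    proof (intro nn_integral_cong)
      fix \<omega>
      have "ennreal (exp (real k * \<Xi> u \<omega>)) * ennreal (M u \<omega> * exp (- real k * \<Xi> u \<omega>)) = ennreal (exp (real k * \<Xi> u \<omega>) * (M u \<omega> * exp (- real k * \<Xi> u \<omega>)))"
        by (rule ennreal_mult'[symmetric]) simp
      also have "\<dots> = ennreal (M u \<omega>)" by (simp add: exp_minus field_simps)
      finally show "indicator A \<omega> * ennreal (exp (real k * \<Xi> u \<omega>)) * ennreal (M u \<omega> * exp (- real k * \<Xi> u \<omega>)) = indicator A \<omega> * ennreal (M u \<omega>)"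
        by (simp only: mult.assoc)
    qed
    also have "ennreal (exp (- (w - u) * \<Psi> (real k))) * emeasure Q A = (\<integral>\<^sup>+x. ennreal (exp (- real k * x)) \<partial>M2)"
      by (subst e2, measurable, subst laplace_law[OF w(2)], rule mult.commute)
    finally show "(\<integral>x. exp (- real k * x) \<partial>M1) = (\<integral>x. exp (- real k * x) \<partial>M2)"
      by (simp add: integral_eq_nn_integral M1_def M2_def)
  qed (simp_all add: M1_def M2_def)
  then have "(\<integral>\<^sup>+x. indicator C x \<partial>M1) = (\<integral>\<^sup>+x. indicator C x \<partial>M2)" by simp
  then have "(\<integral>\<^sup>+\<omega>. indicator A \<omega> * indicator C (?D \<omega>) \<partial>Q) = emeasure Q A * emeasure (law (w - u)) C"
    using C by (simp only: e1 e2 borel_measurable_indicator) simp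
  moreover have "(\<integral>\<^sup>+\<omega>. indicator A \<omega> * indicator C (?D \<omega>) \<partial>Q) = (\<integral>\<^sup>+\<omega>. indicator (A \<inter> (?D -` C \<inter> space Q)) \<omega> \<partial>Q)"
    by (intro nn_integral_cong) (auto split: split_indicator)
  ultimately show ?thesis using measurable_sets[OF DQ C] by simp
qed

lemma same_law_local_density:
  assumes Q: "local_density_measure P X M Q" shows "same_law Q \<Xi> P X"
proof (rule same_law_independent_increments[OF _ independent_increments_X])
  have sp: "space Q = space P" and p: "prob_space Q" using Q by (auto simp: local_density_measure_def)
  have FQ: "subalgebra Q (F u)" if "0 \<le> u" for u
    using Q sets_F_F_inf[OF that] by (simp add: subalgebra_def local_density_measure_def)
  show "independent_increments Q F \<Xi> law"
    by (intro independent_increments.intro independent_increments_axioms.intro p)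
      (simp_all add: FQ measurable_F_mono[OF _ \<Xi>_adapted] \<Xi>_zero sp prob_space_law increment_local_density[OF Q, unfolded sp])
qed

end

section \<open>Existence of the new measure\<close>

text \<open>The right limit along the rationals, written as an infimum because the relevant paths
  increase.\<close>

definition regularise :: "(real \<Rightarrow> real) \<Rightarrow> real \<Rightarrow> real" where
  "regularise v t = Inf (v ` {q\<in>\<rat>. t < q})"

text \<open>Countably many conditions, hence a measurable event: nonnegative and increasing on the
  nonnegative rationals, with values near 0 on rationals in (0,1]. The last one makes the
  regularised path start at 0.\<close>

definition rational_path :: "(real \<Rightarrow> real) \<Rightarrow> bool" where
  "rational_path v \<longleftrightarrow> (\<forall>p\<in>\<rat> \<inter> {0..}. 0 \<le> v p \<and> (\<forall>q\<in>\<rat> \<inter> {p..}. v p \<le> v q)) \<and> (\<forall>n. \<exists>q\<in>\<rat> \<inter> {0<..1}. v q < 1 / real (Suc n))"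

context
  fixes v assumes v: "rational_path v"
begin

text \<open>Reduces the infimum to a countable union of coordinate events. Monotonicity, right
  continuity and measurability of the regularised path all follow from it.\<close>

lemma regularise_less_iff: assumes t: "0 \<le> t" shows "regularise v t < a \<longleftrightarrow> (\<exists>q\<in>\<rat>. t < q \<and> v q < a)"
proof -
  have "v ` {q\<in>\<rat>. t < q} \<noteq> {}" using Rats_dense_in_real[of t "t + 1"] by auto
  moreover have "bdd_below (v ` {q\<in>\<rat>. t < q})"
    using v t by (intro bdd_belowI2[where m=0]) (auto simp: rational_path_def)
  ultimately show ?thesis unfolding regularise_def by (subst cInf_less_iff) auto
qed

lemma regularise_mono: "0 \<le> s \<Longrightarrow> s \<le> t \<Longrightarrow> regularise v s \<le> regularise v t"
proof (rule ccontr)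
  assume "0 \<le> s" "s \<le> t" "\<not> regularise v s \<le> regularise v t"
  then obtain q where "q \<in> \<rat>" "t < q" "v q < regularise v s" using regularise_less_iff[of t "regularise v s"] by auto
  then show False using regularise_less_iff[of s "regularise v s"] \<open>0 \<le> s\<close> \<open>s \<le> t\<close> by force
qed

lemma regularise_0: "regularise v 0 = 0"
proof (rule antisym)
  show "regularise v 0 \<le> 0"
  proof (rule ccontr)
    assume "\<not> regularise v 0 \<le> 0"
    then obtain n where n: "1 / real (Suc n) < regularise v 0" using reals_Archimedean[of "regularise v 0"] by (auto simp: inverse_eq_divide)
    have "\<exists>q\<in>\<rat> \<inter> {0<..1}. v q < 1 / real (Suc n)" using v unfolding rational_path_def by blast
    then obtain q where "q \<in> \<rat>" "0 < q" "v q < 1 / real (Suc n)" by auto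
    then have "regularise v 0 < 1 / real (Suc n)" by (subst regularise_less_iff) auto
    then show False using n by simp
  qed
  show "0 \<le> regularise v 0"
    using regularise_less_iff[of 0 0] v by (force simp: rational_path_def not_less[symmetric])
qed

lemma cadlag_regularise: "cadlag (regularise v)"
  unfolding cadlag_def
proof (intro conjI allI impI)
  fix t :: real assume t: "0 \<le> t"
  show "(regularise v \<longlongrightarrow> regularise v t) (at_right t)"
  proof (rule order_tendstoI)
    fix a assume a: "a < regularise v t"
    show "\<forall>\<^sub>F r in at_right t. a < regularise v r"
      using eventually_at_right_less[of t] by eventually_elim (use a regularise_mono t in \<open>auto intro: less_le_trans less_imp_le\<close>)
  next
    fix a assume "regularise v t < a"
    then obtain q where q: "q \<in> \<rat>" "t < q" "v q < a" using regularise_less_iff[OF t] by blast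
    show "\<forall>\<^sub>F r in at_right t. regularise v r < a"
      unfolding eventually_at_right_field
    proof (intro exI[of _ q] conjI q allI impI)
      fix r assume "t < r" "r < q"
      then show "regularise v r < a" using q t by (subst regularise_less_iff) auto
    qed
  qed
next
  fix t :: real assume t: "0 < t"
  have bdd: "bdd_above (regularise v ` {0..<t})" by (rule bdd_aboveI2[where M="regularise v t"]) (auto intro: regularise_mono)
  have "(regularise v \<longlongrightarrow> (SUP s\<in>{0..<t}. regularise v s)) (at_left t)"
  proof (rule order_tendstoI)
    fix a assume "a < (SUP s\<in>{0..<t}. regularise v s)"
    then obtain s where s: "0 \<le> s" "s < t" "a < regularise v s" using t bdd by (subst (asm) less_cSUP_iff) auto
    show "\<forall>\<^sub>F r in at_left t. a < regularise v r"
      unfolding eventually_at_left_field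
    proof (intro exI[of _ s] conjI s allI impI)
      fix r assume "s < r" "r < t"
      then show "a < regularise v r" using s regularise_mono[of s r] by simp
    qed
  next
    fix a assume a: "(SUP s\<in>{0..<t}. regularise v s) < a"
    show "\<forall>\<^sub>F r in at_left t. regularise v r < a"
      unfolding eventually_at_left_field
    proof (intro exI[of _ 0] conjI t allI impI)
      fix r :: real assume "0 < r" "r < t"
      then have "regularise v r \<le> (SUP s\<in>{0..<t}. regularise v s)" using bdd by (intro cSUP_upper) auto
      then show "regularise v r < a" using a by simp
    qed
  qed
  then show "\<exists>l. (regularise v \<longlongrightarrow> l) (at_left t)" by blast
qed

text \<open>As s may be irrational, comparison with rationals to its right has to be assumed. It is
  asked only up to s + 1, since almost sure properties are transferred on bounded intervals;
  monotonicity on the rationals carries it further.\<close>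

lemma regularise_eq:
  assumes s: "0 \<le> s" and lower: "\<And>q. q \<in> \<rat> \<Longrightarrow> s < q \<Longrightarrow> q \<le> s + 1 \<Longrightarrow> v s \<le> v q"
    and upper: "\<And>n. \<exists>q\<in>\<rat>. s < q \<and> v q < v s + 1 / real (Suc n)"
  shows "regularise v s = v s"
proof (rule antisym)
  show "regularise v s \<le> v s"
  proof (rule ccontr)
    assume "\<not> regularise v s \<le> v s"
    then obtain n where n: "1 / real (Suc n) < regularise v s - v s" using reals_Archimedean[of "regularise v s - v s"] by (auto simp: inverse_eq_divide)
    obtain q where "q \<in> \<rat>" "s < q" "v q < v s + 1 / real (Suc n)" using upper by blast
    then have "regularise v s < v s + 1 / real (Suc n)" using s by (subst regularise_less_iff) auto
    then show False using n by simp
  qed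
  show "v s \<le> regularise v s"
  proof (rule ccontr)
    assume "\<not> v s \<le> regularise v s"
    then obtain q where q: "q \<in> \<rat>" "s < q" "v q < v s" using regularise_less_iff[OF s, of "v s"] by auto
    obtain p where p: "p \<in> \<rat>" "s < p" "p < min q (s + 1)" using Rats_dense_in_real[of s "min q (s + 1)"] q by auto
    have "v s \<le> v p" using p by (intro lower) auto
    also have "v p \<le> v q" using p q s v by (auto simp: rational_path_def)
    finally show False using q by simp
  qed
qed

end

section \<open>Kolmogorov extension and transfer to the sample space\<close>

locale consistent_measures = increasing_levy +
  fixes R :: "real \<Rightarrow> 'a measure"
  assumes R: "\<And>t. 0 \<le> t \<Longrightarrow> prob_space (R t)" "\<And>t. sets (R t) = sets P"
    and consistent: "\<And>u t A. 0 \<le> u \<Longrightarrow> u \<le> t \<Longrightarrow> A \<in> sets (F u) \<Longrightarrow> emeasure (R t) A = emeasure (R u) A"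
begin

abbreviation Path :: "real set \<Rightarrow> (real \<Rightarrow> real) measure" where "Path J \<equiv> PiM J (\<lambda>_. borel)"

definition vec :: "real set \<Rightarrow> 'a \<Rightarrow> real \<Rightarrow> real" where "vec J \<omega> = (\<lambda>j\<in>J. X j \<omega>)"

text \<open>The smallest horizon covering J is a definite choice; by consistency every later horizon
  gives the same marginal.\<close>

definition marginal :: "real set \<Rightarrow> (real \<Rightarrow> real) measure" where
  "marginal J = distr (R (Max (insert 0 J))) (Path J) (vec J)"

lemma space_R: "space (R t) = space P" by (rule sets_eq_imp_space_eq[OF R(2)])

lemma vec_measurable_F: "J \<subseteq> {0..t} \<Longrightarrow> vec J \<in> F t \<rightarrow>\<^sub>M Path J"
  unfolding vec_def[abs_def] by (rule measurable_restrict) (auto intro!: X_adapted)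

lemma vec_measurable_R: "J \<subseteq> {0..} \<Longrightarrow> vec J \<in> R t \<rightarrow>\<^sub>M Path J"
  unfolding vec_def[abs_def] by (rule measurable_restrict) (auto simp: measurable_cong_sets[OF R(2) refl])

lemma emeasure_marginal:
  assumes J: "finite J" "J \<subseteq> {0..t}" and t: "0 \<le> t" and B: "B \<in> sets (Path J)"
  shows "emeasure (marginal J) B = emeasure (R t) (vec J -` B \<inter> space P)"
proof -
  let ?m = "Max (insert 0 J)"
  have m: "0 \<le> ?m" "?m \<le> t" "J \<subseteq> {0..?m}" and J0: "J \<subseteq> {0..}" using J t by auto
  have "vec J -` B \<inter> space P \<in> sets (F ?m)" using measurable_sets[OF vec_measurable_F[OF m(3)] B] by simp
  from consistent[OF m(1,2) this] show ?thesis
    unfolding marginal_def by (simp add: emeasure_distr[OF vec_measurable_R[OF J0] B] space_R)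
qed

lemma projective: "polish_projective {0..} marginal"
  unfolding polish_projective_def
proof (rule projective_family.intro)
  fix J H :: "real set" assume JH: "J \<subseteq> H" "finite H" "H \<subseteq> {0..}"
  show "marginal J = distr (marginal H) (Path J) (\<lambda>f. restrict f J)"
  proof (rule measure_eqI)
    fix B assume "B \<in> sets (marginal J)"
    then have B: "B \<in> sets (Path J)" by (simp add: marginal_def)
    note r = measurable_restrict_subset[OF JH(1), of "\<lambda>_. borel :: real measure"]
    define t where "t = Max (insert 0 H)"
    have Ht: "0 \<le> t" "H \<subseteq> {0..t}" using JH(2,3) by (auto simp: t_def)
    note t = Ht order_trans[OF JH(1) Ht(2)] finite_subset[OF JH(1,2)]
    have rB: "(\<lambda>f. restrict f J) -` B \<inter> space (Path H) \<in> sets (Path H)" by (rule measurable_sets[OF r B])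
    have "emeasure (distr (marginal H) (Path J) (\<lambda>f. restrict f J)) B = emeasure (marginal H) ((\<lambda>f. restrict f J) -` B \<inter> space (Path H))"
      using B r by (subst emeasure_distr) (auto simp: marginal_def)
    also have "\<dots> = emeasure (R t) (vec H -` ((\<lambda>f. restrict f J) -` B \<inter> space (Path H)) \<inter> space P)"
      by (rule emeasure_marginal[OF JH(2) t(2,1) rB])
    also have "vec H -` ((\<lambda>f. restrict f J) -` B \<inter> space (Path H)) \<inter> space P = vec J -` B \<inter> space P"
      using JH(1) by (auto simp: vec_def restrict_restrict Int_absorb1 space_PiM)
    finally show "emeasure (marginal J) B = emeasure (distr (marginal H) (Path J) (\<lambda>f. restrict f J)) B"
      unfolding emeasure_marginal[OF t(4,3,1) B] by (rule sym)
  qed (simp add: marginal_def)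
next
  fix J :: "real set" assume J: "finite J" "J \<subseteq> {0..}"
  show "prob_space (marginal J)" unfolding marginal_def
    using J by (intro prob_space.prob_space_distr R vec_measurable_R) auto
qed

interpretation polish_projective "{0..}" marginal by (rule projective)

lemma restrict_measurable: "(\<lambda>v. restrict v {0..T}) \<in> lim \<rightarrow>\<^sub>M Path {0..T}"
  by (subst measurable_cong_sets[OF sets_lim refl], rule measurable_restrict_subset) auto

lemma coordinate_measurable: "0 \<le> s \<Longrightarrow> (\<lambda>v. v s) \<in> borel_measurable lim"
  by (subst measurable_cong_sets[OF sets_lim refl], rule measurable_component_singleton) auto

text \<open>Consistency up to T identifies all finite-dimensional marginals, and these determine the
  law on the product space over the whole interval.\<close>

lemma law_on_interval:
  assumes T: "0 \<le> T"
  shows "distr lim (Path {0..T}) (\<lambda>v. restrict v {0..T}) = distr (R T) (Path {0..T}) (vec {0..T})"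
proof (rule measure_eqI_PiM_infinite)
  have T0: "{0..T} \<subseteq> {0..}" by auto
  fix A and J :: "real set" assume J: "finite J" "J \<subseteq> {0..T}" and A: "\<And>i. i \<in> J \<Longrightarrow> A i \<in> sets (borel :: real measure)"
  have J0: "J \<subseteq> {0..}" using J by auto
  let ?E = "Pi\<^sub>E J A"
  have B: "?E \<in> sets (Path J)" using A J by (intro sets_PiM_I_finite)
  have S: "prod_emb {0..T} (\<lambda>_. borel) J ?E \<in> sets (Path {0..T})" using J A by (intro sets_PiM_I) auto
  have "emeasure (distr lim (Path {0..T}) (\<lambda>v. restrict v {0..T})) (prod_emb {0..T} (\<lambda>_. borel) J ?E) = emeasure lim (emb {0..} J ?E)"
    unfolding emeasure_distr[OF restrict_measurable S]
    using J J0 by (intro arg_cong[where f="emeasure lim"]) (auto simp: prod_emb_def restrict_restrict Int_absorb1 space_PiM)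
  also have "\<dots> = emeasure (R T) (vec J -` ?E \<inter> space P)"
    by (simp add: emeasure_lim_emb[OF J0 J(1) B] emeasure_marginal[OF J T B])
  also have "\<dots> = emeasure (distr (R T) (Path {0..T}) (vec {0..T})) (prod_emb {0..T} (\<lambda>_. borel) J ?E)"
    unfolding emeasure_distr[OF vec_measurable_R[OF T0] S] space_R
    using J by (intro arg_cong[where f="emeasure (R T)"]) (auto simp: vec_def prod_emb_def restrict_restrict Int_absorb1)
  finally show "emeasure (distr lim (Path {0..T}) (\<lambda>v. restrict v {0..T})) (prod_emb {0..T} (\<lambda>_. borel) J ?E) =
    emeasure (distr (R T) (Path {0..T}) (vec {0..T})) (prod_emb {0..T} (\<lambda>_. borel) J ?E)" .
next
  show "finite_measure (distr lim (Path {0..T}) (\<lambda>v. restrict v {0..T}))"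
    by (rule prob_space.finite_measure[OF P.prob_space_distr[OF restrict_measurable]])
qed simp_all

text \<open>A measurable property shared by all paths of X up to T holds almost surely under the
  Kolmogorov limit. This is how path regularity is recovered on the rationals.\<close>

lemma AE_lim:
  assumes T: "0 \<le> T" and Q: "Measurable.pred (Path {0..T}) Q" and s: "\<And>\<omega>. \<omega> \<in> space P \<Longrightarrow> Q (vec {0..T} \<omega>)"
  shows "AE v in lim. Q (restrict v {0..T})"
proof -
  have "AE x in distr (R T) (Path {0..T}) (vec {0..T}). Q x"
    by (subst AE_distr_iff[OF vec_measurable_R]) (use Q s in \<open>auto simp: space_R pred_def\<close>)
  then show ?thesis unfolding law_on_interval[OF T, symmetric]
    by (subst (asm) AE_distr_iff[OF restrict_measurable]) (use Q in \<open>auto simp: pred_def\<close>)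
qed

end

lemma pred_countable_Bex:
  assumes S: "countable S" and P: "\<And>q. q \<in> S \<Longrightarrow> Measurable.pred M (\<lambda>x. P x q)"
  shows "Measurable.pred M (\<lambda>x. \<exists>q\<in>S. P x q)"
proof -
  have "(\<Union>q\<in>S. {x\<in>space M. P x q}) \<in> sets M" using P by (intro sets.countable_UN''[OF S]) (simp add: pred_def)
  also have "(\<Union>q\<in>S. {x\<in>space M. P x q}) = {x\<in>space M. \<exists>q\<in>S. P x q}" by auto
  finally show ?thesis by (simp add: pred_def)
qed

lemma pred_countable_Ball:
  assumes S: "countable S" and P: "\<And>q. q \<in> S \<Longrightarrow> Measurable.pred M (\<lambda>x. P x q)"
  shows "Measurable.pred M (\<lambda>x. \<forall>q\<in>S. P x q)"
proof -
  have "Measurable.pred M (\<lambda>x. \<not> (\<exists>q\<in>S. \<not> P x q))"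
    by (intro pred_intros_logic(2) pred_countable_Bex S P)
  then show ?thesis by simp
qed

lemma pred_borel_le:
  fixes f :: "'a \<Rightarrow> real"
  shows "f \<in> borel_measurable M \<Longrightarrow> g \<in> borel_measurable M \<Longrightarrow> Measurable.pred M (\<lambda>w. f w \<le> g w)"
  by (simp add: pred_def)

lemma (in increasing_levy) rational_approach:
  assumes \<omega>: "\<omega> \<in> space P" and s: "0 \<le> s" and e: "0 < e"
  shows "\<exists>q\<in>\<rat> \<inter> {s<..s + 1}. X q \<omega> < X s \<omega> + e"
proof -
  have "\<forall>\<^sub>F r in at s within {s..}. X r \<omega> < X s \<omega> + e"
    using order_tendstoD(2)[OF path_right[OF path[OF \<omega>] s], of "X s \<omega> + e"] e by simp
  then obtain d where d: "0 < d" "\<And>r. s \<le> r \<Longrightarrow> r \<noteq> s \<Longrightarrow> dist r s < d \<Longrightarrow> X r \<omega> < X s \<omega> + e"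
    unfolding eventually_at by auto
  obtain q where q: "q \<in> \<rat>" "s < q" "q < s + min d 1" using Rats_dense_in_real[of s "s + min d 1"] d(1) by auto
  then have "X q \<omega> < X s \<omega> + e" by (intro d(2)) (auto simp: dist_real_def)
  then show ?thesis using q by auto
qed

context consistent_measures
begin

interpretation polish_projective "{0..}" marginal by (rule projective)

lemma pred_rational_path: "Measurable.pred lim rational_path"
proof -
  have c: "countable (\<rat> \<inter> S)" for S :: "real set" by (rule countable_Int1[OF countable_rat])
  show ?thesis unfolding rational_path_def[abs_def]
    by (intro pred_intros_logic(3) pred_intros_countable(1) pred_countable_Bex pred_countable_Ball c
        borel_measurable_pred_less pred_borel_le coordinate_measurable borel_measurable_const) auto
qed

lemma AE_rational_path: "AE v in lim. rational_path v"
proof -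
  have c: "countable (\<rat> \<inter> S)" for S :: "real set" by (rule countable_Int1[OF countable_rat])
  have "AE v in lim. 0 \<le> v p" if p: "0 \<le> p" for p
    using AE_lim[OF p, of "\<lambda>v. 0 \<le> v p"] p
    by (auto intro!: pred_borel_le measurable_component_singleton simp: vec_def path_nonneg[OF path])
  moreover have "AE v in lim. v p \<le> v q" if p: "0 \<le> p" "p \<le> q" for p q
  proof -
    have "AE v in lim. restrict v {0..q} p \<le> restrict v {0..q} q"
      using p by (intro AE_lim) (auto intro!: pred_borel_le measurable_component_singleton simp: vec_def path_mono[OF path])
    then show ?thesis using p by simp
  qed
  moreover have "AE v in lim. \<exists>q\<in>\<rat> \<inter> {0<..1}. v q < 1 / real (Suc n)" for n
  proof -
    have "AE v in lim. \<exists>q\<in>\<rat> \<inter> {0<..1}. restrict v {0..1} q < 1 / real (Suc n)"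
    proof (rule AE_lim)
      show "Measurable.pred (Path {0..1}) (\<lambda>v. \<exists>q\<in>\<rat> \<inter> {0<..1}. v q < 1 / real (Suc n))"
        by (intro pred_countable_Bex c borel_measurable_pred_less measurable_component_singleton) auto
      fix \<omega> assume \<omega>: "\<omega> \<in> space P"
      obtain q where "q \<in> \<rat> \<inter> {0<..1}" "X q \<omega> < 1 / real (Suc n)" using rational_approach[OF \<omega>, of 0 "1 / real (Suc n)"] X_0[OF \<omega>] by auto
      then show "\<exists>q\<in>\<rat> \<inter> {0<..1}. vec {0..1} \<omega> q < 1 / real (Suc n)" by (intro bexI[of _ q]) (auto simp: vec_def)
    qed simp
    then show ?thesis by (rule eventually_mono) auto
  qed
  ultimately show ?thesis unfolding rational_path_def
    by (intro AE_conjI AE_ball_countable' c AE_all_countable[THEN iffD2] allI) auto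
qed

text \<open>For each fixed time, right continuity and monotonicity of the paths of X along rationals
  transfer to the coordinate process and pin down the right limit.\<close>

lemma AE_regularise:
  assumes s: "0 \<le> s" shows "AE v in lim. regularise v s = v s"
proof -
  let ?S = "\<rat> \<inter> {s<..s + 1}" and ?T = "{0..s + 1}"
  have c: "countable ?S" by (rule countable_Int1[OF countable_rat])
  have "AE v in lim. (\<forall>q\<in>?S. restrict v ?T s \<le> restrict v ?T q) \<and> (\<forall>n. \<exists>q\<in>?S. restrict v ?T q < restrict v ?T s + 1 / real (Suc n))"
  proof (rule AE_lim)
    show "Measurable.pred (Path ?T) (\<lambda>v. (\<forall>q\<in>?S. v s \<le> v q) \<and> (\<forall>n. \<exists>q\<in>?S. v q < v s + 1 / real (Suc n)))"
      using s by (intro pred_intros_logic(3) pred_intros_countable(1) pred_countable_Bex pred_countable_Ball c borel_measurable_pred_less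
        pred_borel_le borel_measurable_add borel_measurable_const measurable_component_singleton) auto
    fix \<omega> assume \<omega>: "\<omega> \<in> space P"
    have "\<exists>q\<in>?S. vec ?T \<omega> q < vec ?T \<omega> s + 1 / real (Suc n)" for n
    proof -
      obtain q where q: "q \<in> ?S" "X q \<omega> < X s \<omega> + 1 / real (Suc n)" using rational_approach[OF \<omega> s, of "1 / real (Suc n)"] by auto
      then show ?thesis using s by (intro bexI[of _ q]) (auto simp: vec_def)
    qed
    moreover have "\<forall>q\<in>?S. vec ?T \<omega> s \<le> vec ?T \<omega> q" using s path_mono[OF path[OF \<omega>]] by (auto simp: vec_def)
    ultimately show "(\<forall>q\<in>?S. vec ?T \<omega> s \<le> vec ?T \<omega> q) \<and> (\<forall>n. \<exists>q\<in>?S. vec ?T \<omega> q < vec ?T \<omega> s + 1 / real (Suc n))" by blast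
  qed (use s in simp)
  with AE_rational_path show ?thesis
  proof eventually_elim
    case (elim v)
    have r: "restrict v ?T q = v q" if "q \<in> insert s ?S" for q using that s by auto
    show ?case
    proof (rule regularise_eq[OF elim(1) s])
      show "v s \<le> v q" if "q \<in> \<rat>" "s < q" "q \<le> s + 1" for q
      proof -
        have q: "q \<in> ?S" using that by auto
        show ?thesis using elim(2)[THEN conjunct1, rule_format, OF q] r[of q] r[of s] q by (simp only: insert_iff simp_thms)
      qed
      show "\<exists>q\<in>\<rat>. s < q \<and> v q < v s + 1 / real (Suc n)" for n
      proof -
        obtain q where q: "q \<in> ?S" "restrict v ?T q < restrict v ?T s + 1 / real (Suc n)" using elim(2) by blast
        then have "v q < v s + 1 / real (Suc n)" using r[of q] r[of s] by (simp only: insert_iff simp_thms)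
        then show ?thesis using q(1) by (intro bexI[of _ q]) auto
      qed
    qed
  qed
qed

text \<open>Replacing exceptional coordinates by the zero path makes every value an admissible path,
  so that a sample point can be chosen for each of them.\<close>

definition path_version :: "(real \<Rightarrow> real) \<Rightarrow> real \<Rightarrow> real" where
  "path_version v = (if rational_path v then regularise v else (\<lambda>_. 0))"

lemma path_version_measurable: assumes s: "0 \<le> s" shows "(\<lambda>v. path_version v s) \<in> borel_measurable lim"
proof (rule borel_measurable_iff_less[THEN iffD2], rule allI)
  fix a
  have "Measurable.pred lim (\<lambda>v. (rational_path v \<and> (\<exists>q\<in>\<rat> \<inter> {s<..}. v q < a)) \<or> (\<not> rational_path v \<and> 0 < a))"
    using s by (intro pred_intros_logic(2,3,5) pred_rational_path pred_countable_Bex countable_Int1[OF countable_rat]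
      borel_measurable_pred_less coordinate_measurable borel_measurable_const) auto
  then have "{v\<in>space lim. (rational_path v \<and> (\<exists>q\<in>\<rat> \<inter> {s<..}. v q < a)) \<or> (\<not> rational_path v \<and> 0 < a)} \<in> sets lim"
    by (simp add: pred_def)
  moreover have "(path_version v s < a) = ((rational_path v \<and> (\<exists>q\<in>\<rat> \<inter> {s<..}. v q < a)) \<or> (\<not> rational_path v \<and> 0 < a))" for v
    using s by (auto simp: path_version_def regularise_less_iff)
  ultimately show "{v\<in>space lim. path_version v s < a} \<in> sets lim" by simp
qed

lemma AE_path_version: "0 \<le> s \<Longrightarrow> AE v in lim. path_version v s = v s"
  using AE_rational_path AE_regularise[of s] by (auto simp: path_version_def elim!: eventually_elim2)

lemma path_version_path: "path_version v 0 = 0 \<and> cadlag (path_version v) \<and> mono_on {0..} (path_version v)"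
  by (cases "rational_path v")
    (auto simp: path_version_def regularise_0 cadlag_regularise regularise_mono intro!: mono_onI, auto simp: cadlag_def)

text \<open>Choose for each coordinate path v a sample point \<Phi> v realising its regular version
  and push the Kolmogorov limit forward. Whatever the choice, \<Phi> is measurable, since the target
  sigma-algebra is generated by the X s and each X s composed with \<Phi> is a coordinate of the
  version.\<close>

theorem extension:
  assumes "realises_all_paths (space P) X"
  shows "\<exists>Q. prob_space Q \<and> space Q = space P \<and> sets Q = sets F_inf \<and> (\<forall>t\<ge>0. \<forall>A\<in>sets (F t). emeasure Q A = emeasure (R t) A)"
proof -
  have "\<forall>v. \<exists>\<omega>. \<omega> \<in> space P \<and> (\<forall>t\<ge>0. X t \<omega> = path_version v t)"
    using assms path_version_path unfolding realises_all_paths_def by blast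
  then obtain \<Phi> where \<Phi>: "\<And>v. \<Phi> v \<in> space P" "\<And>v t. 0 \<le> t \<Longrightarrow> X t (\<Phi> v) = path_version v t" by metis
  have \<Phi>_m: "\<Phi> \<in> lim \<rightarrow>\<^sub>M F_inf"
    unfolding generated_sigma_def
  proof (rule measurable_measure_of)
    fix y assume "y \<in> {X s -` A \<inter> space P |s A. s \<in> {0..} \<and> A \<in> sets (borel :: real measure)}"
    then obtain s A where y: "y = X s -` A \<inter> space P" "0 \<le> s" "A \<in> sets borel" by auto
    have "\<Phi> -` y \<inter> space lim = (\<lambda>v. path_version v s) -` A \<inter> space lim" using \<Phi> y by auto
    then show "\<Phi> -` y \<inter> space lim \<in> sets lim" using measurable_sets[OF path_version_measurable[OF y(2)] y(3)] by simp
  qed (use \<Phi>(1) in auto)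
  define Q where "Q = distr lim F_inf \<Phi>"
  have Q: "prob_space Q" "space Q = space P" "sets Q = sets F_inf"
    unfolding Q_def by (simp_all add: P.prob_space_distr[OF \<Phi>_m])
  have "emeasure Q A = emeasure (R t) A" if t: "0 \<le> t" and A: "A \<in> sets (F t)" for t A
  proof -
    let ?T = "{0..t}"
    have T0: "?T \<subseteq> {0..}" by auto
    \<comment> \<open>Every event of F t is the preimage of a product-measurable set of paths on the
      interval from 0 to t, so its probability is read off the law of the paths.\<close>
    have "sets (F t) \<subseteq> sets (vimage_algebra (space P) (vec ?T) (Path ?T))"
      unfolding sets_F
    proof (rule sets.sigma_sets_subset[of _ "vimage_algebra (space P) (vec ?T) (Path ?T)", simplified], safe)
      fix s A assume s: "s \<in> ?T" and A: "A \<in> sets (borel :: real measure)"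
      have "(\<lambda>v. v s) -` A \<inter> space (Path ?T) \<in> sets (Path ?T)" using s A by (intro measurable_sets[OF measurable_component_singleton])
      moreover have "X s -` A \<inter> space P = vec ?T -` ((\<lambda>v. v s) -` A \<inter> space (Path ?T)) \<inter> space P"
        using s by (auto simp: vec_def space_PiM)
      ultimately show "X s -` A \<inter> space P \<in> sets (vimage_algebra (space P) (vec ?T) (Path ?T))"
        by (simp only: in_vimage_algebra)
    qed
    also have "\<dots> = {vec ?T -` B \<inter> space P |B. B \<in> sets (Path ?T)}"
      by (rule sets_vimage_algebra2) (auto simp: vec_def space_PiM)
    finally obtain B where B: "A = vec ?T -` B \<inter> space P" "B \<in> sets (Path ?T)" using A by blast
    let ?V = "\<lambda>v. \<lambda>s\<in>?T. path_version v s"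
    have V: "?V \<in> lim \<rightarrow>\<^sub>M Path ?T" by (rule measurable_restrict) (auto intro!: path_version_measurable)
    have "distr lim (Path ?T) ?V = distr lim (Path ?T) (\<lambda>v. restrict v ?T)"
    proof (rule measure_eqI_PiM_infinite)
      fix E and J :: "real set" assume J: "finite J" "J \<subseteq> ?T" and E: "\<And>i. i \<in> J \<Longrightarrow> E i \<in> sets (borel :: real measure)"
      let ?B = "prod_emb ?T (\<lambda>_. borel) J (Pi\<^sub>E J E)"
      have S: "?B \<in> sets (Path ?T)" using J E by (intro sets_PiM_I) auto
      have "AE v in lim. \<forall>s\<in>J. path_version v s = v s"
        using J by (intro AE_ball_countable' countable_finite AE_path_version) auto
      then have "AE v in lim. (v \<in> ?V -` ?B \<inter> space lim) = (v \<in> (\<lambda>v. restrict v ?T) -` ?B \<inter> space lim)"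
      proof eventually_elim
        case (elim v)
        then have "restrict (?V v) J = restrict (restrict v ?T) J" using J by (auto simp: fun_eq_iff restrict_def)
        then show ?case by (simp add: prod_emb_def space_PiM)
      qed
      then show "emeasure (distr lim (Path ?T) ?V) ?B = emeasure (distr lim (Path ?T) (\<lambda>v. restrict v ?T)) ?B"
        unfolding emeasure_distr[OF V S] emeasure_distr[OF restrict_measurable S]
        by (rule emeasure_eq_AE) (use measurable_sets[OF V S] measurable_sets[OF restrict_measurable S] in auto)
    next
      show "finite_measure (distr lim (Path ?T) ?V)" by (rule prob_space.finite_measure[OF P.prob_space_distr[OF V]])
    qed simp_all
    then have "distr lim (Path ?T) ?V = distr (R t) (Path ?T) (vec ?T)" by (simp only: law_on_interval[OF t])
    then have "emeasure lim (?V -` B \<inter> space lim) = emeasure (R t) A"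
      using emeasure_distr[OF V B(2)] emeasure_distr[OF vec_measurable_R[OF T0] B(2), of t] by (simp add: B(1) space_R)
    moreover have "?V -` B \<inter> space lim = \<Phi> -` A \<inter> space lim"
    proof -
      have "vec ?T (\<Phi> v) = ?V v" for v using \<Phi>(2)[of _ v] by (auto simp: vec_def fun_eq_iff)
      then show ?thesis using \<Phi>(1) by (auto simp: B(1))
    qed
    ultimately show ?thesis
      unfolding Q_def using sets_F_F_inf[OF t] A by (subst emeasure_distr[OF \<Phi>_m]) auto
  qed
  with Q show ?thesis by blast
qed

end

text \<open>The measures with density M t with respect to P are consistent on the filtration by the
  martingale property, and have mass 1 because the expectation of M t is 1.\<close>

lemma (in girsanov) local_density_exists:
  assumes "realises_all_paths (space P) X" shows "\<exists>Q. local_density_measure P X M Q"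
proof -
  let ?R = "\<lambda>t. density P (\<lambda>\<omega>. ennreal (M t \<omega>))"
  have eR: "emeasure (?R t) A = (\<integral>\<^sup>+\<omega>. indicator A \<omega> * ennreal (M t \<omega>) \<partial>P)" if "0 \<le> t" "A \<in> sets P" for t A
    using that M_measurable_P by (subst emeasure_density) (auto simp: mult.commute)
  interpret consistent_measures P X ?R
  proof (intro consistent_measures.intro consistent_measures_axioms.intro increasing_levy_axioms)
    show "prob_space (?R t)" if "0 \<le> t" for t
      using eR[OF that, of "space P"] M_nn_integral[OF that] by (intro prob_spaceI) (simp cong: nn_integral_cong)
    show "emeasure (?R t) A = emeasure (?R u) A" if "0 \<le> u" "u \<le> t" "A \<in> sets (F u)" for u t A
    proof -
      have "A \<in> sets P" by (rule subsetD[OF sets_F_subset that(3)])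
      then show ?thesis using M_martingale[OF that(1,2), of "indicator A"] that by (simp add: eR)
    qed
  qed simp
  obtain Q where Q: "prob_space Q" "space Q = space P" "sets Q = sets F_inf" "\<And>t A. 0 \<le> t \<Longrightarrow> A \<in> sets (F t) \<Longrightarrow> emeasure Q A = emeasure (?R t) A"
    using extension[OF assms] by blast
  have "restr_to_subalg Q (F t) = density (restr_to_subalg P (F t)) (\<lambda>\<omega>. ennreal (M t \<omega>))" if t: "0 \<le> t" for t
  proof (rule measure_eqI)
    have sub: "subalgebra Q (F t)" using Q sets_F_F_inf[OF t] by (simp add: subalgebra_def)
    note [measurable_cong] = sets_restr_to_subalg[OF subalgebra_F[of t]]
    note [measurable] = M_adapted[OF t]
    show "sets (restr_to_subalg Q (F t)) = sets (density (restr_to_subalg P (F t)) (\<lambda>\<omega>. ennreal (M t \<omega>)))"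
      by (simp add: sets_restr_to_subalg[OF sub] sets_restr_to_subalg[OF subalgebra_F])
    fix A assume "A \<in> sets (restr_to_subalg Q (F t))"
    then have A[measurable]: "A \<in> sets (F t)" by (simp add: sets_restr_to_subalg[OF sub])
    then have AP: "A \<in> sets P" by (rule subsetD[OF sets_F_subset])
    have "emeasure (density (restr_to_subalg P (F t)) (\<lambda>\<omega>. ennreal (M t \<omega>))) A = (\<integral>\<^sup>+\<omega>. ennreal (M t \<omega>) * indicator A \<omega> \<partial>restr_to_subalg P (F t))"
      by (rule emeasure_density) (use A in \<open>simp_all add: sets_restr_to_subalg[OF subalgebra_F]\<close>)
    also have "\<dots> = (\<integral>\<^sup>+\<omega>. ennreal (M t \<omega>) * indicator A \<omega> \<partial>P)"
      by (rule nn_integral_subalgebra2[OF subalgebra_F]) measurable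
    finally show "emeasure (restr_to_subalg Q (F t)) A = emeasure (density (restr_to_subalg P (F t)) (\<lambda>\<omega>. ennreal (M t \<omega>))) A"
      by (simp add: emeasure_restr_to_subalg[OF sub A] Q(4)[OF t A] eR[OF t AP] mult.commute)
  qed
  with Q show ?thesis unfolding local_density_measure_def by blast
qed

theorem theorem1p2:
  fixes P :: "'a measure" and \<xi> :: "real \<Rightarrow> 'a \<Rightarrow> real"
    and g :: "real \<Rightarrow> real" and g0 :: real
    and h :: "real \<Rightarrow> 'a \<Rightarrow> real \<Rightarrow> real"
    and \<kappa> \<alpha> :: real
  assumes L: "class_L P \<xi> g g0"
    and h_nonneg: "\<And>s \<omega> x. 0 \<le> s \<Longrightarrow> \<omega> \<in> space P \<Longrightarrow> 0 \<le> x \<Longrightarrow> 0 \<le> h s \<omega> x"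
    and h_predictable:
      "(\<lambda>((s, \<omega>), x). h s \<omega> x) \<in> borel_measurable
         (predictable_sigma (space P) (natural_filtration (space P) \<xi>)
            \<Otimes>\<^sub>M restrict_space borel {0..})"
    and kappa: "\<kappa> > 1" and alpha: "0 < \<alpha>" "\<alpha> < 1"
    and h_holder: "AE \<omega> in P. \<forall>s\<ge>0. \<forall>x\<ge>0. \<forall>y\<ge>0.
         \<bar>h s \<omega> x - h s \<omega> y\<bar> \<le> \<kappa> * \<bar>x - y\<bar> powr \<alpha>"
    and h_bounds: "AE \<omega> in P. \<forall>s\<ge>0. \<forall>x\<ge>0. 1 / \<kappa> \<le> h s \<omega> x \<and> h s \<omega> x \<le> \<kappa>"
  shows "martingale P (natural_filtration (space P) \<xi>) (M_H \<xi> g g0 h)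
       \<and> (\<forall>t\<ge>0. (\<integral>\<omega>. M_H \<xi> g g0 h t \<omega> \<partial>P) = 1)
       \<and> (AE \<omega> in P. \<forall>t\<ge>0. M_H \<xi> g g0 h t \<omega> > 0)
       \<and> (\<exists>\<^sub>\<le>\<^sub>1 PH. local_density_measure P \<xi> (M_H \<xi> g g0 h) PH)
       \<and> (realises_all_paths (space P) \<xi> \<longrightarrow>
            (\<exists>PH. local_density_measure P \<xi> (M_H \<xi> g g0 h) PH))
       \<and> (\<forall>PH. local_density_measure P \<xi> (M_H \<xi> g g0 h) PH \<longrightarrow>
            same_law PH (xi_H \<xi> h) P \<xi>)"
proof -
  interpret girsanov P \<xi> g g0 h \<kappa> \<alpha>
  proof (intro girsanov.intro girsanov_axioms.intro class_L_process.intro class_L_process_axioms.intro)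
    show "prob_space P" using L by (simp add: class_L_def subordinator_def levy_process_def)
  qed (fact assms)+
  show ?thesis
    using martingale_M M_expectation AE_M_pos local_density_unique local_density_exists same_law_local_density
    by (intro conjI allI impI Uniq_I) simp_all
qed

end
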